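(* Let $R$ be a $p$-DG algebra, $I$ a finite set, and for $i\in I$ let $u_i,v_i\in R$ satisfy $$u_iv_iu_i=u_i,\qquad v_iu_iv_i=v_i,\qquad v_iu_j=0\ \text{ for }i\ne j.$$ Assume furthermore that $\partial(\epsilon)=0$ and $\partial(v_iu_i)=0$ for all $i\in I$, where $\epsilon=\sum_iu_iv_i$. Then there is a fantastic filtration built from this data if and only if there is a total order on $I$ such that $$v_i\partial(u_j)=0\quad\text{for }j\ge i.$$ If so, then $$[R\epsilon]=\sum_{i\in I}[Rv_iu_i]$$ in $K_0(R)$.
   Context: $\Bbbk$ is a field of characteristic $p>0$. A $p$-DG algebra is a $\mathbb Z$-graded $\Bbbk$-algebra $R$ with a degree $2$ endomorphism $\partial$ with $\partial^p=0$ satisfying the Leibniz rule. A (left) $p$-DG module $M$ is a graded $R$-module with a degree $2$, $p$-nilpotent $\partial_M$ with $\partial_M(um)=\partial(u)m+u\partial_M(m)$; morphisms are $R$-module maps commuting with the differentials. **Fantastic filtration (Fc-filtration).** Given a total order on $I$, put $F^{\le i}=\sum_{k\le i}Ru_kv_k$ and $F^{<i}=\sum_{k<i}Ru_kv_k$. The data form a fantastic filtration on $R\epsilon$ (for this order) if $\partial(\epsilon)=0$, $\partial(v_iu_i)=0$ for all $i\in I$, and $v_i\partial(u_i)=0$ and $u_i\partial(v_i)\in F^{<i}$ for all $i\in I$. (The last two conditions are equivalent to: $F^\bullet$ is a filtration of $R\epsilon$ by $p$-DG modules, each $Rv_iu_i$ is a $p$-DG module, and the mutually inverse isomorphisms $F^{\le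 i}/F^{<i}\cong Rv_iu_i$ given by right multiplication by $u_i$ and by $v_i$ are isomorphisms of $p$-DG modules.) **$K_0$.** A morphism $M\to N$ of $p$-DG modules is null-homotopic if it equals $\sum_{i=0}^{p-1}\partial_N^ih\,\partial_M^{p-1-i}$ for an $R$-module map $h$ of degree $2-2p$; the quotient by null-homotopic morphisms is the triangulated homotopy category, and inverting the morphisms whose underlying maps of $p$-complexes are isomorphisms in the homotopy category of $p$-complexes (the case of $\Bbbk$ with zero differential) gives the triangulated derived category $\mathcal D(R)$. $K_0(R)$ is the Grothendieck group of the full triangulated subcategory of compact objects of $\mathcal D(R)$.
   Formalization: The identity in K_0(R) is stated for u_i, v_i homogeneous of degree 0; without this it fails (graded 2×2 matrices, deg E12 = 1, ∂ = 0, u = E12, v = E21), or the left ideals need not be graded. The equivalence is for arbitrary u_i, v_i. *)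

theory Defs
  imports Complex_Main "HOL-Algebra.Module" "HOL-Algebra.AbelCoset" "HOL-Algebra.Free_Abelian_Groups"
begin

section \<open>$p$-DG algebras and $p$-DG modules\<close>

text \<open>
  The ground field is the type \<open>'k\<close> and the underlying ring of a $p$-DG algebra is the type
  \<open>'r\<close>; the sort \<open>{ring, monoid_mult}\<close> means unital associative ring, possibly zero
  (class \<open>ring_1\<close> would exclude the zero ring). Throughout, $p$ is \<open>CHAR('k)\<close>.
\<close>

record ('k, 'r) pdg_alg =
  scal :: "'k \<Rightarrow> 'r \<Rightarrow> 'r"
  agr  :: "int \<Rightarrow> 'r set"
  adif :: "'r \<Rightarrow> 'r"

definition pchar :: "('k::field, 'r) pdg_alg \<Rightarrow> nat"
  where "pchar A = CHAR('k)"

locale pdg_algebra = vector_space "scal A"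
  for A :: "('k::field, 'r::{ring, monoid_mult}) pdg_alg" +
  assumes char_pos: "pchar A > 0"
    and scal_mult_left: "scal A c (x * y) = scal A c x * y"
    and scal_mult_right: "scal A c (x * y) = x * scal A c y"
    and agr_subspace: "subspace (agr A n)"
    and agr_decomp: "\<exists>!c. (\<forall>n. c n \<in> agr A n) \<and> finite {n. c n \<noteq> 0} \<and> x = (\<Sum>n | c n \<noteq> 0. c n)"
    and agr_one: "1 \<in> agr A 0"
    and agr_mult: "x \<in> agr A m \<Longrightarrow> y \<in> agr A n \<Longrightarrow> x * y \<in> agr A (m + n)"
    and adif_linear: "Vector_Spaces.linear (scal A) (scal A) (adif A)"
    and adif_degree: "x \<in> agr A n \<Longrightarrow> adif A x \<in> agr A (n + 2)"
    and adif_nilpotent: "(adif A ^^ pchar A) x = 0"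
    and adif_Leibniz: "adif A (x * y) = adif A x * y + x * adif A y"

text \<open>The field itself with zero differential; its $p$-DG modules are the $p$-complexes.\<close>

definition ground :: "('k::field, 'k) pdg_alg"
  where "ground = \<lparr>scal = (*), agr = (\<lambda>n. if n = 0 then UNIV else {0}), adif = (\<lambda>_. 0)\<rparr>"

text \<open>
  Modules are sets inside a type, with the additive structure of \<open>abelian_group\<close>. As usual for
  the library's \<open>module\<close> record, the fields \<open>mult\<close> and \<open>one\<close> are unused.
\<close>

record ('r, 'm) pdg_mod = "('r, 'm) module" +
  grade :: "int \<Rightarrow> 'm set"
  dif   :: "'m \<Rightarrow> 'm"

locale pdg_module = abelian_group M
  for A :: "('k::field, 'r::{ring, monoid_mult}) pdg_alg" and M :: "('r, 'm) pdg_mod" (structure) +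
  assumes smult_closed: "x \<in> carrier M \<Longrightarrow> r \<odot> x \<in> carrier M"
    and smult_l_distr: "x \<in> carrier M \<Longrightarrow> (r + s) \<odot> x = (r \<odot> x) \<oplus> (s \<odot> x)"
    and smult_r_distr: "x \<in> carrier M \<Longrightarrow> y \<in> carrier M \<Longrightarrow> r \<odot> (x \<oplus> y) = (r \<odot> x) \<oplus> (r \<odot> y)"
    and smult_assoc: "x \<in> carrier M \<Longrightarrow> (r * s) \<odot> x = r \<odot> (s \<odot> x)"
    and smult_one: "x \<in> carrier M \<Longrightarrow> 1 \<odot> x = x"
    and grade_subgroup: "additive_subgroup (grade M n) M"
    and grade_decomp: "x \<in> carrier M \<Longrightarrow>
          \<exists>!c. (\<forall>n. c n \<in> grade M n) \<and> finite {n. c n \<noteq> \<zero>} \<and> x = (\<Oplus>n\<in>{n. c n \<noteq> \<zero>}. c n)"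
    and grade_smult: "r \<in> agr A m \<Longrightarrow> x \<in> grade M n \<Longrightarrow> r \<odot> x \<in> grade M (m + n)"
    and dif_closed: "x \<in> carrier M \<Longrightarrow> dif M x \<in> carrier M"
    and dif_add: "x \<in> carrier M \<Longrightarrow> y \<in> carrier M \<Longrightarrow> dif M (x \<oplus> y) = dif M x \<oplus> dif M y"
    and dif_degree: "x \<in> grade M n \<Longrightarrow> dif M x \<in> grade M (n + 2)"
    and dif_nilpotent: "x \<in> carrier M \<Longrightarrow> (dif M ^^ pchar A) x = \<zero>"
    and dif_Leibniz: "x \<in> carrier M \<Longrightarrow> dif M (r \<odot> x) = (adif A r \<odot> x) \<oplus> (r \<odot> dif M x)"

definition gr_hom :: "int \<Rightarrow> ('r, 'm) pdg_mod \<Rightarrow> ('r, 'n) pdg_mod \<Rightarrow> ('m \<Rightarrow> 'n) set"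
  where "gr_hom d M N = {f. f \<in> carrier M \<rightarrow> carrier N \<and>
      (\<forall>x\<in>carrier M. \<forall>y\<in>carrier M. f (x \<oplus>\<^bsub>M\<^esub> y) = f x \<oplus>\<^bsub>N\<^esub> f y) \<and>
      (\<forall>r. \<forall>x\<in>carrier M. f (r \<odot>\<^bsub>M\<^esub> x) = r \<odot>\<^bsub>N\<^esub> f x) \<and>
      (\<forall>n. \<forall>x\<in>grade M n. f x \<in> grade N (n + d))}"

definition pdg_hom :: "('r, 'm) pdg_mod \<Rightarrow> ('r, 'n) pdg_mod \<Rightarrow> ('m \<Rightarrow> 'n) set"
  where "pdg_hom M N = {f \<in> gr_hom 0 M N. \<forall>x\<in>carrier M. f (dif M x) = dif N (f x)}"

definition null_homotopic ::
    "('k::field, 'r) pdg_alg \<Rightarrow> ('r, 'm) pdg_mod \<Rightarrow> ('r, 'n) pdg_mod \<Rightarrow> ('m \<Rightarrow> 'n) \<Rightarrow> bool"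
  where "null_homotopic A M N f \<longleftrightarrow> (\<exists>h \<in> gr_hom (2 - 2 * int (pchar A)) M N. \<forall>x\<in>carrier M.
      f x = (\<Oplus>\<^bsub>N\<^esub>i\<in>{..<pchar A}. (dif N ^^ i) (h ((dif M ^^ (pchar A - 1 - i)) x))))"

definition homotopic ::
    "('k::field, 'r) pdg_alg \<Rightarrow> ('r, 'm) pdg_mod \<Rightarrow> ('r, 'n) pdg_mod \<Rightarrow> ('m \<Rightarrow> 'n) \<Rightarrow> ('m \<Rightarrow> 'n) \<Rightarrow> bool"
  where "homotopic A M N f g \<longleftrightarrow> null_homotopic A M N (\<lambda>x. f x \<ominus>\<^bsub>N\<^esub> g x)"

text \<open>Restriction along the structure map from the ground field.\<close>

definition underlying :: "('k::field, 'r::{ring, monoid_mult}) pdg_alg \<Rightarrow> ('r, 'm) pdg_mod \<Rightarrow> ('k, 'm) pdg_mod"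
  where "underlying A M = \<lparr>carrier = carrier M, monoid.mult = monoid.mult M, monoid.one = monoid.one M,
     ring.zero = ring.zero M, ring.add = ring.add M, smult = (\<lambda>c x. scal A c 1 \<odot>\<^bsub>M\<^esub> x), grade = grade M, dif = dif M\<rparr>"


section \<open>Categories, coproducts, compact objects, localization\<close>

text \<open>\<open>cmp C X Y Z g f\<close> is the composite of \<open>f\<close> from \<open>X\<close> to \<open>Y\<close> and \<open>g\<close> from \<open>Y\<close> to \<open>Z\<close>.\<close>

record ('o, 'a) cat =
  Ob    :: "'o set"
  Hom   :: "'o \<Rightarrow> 'o \<Rightarrow> 'a set"
  ident :: "'o \<Rightarrow> 'a"
  cmp   :: "'o \<Rightarrow> 'o \<Rightarrow> 'o \<Rightarrow> 'a \<Rightarrow> 'a \<Rightarrow> 'a"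

definition is_iso :: "('o, 'a) cat \<Rightarrow> 'o \<Rightarrow> 'o \<Rightarrow> 'a \<Rightarrow> bool"
  where "is_iso C X Y f \<longleftrightarrow> X \<in> Ob C \<and> Y \<in> Ob C \<and> f \<in> Hom C X Y \<and>
     (\<exists>g \<in> Hom C Y X. cmp C X Y X g f = ident C X \<and> cmp C Y X Y f g = ident C Y)"

definition is_coproduct ::
    "('o, 'a) cat \<Rightarrow> 'j set \<Rightarrow> ('j \<Rightarrow> 'o) \<Rightarrow> 'o \<Rightarrow> ('j \<Rightarrow> 'a) \<Rightarrow> bool"
  where "is_coproduct C J N X \<iota> \<longleftrightarrow> X \<in> Ob C \<and> (\<forall>j\<in>J. N j \<in> Ob C \<and> \<iota> j \<in> Hom C (N j) X) \<and>
     (\<forall>Y\<in>Ob C. \<forall>g. (\<forall>j\<in>J. g j \<in> Hom C (N j) Y) \<longrightarrow>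
        (\<exists>!m. m \<in> Hom C X Y \<and> (\<forall>j\<in>J. cmp C (N j) X Y m (\<iota> j) = g j)))"

text \<open>
  Compactness (\<open>\<aleph>\<^sub>0\<close>-smallness, as in Neeman's book on triangulated categories): every morphism
  into a coproduct factors through the coproduct of a finite subfamily. Finite coproducts are unique
  up to canonical isomorphism, and \<open>Y'\<close> stands for any choice of one; \<open>m\<close> is the canonical
  morphism from it to \<open>Y\<close>. The type \<open>'j\<close> bounds the size of the families.
\<close>

definition is_compact :: "'j itself \<Rightarrow> ('o, 'a) cat \<Rightarrow> 'o \<Rightarrow> bool"
  where "is_compact T C X \<longleftrightarrow> X \<in> Ob C \<and>
     (\<forall>(J :: 'j set) N Y \<iota>. is_coproduct C J N Y \<iota> \<longrightarrow> (\<forall>f \<in> Hom C X Y.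
        \<exists>S. finite S \<and> S \<subseteq> J \<and> (\<forall>Y' \<iota>'. is_coproduct C S N Y' \<iota>' \<longrightarrow>
          (\<exists>g \<in> Hom C X Y'. \<exists>m \<in> Hom C Y' Y.
             (\<forall>j\<in>S. cmp C (N j) Y' Y m (\<iota>' j) = \<iota> j) \<and> f = cmp C X Y' Y m g))))"

text \<open>
  Gabriel--Zisman localization: morphisms are zigzags of morphisms, where \<open>Fwd X f Y\<close> is a morphism
  \<open>f\<close> from \<open>X\<close> to \<open>Y\<close> and \<open>Bwd X s Y\<close> is the formal inverse of a morphism \<open>s\<close> from \<open>Y\<close> to \<open>X\<close> in
  the class \<open>W\<close>, modulo the congruence generated by composition, identities and cancellation of
  formal inverses. A list is read in the order in which its steps are travelled.
\<close>

datatype ('o, 'a) step = Fwd 'o 'a 'o | Bwd 'o 'a 'o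

inductive zigzag :: "('o, 'a) cat \<Rightarrow> ('o \<Rightarrow> 'o \<Rightarrow> 'a \<Rightarrow> bool) \<Rightarrow> 'o \<Rightarrow> ('o, 'a) step list \<Rightarrow> 'o \<Rightarrow> bool"
  for C W where
  zz_Nil: "X \<in> Ob C \<Longrightarrow> zigzag C W X [] X"
| zz_Fwd: "X \<in> Ob C \<Longrightarrow> f \<in> Hom C X Y \<Longrightarrow> zigzag C W Y a Z \<Longrightarrow> zigzag C W X (Fwd X f Y # a) Z"
| zz_Bwd: "X \<in> Ob C \<Longrightarrow> s \<in> Hom C Y X \<Longrightarrow> W Y X s \<Longrightarrow> zigzag C W Y a Z \<Longrightarrow> zigzag C W X (Bwd X s Y # a) Z"

inductive loc_rel :: "('o, 'a) cat \<Rightarrow> ('o, 'a) step list \<Rightarrow> ('o, 'a) step list \<Rightarrow> bool"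
  for C where
  lr_comp: "f \<in> Hom C X Y \<Longrightarrow> g \<in> Hom C Y Z \<Longrightarrow> loc_rel C [Fwd X f Y, Fwd Y g Z] [Fwd X (cmp C X Y Z g f) Z]"
| lr_ident: "loc_rel C [Fwd X (ident C X) X] []"
| lr_cancel: "loc_rel C [Fwd X s Y, Bwd Y s X] []"
| lr_cancel': "loc_rel C [Bwd Y s X, Fwd X s Y] []"

inductive loc_eq :: "('o, 'a) cat \<Rightarrow> ('o \<Rightarrow> 'o \<Rightarrow> 'a \<Rightarrow> bool) \<Rightarrow> 'o \<Rightarrow> 'o \<Rightarrow>
    ('o, 'a) step list \<Rightarrow> ('o, 'a) step list \<Rightarrow> bool"
  for C W X Y where
  le_rel: "loc_rel C l r \<Longrightarrow> zigzag C W X (a @ l @ b) Y \<Longrightarrow> zigzag C W X (a @ r @ b) Y \<Longrightarrow>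
             loc_eq C W X Y (a @ l @ b) (a @ r @ b)"
| le_refl: "zigzag C W X a Y \<Longrightarrow> loc_eq C W X Y a a"
| le_sym: "loc_eq C W X Y a b \<Longrightarrow> loc_eq C W X Y b a"
| le_trans: "loc_eq C W X Y a b \<Longrightarrow> loc_eq C W X Y b c \<Longrightarrow> loc_eq C W X Y a c"

definition localization ::
    "('o, 'a) cat \<Rightarrow> ('o \<Rightarrow> 'o \<Rightarrow> 'a \<Rightarrow> bool) \<Rightarrow> ('o, ('o, 'a) step list set) cat"
  where "localization C W =
     \<lparr>Ob = Ob C,
      Hom = (\<lambda>X Y. {Collect (loc_eq C W X Y a) | a. zigzag C W X a Y}),
      ident = (\<lambda>X. Collect (loc_eq C W X X [])),
      cmp = (\<lambda>X Y Z G F. {c. \<exists>a\<in>F. \<exists>b\<in>G. loc_eq C W X Z (a @ b) c})\<rparr>"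


section \<open>The homotopy category and the derived category\<close>

definition hclass ::
    "('k::field, 'r) pdg_alg \<Rightarrow> ('r, 'm) pdg_mod \<Rightarrow> ('r, 'm) pdg_mod \<Rightarrow> ('m \<Rightarrow> 'm) \<Rightarrow> ('m \<Rightarrow> 'm) set"
  where "hclass A M N f = {k \<in> pdg_hom M N. homotopic A M N f k}"

definition homotopy_cat ::
    "('k::field, 'r::{ring, monoid_mult}) pdg_alg \<Rightarrow> (('r, 'm) pdg_mod, ('m \<Rightarrow> 'm) set) cat"
  where "homotopy_cat A =
     \<lparr>Ob = {M. pdg_module A M},
      Hom = (\<lambda>M N. hclass A M N ` pdg_hom M N),
      ident = (\<lambda>M. hclass A M M (\<lambda>x. x)),
      cmp = (\<lambda>L M N G F. \<Union>f\<in>F. \<Union>g\<in>G. hclass A L N (\<lambda>x. g (f x)))\<rparr>"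

text \<open>
  The class of morphisms to be inverted: the underlying map of $p$-complexes is an isomorphism in the
  homotopy category of $p$-complexes.
\<close>

definition qis ::
    "('k::field, 'r::{ring, monoid_mult}) pdg_alg \<Rightarrow> ('r, 'm) pdg_mod \<Rightarrow> ('r, 'm) pdg_mod \<Rightarrow> ('m \<Rightarrow> 'm) set \<Rightarrow> bool"
  where "qis A M N F \<longleftrightarrow>
     is_iso (homotopy_cat (ground :: ('k, 'k) pdg_alg)) (underlying A M) (underlying A N)
       (\<Union>f\<in>F. hclass (ground :: ('k, 'k) pdg_alg) (underlying A M) (underlying A N) f)"

definition derived_cat ::
    "('k::field, 'r::{ring, monoid_mult}) pdg_alg \<Rightarrow>
      (('r, 'm) pdg_mod, (('r, 'm) pdg_mod, ('m \<Rightarrow> 'm) set) step list set) cat"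
  where "derived_cat A = localization (homotopy_cat A) (qis A)"

text \<open>The image in the derived category of a morphism of $p$-DG modules.\<close>

definition dmor ::
    "('k::field, 'r::{ring, monoid_mult}) pdg_alg \<Rightarrow> ('r, 'm) pdg_mod \<Rightarrow> ('r, 'm) pdg_mod \<Rightarrow> ('m \<Rightarrow> 'm) \<Rightarrow>
      (('r, 'm) pdg_mod, ('m \<Rightarrow> 'm) set) step list set"
  where "dmor A X Y f = Collect (loc_eq (homotopy_cat A) (qis A) X Y [Fwd X (hclass A X Y f) Y])"


section \<open>Shift, cones and distinguished triangles\<close>

text \<open>
  The universe of module elements. It contains \<open>'r\<close> (so that left ideals are available) and is closed
  under tuples (so that shifts and cones are available); the type \<open>'x\<close> is an arbitrary parameter by
  which the universe can be made as large as desired.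
\<close>

datatype ('r, 'x) univ = Elem (elem_of: 'r) | Point 'x | Tuple (entries: "('r, 'x) univ list")

text \<open>
  \<open>tower A Ms \<phi>\<close> is the direct sum of the modules in the list \<open>Ms\<close>, where the summand number \<open>i\<close> is
  shifted so that its degree \<open>n + 2(p - 1 - i)\<close> part lies in degree \<open>n\<close>, with the differential
  \<open>\<partial>(x)\<^sub>i = \<partial>(x\<^sub>i) + \<phi>\<^sub>i\<^sub>-\<^sub>1(x\<^sub>i\<^sub>-\<^sub>1)\<close>.

  For \<open>V = k[\<partial>]/(\<partial>\<^sup>p)\<close> with \<open>\<partial>\<^sup>p\<^sup>-\<^sup>1\<close> placed in degree 0, the module \<open>X \<otimes> V\<close> is the tower of \<open>p\<close> copies
  of \<open>X\<close> with identity connecting maps, \<open>x\<^sub>i\<close> being the coefficient of \<open>\<partial>\<^sup>i\<close>. The shift \<open>X[1]\<close> is the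
  cokernel of \<open>x \<mapsto> x \<otimes> \<partial>\<^sup>p\<^sup>-\<^sup>1\<close> from \<open>X\<close> to \<open>X \<otimes> V\<close>, and the cone of \<open>f\<close> from \<open>X\<close> to \<open>Y\<close> is the
  pushout of that map along \<open>f\<close>: the last copy of \<open>X\<close> is replaced by \<open>Y\<close>, and the last connecting
  map by \<open>f\<close>.
\<close>

definition tower ::
    "('k::field, 'r::{ring, monoid_mult}) pdg_alg \<Rightarrow> ('r, ('a, 'x) univ) pdg_mod list \<Rightarrow>
     (nat \<Rightarrow> ('a, 'x) univ \<Rightarrow> ('a, 'x) univ) \<Rightarrow> ('r, ('a, 'x) univ) pdg_mod"
  where "tower A Ms \<phi> =
     \<lparr>carrier = {Tuple xs | xs. length xs = length Ms \<and> (\<forall>i<length Ms. xs ! i \<in> carrier (Ms ! i))},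
      monoid.mult = (\<lambda>_ _. undefined), monoid.one = undefined,
      ring.zero = Tuple (map ring.zero Ms),
      ring.add = (\<lambda>x y. Tuple (map (\<lambda>i. entries x ! i \<oplus>\<^bsub>Ms ! i\<^esub> entries y ! i) [0..<length Ms])),
      smult = (\<lambda>r x. Tuple (map (\<lambda>i. r \<odot>\<^bsub>Ms ! i\<^esub> entries x ! i) [0..<length Ms])),
      grade = (\<lambda>n. {Tuple xs | xs. length xs = length Ms \<and>
                 (\<forall>i<length Ms. xs ! i \<in> grade (Ms ! i) (n + 2 * (int (pchar A) - 1 - int i)))}),
      dif = (\<lambda>x. Tuple (map (\<lambda>i. if i = 0 then dif (Ms ! i) (entries x ! i)
                 else dif (Ms ! i) (entries x ! i) \<oplus>\<^bsub>Ms ! i\<^esub> \<phi> (i - 1) (entries x ! (i - 1)))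
               [0..<length Ms]))\<rparr>"

definition shift_ob ::
    "('k::field, 'r::{ring, monoid_mult}) pdg_alg \<Rightarrow> ('r, ('a, 'x) univ) pdg_mod \<Rightarrow> ('r, ('a, 'x) univ) pdg_mod"
  where "shift_ob A X = tower A (replicate (pchar A - 1) X) (\<lambda>_ x. x)"

definition cone ::
    "('k::field, 'r::{ring, monoid_mult}) pdg_alg \<Rightarrow> ('r, ('a, 'x) univ) pdg_mod \<Rightarrow> ('r, ('a, 'x) univ) pdg_mod \<Rightarrow>
     (('a, 'x) univ \<Rightarrow> ('a, 'x) univ) \<Rightarrow> ('r, ('a, 'x) univ) pdg_mod"
  where "cone A X Y f = tower A (replicate (pchar A - 1) X @ [Y]) (\<lambda>i. if i = pchar A - 2 then f else (\<lambda>x. x))"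

definition cone_incl ::
    "('k::field, 'r) pdg_alg \<Rightarrow> ('r, ('a, 'x) univ) pdg_mod \<Rightarrow> ('a, 'x) univ \<Rightarrow> ('a, 'x) univ"
  where "cone_incl A X y = Tuple (replicate (pchar A - 1) (ring.zero X) @ [y])"

definition cone_proj :: "('a, 'x) univ \<Rightarrow> ('a, 'x) univ"
  where "cone_proj c = Tuple (butlast (entries c))"

text \<open>The shift functor on morphisms: of modules, of the homotopy category, of the derived category.\<close>

definition shift_map :: "(('a, 'x) univ \<Rightarrow> ('a, 'x) univ) \<Rightarrow> ('a, 'x) univ \<Rightarrow> ('a, 'x) univ"
  where "shift_map f x = Tuple (map f (entries x))"

definition hshift ::
    "('k::field, 'r::{ring, monoid_mult}) pdg_alg \<Rightarrow> ('r, ('a, 'x) univ) pdg_mod \<Rightarrow> ('r, ('a, 'x) univ) pdg_mod \<Rightarrow>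
     (('a, 'x) univ \<Rightarrow> ('a, 'x) univ) set \<Rightarrow> (('a, 'x) univ \<Rightarrow> ('a, 'x) univ) set"
  where "hshift A X Y F = (\<Union>f\<in>F. hclass A (shift_ob A X) (shift_ob A Y) (shift_map f))"

fun shift_step ::
    "('k::field, 'r::{ring, monoid_mult}) pdg_alg \<Rightarrow>
     (('r, ('a, 'x) univ) pdg_mod, (('a, 'x) univ \<Rightarrow> ('a, 'x) univ) set) step \<Rightarrow>
     (('r, ('a, 'x) univ) pdg_mod, (('a, 'x) univ \<Rightarrow> ('a, 'x) univ) set) step"
  where
    "shift_step A (Fwd X F Y) = Fwd (shift_ob A X) (hshift A X Y F) (shift_ob A Y)"
  | "shift_step A (Bwd X F Y) = Bwd (shift_ob A X) (hshift A Y X F) (shift_ob A Y)"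

definition dshift ::
    "('k::field, 'r::{ring, monoid_mult}) pdg_alg \<Rightarrow> ('r, ('a, 'x) univ) pdg_mod \<Rightarrow> ('r, ('a, 'x) univ) pdg_mod \<Rightarrow>
     (('r, ('a, 'x) univ) pdg_mod, (('a, 'x) univ \<Rightarrow> ('a, 'x) univ) set) step list set \<Rightarrow>
     (('r, ('a, 'x) univ) pdg_mod, (('a, 'x) univ \<Rightarrow> ('a, 'x) univ) set) step list set"
  where "dshift A X Y P =
     (\<Union>a\<in>P. Collect (loc_eq (homotopy_cat A) (qis A) (shift_ob A X) (shift_ob A Y) (map (shift_step A) a)))"

text \<open>
  A triangle \<open>X \<rightarrow> Y \<rightarrow> Z \<rightarrow> X[1]\<close> in the derived category is distinguished if it is isomorphic to the
  image of a standard triangle \<open>X' \<rightarrow> Y' \<rightarrow> cone f' \<rightarrow> X'[1]\<close>.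
\<close>

definition distinguished ::
    "('k::field, 'r::{ring, monoid_mult}) pdg_alg \<Rightarrow>
     ('r, ('a, 'x) univ) pdg_mod \<Rightarrow> ('r, ('a, 'x) univ) pdg_mod \<Rightarrow> ('r, ('a, 'x) univ) pdg_mod \<Rightarrow>
     (('r, ('a, 'x) univ) pdg_mod, (('a, 'x) univ \<Rightarrow> ('a, 'x) univ) set) step list set \<Rightarrow>
     (('r, ('a, 'x) univ) pdg_mod, (('a, 'x) univ \<Rightarrow> ('a, 'x) univ) set) step list set \<Rightarrow>
     (('r, ('a, 'x) univ) pdg_mod, (('a, 'x) univ \<Rightarrow> ('a, 'x) univ) set) step list set \<Rightarrow> bool"
  where "distinguished A X Y Z f g h \<longleftrightarrow>
     (let D = derived_cat A; S = shift_ob A in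
       X \<in> Ob D \<and> Y \<in> Ob D \<and> Z \<in> Ob D \<and> f \<in> Hom D X Y \<and> g \<in> Hom D Y Z \<and> h \<in> Hom D Z (S X) \<and>
       (\<exists>X' Y' f' \<alpha> \<beta> \<gamma>. pdg_module A X' \<and> pdg_module A Y' \<and> f' \<in> pdg_hom X' Y' \<and>
          (let Z' = cone A X' Y' f' in
            is_iso D X X' \<alpha> \<and> is_iso D Y Y' \<beta> \<and> is_iso D Z Z' \<gamma> \<and>
            cmp D X Y Y' \<beta> f = cmp D X X' Y' (dmor A X' Y' f') \<alpha> \<and>
            cmp D Y Z Z' \<gamma> g = cmp D Y Y' Z' (dmor A Y' Z' (cone_incl A X')) \<beta> \<and>
            cmp D Z (S X) (S X') (dshift A X X' \<alpha>) h
              = cmp D Z Z' (S X') (dmor A Z' (S X') cone_proj) \<gamma>)))"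


section \<open>The Grothendieck group\<close>

text \<open>
  The derived category is taken on the modules inside the universe, and coproducts are indexed by
  subsets of the universe; it has all such coproducts. Since the universe is infinite and contains
  \<open>'r\<close>, every compact object of the full derived category (a retract of a finite extension of shifts
  of the regular module) has a model in it, so \<open>K0\<close> does not depend on \<open>'x\<close>.
\<close>

definition compact_obs ::
    "('k::field, 'r::{ring, monoid_mult}) pdg_alg \<Rightarrow> ('r, ('r, 'x) univ) pdg_mod set"
  where "compact_obs A = {X. is_compact TYPE(('r, 'x) univ)
     (derived_cat A :: (('r, ('r, 'x) univ) pdg_mod, _) cat) X}"

definition K0_relations ::
    "('k::field, 'r::{ring, monoid_mult}) pdg_alg \<Rightarrow> (('r, ('r, 'x) univ) pdg_mod \<Rightarrow>\<^sub>0 int) set"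
  where "K0_relations A = generate (free_Abelian_group (compact_obs A))
     {frag_of Y - frag_of X - frag_of Z | X Y Z.
        X \<in> compact_obs A \<and> Y \<in> compact_obs A \<and> Z \<in> compact_obs A \<and> (\<exists>f g h. distinguished A X Y Z f g h)}"

text \<open>
  The library's quotient groups are written multiplicatively, so sums in \<open>K0 A\<close> are \<open>finprod (K0 A)\<close>.
  Isomorphic objects are identified because of the distinguished triangles \<open>X \<rightarrow> Y \<rightarrow> 0 \<rightarrow> X[1]\<close>.
\<close>

definition K0 ::
    "('k::field, 'r::{ring, monoid_mult}) pdg_alg \<Rightarrow> (('r, ('r, 'x) univ) pdg_mod \<Rightarrow>\<^sub>0 int) set monoid"
  where "K0 A = free_Abelian_group (compact_obs A) Mod K0_relations A"

definition K0_class ::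
    "('k::field, 'r::{ring, monoid_mult}) pdg_alg \<Rightarrow> ('r, ('r, 'x) univ) pdg_mod \<Rightarrow>
     (('r, ('r, 'x) univ) pdg_mod \<Rightarrow>\<^sub>0 int) set"
  where "K0_class A X = K0_relations A #>\<^bsub>free_Abelian_group (compact_obs A)\<^esub> frag_of X"

text \<open>The left ideal \<open>R e\<close>, for \<open>e\<close> of degree 0 with \<open>\<partial>(e) = 0\<close>, as a $p$-DG module.\<close>

definition left_ideal ::
    "('k::field, 'r::{ring, monoid_mult}) pdg_alg \<Rightarrow> 'r \<Rightarrow> ('r, ('r, 'x) univ) pdg_mod"
  where "left_ideal A e =
     \<lparr>carrier = Elem ` range (\<lambda>r. r * e),
      monoid.mult = (\<lambda>_ _. undefined), monoid.one = undefined,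
      ring.zero = Elem 0,
      ring.add = (\<lambda>x y. Elem (elem_of x + elem_of y)),
      smult = (\<lambda>r x. Elem (r * elem_of x)),
      grade = (\<lambda>n. Elem ` (agr A n \<inter> range (\<lambda>r. r * e))),
      dif = (\<lambda>x. Elem (adif A (elem_of x)))\<rparr>"


section \<open>Fantastic filtrations\<close>

text \<open>A pair \<open>(k, i)\<close> in \<open>ord\<close> means that \<open>k \<le> i\<close>. The set below is \<open>F\<close> in filtration degree \<open>< i\<close>.\<close>

definition filt_lt :: "'i set \<Rightarrow> ('i \<Rightarrow> 'r::ring) \<Rightarrow> ('i \<Rightarrow> 'r) \<Rightarrow> ('i \<times> 'i) set \<Rightarrow> 'i \<Rightarrow> 'r set"
  where "filt_lt I u v ord i = {\<Sum>k | k \<in> I \<and> (k, i) \<in> ord \<and> k \<noteq> i. a k * (u k * v k) | a. True}"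

definition fantastic_filtration ::
    "('k, 'r::{ring, monoid_mult}) pdg_alg \<Rightarrow> 'i set \<Rightarrow> ('i \<Rightarrow> 'r) \<Rightarrow> ('i \<Rightarrow> 'r) \<Rightarrow> ('i \<times> 'i) set \<Rightarrow> bool"
  where "fantastic_filtration A I u v ord \<longleftrightarrow> linear_order_on I ord \<and>
     adif A (\<Sum>i\<in>I. u i * v i) = 0 \<and>
     (\<forall>i\<in>I. adif A (v i * u i) = 0) \<and>
     (\<forall>i\<in>I. v i * adif A (u i) = 0) \<and>
     (\<forall>i\<in>I. u i * adif A (v i) \<in> filt_lt I u v ord i)"

end

theory Submission
  imports Defs "HOL-Computational_Algebra.Primes"
begin

text \<open>
  In characteristic \<open>p\<close> the formula defining null-homotopic maps is the \<open>(p - 1)\<close>st power of the commutator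
  \<open>h \<mapsto> h \<partial> - \<partial> h\<close>, which makes homotopies easy to compose. Quasi-isomorphisms can be replaced by acyclic
  fibrations: graded split surjections whose kernel is contractible over the ground field. Pullbacks of
  these give the calculus of fractions in the homotopy category.

  A $p$-DG module \<open>Q\<close> over which every acyclic fibration splits sees all quasi-isomorphisms as bijections on
  homotopy classes of maps out of it; if it is moreover cyclic, then a map from it to a direct sum has finite
  support, and \<open>Q\<close> is compact. The modules \<open>F\<^sup>\<le>\<^sup>i\<close> of a fantastic filtration have this property: over the cell
  \<open>u\<^sub>i v\<^sub>i\<close> a section is determined by the image of \<open>v\<^sub>i\<close>, and any graded choice of it can be corrected inside the
  kernel because \<open>\<partial> v\<^sub>i\<close> lies in \<open>F\<^sup><\<^sup>i\<close>. Right multiplication by \<open>u\<^sub>i\<close> maps the cone of \<open>F\<^sup><\<^sup>i \<subseteq> F\<^sup>\<le>\<^sup>i\<close> onto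
  \<open>R v\<^sub>i u\<^sub>i\<close> by an acyclic fibration, and the resulting triangles add up to the formula in \<open>K\<^sub>0\<close>.
\<close>

section \<open>Additive maps and graded homomorphisms\<close>

text \<open>Two kinds of linearity must be kept apart. A quasi-isomorphism yields homotopies that
  are linear over the ground field only, while a section of a fibration has to be linear over the
  algebra. An acyclic fibration therefore carries an algebra-linear graded splitting and a
  ground-linear contraction of its kernel. Correcting a graded section over a cell means solving one
  equation \<open>dif y' = y\<close> in the kernel. A ground-linear contraction suffices for this:
  \<open>dif^(p - 1) y = 0\<close>, since \<open>p\<close>th powers of differentials vanish, and so
  the only term of the null-homotopy formula that is not a boundary drops out.

  In the derived category, morphisms are classes of zigzags and coproducts are known only by a
  universal property. Zigzags act on homotopy classes of maps out of a suitable \<open>Q\<close>,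
  which turns morphisms out of \<open>Q\<close> into module maps; and a coproduct is shown to be a
  retract of the direct sum of modules, which is enough to detect finite supports.

  Partial sums of the total idempotent are in general not closed. Their left ideals are nevertheless
  stable under the differential, and the vanishing of \<open>v i * adif A (u j)\<close> for
  \<open>j\<close> at or above \<open>i\<close> is what ensures this.\<close>

definition addmap where
  "addmap M N f \<longleftrightarrow> f \<in> carrier M \<rightarrow> carrier N \<and>
     (\<forall>x\<in>carrier M. \<forall>y\<in>carrier M. f (x \<oplus>\<^bsub>M\<^esub> y) = f x \<oplus>\<^bsub>N\<^esub> f y)"

lemma addmap_closed: "addmap M N f \<Longrightarrow> x \<in> carrier M \<Longrightarrow> f x \<in> carrier N"
  by (auto simp: addmap_def)

lemma addmap_add:
  "addmap M N f \<Longrightarrow> x \<in> carrier M \<Longrightarrow> y \<in> carrier M \<Longrightarrow> f (x \<oplus>\<^bsub>M\<^esub> y) = f x \<oplus>\<^bsub>N\<^esub> f y"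
  by (auto simp: addmap_def)

lemma addmap_zero:
  assumes "abelian_group M" "abelian_group N" "addmap M N f"
  shows "f \<zero>\<^bsub>M\<^esub> = \<zero>\<^bsub>N\<^esub>"
proof -
  interpret M: abelian_group M by fact
  interpret N: abelian_group N by fact
  have "f \<zero>\<^bsub>M\<^esub> \<oplus>\<^bsub>N\<^esub> f \<zero>\<^bsub>M\<^esub> = f \<zero>\<^bsub>M\<^esub> \<oplus>\<^bsub>N\<^esub> \<zero>\<^bsub>N\<^esub>"
    using addmap_add[OF assms(3), of "\<zero>\<^bsub>M\<^esub>" "\<zero>\<^bsub>M\<^esub>"] addmap_closed[OF assms(3), of "\<zero>\<^bsub>M\<^esub>"] by simp
  then show ?thesis
    using N.add.l_cancel_one addmap_closed[OF assms(3), of "\<zero>\<^bsub>M\<^esub>"] by simp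
qed

lemma addmap_neg:
  assumes "abelian_group M" "abelian_group N" "addmap M N f" "x \<in> carrier M"
  shows "f (\<ominus>\<^bsub>M\<^esub> x) = \<ominus>\<^bsub>N\<^esub> f x"
proof -
  interpret M: abelian_group M by fact
  interpret N: abelian_group N by fact
  have "f (\<ominus>\<^bsub>M\<^esub> x) \<oplus>\<^bsub>N\<^esub> f x = \<zero>\<^bsub>N\<^esub>"
    using addmap_add[OF assms(3), of "\<ominus>\<^bsub>M\<^esub> x" x] assms(4) addmap_zero[OF assms(1-3)]
    by (simp add: M.l_neg)
  then show ?thesis
    using N.minus_equality addmap_closed[OF assms(3)] assms(4) by (metis M.a_inv_closed)
qed

lemma addmap_sub:
  assumes "abelian_group M" "abelian_group N" "addmap M N f" "x \<in> carrier M" "y \<in> carrier M"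
  shows "f (x \<ominus>\<^bsub>M\<^esub> y) = f x \<ominus>\<^bsub>N\<^esub> f y"
proof -
  interpret M: abelian_group M by fact
  show ?thesis
    using addmap_add[OF assms(3), of x "\<ominus>\<^bsub>M\<^esub> y"] addmap_neg[OF assms(1-3,5)] assms(4,5)
    by (simp add: a_minus_def)
qed

lemma addmap_finsum:
  assumes "abelian_group M" "abelian_group N" "addmap M N f" "x \<in> I \<rightarrow> carrier M"
  shows "f (finsum M x I) = finsum N (\<lambda>i. f (x i)) I"
proof -
  interpret M: abelian_group M by fact
  interpret N: abelian_group N by fact
  show ?thesis using assms(4)
  proof (induction I rule: infinite_finite_induct)
    case (insert i I)
    have "(\<lambda>i. f (x i)) \<in> I \<rightarrow> carrier N" "f (x i) \<in> carrier N"
      using insert.prems addmap_closed[OF assms(3)] by auto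
    then show ?case using insert
      by (simp add: M.finsum_insert N.finsum_insert addmap_add[OF assms(3)] Pi_iff)
  qed (simp_all add: M.finsum_empty N.finsum_empty addmap_zero[OF assms(1-3)])
qed

lemma gr_hom_addmap: "f \<in> gr_hom d M N \<Longrightarrow> addmap M N f"
  by (auto simp: gr_hom_def addmap_def)

lemma gr_hom_closed: "f \<in> gr_hom d M N \<Longrightarrow> x \<in> carrier M \<Longrightarrow> f x \<in> carrier N"
  by (auto simp: gr_hom_def)

lemma gr_hom_add:
  "f \<in> gr_hom d M N \<Longrightarrow> x \<in> carrier M \<Longrightarrow> y \<in> carrier M \<Longrightarrow> f (x \<oplus>\<^bsub>M\<^esub> y) = f x \<oplus>\<^bsub>N\<^esub> f y"
  by (auto simp: gr_hom_def)

lemma gr_hom_smult: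
  "f \<in> gr_hom d M N \<Longrightarrow> x \<in> carrier M \<Longrightarrow> f (r \<odot>\<^bsub>M\<^esub> x) = r \<odot>\<^bsub>N\<^esub> f x"
  by (auto simp: gr_hom_def)

lemma gr_hom_grade: "f \<in> gr_hom d M N \<Longrightarrow> x \<in> grade M n \<Longrightarrow> f x \<in> grade N (n + d)"
  by (auto simp: gr_hom_def)

lemma gr_homI:
  assumes "\<And>x. x \<in> carrier M \<Longrightarrow> f x \<in> carrier N"
    "\<And>x y. x \<in> carrier M \<Longrightarrow> y \<in> carrier M \<Longrightarrow> f (x \<oplus>\<^bsub>M\<^esub> y) = f x \<oplus>\<^bsub>N\<^esub> f y"
    "\<And>r x. x \<in> carrier M \<Longrightarrow> f (r \<odot>\<^bsub>M\<^esub> x) = r \<odot>\<^bsub>N\<^esub> f x"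
    "\<And>n x. x \<in> grade M n \<Longrightarrow> f x \<in> grade N (n + d)"
  shows "f \<in> gr_hom d M N"
  using assms by (auto simp: gr_hom_def)

lemma pdg_hom_gr: "f \<in> pdg_hom M N \<Longrightarrow> f \<in> gr_hom 0 M N"
  by (auto simp: pdg_hom_def)

lemma pdg_hom_dif: "f \<in> pdg_hom M N \<Longrightarrow> x \<in> carrier M \<Longrightarrow> f (dif M x) = dif N (f x)"
  by (auto simp: pdg_hom_def)

lemma pdg_homI: "f \<in> gr_hom 0 M N \<Longrightarrow> (\<And>x. x \<in> carrier M \<Longrightarrow> f (dif M x) = dif N (f x)) \<Longrightarrow> f \<in> pdg_hom M N"
  by (auto simp: pdg_hom_def)

lemmas pdg_hom_closed = gr_hom_closed[OF pdg_hom_gr]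
lemmas pdg_hom_add = gr_hom_add[OF pdg_hom_gr]
lemmas pdg_hom_smult = gr_hom_smult[OF pdg_hom_gr]
lemmas pdg_hom_addmap = gr_hom_addmap[OF pdg_hom_gr]

lemma pdg_hom_grade: "f \<in> pdg_hom M N \<Longrightarrow> x \<in> grade M n \<Longrightarrow> f x \<in> grade N n"
  using gr_hom_grade[OF pdg_hom_gr] by fastforce

lemma gr_hom_comp: "f \<in> gr_hom d L M \<Longrightarrow> g \<in> gr_hom e M N \<Longrightarrow> (\<lambda>x. g (f x)) \<in> gr_hom (d + e) L N"
  by (rule gr_homI) (auto simp: gr_hom_closed gr_hom_add gr_hom_smult add.assoc[symmetric]
      dest!: gr_hom_grade[of f] gr_hom_grade[of g])

lemma gr_hom_comp0: "f \<in> gr_hom d L M \<Longrightarrow> g \<in> gr_hom 0 M N \<Longrightarrow> (\<lambda>x. g (f x)) \<in> gr_hom d L N"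
  using gr_hom_comp[of f d L M g 0 N] by simp

lemma gr_hom_0comp: "f \<in> gr_hom 0 L M \<Longrightarrow> g \<in> gr_hom d M N \<Longrightarrow> (\<lambda>x. g (f x)) \<in> gr_hom d L N"
  using gr_hom_comp[of f 0 L M g d N] by simp

lemma gr_hom_ident: "(\<lambda>x. x) \<in> gr_hom 0 M M"
  by (rule gr_homI) auto

lemma pdg_hom_ident: "(\<lambda>x. x) \<in> pdg_hom M M"
  by (rule pdg_homI) (auto intro: gr_hom_ident)

lemma pdg_hom_comp: "f \<in> pdg_hom L M \<Longrightarrow> g \<in> pdg_hom M N \<Longrightarrow> (\<lambda>x. g (f x)) \<in> pdg_hom L N"
  by (rule pdg_homI) (auto simp: pdg_hom_dif pdg_hom_closed intro: gr_hom_comp0 pdg_hom_gr)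

section \<open>Basic facts on $p$-DG algebras and modules\<close>

context pdg_algebra begin

lemma adif_add: "adif A (x + y) = adif A x + adif A y"
  using adif_linear by (simp add: Vector_Spaces.linear_iff)

lemma adif_0 [simp]: "adif A 0 = 0"
  using adif_add[of 0 0] by simp

lemma adif_1 [simp]: "adif A 1 = 0"
  using adif_Leibniz[of 1 1] by simp

lemma adif_scal: "adif A (scal A c x) = scal A c (adif A x)"
  using adif_linear by (simp add: Vector_Spaces.linear_iff)

lemma prime_pchar: "prime (pchar A)"
  using char_pos by (simp add: pchar_def prime_CHAR_semidom)

lemma pchar_ge2: "pchar A \<ge> 2"
  using prime_pchar prime_ge_2_nat by auto

lemma agr_0 [simp]: "0 \<in> agr A n"
  using agr_subspace subspace_0 by auto

lemma agr_add: "x \<in> agr A n \<Longrightarrow> y \<in> agr A n \<Longrightarrow> x + y \<in> agr A n"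
  using agr_subspace subspace_add by auto

lemma agr_neg: "x \<in> agr A n \<Longrightarrow> - x \<in> agr A n"
  using agr_subspace subspace_neg by auto

lemma agr_scal: "x \<in> agr A n \<Longrightarrow> scal A c x \<in> agr A n"
  using agr_subspace subspace_scale by auto

lemma scal_one_mult: "scal A c 1 * x = scal A c x" "x * scal A c 1 = scal A c x"
  by (simp_all flip: scal_mult_left scal_mult_right)

lemma scal_char: "scal A (of_nat (pchar A)) x = 0"
  by (simp add: pchar_def)

end

context pdg_module begin

lemma zero_smult [simp]: "x \<in> carrier M \<Longrightarrow> 0 \<odot> x = \<zero>"
  using smult_l_distr[of x 0 0] by (metis add.left_neutral add.r_cancel_one smult_closed)

lemma smult_zero [simp]: "r \<odot> \<zero> = \<zero>"
  using smult_r_distr[of \<zero> \<zero> r] by (metis add.r_cancel_one' l_zero smult_closed zero_closed)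

lemma addmap_smult: "addmap M M ((\<odot>) r)"
  by (auto simp: addmap_def smult_closed smult_r_distr)

lemma addmap_dif: "addmap M M (dif M)"
  by (auto simp: addmap_def dif_closed dif_add)

lemma smult_neg: "x \<in> carrier M \<Longrightarrow> r \<odot> (\<ominus> x) = \<ominus> (r \<odot> x)"
  using addmap_neg[OF abelian_group_axioms abelian_group_axioms addmap_smult] .

lemma smult_sub: "x \<in> carrier M \<Longrightarrow> y \<in> carrier M \<Longrightarrow> r \<odot> (x \<ominus> y) = (r \<odot> x) \<ominus> (r \<odot> y)"
  using addmap_sub[OF abelian_group_axioms abelian_group_axioms addmap_smult] .

lemma neg_smult: "x \<in> carrier M \<Longrightarrow> (- r) \<odot> x = \<ominus> (r \<odot> x)"
  using smult_l_distr[of x "- r" r] by (metis add.left_inverse minus_equality smult_closed zero_smult)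

lemma dif_zero [simp]: "dif M \<zero> = \<zero>"
  using addmap_zero[OF abelian_group_axioms abelian_group_axioms addmap_dif] .

lemma dif_neg: "x \<in> carrier M \<Longrightarrow> dif M (\<ominus> x) = \<ominus> (dif M x)"
  using addmap_neg[OF abelian_group_axioms abelian_group_axioms addmap_dif] .

lemma dif_sub: "x \<in> carrier M \<Longrightarrow> y \<in> carrier M \<Longrightarrow> dif M (x \<ominus> y) = dif M x \<ominus> dif M y"
  using addmap_sub[OF abelian_group_axioms abelian_group_axioms addmap_dif] .

lemma dif_pow_closed [simp]: "x \<in> carrier M \<Longrightarrow> (dif M ^^ n) x \<in> carrier M"
  by (induction n) (auto simp: dif_closed)

lemma dif_pow_zero [simp]: "(dif M ^^ n) \<zero> = \<zero>"
  by (induction n) auto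

lemma dif_pow_neg: "x \<in> carrier M \<Longrightarrow> (dif M ^^ n) (\<ominus> x) = \<ominus> ((dif M ^^ n) x)"
  by (induction n) (auto simp: dif_neg)

lemma dif_pow_add: "x \<in> carrier M \<Longrightarrow> y \<in> carrier M \<Longrightarrow> (dif M ^^ n) (x \<oplus> y) = (dif M ^^ n) x \<oplus> (dif M ^^ n) y"
  by (induction n) (auto simp: dif_add)

lemma grade_carrier: "x \<in> grade M n \<Longrightarrow> x \<in> carrier M"
  using additive_subgroup.a_subset[OF grade_subgroup] by auto

lemma grade_zero [simp]: "\<zero> \<in> grade M n"
  using additive_subgroup.zero_closed[OF grade_subgroup] .

lemma grade_add: "x \<in> grade M n \<Longrightarrow> y \<in> grade M n \<Longrightarrow> x \<oplus> y \<in> grade M n"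
  using additive_subgroup.a_closed[OF grade_subgroup] by auto

lemma grade_neg: "x \<in> grade M n \<Longrightarrow> \<ominus> x \<in> grade M n"
  using additive_subgroup.a_inv_closed[OF grade_subgroup] grade_carrier abelian_group_axioms by metis

lemma grade_sub: "x \<in> grade M n \<Longrightarrow> y \<in> grade M n \<Longrightarrow> x \<ominus> y \<in> grade M n"
  by (simp add: a_minus_def grade_add grade_neg)

lemma sub_self [simp]: "x \<in> carrier M \<Longrightarrow> x \<ominus> x = \<zero>"
  by (simp add: a_minus_def r_neg)

lemma sub_zero [simp]: "x \<in> carrier M \<Longrightarrow> x \<ominus> \<zero> = x"
  by (simp add: a_minus_def)

end

context abelian_group begin

lemma sub_add_cancel: "x \<in> carrier G \<Longrightarrow> y \<in> carrier G \<Longrightarrow> (x \<ominus> y) \<oplus> y = x"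
  by (simp add: a_minus_def a_assoc l_neg)

lemma add_sub_cancel: "x \<in> carrier G \<Longrightarrow> y \<in> carrier G \<Longrightarrow> (x \<oplus> y) \<ominus> y = x"
  by (simp add: a_minus_def a_assoc r_neg)

lemma add_sub_cancel_left: "x \<in> carrier G \<Longrightarrow> y \<in> carrier G \<Longrightarrow> (y \<oplus> x) \<ominus> y = x"
  by (simp add: a_comm add_sub_cancel)

lemma sub_sub_cancel: "x \<in> carrier G \<Longrightarrow> y \<in> carrier G \<Longrightarrow> x \<ominus> (x \<ominus> y) = y"
  by (simp add: a_minus_def minus_add a_assoc[symmetric] r_neg)

lemma sub_eq_zero_iff: "x \<in> carrier G \<Longrightarrow> y \<in> carrier G \<Longrightarrow> x \<ominus> y = \<zero> \<longleftrightarrow> x = y"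
  using sub_add_cancel[of x y] by (auto simp: a_minus_def r_neg)

lemma add_sub_add:
  "\<lbrakk>a \<in> carrier G; b \<in> carrier G; c \<in> carrier G; d \<in> carrier G\<rbrakk> \<Longrightarrow>
    (a \<oplus> b) \<ominus> (c \<oplus> d) = (a \<ominus> c) \<oplus> (b \<ominus> d)"
  by (simp add: a_minus_def minus_add a_ac)

lemma sub_trans:
  "\<lbrakk>a \<in> carrier G; b \<in> carrier G; c \<in> carrier G\<rbrakk> \<Longrightarrow> (a \<ominus> b) \<oplus> (b \<ominus> c) = a \<ominus> c"
  by (simp add: a_minus_def a_assoc add.inv_solve_left l_neg r_neg) (metis a_assoc a_inv_closed l_neg l_zero)

lemma neg_sub: "\<lbrakk>a \<in> carrier G; b \<in> carrier G\<rbrakk> \<Longrightarrow> \<ominus> (a \<ominus> b) = b \<ominus> a"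
  by (simp add: a_minus_def minus_add a_comm)

end

section \<open>Null-homotopies as powers of a commutator\<close>

section \<open>Binomial expansions in characteristic $p$\<close>

text \<open>Model: for commuting operators \<open>a\<close>, \<open>b\<close> and
  \<open>z i j = a^i (b^j x)\<close> this is the effect of \<open>a + b\<close>. Arrays are used
  instead of operators because \<open>i\<close> may count differentials in the target of a map and
  \<open>j\<close> those in its source, which are not endomorphisms of one group.\<close>

definition bistep where
  "bistep G z i j = z (Suc i) j \<oplus>\<^bsub>G\<^esub> z i (Suc j)"

context abelian_group begin

text \<open>The binomial theorem for \<open>a + b\<close> in this model. In the sum where the second
  index grows, a term with \<open>n choose Suc n = 0\<close> is added and the index is shifted by
  one; then the coefficients combine by Pascal's rule.\<close>

lemma bistep_pow:
  assumes z: "\<And>i j. z i j \<in> carrier G"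
  shows "(bistep G ^^ n) z i j = (\<Oplus>a\<in>{..n}. [(n choose a)] \<cdot> z (i + a) (j + (n - a)))"
proof (induction n arbitrary: i j)
  case 0
  have "z i j \<in> carrier G" using z .
  then show ?case by (simp add: Pi_iff)
next
  case (Suc n)
  let ?f = "\<lambda>a. [(Suc n choose a)] \<cdot> z (i + a) (j + (Suc n - a))"
  have 1: "(\<Oplus>a\<in>{..n}. [(n choose a)] \<cdot> z (i + a) (Suc j + (n - a)))
      = (\<Oplus>a\<in>{..n}. [(n choose a)] \<cdot> z (i + a) (j + (Suc n - a)))"
    using z by (intro finsum_cong') (auto simp: Suc_diff_le)
  have 2: "(\<Oplus>a\<in>{..n}. [(n choose a)] \<cdot> z (i + a) (j + (Suc n - a)))
      = (\<Oplus>a\<in>{..Suc n}. [(n choose a)] \<cdot> z (i + a) (j + (Suc n - a)))"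
    using z by (simp add: finsum_Suc Pi_iff binomial_eq_0)
  have 3: "\<dots> = (\<Oplus>a\<in>{..n}. [(n choose Suc a)] \<cdot> z (i + Suc a) (j + (n - a))) \<oplus> z i (j + Suc n)"
    using z by (subst finsum_Suc2) (auto simp: Pi_iff)
  have "(bistep G ^^ Suc n) z i j =
     (\<Oplus>a\<in>{..n}. [(n choose a)] \<cdot> z (Suc i + a) (j + (n - a))) \<oplus>
     ((\<Oplus>a\<in>{..n}. [(n choose Suc a)] \<cdot> z (i + Suc a) (j + (n - a))) \<oplus> z i (j + Suc n))"
    by (simp add: bistep_def Suc.IH 1[simplified] 2[simplified] 3[simplified])
  also have "\<dots> = (\<Oplus>a\<in>{..n}. [(n choose a)] \<cdot> z (i + Suc a) (j + (n - a)) \<oplus>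
      [(n choose Suc a)] \<cdot> z (i + Suc a) (j + (n - a))) \<oplus> z i (j + Suc n)"
    using z by (simp add: a_assoc finsum_addf Pi_iff)
  also have "\<dots> = (\<Oplus>a\<in>{..n}. ?f (Suc a)) \<oplus> ?f 0"
    using z by (simp add: add.nat_pow_mult)
  also have "\<dots> = (\<Oplus>a\<in>{..Suc n}. ?f a)"
    using z by (subst finsum_Suc2) (auto simp: Pi_iff)
  finally show ?case .
qed

text \<open>\<open>p\<close> divides \<open>p choose a\<close> for \<open>0 < a < p\<close>, so only
  the two end terms of the expansion survive. This serves both the commutator with the differential
  and the differential of a tower.\<close>

lemma bistep_pow_prime:
  assumes z: "\<And>i j. z i j \<in> carrier G" and p: "prime (p :: nat)"
    and char: "\<And>x. x \<in> carrier G \<Longrightarrow> [p] \<cdot> x = \<zero>"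
  shows "(bistep G ^^ p) z i j = z (i + p) j \<oplus> z i (j + p)"
proof -
  obtain q where q: "p = Suc q" using prime_gt_0_nat[OF p] by (cases p) auto
  have van: "[(p choose a)] \<cdot> x = \<zero>" if "a \<in> {1..q}" "x \<in> carrier G" for a x
  proof -
    have "p dvd (p choose a)" using that q p by (intro dvd_choose_prime) auto
    then obtain m where m: "(p choose a) = p * m" by (auto simp: dvd_def)
    show ?thesis using that char by (simp add: m add.nat_pow_pow[symmetric])
  qed
  have z1: "z (i + Suc a) (j + (q - a)) \<in> carrier G" for a using z by blast
  have "(\<Oplus>a\<in>{..q}. [(p choose a)] \<cdot> z (i + a) (j + (p - a)))
      = (\<Oplus>a\<in>{..q}. if a = 0 then z i (j + p) else \<zero>)"
    using z van by (intro finsum_cong') auto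
  also have "\<dots> = z i (j + p)"
    using z add.finprod_singleton_swap[of 0 "{..q}" "\<lambda>_. z i (j + p)"] by (simp add: Pi_iff)
  finally show ?thesis
    unfolding bistep_pow[OF z] using z by (simp add: q finsum_Suc Pi_iff)
qed

end

context abelian_group begin

text \<open>The sign on odd rows replaces \<open>a + b\<close> by \<open>b - a\<close>. Modulo
  \<open>p\<close> the coefficient \<open>p - 1 choose a\<close> is again \<open>(- 1)^a\<close>,
  and the two signs cancel: this is where a null-homotopy sum without coefficients comes
  from.\<close>

lemma bistep_pow_pred:
  fixes p :: nat
  assumes z: "\<And>i j. z i j \<in> carrier G" and p: "prime p"
    and char: "\<And>x. x \<in> carrier G \<Longrightarrow> [p] \<cdot> x = \<zero>"
  shows "(bistep G ^^ (p - 1)) (\<lambda>i j. if even i then z i j else \<ominus> z i j) 0 0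
    = (\<Oplus>a\<in>{..<p}. z a (p - 1 - a))"
proof -
  obtain q where q: "p = Suc q" using prime_gt_0_nat[OF p] by (cases p) auto
  \<comment> \<open>Induction on \<open>a\<close>: two consecutive coefficients
    \<open>q choose a\<close> and \<open>q choose Suc a\<close> add up to
    \<open>p choose Suc a\<close>, which is divisible by \<open>p\<close>.\<close>
  have binom: "[(q choose a)] \<cdot> x = (if even a then x else \<ominus> x)" if "x \<in> carrier G" "a \<le> q" for x a
    using that(2)
  proof (induction a)
    case (Suc a)
    have "p dvd (p choose Suc a)" using Suc.prems q p by (intro dvd_choose_prime) auto
    then obtain m where m: "(p choose Suc a) = p * m" by (auto simp: dvd_def)
    have "[(q choose Suc a)] \<cdot> x \<oplus> [(q choose a)] \<cdot> x = [(p choose Suc a)] \<cdot> x"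
      using that(1) by (simp add: q add.nat_pow_mult add.commute)
    also have "\<dots> = \<zero>" using that char by (simp add: m add.nat_pow_pow[symmetric])
    finally have "[(q choose Suc a)] \<cdot> x = \<ominus> ([(q choose a)] \<cdot> x)"
      using that(1) by (intro minus_equality[symmetric]) simp_all
    then show ?case using Suc that(1) by auto
  qed (use that in simp)
  let ?z = "\<lambda>i j. if even i then z i j else \<ominus> z i j"
  have z': "?z i j \<in> carrier G" for i j using z by simp
  have "(bistep G ^^ q) ?z 0 0 = (\<Oplus>a\<in>{..q}. [(q choose a)] \<cdot> ?z a (q - a))"
    by (subst bistep_pow) (simp_all only: add_0_left z')
  also have "\<dots> = (\<Oplus>a\<in>{..<p}. z a (p - 1 - a))"
  proof (rule finsum_cong')
    fix a assume "a \<in> {..<p}"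
    then have "a \<le> q" using q by auto
    then show "[(q choose a)] \<cdot> ?z a (q - a) = z a (p - 1 - a)"
      using binom[OF z', of a a "q - a"] z by (simp add: q)
  qed (use q z in auto)
  finally show ?thesis by (simp add: q)
qed

end

lemma bistep_pow_Suc: "(bistep G ^^ Suc n) z i j = (bistep G ^^ n) z (Suc i) j \<oplus>\<^bsub>G\<^esub> (bistep G ^^ n) z i (Suc j)"
  by (simp add: bistep_def)

section \<open>The commutator with the differential\<close>

text \<open>Since \<open>(p - 1 choose i)\<close> is \<open>(- 1)\<^sup>i\<close> modulo \<open>p\<close>, the null-homotopy formula is a power of this operator.\<close>

definition dl where "dl M N g = (\<lambda>x. g (dif M x) \<ominus>\<^bsub>N\<^esub> dif N (g x))"

lemma dl_apply: "dl M N g x = g (dif M x) \<ominus>\<^bsub>N\<^esub> dif N (g x)"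
  by (simp add: dl_def)

lemma dl_pow_Suc: "(dl M N ^^ Suc n) g x = (dl M N ^^ n) g (dif M x) \<ominus>\<^bsub>N\<^esub> dif N ((dl M N ^^ n) g x)"
  by (simp add: dl_def)

locale pdg_module_pair = pdg_algebra A + M: pdg_module A M + N: pdg_module A N
  for A :: "('k::field, 'r::{ring, monoid_mult}) pdg_alg"
    and M :: "('r, 'm) pdg_mod" and N :: "('r, 'n) pdg_mod"
begin

lemma dl_closed: "g \<in> carrier M \<rightarrow> carrier N \<Longrightarrow> dl M N g \<in> carrier M \<rightarrow> carrier N"
  by (auto simp: dl_apply M.dif_closed N.dif_closed Pi_iff)

lemma dl_pow_closed: "g \<in> carrier M \<rightarrow> carrier N \<Longrightarrow> (dl M N ^^ n) g \<in> carrier M \<rightarrow> carrier N"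
  by (induction n) (simp_all add: dl_closed)

lemma dl_pow_closed': "g \<in> carrier M \<rightarrow> carrier N \<Longrightarrow> x \<in> carrier M \<Longrightarrow> (dl M N ^^ n) g x \<in> carrier N"
  using dl_pow_closed by auto

lemma dl_pow_cong:
  "(\<And>x. x \<in> carrier M \<Longrightarrow> g x = g' x) \<Longrightarrow> x \<in> carrier M \<Longrightarrow> (dl M N ^^ n) g x = (dl M N ^^ n) g' x"
  by (induction n arbitrary: x) (simp_all add: dl_apply M.dif_closed)

lemma dl_pow_add:
  assumes g: "g \<in> carrier M \<rightarrow> carrier N" "h \<in> carrier M \<rightarrow> carrier N" and "x \<in> carrier M"
  shows "(dl M N ^^ n) (\<lambda>x. g x \<oplus>\<^bsub>N\<^esub> h x) x = (dl M N ^^ n) g x \<oplus>\<^bsub>N\<^esub> (dl M N ^^ n) h x"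
  using \<open>x \<in> carrier M\<close>
proof (induction n arbitrary: x)
  case (Suc n)
  have "(dl M N ^^ n) g y \<in> carrier N" "(dl M N ^^ n) h y \<in> carrier N" if "y \<in> carrier M" for y
    using dl_pow_closed' g that by auto
  then show ?case using Suc
    by (simp add: dl_pow_Suc M.dif_closed N.dif_add N.add_sub_add N.dif_closed del: funpow.simps)
qed simp

lemma dl_pow_neg:
  assumes g: "g \<in> carrier M \<rightarrow> carrier N" and "x \<in> carrier M"
  shows "(dl M N ^^ n) (\<lambda>x. \<ominus>\<^bsub>N\<^esub> g x) x = \<ominus>\<^bsub>N\<^esub> (dl M N ^^ n) g x"
  using \<open>x \<in> carrier M\<close>
proof (induction n arbitrary: x)
  case (Suc n)
  have "(dl M N ^^ n) g y \<in> carrier N" if "y \<in> carrier M" for y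
    using dl_pow_closed' g that by auto
  then show ?case using Suc
    by (simp add: dl_pow_Suc M.dif_closed N.dif_neg N.dif_closed a_minus_def N.minus_add del: funpow.simps)
qed simp

lemma dl_gr_hom:
  assumes g: "g \<in> gr_hom d M N"
  shows "dl M N g \<in> gr_hom (d + 2) M N"
proof (rule gr_homI)
  fix x y assume xy: "x \<in> carrier M" "y \<in> carrier M"
  show "dl M N g (x \<oplus>\<^bsub>M\<^esub> y) = dl M N g x \<oplus>\<^bsub>N\<^esub> dl M N g y"
    using xy by (simp add: dl_apply M.dif_add M.dif_closed gr_hom_add[OF g] N.dif_add gr_hom_closed[OF g]
        N.dif_closed N.add_sub_add)
next
  fix r x assume x: "x \<in> carrier M"
  show "dl M N g (r \<odot>\<^bsub>M\<^esub> x) = r \<odot>\<^bsub>N\<^esub> dl M N g x"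
    using x by (simp add: dl_apply M.dif_Leibniz M.smult_closed M.dif_closed gr_hom_add[OF g] gr_hom_smult[OF g]
        N.dif_Leibniz gr_hom_closed[OF g] N.dif_closed N.add_sub_add N.smult_closed N.smult_sub)
next
  fix n x assume x: "x \<in> grade M n"
  have "g (dif M x) \<in> grade N (n + 2 + d)" "dif N (g x) \<in> grade N (n + d + 2)"
    using x by (auto intro!: M.dif_degree N.dif_degree gr_hom_grade[OF g])
  then show "dl M N g x \<in> grade N (n + (d + 2))"
    unfolding dl_apply by (intro N.grade_sub) (simp_all add: algebra_simps)
qed (use g gr_hom_closed M.dif_closed N.dif_closed in \<open>auto simp: dl_apply gr_hom_closed\<close>)

lemma dl_pow_gr_hom: "g \<in> gr_hom d M N \<Longrightarrow> (dl M N ^^ n) g \<in> gr_hom (d + 2 * int n) M N"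
proof (induction n)
  case (Suc n)
  then show ?case using dl_gr_hom[of "(dl M N ^^ n) g" "d + 2 * int n"] by (simp add: algebra_simps)
qed simp

lemma add_pow_smult: "x \<in> carrier N \<Longrightarrow> [n] \<cdot>\<^bsub>N\<^esub> x = scal A (of_nat n) 1 \<odot>\<^bsub>N\<^esub> x"
proof (induction n)
  case (Suc n)
  then show ?case
    by (simp add: scale_left_distrib N.smult_l_distr N.smult_one N.a_comm N.smult_closed)
qed simp

lemma char_add_pow: "x \<in> carrier N \<Longrightarrow> [pchar A] \<cdot>\<^bsub>N\<^esub> x = \<zero>\<^bsub>N\<^esub>"
  by (simp only: add_pow_smult scal_char N.zero_smult)

text \<open>The array is \<open>(- 1)^i dif_N^i g dif_M^j\<close> evaluated at \<open>x\<close>.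
  With this sign, replacing \<open>g\<close> by its commutator \<open>g dif - dif g\<close> is one
  application of \<open>bistep\<close>.\<close>

lemma dl_pow_bistep:
  assumes "g \<in> carrier M \<rightarrow> carrier N" "x \<in> carrier M"
  shows "(if even i then (dif N ^^ i) ((dl M N ^^ n) g ((dif M ^^ j) x))
      else \<ominus>\<^bsub>N\<^esub> (dif N ^^ i) ((dl M N ^^ n) g ((dif M ^^ j) x))) =
    (bistep N ^^ n) (\<lambda>i j. if even i then (dif N ^^ i) (g ((dif M ^^ j) x))
      else \<ominus>\<^bsub>N\<^esub> (dif N ^^ i) (g ((dif M ^^ j) x))) i j"
proof (induction n arbitrary: i j)
  case (Suc n)
  have cl: "(dl M N ^^ n) g y \<in> carrier N" if "y \<in> carrier M" for y
    using dl_pow_closed' assms(1) that by auto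
  let ?y = "(dl M N ^^ n) g ((dif M ^^ Suc j) x)" and ?z = "(dl M N ^^ n) g ((dif M ^^ j) x)"
  have [simp]: "?y \<in> carrier N" "?z \<in> carrier N" "dif N ?z \<in> carrier N"
    using cl assms M.dif_pow_closed N.dif_closed by blast+
  then have [simp]: "(dl M N ^^ n) g (dif M ((dif M ^^ j) x)) \<in> carrier N" by simp
  have e: "(dif N ^^ i) ((dl M N ^^ Suc n) g ((dif M ^^ j) x)) = (dif N ^^ i) ?y \<ominus>\<^bsub>N\<^esub> (dif N ^^ Suc i) ?z"
    by (simp add: dl_apply a_minus_def N.dif_pow_add N.dif_pow_neg funpow_swap1[of "dif N"])
  show ?case
    by (simp only: e bistep_pow_Suc Suc.IH[symmetric])
       (simp add: a_minus_def N.minus_add N.a_comm del: funpow.simps(2))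
qed simp

lemma bistep_arg_closed:
  assumes "g \<in> carrier M \<rightarrow> carrier N" "x \<in> carrier M"
  shows "(if even i then (dif N ^^ i) (g ((dif M ^^ j) x)) else \<ominus>\<^bsub>N\<^esub> (dif N ^^ i) (g ((dif M ^^ j) x))) \<in> carrier N"
proof -
  have "g ((dif M ^^ j) x) \<in> carrier N" using assms M.dif_pow_closed by auto
  then show ?thesis by simp
qed

text \<open>Both surviving terms of the expansion contain a \<open>p\<close>th power of a
  differential. The value at zero is a separate hypothesis because \<open>g\<close> is an arbitrary
  function here, not assumed additive.\<close>

lemma dl_pow_pchar:
  assumes "g \<in> carrier M \<rightarrow> carrier N" "g \<zero>\<^bsub>M\<^esub> = \<zero>\<^bsub>N\<^esub>" "x \<in> carrier M"
  shows "(dl M N ^^ pchar A) g x = \<zero>\<^bsub>N\<^esub>"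
proof -
  have "g x \<in> carrier N" using assms by auto
  then show ?thesis
    using dl_pow_bistep[OF assms(1,3), of 0 "pchar A" 0] assms
    by (simp add: N.bistep_pow_prime[OF bistep_arg_closed[OF assms(1,3)] prime_pchar char_add_pow]
        M.dif_nilpotent N.dif_nilpotent)
qed

lemma dl_pow_pred:
  assumes "g \<in> carrier M \<rightarrow> carrier N" "x \<in> carrier M"
  shows "(dl M N ^^ (pchar A - 1)) g x =
    (\<Oplus>\<^bsub>N\<^esub>i\<in>{..<pchar A}. (dif N ^^ i) (g ((dif M ^^ (pchar A - 1 - i)) x)))"
proof -
  have "(dif N ^^ i) (g ((dif M ^^ j) x)) \<in> carrier N" for i j
  proof -
    have "g ((dif M ^^ j) x) \<in> carrier N" using assms M.dif_pow_closed by auto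
    then show ?thesis by simp
  qed
  from N.bistep_pow_pred[OF this prime_pchar char_add_pow]
  show ?thesis
    using dl_pow_bistep[OF assms, of 0 "pchar A - 1" 0] by simp
qed

lemma gr_hom_funcset: "h \<in> gr_hom d M N \<Longrightarrow> h \<in> carrier M \<rightarrow> carrier N"
  by (auto simp: gr_hom_closed)

lemma null_homotopic_iff: 
  "null_homotopic A M N f \<longleftrightarrow>
    (\<exists>h \<in> gr_hom (2 - 2 * int (pchar A)) M N. \<forall>x\<in>carrier M. f x = (dl M N ^^ (pchar A - 1)) h x)"
  unfolding null_homotopic_def
  by (intro bex_cong ball_cong refl) (simp only: dl_pow_pred[OF gr_hom_funcset])

lemma int_pchar_pred: "2 * int (pchar A - 1) = 2 * int (pchar A) - 2"
  using pchar_ge2 by (simp add: of_nat_diff)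

text \<open>A map commutes with the differentials exactly when its commutator vanishes, and one
  further commutator of \<open>dl^(p - 1) h\<close> is \<open>dl^p h = 0\<close>. The degree comes
  out as 0 because each \<open>dl\<close> raises it by 2.\<close>

lemma dl_pow_pred_pdg_hom:
  assumes "h \<in> gr_hom (2 - 2 * int (pchar A)) M N"
  shows "(dl M N ^^ (pchar A - 1)) h \<in> pdg_hom M N"
proof (rule pdg_homI)
  show 1: "(dl M N ^^ (pchar A - 1)) h \<in> gr_hom 0 M N"
    using dl_pow_gr_hom[OF assms, of "pchar A - 1"] by (simp only: int_pchar_pred) simp
  fix x assume x: "x \<in> carrier M"
  have h: "h \<in> carrier M \<rightarrow> carrier N" "h \<zero>\<^bsub>M\<^esub> = \<zero>\<^bsub>N\<^esub>"
    using assms addmap_zero[OF M.abelian_group_axioms N.abelian_group_axioms gr_hom_addmap[OF assms]]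
      gr_hom_closed by auto
  obtain q where q: "pchar A = Suc q" using pchar_ge2 by (cases "pchar A") auto
  have "dl M N ((dl M N ^^ (pchar A - 1)) h) x = \<zero>\<^bsub>N\<^esub>"
    using dl_pow_pchar[OF h x] by (simp add: q)
  then show "(dl M N ^^ (pchar A - 1)) h (dif M x) = dif N ((dl M N ^^ (pchar A - 1)) h x)"
    unfolding dl_apply[of M N "(dl M N ^^ (pchar A - 1)) h"]
    using N.sub_eq_zero_iff gr_hom_closed[OF 1] x M.dif_closed N.dif_closed by blast
qed

end

text \<open>A map \<open>f\<close> that commutes with the differentials can be pulled out of the
  commutator. Hence a homotopy can be composed with a morphism; \<open>dl_pow_precomp\<close> is the
  same on the other side.\<close>

lemma dl_pow_postcomp:
  assumes "pdg_module_pair A M N" "pdg_module A L" "f \<in> pdg_hom N L"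
    and g: "g \<in> carrier M \<rightarrow> carrier N" and "x \<in> carrier M"
  shows "(dl M L ^^ n) (\<lambda>x. f (g x)) x = f ((dl M N ^^ n) g x)"
proof -
  interpret pdg_module_pair A M N by fact
  interpret L: pdg_module A L by fact
  show ?thesis using \<open>x \<in> carrier M\<close>
  proof (induction n arbitrary: x)
    case (Suc n)
    have "(dl M N ^^ n) g y \<in> carrier N" if "y \<in> carrier M" for y
      using dl_pow_closed' g that by auto
    then show ?case using Suc
      by (simp add: dl_pow_Suc M.dif_closed N.dif_closed pdg_hom_dif[OF assms(3)]
        addmap_sub[OF N.abelian_group_axioms L.abelian_group_axioms pdg_hom_addmap[OF assms(3)]]
        del: funpow.simps)
  qed simp
qed

lemma dl_pow_precomp:
  assumes "f \<in> pdg_hom L M" and "x \<in> carrier L" and "\<And>x. x \<in> carrier L \<Longrightarrow> dif L x \<in> carrier L"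
  shows "(dl L N ^^ n) (\<lambda>x. g (f x)) x = (dl M N ^^ n) g (f x)"
  using assms(2) by (induction n arbitrary: x) (simp_all add: dl_apply pdg_hom_dif[OF assms(1)] assms(3))

section \<open>Homotopy\<close>

context pdg_module_pair begin

lemma homotopic_iff:
  "homotopic A M N f g \<longleftrightarrow>
    (\<exists>h \<in> gr_hom (2 - 2 * int (pchar A)) M N. \<forall>x\<in>carrier M. f x \<ominus>\<^bsub>N\<^esub> g x = (dl M N ^^ (pchar A - 1)) h x)"
  unfolding homotopic_def null_homotopic_iff ..

lemma zero_gr_hom: "(\<lambda>_. \<zero>\<^bsub>N\<^esub>) \<in> gr_hom d M N"
  by (rule gr_homI) auto

lemma neg_gr_hom: "h \<in> gr_hom d M N \<Longrightarrow> (\<lambda>x. \<ominus>\<^bsub>N\<^esub> h x) \<in> gr_hom d M N"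
  by (rule gr_homI) (auto simp: gr_hom_closed gr_hom_add gr_hom_smult N.minus_add N.smult_neg N.a_comm
      intro!: N.grade_neg dest!: gr_hom_grade[of h])

lemma add_gr_hom: "h \<in> gr_hom d M N \<Longrightarrow> g \<in> gr_hom d M N \<Longrightarrow> (\<lambda>x. h x \<oplus>\<^bsub>N\<^esub> g x) \<in> gr_hom d M N"
  by (rule gr_homI) (auto simp: gr_hom_closed gr_hom_add gr_hom_smult N.smult_r_distr N.a_ac N.smult_closed
      intro!: N.grade_add dest!: gr_hom_grade[of h] gr_hom_grade[of g])

lemma sub_gr_hom: "h \<in> gr_hom d M N \<Longrightarrow> g \<in> gr_hom d M N \<Longrightarrow> (\<lambda>x. h x \<ominus>\<^bsub>N\<^esub> g x) \<in> gr_hom d M N"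
  unfolding a_minus_def by (intro add_gr_hom neg_gr_hom)

lemma zero_pdg_hom: "(\<lambda>_. \<zero>\<^bsub>N\<^esub>) \<in> pdg_hom M N"
  by (rule pdg_homI) (auto intro: zero_gr_hom)

lemma add_pdg_hom: "h \<in> pdg_hom M N \<Longrightarrow> g \<in> pdg_hom M N \<Longrightarrow> (\<lambda>x. h x \<oplus>\<^bsub>N\<^esub> g x) \<in> pdg_hom M N"
  by (rule pdg_homI[OF add_gr_hom[OF pdg_hom_gr pdg_hom_gr]]) (auto simp: pdg_hom_closed pdg_hom_dif N.dif_add)

lemma sub_pdg_hom: "h \<in> pdg_hom M N \<Longrightarrow> g \<in> pdg_hom M N \<Longrightarrow> (\<lambda>x. h x \<ominus>\<^bsub>N\<^esub> g x) \<in> pdg_hom M N"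
  by (rule pdg_homI[OF sub_gr_hom[OF pdg_hom_gr pdg_hom_gr]]) (auto simp: pdg_hom_closed pdg_hom_dif N.dif_sub)

lemma null_homotopic_zero: "null_homotopic A M N (\<lambda>_. \<zero>\<^bsub>N\<^esub>)"
proof -
  have "(dl M N ^^ n) (\<lambda>_. \<zero>\<^bsub>N\<^esub>) x = \<zero>\<^bsub>N\<^esub>" for n x
    by (induction n arbitrary: x) (auto simp: dl_apply)
  then show ?thesis unfolding null_homotopic_iff using zero_gr_hom by (intro bexI) auto
qed

lemma null_homotopic_add:
  assumes "null_homotopic A M N f" "null_homotopic A M N g"
  shows "null_homotopic A M N (\<lambda>x. f x \<oplus>\<^bsub>N\<^esub> g x)"
proof -
  obtain h where h: "h \<in> gr_hom (2 - 2 * int (pchar A)) M N" "\<forall>x\<in>carrier M. f x = (dl M N ^^ (pchar A - 1)) h x"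
    using assms(1) null_homotopic_iff by auto
  obtain k where k: "k \<in> gr_hom (2 - 2 * int (pchar A)) M N" "\<forall>x\<in>carrier M. g x = (dl M N ^^ (pchar A - 1)) k x"
    using assms(2) null_homotopic_iff by auto
  show ?thesis unfolding null_homotopic_iff
    using add_gr_hom[OF h(1) k(1)] h(2) k(2) dl_pow_add[OF gr_hom_funcset[OF h(1)] gr_hom_funcset[OF k(1)]]
    by (intro bexI[of _ "\<lambda>x. h x \<oplus>\<^bsub>N\<^esub> k x"]) auto
qed

lemma null_homotopic_neg:
  assumes "null_homotopic A M N f"
  shows "null_homotopic A M N (\<lambda>x. \<ominus>\<^bsub>N\<^esub> f x)"
proof -
  obtain h where h: "h \<in> gr_hom (2 - 2 * int (pchar A)) M N" "\<forall>x\<in>carrier M. f x = (dl M N ^^ (pchar A - 1)) h x"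
    using assms(1) null_homotopic_iff by auto
  show ?thesis unfolding null_homotopic_iff
    using neg_gr_hom[OF h(1)] h(2) dl_pow_neg[OF gr_hom_funcset[OF h(1)]]
    by (intro bexI[of _ "\<lambda>x. \<ominus>\<^bsub>N\<^esub> h x"]) auto
qed

lemma null_homotopic_cong:
  "(\<And>x. x \<in> carrier M \<Longrightarrow> f x = g x) \<Longrightarrow> null_homotopic A M N f \<longleftrightarrow> null_homotopic A M N g"
  unfolding null_homotopic_iff by (intro bex_cong ball_cong refl) auto

lemma homotopic_refl: "f \<in> pdg_hom M N \<Longrightarrow> homotopic A M N f f"
  unfolding homotopic_def
  by (rule iffD2[OF null_homotopic_cong null_homotopic_zero]) (simp add: pdg_hom_closed)

lemma homotopicI_eq:
  "f \<in> pdg_hom M N \<Longrightarrow> (\<And>x. x \<in> carrier M \<Longrightarrow> f x = g x) \<Longrightarrow> homotopic A M N f g"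
  unfolding homotopic_def
  by (rule iffD2[OF null_homotopic_cong null_homotopic_zero]) (metis N.sub_self pdg_hom_closed)

lemma homotopic_sym:
  assumes "f \<in> pdg_hom M N" "g \<in> pdg_hom M N" "homotopic A M N f g"
  shows "homotopic A M N g f"
  using null_homotopic_neg[OF assms(3)[unfolded homotopic_def]] unfolding homotopic_def
  by (rule iffD1[OF null_homotopic_cong, rotated])
    (simp add: N.neg_sub pdg_hom_closed[OF assms(1)] pdg_hom_closed[OF assms(2)])

lemma homotopic_trans:
  assumes "f \<in> pdg_hom M N" "g \<in> pdg_hom M N" "h \<in> pdg_hom M N"
    "homotopic A M N f g" "homotopic A M N g h"
  shows "homotopic A M N f h"
  using null_homotopic_add[OF assms(4,5)[unfolded homotopic_def]] unfolding homotopic_def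
  by (rule iffD1[OF null_homotopic_cong, rotated])
    (simp add: N.sub_trans pdg_hom_closed[OF assms(1)] pdg_hom_closed[OF assms(2)] pdg_hom_closed[OF assms(3)])

lemma homotopic_add:
  assumes "f \<in> pdg_hom M N" "g \<in> pdg_hom M N" "f' \<in> pdg_hom M N" "g' \<in> pdg_hom M N"
    "homotopic A M N f g" "homotopic A M N f' g'"
  shows "homotopic A M N (\<lambda>x. f x \<oplus>\<^bsub>N\<^esub> f' x) (\<lambda>x. g x \<oplus>\<^bsub>N\<^esub> g' x)"
  using null_homotopic_add[OF assms(5,6)[unfolded homotopic_def]] unfolding homotopic_def
  by (rule iffD1[OF null_homotopic_cong, rotated])
    (simp add: N.add_sub_add pdg_hom_closed[OF assms(1)] pdg_hom_closed[OF assms(2)]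
      pdg_hom_closed[OF assms(3)] pdg_hom_closed[OF assms(4)])

end

lemma null_homotopic_postcomp:
  assumes "pdg_algebra A" "pdg_module A M" "pdg_module A N" "pdg_module A L"
    and f: "f \<in> pdg_hom N L" and "null_homotopic A M N g"
  shows "null_homotopic A M L (\<lambda>x. f (g x))"
proof -
  interpret MN: pdg_module_pair A M N by (intro pdg_module_pair.intro assms)
  interpret MtoL: pdg_module_pair A M L by (intro pdg_module_pair.intro assms)
  obtain h where h: "h \<in> gr_hom (2 - 2 * int (pchar A)) M N" "\<forall>x\<in>carrier M. g x = (dl M N ^^ (pchar A - 1)) h x"
    using assms(6) MN.null_homotopic_iff by auto
  show ?thesis unfolding MtoL.null_homotopic_iff
    using gr_hom_comp0[OF h(1) pdg_hom_gr[OF f]] h(2)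
      dl_pow_postcomp[OF MN.pdg_module_pair_axioms assms(4) f MN.gr_hom_funcset[OF h(1)]]
    by (intro bexI[of _ "\<lambda>x. f (h x)"]) auto
qed

lemma null_homotopic_precomp:
  assumes "pdg_algebra A" "pdg_module A M" "pdg_module A N" "pdg_module A L"
    and f: "f \<in> pdg_hom L M" and "null_homotopic A M N g"
  shows "null_homotopic A L N (\<lambda>x. g (f x))"
proof -
  interpret MN: pdg_module_pair A M N by (intro pdg_module_pair.intro assms)
  interpret LN: pdg_module_pair A L N by (intro pdg_module_pair.intro assms)
  obtain h where h: "h \<in> gr_hom (2 - 2 * int (pchar A)) M N" "\<forall>x\<in>carrier M. g x = (dl M N ^^ (pchar A - 1)) h x"
    using assms(6) MN.null_homotopic_iff by auto
  show ?thesis unfolding LN.null_homotopic_iff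
    using gr_hom_0comp[OF pdg_hom_gr[OF f] h(1)] h(2)
      dl_pow_precomp[OF f, where N = N] LN.M.dif_closed pdg_hom_closed[OF f]
    by (intro bexI[of _ "\<lambda>x. h (f x)"]) auto
qed

lemma homotopic_postcomp:
  assumes "pdg_algebra A" "pdg_module A M" "pdg_module A N" "pdg_module A L"
    and f: "f \<in> pdg_hom N L" and g: "g \<in> pdg_hom M N" "g' \<in> pdg_hom M N" and "homotopic A M N g g'"
  shows "homotopic A M L (\<lambda>x. f (g x)) (\<lambda>x. f (g' x))"
proof -
  interpret MN: pdg_module_pair A M N by (intro pdg_module_pair.intro assms)
  interpret MtoL: pdg_module_pair A M L by (intro pdg_module_pair.intro assms)
  show ?thesis
    using null_homotopic_postcomp[OF assms(1-5) assms(8)[unfolded homotopic_def]] unfolding homotopic_def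
    by (rule iffD1[OF MtoL.null_homotopic_cong, rotated])
      (simp add: pdg_hom_closed[OF g(1)] pdg_hom_closed[OF g(2)]
        addmap_sub[OF MN.N.abelian_group_axioms MtoL.N.abelian_group_axioms pdg_hom_addmap[OF f]])
qed

lemma homotopic_precomp:
  assumes "pdg_algebra A" "pdg_module A M" "pdg_module A N" "pdg_module A L"
    and f: "f \<in> pdg_hom L M" and "homotopic A M N g g'"
  shows "homotopic A L N (\<lambda>x. g (f x)) (\<lambda>x. g' (f x))"
  using null_homotopic_precomp[OF assms(1-5) assms(6)[unfolded homotopic_def]] unfolding homotopic_def .

lemma homotopic_comp:
  assumes "pdg_algebra A" "pdg_module A L" "pdg_module A M" "pdg_module A N"
    and f: "f \<in> pdg_hom L M" "f' \<in> pdg_hom L M" and g: "g \<in> pdg_hom M N" "g' \<in> pdg_hom M N"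
    and "homotopic A L M f f'" "homotopic A M N g g'"
  shows "homotopic A L N (\<lambda>x. g (f x)) (\<lambda>x. g' (f' x))"
proof -
  interpret LN: pdg_module_pair A L N by (intro pdg_module_pair.intro assms)
  show ?thesis
    using homotopic_postcomp[OF assms(1,2,3,4) g(1) f assms(9)]
      homotopic_precomp[OF assms(1,3,4,2) f(2) assms(10)]
    by (rule LN.homotopic_trans[OF pdg_hom_comp[OF f(1) g(1)] pdg_hom_comp[OF f(2) g(1)] pdg_hom_comp[OF f(2) g(2)]])
qed

section \<open>Building graded modules from known ones\<close>

section \<open>Homogeneous components\<close>

definition cpt where
  "cpt M n x = (THE c. (\<forall>n. c n \<in> grade M n) \<and> finite {n. c n \<noteq> \<zero>\<^bsub>M\<^esub>} \<and>
     x = (\<Oplus>\<^bsub>M\<^esub>n\<in>{n. c n \<noteq> \<zero>\<^bsub>M\<^esub>}. c n)) n"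

context pdg_module begin

lemma cpt_spec:
  assumes "x \<in> carrier M"
  shows "(\<forall>n. cpt M n x \<in> grade M n) \<and> finite {n. cpt M n x \<noteq> \<zero>} \<and> x = (\<Oplus>n\<in>{n. cpt M n x \<noteq> \<zero>}. cpt M n x)"
  using theI'[OF grade_decomp[OF assms]] unfolding cpt_def .

lemma cpt_grade: "x \<in> carrier M \<Longrightarrow> cpt M n x \<in> grade M n"
  and cpt_finite: "x \<in> carrier M \<Longrightarrow> finite {n. cpt M n x \<noteq> \<zero>}"
  and cpt_sum: "x \<in> carrier M \<Longrightarrow> x = (\<Oplus>n\<in>{n. cpt M n x \<noteq> \<zero>}. cpt M n x)"
  using cpt_spec by auto

lemma cpt_closed: "x \<in> carrier M \<Longrightarrow> cpt M n x \<in> carrier M"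
  using cpt_grade grade_carrier by auto

lemma cpt_sum_superset:
  assumes "x \<in> carrier M" "finite S" "{n. cpt M n x \<noteq> \<zero>} \<subseteq> S"
  shows "x = (\<Oplus>n\<in>S. cpt M n x)"
proof -
  have "(\<Oplus>n\<in>{n. cpt M n x \<noteq> \<zero>}. cpt M n x) = (\<Oplus>n\<in>S. cpt M n x)"
    using assms by (intro add.finprod_mono_neutral_cong_left) (auto intro: cpt_closed)
  then show ?thesis using cpt_sum[OF assms(1)] by simp
qed

lemma cpt_unique:
  assumes "finite S" "\<And>n. n \<in> S \<Longrightarrow> c n \<in> grade M n" "x = (\<Oplus>n\<in>S. c n)"
  shows "cpt M n x = (if n \<in> S then c n else \<zero>)"
proof -
  define c' where "c' n = (if n \<in> S then c n else \<zero>)" for n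
  have c: "c n \<in> carrier M" if "n \<in> S" for n using that assms(2) grade_carrier by auto
  have sub: "{n. c' n \<noteq> \<zero>} \<subseteq> S" by (auto simp: c'_def)
  have "(\<Oplus>n\<in>{n. c' n \<noteq> \<zero>}. c' n) = (\<Oplus>n\<in>S. c n)"
    using assms(1) c sub by (intro add.finprod_mono_neutral_cong_left) (auto simp: c'_def)
  then have c': "(\<forall>n. c' n \<in> grade M n) \<and> finite {n. c' n \<noteq> \<zero>} \<and> x = (\<Oplus>n\<in>{n. c' n \<noteq> \<zero>}. c' n)"
    using assms sub finite_subset by (auto simp: c'_def)
  have x: "x \<in> carrier M" using assms(3) c by auto
  have "(\<lambda>n. cpt M n x) = c'"
    by (rule ex1E[OF grade_decomp[OF x]]) (metis cpt_spec[OF x] c')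
  then show ?thesis by (metis c'_def)
qed

lemma cpt_homog:
  assumes "x \<in> grade M n"
  shows "cpt M m x = (if m = n then x else \<zero>)"
proof -
  have "x \<in> carrier M" using assms grade_carrier by auto
  then show ?thesis
    using cpt_unique[of "{n}" "\<lambda>_. x" x m] assms by (simp add: finsum_insert)
qed

lemma cpt_add:
  assumes "x \<in> carrier M" "y \<in> carrier M"
  shows "cpt M m (x \<oplus> y) = cpt M m x \<oplus> cpt M m y"
proof -
  let ?S = "{n. cpt M n x \<noteq> \<zero>} \<union> {n. cpt M n y \<noteq> \<zero>}"
  have S: "finite ?S" using assms cpt_finite by auto
  have "x \<oplus> y = (\<Oplus>n\<in>?S. cpt M n x) \<oplus> (\<Oplus>n\<in>?S. cpt M n y)"
    using cpt_sum_superset[OF _ S] assms by simp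
  also have "\<dots> = (\<Oplus>n\<in>?S. cpt M n x \<oplus> cpt M n y)"
    using assms by (intro finsum_addf[symmetric]) (auto intro: cpt_closed)
  finally show ?thesis
    using cpt_unique[OF S, of "\<lambda>n. cpt M n x \<oplus> cpt M n y" "x \<oplus> y" m] assms
    by (auto simp: grade_add cpt_grade)
qed

lemma cpt_addmap: "addmap M M (cpt M n)"
  by (auto simp: addmap_def cpt_add cpt_closed)

lemma cpt_eqI:
  assumes "x \<in> carrier M" "y \<in> carrier M" "\<And>n. cpt M n x = cpt M n y"
  shows "x = y"
proof -
  have "(\<Oplus>n\<in>{n. cpt M n x \<noteq> \<zero>}. cpt M n x) = (\<Oplus>n\<in>{n. cpt M n y \<noteq> \<zero>}. cpt M n y)"
    using assms(3) by simp
  then show ?thesis by (metis cpt_sum assms(1,2))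
qed

end

text \<open>A homogeneous map turns the decomposition of \<open>x\<close> into one of
  \<open>f x\<close> whose indices are moved by \<open>d\<close>; uniqueness of decompositions does
  the rest.\<close>

lemma cpt_hom:
  assumes "pdg_module A M" "pdg_module A N" and f: "f \<in> gr_hom d M N" and x: "x \<in> carrier M"
  shows "cpt N (n + d) (f x) = f (cpt M n x)"
proof -
  interpret M: pdg_module A M by fact
  interpret N: pdg_module A N by fact
  let ?S = "{n. cpt M n x \<noteq> \<zero>\<^bsub>M\<^esub>}"
  have S: "finite ?S" using x M.cpt_finite by auto
  have "f x = f (\<Oplus>\<^bsub>M\<^esub>n\<in>?S. cpt M n x)"
    by (rule arg_cong[OF M.cpt_sum[OF x]])
  also have "\<dots> = (\<Oplus>\<^bsub>N\<^esub>n\<in>?S. f (cpt M n x))"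
    using M.cpt_closed[OF x]
    by (intro addmap_finsum[OF M.abelian_group_axioms N.abelian_group_axioms gr_hom_addmap[OF f]]) auto
  also have "\<dots> = (\<Oplus>\<^bsub>N\<^esub>n\<in>(\<lambda>n. n + d) ` ?S. f (cpt M (n - d) x))"
    using M.cpt_closed[OF x] gr_hom_closed[OF f] by (subst N.finsum_reindex) (auto simp: inj_on_def)
  finally have "cpt N (n + d) (f x) = (if n + d \<in> (\<lambda>n. n + d) ` ?S then f (cpt M (n + d - d) x) else \<zero>\<^bsub>N\<^esub>)"
    using S M.cpt_grade[OF x] gr_hom_grade[OF f] by (intro N.cpt_unique) fastforce+
  then show ?thesis
    using addmap_zero[OF M.abelian_group_axioms N.abelian_group_axioms gr_hom_addmap[OF f]] by auto
qed

text \<open>Only projections that separate points have to be supplied. That \<open>x\<close> is the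
  sum of its projections follows by comparing the projections of both sides, and uniqueness by
  applying \<open>pr m\<close> to a given decomposition.\<close>

lemma (in abelian_group) grade_decompI:
  fixes gd :: "int \<Rightarrow> 'a set"
  assumes gd: "\<And>n. gd n \<subseteq> carrier G"
    and pr: "\<And>n x. x \<in> carrier G \<Longrightarrow> pr n x \<in> gd n"
    and pr_add: "\<And>n. addmap G G (pr n)"
    and pr_homog: "\<And>m n x. x \<in> gd n \<Longrightarrow> pr m x = (if m = n then x else \<zero>)"
    and fin: "\<And>x. x \<in> carrier G \<Longrightarrow> finite {n. pr n x \<noteq> \<zero>}"
    and inj: "\<And>x y. x \<in> carrier G \<Longrightarrow> y \<in> carrier G \<Longrightarrow> (\<And>n. pr n x = pr n y) \<Longrightarrow> x = y"
    and x: "x \<in> carrier G"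
  shows "\<exists>!c. (\<forall>n. c n \<in> gd n) \<and> finite {n. c n \<noteq> \<zero>} \<and> x = (\<Oplus>n\<in>{n. c n \<noteq> \<zero>}. c n)"
proof -
  have pr_sum: "pr m (\<Oplus>n\<in>{n. c n \<noteq> \<zero>}. c n) = c m"
    if c: "\<forall>n. c n \<in> gd n" "finite {n. c n \<noteq> \<zero>}" for c m
  proof -
    let ?S = "{n. c n \<noteq> \<zero>}"
    have cc: "c n \<in> carrier G" for n using c gd by auto
    have "pr m (\<Oplus>n\<in>?S. c n) = (\<Oplus>n\<in>?S. pr m (c n))"
      using cc by (intro addmap_finsum[OF abelian_group_axioms abelian_group_axioms pr_add]) auto
    also have "\<dots> = (\<Oplus>n\<in>?S. if m = n then c n else \<zero>)"
      using cc pr_homog c by (intro finsum_cong') auto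
    also have "\<dots> = c m"
    proof (cases "m \<in> ?S")
      case True
      then show ?thesis using finsum_singleton[of m ?S c] c(2) cc by auto
    next
      case False
      then have "(\<Oplus>n\<in>?S. if m = n then c n else \<zero>) = (\<Oplus>n\<in>?S. \<zero>)" by (intro finsum_cong') auto
      then show ?thesis using False by simp
    qed
    finally show ?thesis .
  qed
  have cl: "pr n x \<in> carrier G" for n using pr x gd by auto
  show ?thesis
  proof (rule ex1I[of _ "\<lambda>n. pr n x"])
    show "(\<forall>n. pr n x \<in> gd n) \<and> finite {n. pr n x \<noteq> \<zero>} \<and> x = (\<Oplus>n\<in>{n. pr n x \<noteq> \<zero>}. pr n x)"
    proof (intro conjI allI)
      show "x = (\<Oplus>n\<in>{n. pr n x \<noteq> \<zero>}. pr n x)"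
        by (rule inj) (use x cl pr_sum[of "\<lambda>n. pr n x"] pr[OF x] fin[OF x] in auto)
    qed (use pr[OF x] fin[OF x] in auto)
  next
    fix c assume c: "(\<forall>n. c n \<in> gd n) \<and> finite {n. c n \<noteq> \<zero>} \<and> x = (\<Oplus>n\<in>{n. c n \<noteq> \<zero>}. c n)"
    show "c = (\<lambda>n. pr n x)"
    proof
      fix n
      have "pr n x = pr n (\<Oplus>n\<in>{n. c n \<noteq> \<zero>}. c n)" using c by (intro arg_cong[of x _ "pr n"]) blast
      also have "\<dots> = c n" using c by (intro pr_sum) blast+
      finally show "c n = pr n x" ..
    qed
  qed
qed

section \<open>Modules described by coordinates\<close>

text \<open>For modules that embed into a product of known ones, so that the equational axioms can
  be checked coordinate by coordinate: towers, degree shifts, pullbacks, direct sums and left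
  ideals. \<open>d j\<close> is the degree shift of coordinate \<open>j\<close>; \<open>comp\<close>
  says that components taken in all coordinates at once come from an element, and \<open>fin\<close>
  bounds the occurring degrees uniformly in \<open>j\<close>. The differential is left out, because
  in a tower it does not act coordinatewise.\<close>

locale coord_module =
  fixes A :: "('k::field, 'r::{ring, monoid_mult}) pdg_alg"
    and M :: "('r, 'm) pdg_mod" and J :: "'j set" and N :: "'j \<Rightarrow> ('r, 'n) pdg_mod"
    and \<pi> :: "'j \<Rightarrow> 'm \<Rightarrow> 'n" and d :: "'j \<Rightarrow> int"
  assumes N: "\<And>j. j \<in> J \<Longrightarrow> pdg_module A (N j)"
    and \<pi>_closed: "\<And>j x. j \<in> J \<Longrightarrow> x \<in> carrier M \<Longrightarrow> \<pi> j x \<in> carrier (N j)"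
    and inj: "\<And>x y. x \<in> carrier M \<Longrightarrow> y \<in> carrier M \<Longrightarrow> (\<And>j. j \<in> J \<Longrightarrow> \<pi> j x = \<pi> j y) \<Longrightarrow> x = y"
    and zero: "\<zero>\<^bsub>M\<^esub> \<in> carrier M" "\<And>j. j \<in> J \<Longrightarrow> \<pi> j \<zero>\<^bsub>M\<^esub> = \<zero>\<^bsub>N j\<^esub>"
    and add: "\<And>x y. x \<in> carrier M \<Longrightarrow> y \<in> carrier M \<Longrightarrow> x \<oplus>\<^bsub>M\<^esub> y \<in> carrier M"
      "\<And>j x y. j \<in> J \<Longrightarrow> x \<in> carrier M \<Longrightarrow> y \<in> carrier M \<Longrightarrow> \<pi> j (x \<oplus>\<^bsub>M\<^esub> y) = \<pi> j x \<oplus>\<^bsub>N j\<^esub> \<pi> j y"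
    and smult: "\<And>r x. x \<in> carrier M \<Longrightarrow> r \<odot>\<^bsub>M\<^esub> x \<in> carrier M"
      "\<And>j r x. j \<in> J \<Longrightarrow> x \<in> carrier M \<Longrightarrow> \<pi> j (r \<odot>\<^bsub>M\<^esub> x) = r \<odot>\<^bsub>N j\<^esub> \<pi> j x"
    and grade: "\<And>n. grade M n = {x \<in> carrier M. \<forall>j\<in>J. \<pi> j x \<in> grade (N j) (n + d j)}"
    and comp: "\<And>x n. x \<in> carrier M \<Longrightarrow> \<exists>y\<in>carrier M. \<forall>j\<in>J. \<pi> j y = cpt (N j) (n + d j) (\<pi> j x)"
    and fin: "\<And>x. x \<in> carrier M \<Longrightarrow> finite {n. \<exists>j\<in>J. cpt (N j) (n + d j) (\<pi> j x) \<noteq> \<zero>\<^bsub>N j\<^esub>}"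
begin

lemma abelian_group: "abelian_group M"
proof (rule abelian_groupI)
  fix x y z assume x: "x \<in> carrier M" and y: "y \<in> carrier M" and z: "z \<in> carrier M"
  show "x \<oplus>\<^bsub>M\<^esub> y \<oplus>\<^bsub>M\<^esub> z = x \<oplus>\<^bsub>M\<^esub> (y \<oplus>\<^bsub>M\<^esub> z)"
  proof (rule inj)
    fix j assume j: "j \<in> J"
    interpret pdg_module A "N j" using N[OF j] .
    show "\<pi> j (x \<oplus>\<^bsub>M\<^esub> y \<oplus>\<^bsub>M\<^esub> z) = \<pi> j (x \<oplus>\<^bsub>M\<^esub> (y \<oplus>\<^bsub>M\<^esub> z))"
      using x y z j by (simp add: add \<pi>_closed a_assoc)
  qed (use x y z add in auto)
next
  fix x y assume x: "x \<in> carrier M" and y: "y \<in> carrier M"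
  show "x \<oplus>\<^bsub>M\<^esub> y = y \<oplus>\<^bsub>M\<^esub> x"
  proof (rule inj)
    fix j assume j: "j \<in> J"
    interpret pdg_module A "N j" using N[OF j] .
    show "\<pi> j (x \<oplus>\<^bsub>M\<^esub> y) = \<pi> j (y \<oplus>\<^bsub>M\<^esub> x)"
      using x y j by (simp add: add \<pi>_closed a_comm)
  qed (use x y add in auto)
next
  fix x assume x: "x \<in> carrier M"
  show "\<zero>\<^bsub>M\<^esub> \<oplus>\<^bsub>M\<^esub> x = x"
  proof (rule inj)
    fix j assume j: "j \<in> J"
    interpret pdg_module A "N j" using N[OF j] .
    show "\<pi> j (\<zero>\<^bsub>M\<^esub> \<oplus>\<^bsub>M\<^esub> x) = \<pi> j x"
      using x j by (simp add: add zero \<pi>_closed)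
  qed (use x add zero in auto)
  \<comment> \<open>Negatives are obtained as multiples by \<open>-1\<close>, so that scalar
    multiplication already provides them.\<close>
  have "(-1) \<odot>\<^bsub>M\<^esub> x \<oplus>\<^bsub>M\<^esub> x = \<zero>\<^bsub>M\<^esub>"
  proof (rule inj)
    fix j assume j: "j \<in> J"
    interpret pdg_module A "N j" using N[OF j] .
    show "\<pi> j ((-1) \<odot>\<^bsub>M\<^esub> x \<oplus>\<^bsub>M\<^esub> x) = \<pi> j \<zero>\<^bsub>M\<^esub>"
      using x j by (simp add: add zero smult \<pi>_closed neg_smult smult_one l_neg)
  qed (use x add zero smult in auto)
  then show "\<exists>y\<in>carrier M. y \<oplus>\<^bsub>M\<^esub> x = \<zero>\<^bsub>M\<^esub>" using smult x by auto
qed (use add zero in auto)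

lemma \<pi>_addmap: "j \<in> J \<Longrightarrow> addmap M (N j) (\<pi> j)"
  by (auto simp: addmap_def \<pi>_closed add)

lemma \<pi>_neg: "j \<in> J \<Longrightarrow> x \<in> carrier M \<Longrightarrow> \<pi> j (\<ominus>\<^bsub>M\<^esub> x) = \<ominus>\<^bsub>N j\<^esub> \<pi> j x"
  using N by (intro addmap_neg[OF abelian_group _ \<pi>_addmap]) (auto simp: pdg_module_def)

lemma \<pi>_sub: "j \<in> J \<Longrightarrow> x \<in> carrier M \<Longrightarrow> y \<in> carrier M \<Longrightarrow> \<pi> j (x \<ominus>\<^bsub>M\<^esub> y) = \<pi> j x \<ominus>\<^bsub>N j\<^esub> \<pi> j y"
  using N by (intro addmap_sub[OF abelian_group _ \<pi>_addmap]) (auto simp: pdg_module_def)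

lemma \<pi>_finsum: "j \<in> J \<Longrightarrow> x \<in> S \<rightarrow> carrier M \<Longrightarrow> \<pi> j (finsum M x S) = finsum (N j) (\<lambda>i. \<pi> j (x i)) S"
  using N by (intro addmap_finsum[OF abelian_group _ \<pi>_addmap]) (auto simp: pdg_module_def)

lemma grade_subgroup: "additive_subgroup (grade M n) M"
proof -
  interpret M: abelian_group M by (rule abelian_group)
  show ?thesis
  proof (rule additive_subgroup.intro, rule subgroup.intro, simp_all)
    show "grade M n \<subseteq> carrier M" by (auto simp: grade)
    show "\<zero>\<^bsub>M\<^esub> \<in> grade M n" using N by (auto simp: grade zero pdg_module.grade_zero[OF N])
    fix x assume x: "x \<in> grade M n"
    have "inv\<^bsub>add_monoid M\<^esub> x = \<ominus>\<^bsub>M\<^esub> x" by (simp add: a_inv_def)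
    moreover have "\<ominus>\<^bsub>M\<^esub> x \<in> grade M n" 
      using x N by (auto simp: grade \<pi>_neg intro!: pdg_module.grade_neg)
    ultimately show "inv\<^bsub>add_monoid M\<^esub> x \<in> grade M n" by simp
  qed (use N add in \<open>auto simp: grade intro!: pdg_module.grade_add\<close>)
qed

lemma grade_decomp:
  assumes "x \<in> carrier M"
  shows "\<exists>!c. (\<forall>n. c n \<in> grade M n) \<and> finite {n. c n \<noteq> \<zero>\<^bsub>M\<^esub>} \<and> x = (\<Oplus>\<^bsub>M\<^esub>n\<in>{n. c n \<noteq> \<zero>\<^bsub>M\<^esub>}. c n)"
proof -
  interpret M: abelian_group M by (rule abelian_group)
  define pr where "pr n x = (SOME y. y \<in> carrier M \<and> (\<forall>j\<in>J. \<pi> j y = cpt (N j) (n + d j) (\<pi> j x)))" for n x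
  have "pr n x \<in> carrier M \<and> (\<forall>j\<in>J. \<pi> j (pr n x) = cpt (N j) (n + d j) (\<pi> j x))" if "x \<in> carrier M" for n x
    unfolding pr_def by (rule someI_ex) (use comp[OF that, of n] in blast)
  then have pr: "\<And>n x. x \<in> carrier M \<Longrightarrow> pr n x \<in> carrier M"
    "\<And>n x j. x \<in> carrier M \<Longrightarrow> j \<in> J \<Longrightarrow> \<pi> j (pr n x) = cpt (N j) (n + d j) (\<pi> j x)" by blast+
  show ?thesis
  proof (rule M.grade_decompI[of "grade M" pr])
    fix n show "grade M n \<subseteq> carrier M" by (auto simp: grade)
    show "addmap M M (pr n)"
      using pr N by (auto simp: addmap_def add pdg_module.cpt_add[OF N] \<pi>_closed intro!: inj)
    fix x assume "x \<in> carrier M"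
    then show "pr n x \<in> grade M n"
      using pr N by (auto simp: grade \<pi>_closed intro!: pdg_module.cpt_grade)
  next
    fix m n x assume x: "x \<in> grade M n"
    show "pr m x = (if m = n then x else \<zero>\<^bsub>M\<^esub>)"
    proof (rule inj)
      fix j assume j: "j \<in> J"
      show "\<pi> j (pr m x) = \<pi> j (if m = n then x else \<zero>\<^bsub>M\<^esub>)"
        using x j pr pdg_module.cpt_homog[OF N[OF j], of "\<pi> j x" "n + d j" "m + d j"] by (auto simp: grade zero)
    qed (use x pr zero in \<open>auto simp: grade\<close>)
  next
    fix x assume x: "x \<in> carrier M"
    have "{n. pr n x \<noteq> \<zero>\<^bsub>M\<^esub>} \<subseteq> {n. \<exists>j\<in>J. cpt (N j) (n + d j) (\<pi> j x) \<noteq> \<zero>\<^bsub>N j\<^esub>}"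
    proof
      fix n assume n: "n \<in> {n. pr n x \<noteq> \<zero>\<^bsub>M\<^esub>}"
      then have "\<exists>j\<in>J. \<pi> j (pr n x) \<noteq> \<pi> j \<zero>\<^bsub>M\<^esub>" using inj[of "pr n x" "\<zero>\<^bsub>M\<^esub>"] x pr zero by auto
      then show "n \<in> {n. \<exists>j\<in>J. cpt (N j) (n + d j) (\<pi> j x) \<noteq> \<zero>\<^bsub>N j\<^esub>}" using x pr zero by auto
    qed
    then show "finite {n. pr n x \<noteq> \<zero>\<^bsub>M\<^esub>}" using fin[OF x] finite_subset by blast
  next
    fix x y assume x: "x \<in> carrier M" "y \<in> carrier M" and eq: "\<And>n. pr n x = pr n y"
    show "x = y"
    proof (rule inj[OF x])
      fix j assume j: "j \<in> J"
      have "cpt (N j) n (\<pi> j x) = cpt (N j) n (\<pi> j y)" for n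
        using pr(2)[OF x(1) j, of "n - d j"] pr(2)[OF x(2) j, of "n - d j"] eq by simp
      then show "\<pi> j x = \<pi> j y"
        using pdg_module.cpt_eqI[OF N[OF j]] \<pi>_closed[OF j] x by blast
    qed
  qed fact
qed

lemma pdg_moduleI:
  assumes dif: "\<And>x. x \<in> carrier M \<Longrightarrow> dif M x \<in> carrier M"
    "\<And>x y. x \<in> carrier M \<Longrightarrow> y \<in> carrier M \<Longrightarrow> dif M (x \<oplus>\<^bsub>M\<^esub> y) = dif M x \<oplus>\<^bsub>M\<^esub> dif M y"
    "\<And>x n. x \<in> grade M n \<Longrightarrow> dif M x \<in> grade M (n + 2)"
    "\<And>x. x \<in> carrier M \<Longrightarrow> (dif M ^^ pchar A) x = \<zero>\<^bsub>M\<^esub>"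
    "\<And>r x. x \<in> carrier M \<Longrightarrow> dif M (r \<odot>\<^bsub>M\<^esub> x) = (adif A r \<odot>\<^bsub>M\<^esub> x) \<oplus>\<^bsub>M\<^esub> (r \<odot>\<^bsub>M\<^esub> dif M x)"
  shows "pdg_module A M"
proof (intro pdg_module.intro pdg_module_axioms.intro)
  note [simp] = smult add \<pi>_closed
  show "abelian_group M" by (rule abelian_group)
  fix x r s assume x: "x \<in> carrier M"
  show "(r + s) \<odot>\<^bsub>M\<^esub> x = r \<odot>\<^bsub>M\<^esub> x \<oplus>\<^bsub>M\<^esub> s \<odot>\<^bsub>M\<^esub> x"
    using x N by (intro inj) (auto simp: pdg_module.smult_l_distr[OF N])
  show "(r * s) \<odot>\<^bsub>M\<^esub> x = r \<odot>\<^bsub>M\<^esub> (s \<odot>\<^bsub>M\<^esub> x)"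
    using x N by (intro inj) (auto simp: pdg_module.smult_assoc[OF N])
  show "1 \<odot>\<^bsub>M\<^esub> x = x"
    using x N by (intro inj) (auto simp: pdg_module.smult_one[OF N])
  fix y assume y: "y \<in> carrier M"
  show "r \<odot>\<^bsub>M\<^esub> (x \<oplus>\<^bsub>M\<^esub> y) = r \<odot>\<^bsub>M\<^esub> x \<oplus>\<^bsub>M\<^esub> r \<odot>\<^bsub>M\<^esub> y"
    using x y N by (intro inj) (auto simp: pdg_module.smult_r_distr[OF N])
next
  fix r m x n assume r: "r \<in> agr A m" and x: "x \<in> grade M n"
  show "r \<odot>\<^bsub>M\<^esub> x \<in> grade M (m + n)"
    using r x N by (auto simp: grade smult add.assoc intro!: pdg_module.grade_smult)
qed (use smult dif grade_subgroup grade_decomp in auto)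

text \<open>The case in which the coordinates are compatible with the differential, so that its
  axioms are inherited too. It covers all uses except towers.\<close>

lemma pdg_moduleI_strict:
  assumes A: "pdg_algebra A" and cl: "\<And>x. x \<in> carrier M \<Longrightarrow> dif M x \<in> carrier M"
    and \<pi>_dif: "\<And>j x. j \<in> J \<Longrightarrow> x \<in> carrier M \<Longrightarrow> \<pi> j (dif M x) = dif (N j) (\<pi> j x)"
  shows "pdg_module A M"
proof (rule pdg_moduleI)
  note [simp] = smult add \<pi>_closed cl \<pi>_dif
  show "dif M x \<in> carrier M" if "x \<in> carrier M" for x using that cl by auto
  show "dif M (x \<oplus>\<^bsub>M\<^esub> y) = dif M x \<oplus>\<^bsub>M\<^esub> dif M y" if "x \<in> carrier M" "y \<in> carrier M" for x y
    using that N by (intro inj) (auto simp: pdg_module.dif_add[OF N])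
  show "dif M x \<in> grade M (n + 2)" if "x \<in> grade M n" for x n
  proof -
    have "dif (N j) (\<pi> j x) \<in> grade (N j) (n + 2 + d j)" if "j \<in> J" for j
      using pdg_module.dif_degree[OF N[OF that], of "\<pi> j x" "n + d j"] \<open>x \<in> grade M n\<close> that
      by (simp add: grade algebra_simps)
    then show ?thesis using that by (simp add: grade)
  qed
  show "(dif M ^^ pchar A) x = \<zero>\<^bsub>M\<^esub>" if x: "x \<in> carrier M" for x
  proof -
    have *: "(dif M ^^ n) x \<in> carrier M \<and> (\<forall>j\<in>J. \<pi> j ((dif M ^^ n) x) = (dif (N j) ^^ n) (\<pi> j x))" for n
      using x by (induction n) auto
    then show ?thesis using x zero N by (intro inj) (auto simp: pdg_module.dif_nilpotent[OF N])
  qed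
  show "dif M (r \<odot>\<^bsub>M\<^esub> x) = (adif A r \<odot>\<^bsub>M\<^esub> x) \<oplus>\<^bsub>M\<^esub> (r \<odot>\<^bsub>M\<^esub> dif M x)" if "x \<in> carrier M" for r x
    using that N by (intro inj) (auto simp: pdg_module.dif_Leibniz[OF N])
qed

end

section \<open>The ground field and underlying $p$-complexes\<close>

lemma pchar_ground: "pchar (ground :: ('k::field, 'k) pdg_alg) = pchar (A :: ('k, 'r) pdg_alg)"
  by (simp add: pchar_def)

lemma pdg_algebra_ground:
  assumes "pdg_algebra (A :: ('k::field, 'r::{ring, monoid_mult}) pdg_alg)"
  shows "pdg_algebra (ground :: ('k, 'k) pdg_alg)"
proof -
  interpret pdg_algebra A by fact
  have vs: "vector_space ((*) :: 'k \<Rightarrow> 'k \<Rightarrow> 'k)"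
    by unfold_locales (auto simp: algebra_simps)
  then have vs': "vector_space (scal (ground :: ('k, 'k) pdg_alg))" by (simp add: ground_def)
  interpret G: vector_space "scal (ground :: ('k, 'k) pdg_alg)" by (rule vs')
  show ?thesis
  proof (intro pdg_algebra.intro pdg_algebra_axioms.intro vs')
    show "pchar (ground :: ('k, 'k) pdg_alg) > 0" using char_pos by (simp add: pchar_def)
    fix n show "G.subspace (agr (ground :: ('k, 'k) pdg_alg) n)"
      by (auto simp: G.subspace_def) (auto simp: ground_def split: if_splits)
    show "(adif (ground :: ('k, 'k) pdg_alg) ^^ pchar (ground :: ('k, 'k) pdg_alg)) x = 0" for x :: 'k
      using char_pos by (simp add: pchar_def ground_def) (metis funpow_simps_right(2) comp_apply gr0_implies_Suc funpow.simps(2))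
    show "Vector_Spaces.linear (scal (ground :: ('k, 'k) pdg_alg)) (scal (ground :: ('k, 'k) pdg_alg)) (adif (ground :: ('k, 'k) pdg_alg))"
      using vs' by (simp add: Vector_Spaces.linear_iff) (simp add: ground_def)
    fix x :: 'k
    show "\<exists>!c. (\<forall>n. c n \<in> agr (ground :: ('k, 'k) pdg_alg) n) \<and> finite {n. c n \<noteq> 0} \<and> x = (\<Sum>n | c n \<noteq> 0. c n)"
    proof (rule ex1I[of _ "\<lambda>n. if n = 0 then x else 0"])
      have fs: "finite {n::int. n = 0 \<and> x \<noteq> 0}" by (rule finite_subset[of _ "{0}"]) auto
      have "(\<Sum>n | (if n = (0::int) then x else 0) \<noteq> 0. if n = 0 then x else 0) = (\<Sum>n\<in>{0::int}. if n = 0 then x else 0)"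
        by (rule sum.mono_neutral_left) auto
      also have "\<dots> = x" by simp
      finally have sum: "x = (\<Sum>n | (if n = (0::int) then x else 0) \<noteq> 0. if n = 0 then x else 0)" ..
      show "(\<forall>n. (if n = 0 then x else 0) \<in> agr (ground :: ('k, 'k) pdg_alg) n) \<and> finite {n. (if n = (0::int) then x else 0) \<noteq> 0} \<and>
        x = (\<Sum>n | (if n = (0::int) then x else 0) \<noteq> 0. if n = 0 then x else 0)"
        using fs sum by (intro conjI) (auto simp: ground_def)
    next
      fix c assume c: "(\<forall>n. c n \<in> agr (ground :: ('k, 'k) pdg_alg) n) \<and> finite {n. c n \<noteq> 0} \<and> x = (\<Sum>n | c n \<noteq> 0. c n)"
      then have c0: "c n = 0" if "n \<noteq> 0" for n using that by (auto simp: ground_def split: if_splits dest!: spec[of _ n])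
      have "{n. c n \<noteq> 0} \<subseteq> {0}" using c0 by auto
      then have "(\<Sum>n | c n \<noteq> 0. c n) = (\<Sum>n\<in>{0}. c n)" by (intro sum.mono_neutral_left) auto
      then have "x = c 0" using c by simp
      then show "c = (\<lambda>n. if n = 0 then x else 0)" using c0 by auto
    qed
  qed (auto simp: ground_def split: if_splits)
qed

lemma underlying_simps [simp]:
  "carrier (underlying A M) = carrier M" "ring.zero (underlying A M) = ring.zero M"
  "ring.add (underlying A M) = ring.add M" "grade (underlying A M) = grade M" "dif (underlying A M) = dif M"
  "smult (underlying A M) c x = scal A c 1 \<odot>\<^bsub>M\<^esub> x"
  by (simp_all add: underlying_def)

lemma a_minus_underlying [simp]: "a_minus (underlying A M) = a_minus M"
  by (intro ext) (simp add: a_minus_def a_inv_def m_inv_def)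

lemma finsum_underlying [simp]: "finsum (underlying A M) = finsum M"
  by (intro ext) (simp add: finsum_def finprod_def)

lemma dl_underlying [simp]: "dl (underlying A M) (underlying A N) = dl M N"
  by (intro ext) (simp add: dl_def)

lemma pdg_module_underlying:
  assumes "pdg_algebra (A :: ('k::field, 'r::{ring, monoid_mult}) pdg_alg)" "pdg_module A M"
  shows "pdg_module (ground :: ('k, 'k) pdg_alg) (underlying A M)"
proof -
  interpret pdg_algebra A by fact
  interpret M: pdg_module A M by fact
  show ?thesis
  proof (intro pdg_module.intro pdg_module_axioms.intro)
    show "abelian_group (underlying A M)"
      using abelian_groupE[OF M.abelian_group_axioms] by (intro abelian_groupI) auto
    show "additive_subgroup (grade (underlying A M) n) (underlying A M)" for n
      using M.grade_subgroup[of n] by (simp add: additive_subgroup_def subgroup_def m_inv_def)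
    show "r \<odot>\<^bsub>underlying A M\<^esub> x \<in> grade (underlying A M) (m + n)"
      if "r \<in> agr (ground :: ('k, 'k) pdg_alg) m" "x \<in> grade (underlying A M) n" for r m x n
    proof (cases "m = 0")
      case True
      then show ?thesis using M.grade_smult[of "scal A r 1" 0 x n] agr_scal[OF agr_one] that by simp
    next
      case False
      then show ?thesis using that M.grade_carrier by (simp add: ground_def)
    qed
    show "\<exists>!c. (\<forall>n. c n \<in> grade (underlying A M) n) \<and> finite {n. c n \<noteq> \<zero>\<^bsub>underlying A M\<^esub>} \<and>
      x = (\<Oplus>\<^bsub>underlying A M\<^esub>n\<in>{n. c n \<noteq> \<zero>\<^bsub>underlying A M\<^esub>}. c n)" if "x \<in> carrier (underlying A M)" for x
      using M.grade_decomp[of x] that by simp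
    show "(dif (underlying A M) ^^ pchar (ground :: ('k, 'k) pdg_alg)) x = \<zero>\<^bsub>underlying A M\<^esub>"
      if "x \<in> carrier (underlying A M)" for x
      using M.dif_nilpotent[of x] that by (simp add: pchar_ground[of A])
    show "dif (underlying A M) (r \<odot>\<^bsub>underlying A M\<^esub> x) =
      adif (ground :: ('k, 'k) pdg_alg) r \<odot>\<^bsub>underlying A M\<^esub> x \<oplus>\<^bsub>underlying A M\<^esub> r \<odot>\<^bsub>underlying A M\<^esub> dif (underlying A M) x"
      if "x \<in> carrier (underlying A M)" for x r
      using that by (simp add: M.dif_Leibniz adif_scal) (simp add: ground_def)
    show "(r * s) \<odot>\<^bsub>underlying A M\<^esub> x = r \<odot>\<^bsub>underlying A M\<^esub> (s \<odot>\<^bsub>underlying A M\<^esub> x)"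
      if "x \<in> carrier (underlying A M)" for x r s
      using that by (simp add: M.smult_assoc[symmetric] scal_one_mult mult.commute)
  qed (auto simp: M.smult_closed M.smult_r_distr M.smult_one scale_left_distrib M.smult_l_distr
       M.dif_closed M.dif_add M.dif_degree)
qed

lemma gr_hom_underlying: "f \<in> gr_hom d M N \<Longrightarrow> f \<in> gr_hom d (underlying A M) (underlying A N)"
  by (auto simp: gr_hom_def)

lemma pdg_hom_underlying: "f \<in> pdg_hom M N \<Longrightarrow> f \<in> pdg_hom (underlying A M) (underlying A N)"
  by (auto simp: pdg_hom_def gr_hom_underlying)

section \<open>Towers, inclusion cones, path objects and pullbacks\<close>

section \<open>Towers\<close>

text \<open>At most \<open>p\<close> layers are allowed: the connecting maps move entries up by one
  layer, and the \<open>p\<close>th power of that shift has to vanish for the differential to be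
  \<open>p\<close>-nilpotent.\<close>

locale pdg_tower = pdg_algebra A
  for A :: "('k::field, 'r::{ring, monoid_mult}) pdg_alg" +
  fixes Ms :: "('r, ('a, 'x) univ) pdg_mod list" and \<phi> :: "nat \<Rightarrow> ('a, 'x) univ \<Rightarrow> ('a, 'x) univ"
  assumes len: "length Ms \<le> pchar A"
    and mods: "\<And>i. i < length Ms \<Longrightarrow> pdg_module A (Ms ! i)"
    and \<phi>: "\<And>i. Suc i < length Ms \<Longrightarrow> \<phi> i \<in> pdg_hom (Ms ! i) (Ms ! Suc i)"
begin

lemma tower_carrierI:
  "length xs = length Ms \<Longrightarrow> (\<And>i. i < length Ms \<Longrightarrow> xs ! i \<in> carrier (Ms ! i)) \<Longrightarrow> Tuple xs \<in> carrier (tower A Ms \<phi>)"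
  by (auto simp: tower_def)

lemma tower_carrierD:
  assumes "x \<in> carrier (tower A Ms \<phi>)"
  shows "x = Tuple (entries x)" "length (entries x) = length Ms"
    "i < length Ms \<Longrightarrow> entries x ! i \<in> carrier (Ms ! i)"
  using assms by (auto simp: tower_def)

lemma tower_eqI:
  assumes "x \<in> carrier (tower A Ms \<phi>)" "y \<in> carrier (tower A Ms \<phi>)"
    "\<And>i. i < length Ms \<Longrightarrow> entries x ! i = entries y ! i"
  shows "x = y"
  using tower_carrierD[OF assms(1)] tower_carrierD[OF assms(2)] assms(3)
  by (metis nth_equalityI)

lemma entries_dif_tower:
  "i < length Ms \<Longrightarrow> entries (dif (tower A Ms \<phi>) x) ! i =
    (if i = 0 then dif (Ms ! i) (entries x ! i)
     else dif (Ms ! i) (entries x ! i) \<oplus>\<^bsub>Ms ! i\<^esub> \<phi> (i - 1) (entries x ! (i - 1)))"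
  using nth_upt[of 0 i "length Ms"] by (auto simp: tower_def)

lemma entries_add_tower:
  "i < length Ms \<Longrightarrow> entries (x \<oplus>\<^bsub>tower A Ms \<phi>\<^esub> y) ! i = entries x ! i \<oplus>\<^bsub>Ms ! i\<^esub> entries y ! i"
  by (simp add: tower_def)

lemma entries_smult_tower:
  "i < length Ms \<Longrightarrow> entries (r \<odot>\<^bsub>tower A Ms \<phi>\<^esub> x) ! i = r \<odot>\<^bsub>Ms ! i\<^esub> entries x ! i"
  by (simp add: tower_def)

lemma \<phi>_pred: "i < length Ms \<Longrightarrow> i \<noteq> 0 \<Longrightarrow> \<phi> (i - 1) \<in> pdg_hom (Ms ! (i - 1)) (Ms ! i)"
  using \<phi>[of "i - 1"] by simp

lemma tower_dif_closed: "x \<in> carrier (tower A Ms \<phi>) \<Longrightarrow> dif (tower A Ms \<phi>) x \<in> carrier (tower A Ms \<phi>)"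
  unfolding tower_def[of A Ms \<phi>]
  using pdg_module.dif_closed[OF mods] pdg_hom_closed[OF \<phi>_pred]
    abelian_group.axioms(1)[OF pdg_module.axioms(1)[OF mods], THEN abelian_monoid.a_closed]
  by auto

sublocale tower: coord_module A "tower A Ms \<phi>" "{..<length Ms}" "\<lambda>i. Ms ! i" "\<lambda>i x. entries x ! i"
  "\<lambda>i. 2 * (int (pchar A) - 1 - int i)"
proof (rule coord_module.intro)
  note ag = pdg_module.axioms(1)[OF mods]
  note am = abelian_group.axioms(1)[OF ag]
  show "x = y" if "x \<in> carrier (tower A Ms \<phi>)" "y \<in> carrier (tower A Ms \<phi>)"
    "\<And>j. j \<in> {..<length Ms} \<Longrightarrow> entries x ! j = entries y ! j" for x y
    using tower_eqI that by auto
  show "\<zero>\<^bsub>tower A Ms \<phi>\<^esub> \<in> carrier (tower A Ms \<phi>)"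
    using am by (auto simp: tower_def abelian_monoid.zero_closed)
  show "x \<oplus>\<^bsub>tower A Ms \<phi>\<^esub> y \<in> carrier (tower A Ms \<phi>)"
    if "x \<in> carrier (tower A Ms \<phi>)" "y \<in> carrier (tower A Ms \<phi>)" for x y
    using that am by (auto simp: tower_def abelian_monoid.a_closed)
  show "r \<odot>\<^bsub>tower A Ms \<phi>\<^esub> x \<in> carrier (tower A Ms \<phi>)"
    if "x \<in> carrier (tower A Ms \<phi>)" for x r
    using that by (auto simp: tower_def pdg_module.smult_closed[OF mods])
  show "grade (tower A Ms \<phi>) n = {x \<in> carrier (tower A Ms \<phi>). \<forall>j\<in>{..<length Ms}. entries x ! j \<in> grade (Ms ! j) (n + 2 * (int (pchar A) - 1 - int j))}" for n
    by (auto simp: tower_def intro: pdg_module.grade_carrier[OF mods])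
  show "\<exists>y\<in>carrier (tower A Ms \<phi>). \<forall>j\<in>{..<length Ms}. entries y ! j = cpt (Ms ! j) (n + 2 * (int (pchar A) - 1 - int j)) (entries x ! j)"
    if "x \<in> carrier (tower A Ms \<phi>)" for x n
    using tower_carrierD[OF that] mods
    by (intro bexI[of _ "Tuple (map (\<lambda>j. cpt (Ms ! j) (n + 2 * (int (pchar A) - 1 - int j)) (entries x ! j)) [0..<length Ms])"])
      (auto intro!: tower_carrierI pdg_module.cpt_closed)
  show "finite {n. \<exists>j\<in>{..<length Ms}. cpt (Ms ! j) (n + 2 * (int (pchar A) - 1 - int j)) (entries x ! j) \<noteq> \<zero>\<^bsub>Ms ! j\<^esub>}"
    if x: "x \<in> carrier (tower A Ms \<phi>)" for x
  proof -
    have "finite {n. cpt (Ms ! j) (n + 2 * (int (pchar A) - 1 - int j)) (entries x ! j) \<noteq> \<zero>\<^bsub>Ms ! j\<^esub>}" if j: "j < length Ms" for j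
      using finite_vimageI[OF pdg_module.cpt_finite[OF mods[OF j] tower_carrierD(3)[OF x j]], of "\<lambda>n. n + 2 * (int (pchar A) - 1 - int j)"]
      by (simp add: vimage_def inj_def)
    then have "finite (\<Union>j\<in>{..<length Ms}. {n. cpt (Ms ! j) (n + 2 * (int (pchar A) - 1 - int j)) (entries x ! j) \<noteq> \<zero>\<^bsub>Ms ! j\<^esub>})" by auto
    then show ?thesis by (rule rev_finite_subset) auto
  qed
qed (simp_all add: mods tower_carrierD entries_add_tower entries_smult_tower, simp add: tower_def)

text \<open>The differential is the sum of the layerwise differential and the shift \<open>s\<close>
  along the connecting maps, and these commute because the connecting maps are morphisms. In
  characteristic \<open>p\<close> the \<open>p\<close>th power of the sum is the sum of the
  \<open>p\<close>th powers; \<open>s^p\<close> vanishes for lack of layers, and each layer is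
  \<open>p\<close>-nilpotent.\<close>

lemma tower_nilpotent:
  assumes x: "x \<in> carrier (tower A Ms \<phi>)"
  shows "(dif (tower A Ms \<phi>) ^^ pchar A) x = \<zero>\<^bsub>tower A Ms \<phi>\<^esub>"
proof -
  define s where "s z i = (if i = 0 then \<zero>\<^bsub>Ms ! 0\<^esub> else \<phi> (i - 1) (z (i - 1)))" for z :: "nat \<Rightarrow> ('a, 'x) univ" and i
  define t where "t z = (\<lambda>i. entries z ! i)" for z :: "('a, 'x) univ"
  have s_closed: "(s ^^ a) z i \<in> carrier (Ms ! i)"
    if "\<And>i. i < length Ms \<Longrightarrow> z i \<in> carrier (Ms ! i)" "i < length Ms" for a z i
    using that
  proof (induction a arbitrary: i)
    case (Suc a)
    interpret pdg_module A "Ms ! i" using mods Suc.prems by auto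
    show ?case
      using Suc pdg_hom_closed[OF \<phi>_pred[OF \<open>i < length Ms\<close>]] zero_closed by (cases "i = 0") (auto simp: s_def)
  qed auto
  have s_zero: "(s ^^ a) z i = \<zero>\<^bsub>Ms ! i\<^esub>" if "i < a" "i < length Ms" for a z i
    using that
  proof (induction a arbitrary: i)
    case (Suc a)
    show ?case
    proof (cases "i = 0")
      case False
      have "pdg_module A (Ms ! i)" "pdg_module A (Ms ! (i - 1))" using Suc.prems mods by auto
      then have "\<phi> (i - 1) \<zero>\<^bsub>Ms ! (i - 1)\<^esub> = \<zero>\<^bsub>Ms ! i\<^esub>"
        using addmap_zero[OF _ _ pdg_hom_addmap[OF \<phi>_pred[of i]]] False Suc.prems
        by (auto simp: pdg_module_def)
      then show ?thesis using Suc False by (simp add: s_def)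
    qed (simp add: s_def)
  qed simp
  have s_Suc: "(s ^^ Suc a) z i = (if i = 0 then \<zero>\<^bsub>Ms ! 0\<^esub> else \<phi> (i - 1) ((s ^^ a) z (i - 1)))" for a z i
    by (simp add: s_def)
  have s_dif: "(s ^^ a) (\<lambda>i. dif (Ms ! i) (z i)) i = dif (Ms ! i) ((s ^^ a) z i)"
    if "\<And>i. i < length Ms \<Longrightarrow> z i \<in> carrier (Ms ! i)" "i < length Ms" for a z i
    using that
  proof (induction a arbitrary: i)
    case (Suc a)
    interpret pdg_module A "Ms ! i" using mods Suc.prems by auto
    show ?case
    proof (cases "i = 0")
      case False
      then have "(s ^^ a) z (i - 1) \<in> carrier (Ms ! (i - 1))" using s_closed Suc.prems by auto
      then show ?thesis using False Suc pdg_hom_dif[OF \<phi>_pred[OF \<open>i < length Ms\<close> False]]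
        by (simp add: s_Suc del: funpow.simps)
    next
      case True
      then show ?thesis using dif_zero by (simp add: s_Suc del: funpow.simps dif_zero)
    qed
  qed auto
  have s_add: "(s ^^ a) (\<lambda>i. z i \<oplus>\<^bsub>Ms ! i\<^esub> w i) i = (s ^^ a) z i \<oplus>\<^bsub>Ms ! i\<^esub> (s ^^ a) w i"
    if "\<And>i. i < length Ms \<Longrightarrow> z i \<in> carrier (Ms ! i)" "\<And>i. i < length Ms \<Longrightarrow> w i \<in> carrier (Ms ! i)" "i < length Ms" for a z w i
    using that
  proof (induction a arbitrary: i)
    case (Suc a)
    interpret pdg_module A "Ms ! i" using mods Suc.prems by auto
    show ?case
    proof (cases "i = 0")
      case False
      then have "(s ^^ a) z (i - 1) \<in> carrier (Ms ! (i - 1))" "(s ^^ a) w (i - 1) \<in> carrier (Ms ! (i - 1))"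
        using s_closed Suc.prems by auto
      then show ?thesis using False Suc pdg_hom_add[OF \<phi>_pred[OF \<open>i < length Ms\<close> False]]
        by (simp add: s_Suc del: funpow.simps)
    next
      case True
      then show ?thesis using r_zero[OF zero_closed] by (simp add: s_Suc del: funpow.simps r_zero l_zero)
    qed
  qed auto
  have s_cong: "(s ^^ a) z i = (s ^^ a) w i" if "\<And>i. i < length Ms \<Longrightarrow> z i = w i" "i < length Ms" for a z w i
    using that by (induction a arbitrary: i) (auto simp: s_def)
  have step: "(s ^^ a) (t (dif (tower A Ms \<phi>) z)) i = dif (Ms ! i) ((s ^^ a) (t z) i) \<oplus>\<^bsub>Ms ! i\<^esub> (s ^^ Suc a) (t z) i"
    if z: "z \<in> carrier (tower A Ms \<phi>)" and i: "i < length Ms" for z i a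
  proof -
    have tz: "t z i \<in> carrier (Ms ! i)" if "i < length Ms" for i
      using tower_carrierD(3)[OF z that] by (simp add: t_def)
    have "(s ^^ a) (t (dif (tower A Ms \<phi>) z)) i = (s ^^ a) (\<lambda>i. dif (Ms ! i) (t z i) \<oplus>\<^bsub>Ms ! i\<^esub> s (t z) i) i"
    proof (rule s_cong[OF _ i])
      fix i assume i: "i < length Ms"
      interpret pdg_module A "Ms ! i" using mods i by auto
      show "t (dif (tower A Ms \<phi>) z) i = dif (Ms ! i) (t z i) \<oplus>\<^bsub>Ms ! i\<^esub> s (t z) i"
      proof (cases "i = 0")
        case True
        have "s (t z) i = \<zero>\<^bsub>Ms ! i\<^esub>" using True by (simp add: s_def)
        then have "dif (Ms ! i) (t z i) \<oplus>\<^bsub>Ms ! i\<^esub> s (t z) i = dif (Ms ! i) (t z i)"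
          using tz[OF i] dif_closed by simp
        then show ?thesis using True i by (simp only: t_def entries_dif_tower if_True refl)
      qed (use i in \<open>simp add: t_def s_def entries_dif_tower\<close>)
    qed
    also have "\<dots> = (s ^^ a) (\<lambda>i. dif (Ms ! i) (t z i)) i \<oplus>\<^bsub>Ms ! i\<^esub> (s ^^ a) (s (t z)) i"
      using i tz s_closed[OF tz, where a = 1] mods by (intro s_add) (auto intro: pdg_module.dif_closed)
    also have "(s ^^ a) (\<lambda>i. dif (Ms ! i) (t z i)) i = dif (Ms ! i) ((s ^^ a) (t z) i)"
      using i tz by (intro s_dif) auto
    finally show ?thesis by (simp add: funpow_swap1)
  qed
  have dpc: "(dif (tower A Ms \<phi>) ^^ n) x \<in> carrier (tower A Ms \<phi>)" if "x \<in> carrier (tower A Ms \<phi>)" for n x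
    using that tower_dif_closed by (induction n) auto
  show ?thesis
  proof (rule tower_eqI[OF dpc[OF x] tower.zero(1)])
    fix i assume i: "i < length Ms"
    interpret pdg_module_pair A "Ms ! i" "Ms ! i"
      using mods[OF i] pdg_algebra_axioms by (intro pdg_module_pair.intro)
    \<comment> \<open>Entry \<open>i\<close> after \<open>a\<close> shifts and \<open>b\<close>
      layerwise differentials. The differential of the tower acts on this array as
      \<open>bistep\<close>.\<close>
    let ?z = "\<lambda>x a b. (dif (Ms ! i) ^^ b) ((s ^^ a) (t x) i)"
    have zc: "?z x a b \<in> carrier (Ms ! i)" if "x \<in> carrier (tower A Ms \<phi>)" for x a b
      using s_closed[of "t x" i a] tower_carrierD(3)[OF that] i by (auto simp: t_def)
    have zstep: "?z (dif (tower A Ms \<phi>) x) = bistep (Ms ! i) (?z x)" if "x \<in> carrier (tower A Ms \<phi>)" for x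
    proof (intro ext)
      fix a b
      have "(s ^^ a) (t x) i \<in> carrier (Ms ! i)" "(s ^^ Suc a) (t x) i \<in> carrier (Ms ! i)"
        using zc[OF that, of 0] by (metis funpow_0)+
      then show "?z (dif (tower A Ms \<phi>) x) a b = bistep (Ms ! i) (?z x) a b"
        by (simp only: step[OF that i] bistep_def)
          (simp add: M.dif_pow_add M.dif_closed M.a_comm funpow_swap1 del: funpow.simps(2), simp add: funpow_swap1)
    qed
    have "?z ((dif (tower A Ms \<phi>) ^^ n) x) = (bistep (Ms ! i) ^^ n) (?z x)" if "x \<in> carrier (tower A Ms \<phi>)" for n x
    proof (induction n)
      case (Suc n)
      then show ?case using zstep[OF dpc[OF that]] by simp
    qed simp
    from fun_cong[OF fun_cong[OF this[OF x, of "pchar A"], of 0], of 0]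
    have "t ((dif (tower A Ms \<phi>) ^^ pchar A) x) i = (bistep (Ms ! i) ^^ pchar A) (?z x) 0 0" by simp
    also have "\<dots> = ?z x (pchar A) 0 \<oplus>\<^bsub>Ms ! i\<^esub> ?z x 0 (pchar A)"
      using M.bistep_pow_prime[OF zc[OF x] prime_pchar char_add_pow] by simp
    also have "?z x (pchar A) 0 = \<zero>\<^bsub>Ms ! i\<^esub>" using s_zero i len by simp
    also have "?z x 0 (pchar A) = \<zero>\<^bsub>Ms ! i\<^esub>" using M.dif_nilpotent tower_carrierD(3)[OF x i] by (simp add: t_def)
    finally show "entries ((dif (tower A Ms \<phi>) ^^ pchar A) x) ! i = entries \<zero>\<^bsub>tower A Ms \<phi>\<^esub> ! i"
      using tower.zero i by (simp add: t_def)
  qed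
qed

lemma pdg_module_tower: "pdg_module A (tower A Ms \<phi>)"
proof (rule tower.pdg_moduleI)
  fix x y assume x: "x \<in> carrier (tower A Ms \<phi>)" and y: "y \<in> carrier (tower A Ms \<phi>)"
  show "dif (tower A Ms \<phi>) (x \<oplus>\<^bsub>tower A Ms \<phi>\<^esub> y) = dif (tower A Ms \<phi>) x \<oplus>\<^bsub>tower A Ms \<phi>\<^esub> dif (tower A Ms \<phi>) y"
  proof (rule tower_eqI)
    fix i assume i: "i < length Ms"
    interpret pdg_module A "Ms ! i" using mods[OF i] .
    show "entries (dif (tower A Ms \<phi>) (x \<oplus>\<^bsub>tower A Ms \<phi>\<^esub> y)) ! i =
        entries (dif (tower A Ms \<phi>) x \<oplus>\<^bsub>tower A Ms \<phi>\<^esub> dif (tower A Ms \<phi>) y) ! i"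
      using i x y tower_carrierD(3)[OF x] tower_carrierD(3)[OF y] pdg_hom_closed[OF \<phi>_pred[OF i]]
        dif_add[OF tower_carrierD(3)[OF x i] tower_carrierD(3)[OF y i]]
      by (auto simp: entries_dif_tower entries_add_tower pdg_hom_add[OF \<phi>_pred[OF i]] dif_closed a_ac
          simp del: One_nat_def)
  qed (use x y tower_dif_closed tower.add in auto)
next
  fix n x assume x: "x \<in> grade (tower A Ms \<phi>) n"
  then have xc: "x \<in> carrier (tower A Ms \<phi>)" by (simp add: tower.grade)
  have xg: "entries x ! i \<in> grade (Ms ! i) (n + 2 * (int (pchar A) - 1 - int i))" if "i < length Ms" for i
    using x that by (simp add: tower.grade)
  have "entries (dif (tower A Ms \<phi>) x) ! i \<in> grade (Ms ! i) (n + 2 + 2 * (int (pchar A) - 1 - int i))" if i: "i < length Ms" for i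
  proof -
    interpret pdg_module A "Ms ! i" using mods[OF i] .
    have "dif (Ms ! i) (entries x ! i) \<in> grade (Ms ! i) (n + 2 + 2 * (int (pchar A) - 1 - int i))"
      using dif_degree[OF xg[OF i]] by (simp add: algebra_simps)
    moreover have "\<phi> (i - 1) (entries x ! (i - 1)) \<in> grade (Ms ! i) (n + 2 + 2 * (int (pchar A) - 1 - int i))" if "i \<noteq> 0"
      using pdg_hom_grade[OF \<phi>_pred[OF i that] xg[of "i - 1"]] i that by (simp add: algebra_simps of_nat_diff)
    ultimately show ?thesis using i by (auto simp: entries_dif_tower intro: grade_add)
  qed
  then show "dif (tower A Ms \<phi>) x \<in> grade (tower A Ms \<phi>) (n + 2)"
    using xc tower_dif_closed by (simp add: tower.grade)
next
  fix r x assume x: "x \<in> carrier (tower A Ms \<phi>)"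
  show "dif (tower A Ms \<phi>) (r \<odot>\<^bsub>tower A Ms \<phi>\<^esub> x) = adif A r \<odot>\<^bsub>tower A Ms \<phi>\<^esub> x \<oplus>\<^bsub>tower A Ms \<phi>\<^esub> r \<odot>\<^bsub>tower A Ms \<phi>\<^esub> dif (tower A Ms \<phi>) x"
  proof (rule tower_eqI)
    fix i assume i: "i < length Ms"
    interpret pdg_module A "Ms ! i" using mods[OF i] .
    show "entries (dif (tower A Ms \<phi>) (r \<odot>\<^bsub>tower A Ms \<phi>\<^esub> x)) ! i =
        entries (adif A r \<odot>\<^bsub>tower A Ms \<phi>\<^esub> x \<oplus>\<^bsub>tower A Ms \<phi>\<^esub> r \<odot>\<^bsub>tower A Ms \<phi>\<^esub> dif (tower A Ms \<phi>) x) ! i"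
      using i x tower_carrierD(3)[OF x] pdg_hom_closed[OF \<phi>_pred[OF i]] dif_Leibniz[OF tower_carrierD(3)[OF x i]]
      by (auto simp: entries_dif_tower entries_add_tower entries_smult_tower pdg_hom_smult[OF \<phi>_pred[OF i]]
          dif_closed smult_closed smult_r_distr a_assoc simp del: One_nat_def)
  qed (use x tower_dif_closed tower.add tower.smult in auto)
qed (use tower_dif_closed tower_nilpotent in auto)

end

section \<open>Degree shifts\<close>

definition dshm where "dshm s M = M\<lparr>grade := (\<lambda>n. grade M (n + s))\<rparr>"

lemma dshm_simps [simp]:
  "carrier (dshm s M) = carrier M" "ring.zero (dshm s M) = ring.zero M"
  "ring.add (dshm s M) = ring.add M" "grade (dshm s M) n = grade M (n + s)" "dif (dshm s M) = dif M"
  "smult (dshm s M) = smult M"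
  by (simp_all add: dshm_def)

lemma a_minus_dshm [simp]: "a_minus (dshm s M) = a_minus M"
  by (intro ext) (simp add: a_minus_def a_inv_def m_inv_def)

lemma dl_dshm [simp]: "dl (dshm s M) N = dl M N" "dl M (dshm s N) = dl M N"
  by (rule ext, rule ext, simp add: dl_def)+

text \<open>The module itself serves as the only coordinate, with degree shift
  \<open>s\<close>.\<close>

lemma pdg_module_dshm:
  assumes "pdg_algebra A" "pdg_module A M"
  shows "pdg_module A (dshm s M)"
proof -
  interpret M: pdg_module A M by fact
  have "coord_module A (dshm s M) {()} (\<lambda>_. M) (\<lambda>_ x. x) (\<lambda>_. s)"
  proof (rule coord_module.intro)
    fix x assume "x \<in> carrier (dshm s M)"
    then have "finite {n. cpt M n x \<noteq> \<zero>\<^bsub>M\<^esub>}" using M.cpt_finite by simp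
    from finite_vimageI[OF this, of "\<lambda>n. n + s"]
    show "finite {n. \<exists>j\<in>{()}. cpt M (n + s) x \<noteq> \<zero>\<^bsub>M\<^esub>}" by (simp add: vimage_def inj_def)
  qed (use assms in \<open>auto simp: M.smult_closed M.cpt_closed M.grade_carrier\<close>)
  then show ?thesis
    by (rule coord_module.pdg_moduleI_strict) (auto simp: assms M.dif_closed)
qed

lemma gr_hom_dshm: "f \<in> gr_hom d M N \<Longrightarrow> f \<in> gr_hom d (dshm s M) (dshm s N)"
  by (rule gr_homI) (auto simp: gr_hom_closed gr_hom_add gr_hom_smult add_ac dest!: gr_hom_grade[of f])

section \<open>Inclusion cones\<close>

lemma finsum_pick:
  assumes "abelian_group G" "finite S" "a \<in> S" "\<And>i. i \<in> S \<Longrightarrow> f i \<in> carrier G" "\<And>i. i \<in> S \<Longrightarrow> i \<noteq> a \<Longrightarrow> f i = \<zero>\<^bsub>G\<^esub>"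
  shows "finsum G f S = f a"
proof -
  interpret abelian_group G by fact
  have "finsum G f S = (\<Oplus>\<^bsub>G\<^esub>i\<in>S. if i = a then f i else \<zero>\<^bsub>G\<^esub>)"
    using assms by (intro finsum_cong') auto
  also have "\<dots> = f a" using add.finprod_singleton_swap[of a S f] assms by auto
  finally show ?thesis .
qed

text \<open>The cone of an inclusion that is the identity on elements: all connecting maps,
  including the last one, are then given by the same function, and the case distinction in
  \<open>cone\<close> disappears.\<close>

definition inctower where
  "inctower A X Y = tower A (replicate (pchar A - 1) X @ [Y]) (\<lambda>_ x. x)"

text \<open>\<open>\<rho>\<close> splits the inclusion as a map of graded modules; it is linear over
  the algebra but not assumed to commute with the differentials. The number \<open>q\<close> is
  \<open>p - 1\<close>, the index of the last layer.\<close>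

locale inclusion_cone = pdg_module_pair A X Y
  for A :: "('k::field, 'r::{ring, monoid_mult}) pdg_alg"
    and X Y :: "('r, ('a, 'x) univ) pdg_mod" +
  fixes \<rho> and q :: nat
  assumes q: "pchar A = Suc q"
    and incl: "(\<lambda>x. x) \<in> pdg_hom X Y"
    and \<rho>: "\<rho> \<in> gr_hom 0 Y X"
    and \<rho>_incl: "\<And>x. x \<in> carrier X \<Longrightarrow> \<rho> x = x"
begin

abbreviation "Ms \<equiv> replicate q X @ [Y]"
abbreviation "T \<equiv> inctower A X Y"

lemma q_pos: "q > 0" using pchar_ge2 q by simp

lemma pred_q: "pchar A - 1 = q" using q by simp

lemma pdg_tower_Ms: "pdg_tower A Ms (\<lambda>_ x. x)"
proof (intro pdg_tower.intro pdg_tower_axioms.intro pdg_algebra_axioms)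
  show "length Ms \<le> pchar A" using q by simp
  fix i
  show "pdg_module A (Ms ! i)" if "i < length Ms"
    using that M.pdg_module_axioms N.pdg_module_axioms by (auto simp: nth_append less_Suc_eq)
  show "(\<lambda>x. x) \<in> pdg_hom (Ms ! i) (Ms ! Suc i)" if "Suc i < length Ms"
    using that incl pdg_hom_ident by (auto simp: nth_append)
qed

sublocale T: pdg_tower A "replicate q X @ [Y]" "\<lambda>_ x. x"
  rewrites "tower A (replicate q X @ [Y]) (\<lambda>_ x. x) = inctower A X Y"
  by (rule pdg_tower_Ms) (simp add: inctower_def q)

lemma nth_Ms: "i < q \<Longrightarrow> Ms ! i = X" "Ms ! q = Y" by (auto simp: nth_append)

lemma pdg_module_T: "pdg_module A T" by (rule T.pdg_module_tower)

lemma T_entries: "z \<in> carrier T \<Longrightarrow> i < q \<Longrightarrow> entries z ! i \<in> carrier X" "z \<in> carrier T \<Longrightarrow> entries z ! q \<in> carrier Y"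
  using T.tower_carrierD(3)[of z i] T.tower_carrierD(3)[of z q] by (auto simp: nth_Ms less_Suc_eq)

text \<open>A contraction of the part of the tower made of copies of \<open>X\<close>: the last
  entry is retracted to \<open>X\<close> and put into layer 0. Layer \<open>i\<close> carries the
  degree shift \<open>2(p - 1 - i)\<close>, so this lowers the degree by \<open>2(p - 1)\<close>, as
  a null-homotopy must.\<close>

definition G where "G z = Tuple (\<rho> (entries z ! q) # replicate (q - 1) \<zero>\<^bsub>X\<^esub> @ [\<zero>\<^bsub>Y\<^esub>])"

lemma entries_G: "entries (G z) ! i = (if i = 0 then \<rho> (entries z ! q) else if i < q then \<zero>\<^bsub>X\<^esub> else \<zero>\<^bsub>Y\<^esub>)"
  if "i \<le> q" for i
  using that q_pos by (cases i) (auto simp: G_def nth_append)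

lemma G_carrier: "z \<in> carrier T \<Longrightarrow> G z \<in> carrier T"
proof (unfold G_def, rule T.tower_carrierI)
  assume z: "z \<in> carrier T"
  show "length (\<rho> (entries z ! q) # replicate (q - 1) \<zero>\<^bsub>X\<^esub> @ [\<zero>\<^bsub>Y\<^esub>]) = length Ms" using q_pos by simp
  fix i assume "i < length Ms"
  then have i: "i \<le> q" by simp
  have "entries (G z) ! i \<in> carrier (Ms ! i)"
    using T_entries(2)[of z] z gr_hom_closed[OF \<rho>] i q_pos
    by (auto simp: entries_G nth_append le_less)
  then show "(\<rho> (entries z ! q) # replicate (q - 1) \<zero>\<^bsub>X\<^esub> @ [\<zero>\<^bsub>Y\<^esub>]) ! i \<in> carrier (Ms ! i)"
    by (simp add: G_def)
qed

lemma G_gr_hom: "G \<in> gr_hom (2 - 2 * int (pchar A)) T T"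
proof (rule gr_homI)
  fix x y assume xy: "x \<in> carrier T" "y \<in> carrier T"
  show "G (x \<oplus>\<^bsub>T\<^esub> y) = G x \<oplus>\<^bsub>T\<^esub> G y"
  proof (rule T.tower_eqI)
    fix i assume "i < length Ms"
    then have i: "i \<le> q" "i < Suc q" by auto
    show "entries (G (x \<oplus>\<^bsub>T\<^esub> y)) ! i = entries (G x \<oplus>\<^bsub>T\<^esub> G y) ! i"
      using i xy T_entries q_pos by (auto simp: entries_G T.entries_add_tower nth_Ms gr_hom_add[OF \<rho>] le_less)
  qed (use xy G_carrier T.tower.add in auto)
next
  fix r x assume x: "x \<in> carrier T"
  show "G (r \<odot>\<^bsub>T\<^esub> x) = r \<odot>\<^bsub>T\<^esub> G x"
  proof (rule T.tower_eqI)
    fix i assume "i < length Ms"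
    then have i: "i \<le> q" "i < Suc q" by auto
    show "entries (G (r \<odot>\<^bsub>T\<^esub> x)) ! i = entries (r \<odot>\<^bsub>T\<^esub> G x) ! i"
      using i x T_entries q_pos by (auto simp: entries_G T.entries_smult_tower nth_Ms gr_hom_smult[OF \<rho>] le_less)
  qed (use x G_carrier T.tower.smult in auto)
next
  fix n x assume x: "x \<in> grade T n"
  then have xc: "x \<in> carrier T" and "entries x ! q \<in> grade Y n"
    using q by (auto simp: T.tower.grade nth_Ms dest!: bspec[of _ _ q])
  then have "\<rho> (entries x ! q) \<in> grade X n" using gr_hom_grade[OF \<rho>] by fastforce
  then show "G x \<in> grade T (n + (2 - 2 * int (pchar A)))"
    using xc G_carrier q q_pos by (auto simp: T.tower.grade entries_G nth_append less_Suc_eq)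
qed (rule G_carrier)

text \<open>Each differential pushes the topmost nonzero entry up by one layer along an identity
  map, so after \<open>i\<close> steps it stands unchanged in layer \<open>i\<close> with zeros
  above it.\<close>

lemma last_dif_G:
  assumes z: "z \<in> carrier T" and "i \<le> q"
  shows "(\<forall>j\<le>q. i < j \<longrightarrow> entries ((dif T ^^ i) (G z)) ! j = \<zero>\<^bsub>Ms ! j\<^esub>) \<and> entries ((dif T ^^ i) (G z)) ! i = \<rho> (entries z ! q)"
  using \<open>i \<le> q\<close>
proof (induction i)
  case 0
  show ?case using q_pos by (auto simp: entries_G nth_append)
next
  case (Suc i)
  let ?y = "(dif T ^^ i) (G z)"
  have y: "?y \<in> carrier T" using G_carrier[OF z] T.tower_dif_closed by (induction i) auto
  have IH: "\<And>j. j \<le> q \<Longrightarrow> i < j \<Longrightarrow> entries ?y ! j = \<zero>\<^bsub>Ms ! j\<^esub>" "entries ?y ! i = \<rho> (entries z ! q)"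
    using Suc by auto
  have XY: "\<zero>\<^bsub>X\<^esub> = \<zero>\<^bsub>Y\<^esub>"
    using addmap_zero[OF M.abelian_group_axioms N.abelian_group_axioms pdg_hom_addmap[OF incl]] .
  have c: "\<rho> (entries z ! q) \<in> carrier X" "\<rho> (entries z ! q) \<in> carrier Y"
    using T_entries(2)[OF z] gr_hom_closed[OF \<rho>] pdg_hom_closed[OF incl] by blast+
  have "entries (dif T ?y) ! j = \<zero>\<^bsub>Ms ! j\<^esub>" if "j \<le> q" "Suc i < j" for j
  proof -
    have "Ms ! (j - 1) = X" "\<zero>\<^bsub>Ms ! j\<^esub> = \<zero>\<^bsub>X\<^esub>" "pdg_module A (Ms ! j)"
      using that XY M.pdg_module_axioms N.pdg_module_axioms by (auto simp: nth_append)
    then show ?thesis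
      using that IH(1)[of j] IH(1)[of "j - 1"] q_pos
      by (simp add: T.entries_dif_tower pdg_module.dif_zero abelian_monoid.l_zero[OF abelian_group.axioms(1)[OF pdg_module.axioms(1)]]
         abelian_monoid.zero_closed[OF abelian_group.axioms(1)[OF pdg_module.axioms(1)]] del: One_nat_def)
        (metis abelian_monoid.l_zero[OF abelian_group.axioms(1)[OF pdg_module.axioms(1)]]
         abelian_monoid.zero_closed[OF abelian_group.axioms(1)[OF pdg_module.axioms(1)]] pdg_module.dif_zero)
  qed
  moreover have "entries (dif T ?y) ! Suc i = \<rho> (entries z ! q)"
  proof -
    have "entries ?y ! Suc i = \<zero>\<^bsub>Ms ! Suc i\<^esub>" using IH(1)[of "Suc i"] Suc.prems by simp
    moreover have "pdg_module A (Ms ! Suc i)" using Suc.prems by (intro T.mods) simp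
    then interpret W: pdg_module A "Ms ! Suc i" .
    have "\<rho> (entries z ! q) \<in> carrier (Ms ! Suc i)"
      using c Suc.prems nth_Ms by (cases "Suc i = q") auto
    ultimately show ?thesis
      using Suc.prems IH(2) by (simp add: T.entries_dif_tower del: nth_Cons_Suc)
  qed
  ultimately show ?case by simp
qed

text \<open>Among the terms \<open>dif^i G dif^(q - i)\<close> of the null-homotopy formula only the
  one with \<open>i = q\<close> reaches the last layer.\<close>

lemma last_contraction:
  assumes z: "z \<in> carrier T"
  shows "entries ((dl T T ^^ q) G z) ! q = \<rho> (entries z ! q)"
proof -
  interpret TT: pdg_module_pair A T T
    using pdg_module_T pdg_algebra_axioms by (intro pdg_module_pair.intro)
  have dc: "(dif T ^^ i) z \<in> carrier T" for i using z by simp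
  have tc: "(dif T ^^ i) (G ((dif T ^^ j) z)) \<in> carrier T" for i j
    using G_carrier[OF dc[of j]] by simp
  have "entries ((dl T T ^^ q) G z) ! q = entries (\<Oplus>\<^bsub>T\<^esub>i\<in>{..<pchar A}. (dif T ^^ i) (G ((dif T ^^ (q - i)) z))) ! q"
    using TT.dl_pow_pred[of G z] z G_carrier unfolding pred_q by auto
  also have "\<dots> = (\<Oplus>\<^bsub>Y\<^esub>i\<in>{..<pchar A}. entries ((dif T ^^ i) (G ((dif T ^^ (q - i)) z))) ! q)"
    by (subst T.tower.\<pi>_finsum) (use tc in \<open>auto simp: nth_Ms\<close>)
  also have "\<dots> = entries ((dif T ^^ q) (G ((dif T ^^ (q - q)) z))) ! q"
  proof (rule finsum_pick)
    fix i assume "i \<in> {..<pchar A}" "i \<noteq> q"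
    then have "i < q" using q by auto
    then show "entries ((dif T ^^ i) (G ((dif T ^^ (q - i)) z))) ! q = \<zero>\<^bsub>Y\<^esub>"
      using last_dif_G[OF dc[of "q - i"], of i] by (auto simp: nth_Ms)
  qed (use q T_entries(2)[OF tc] tc N.abelian_group_axioms in auto)
  also have "\<dots> = \<rho> (entries z ! q)" using last_dif_G[OF z, of q] by simp
  finally show ?thesis .
qed

text \<open>The last entry is known from \<open>last_contraction\<close>. The others are recovered
  downwards: entry \<open>j - 1\<close> of \<open>z\<close> is entry \<open>j\<close> of
  \<open>dif z\<close> minus the differential of entry \<open>j\<close> of \<open>z\<close>, and the
  map under consideration commutes with the differential.\<close>

lemma contraction:
  assumes "z \<in> carrier T" "entries z ! q \<in> carrier X"
  shows "(dl T T ^^ q) G z = z"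
proof -
  interpret TT: pdg_module_pair A T T
    using pdg_module_T pdg_algebra_axioms by (intro pdg_module_pair.intro)
  let ?\<psi> = "(dl T T ^^ q) G"
  have \<psi>: "?\<psi> \<in> pdg_hom T T" using TT.dl_pow_pred_pdg_hom[OF G_gr_hom] unfolding pred_q .
  have \<psi>c: "?\<psi> z \<in> carrier T" if "z \<in> carrier T" for z using pdg_hom_closed[OF \<psi> that] .
  have XY: "x \<in> carrier Y" if "x \<in> carrier X" for x using pdg_hom_closed[OF incl] that by auto
  have "\<forall>z\<in>carrier T. entries z ! q \<in> carrier X \<longrightarrow> entries (?\<psi> z) ! (q - i) = entries z ! (q - i)" if "i \<le> q" for i
    using that
  proof (induction i)
    case 0
    then show ?case using last_contraction \<rho>_incl by auto
  next
    case (Suc i)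
    show ?case
    proof (intro ballI impI)
      fix z assume z: "z \<in> carrier T" and zX: "entries z ! q \<in> carrier X"
      let ?j = "q - i"
      have j: "?j \<noteq> 0" "?j < length Ms" "q - Suc i < q" "?j - 1 = q - Suc i" using Suc.prems by auto
      have mj: "pdg_module A (Ms ! ?j)" using T.mods[OF j(2)] .
      interpret Mj: pdg_module A "Ms ! ?j" by (rule mj)
      \<comment> \<open>The induction hypothesis is about to be applied to \<open>dif z\<close>,
        whose last entry therefore has to lie in \<open>X\<close> again.\<close>
      have dX: "entries (dif T z) ! q \<in> carrier X"
      proof -
        have "dif Y (entries z ! q) = dif X (entries z ! q)" using pdg_hom_dif[OF incl zX] by simp
        moreover have "dif X (entries z ! q) \<oplus>\<^bsub>Y\<^esub> entries z ! (q - 1) = dif X (entries z ! q) \<oplus>\<^bsub>X\<^esub> entries z ! (q - 1)"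
          using pdg_hom_add[OF incl, of "dif X (entries z ! q)" "entries z ! (q - 1)"] M.dif_closed[OF zX] T_entries(1)[OF z, of "q - 1"] q_pos by simp
        ultimately show ?thesis
          using T.entries_dif_tower[of q z] q_pos M.dif_closed[OF zX] T_entries(1)[OF z, of "q - 1"]
          by (simp add: nth_Ms)
      qed
      have e: "entries (dif T z) ! ?j = dif (Ms ! ?j) (entries z ! ?j) \<oplus>\<^bsub>Ms ! ?j\<^esub> entries z ! (q - Suc i)" for z
        using j T.entries_dif_tower[OF j(2), of z] by simp
      have "entries (dif T z) ! ?j = entries (?\<psi> (dif T z)) ! ?j"
        using Suc T.tower_dif_closed[OF z] dX by auto
      also have "\<dots> = entries (dif T (?\<psi> z)) ! ?j" using pdg_hom_dif[OF \<psi> z] by simp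
      finally have "dif (Ms ! ?j) (entries z ! ?j) \<oplus>\<^bsub>Ms ! ?j\<^esub> entries z ! (q - Suc i) =
          dif (Ms ! ?j) (entries (?\<psi> z) ! ?j) \<oplus>\<^bsub>Ms ! ?j\<^esub> entries (?\<psi> z) ! (q - Suc i)"
        unfolding e .
      moreover have "entries (?\<psi> z) ! ?j = entries z ! ?j" using Suc z zX by auto
      moreover have "entries z ! ?j \<in> carrier (Ms ! ?j)" using T.tower_carrierD(3)[OF z j(2)] .
      moreover have "entries z ! (q - Suc i) \<in> carrier (Ms ! ?j)" "entries (?\<psi> z) ! (q - Suc i) \<in> carrier (Ms ! ?j)"
        using T_entries(1)[OF z j(3)] T_entries(1)[OF \<psi>c[OF z] j(3)] XY by (auto simp: nth_append)
      ultimately show "entries (?\<psi> z) ! (q - Suc i) = entries z ! (q - Suc i)"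
        by (simp add: Mj.dif_closed)
    qed
  qed
  then have *: "entries (?\<psi> z) ! (q - i) = entries z ! (q - i)" if "i \<le> q" for i using assms that by blast
  show ?thesis
  proof (rule T.tower_eqI[OF \<psi>c[OF assms(1)] assms(1)])
    fix i assume "i < length Ms"
    then show "entries (?\<psi> z) ! i = entries z ! i" using *[of "q - i"] by simp
  qed
qed

end

section \<open>Path objects\<close>

text \<open>The tower of \<open>p\<close> copies of \<open>Y\<close>, regraded so that entry 0 of a
  homogeneous element has the degree of that element. It is contractible, and a null-homotopy of a
  map to \<open>Y\<close> is a lift of this map along entry 0 (\<open>P_lift\<close>,
  \<open>null_P_proj0\<close>).\<close>

definition path_ob where
  "path_ob A Y = dshm (- 2 * (int (pchar A) - 1)) (inctower A Y Y)"

locale path_object = pdg_algebra A + Y: pdg_module A Y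
  for A :: "('k::field, 'r::{ring, monoid_mult}) pdg_alg" and Y :: "('r, ('a, 'x) univ) pdg_mod" +
  fixes q :: nat
  assumes q: "pchar A = Suc q"
begin

sublocale inclusion_cone A Y Y "\<lambda>x. x" q
  by unfold_locales (auto intro: pdg_hom_ident gr_hom_ident simp: q)

abbreviation "P \<equiv> path_ob A Y"

lemma pdg_module_P: "pdg_module A P"
  unfolding path_ob_def by (rule pdg_module_dshm[OF pdg_algebra_axioms pdg_module_T])

lemma Ms_nth: "i \<le> q \<Longrightarrow> Ms ! i = Y" by (auto simp: nth_append)

lemma P_entries: "z \<in> carrier P \<Longrightarrow> i \<le> q \<Longrightarrow> entries z ! i \<in> carrier Y"
  using T_entries(1)[of z i] T_entries(2)[of z] by (auto simp: path_ob_def le_less)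

lemma P_dif: "i \<le> q \<Longrightarrow> entries (dif P z) ! i =
   (if i = 0 then dif Y (entries z ! i) else dif Y (entries z ! i) \<oplus>\<^bsub>Y\<^esub> entries z ! (i - 1))"
  using T.entries_dif_tower[of i z] by (simp add: path_ob_def Ms_nth)

lemma P_eqI:
  assumes "x \<in> carrier P" "y \<in> carrier P" "\<And>i. i \<le> q \<Longrightarrow> entries x ! i = entries y ! i"
  shows "x = y"
  using T.tower_eqI[of x y] assms by (auto simp: path_ob_def)

lemma P_carrierI: "(\<And>i. i \<le> q \<Longrightarrow> x i \<in> carrier Y) \<Longrightarrow> Tuple (map x [0..<Suc q]) \<in> carrier P"
  unfolding path_ob_def dshm_simps
  by (rule T.tower_carrierI) (auto simp: Ms_nth simp del: upt_Suc)

lemma P_gradeI: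
  assumes "\<And>i. i \<le> q \<Longrightarrow> x i \<in> grade Y (n - 2 * int i)"
  shows "Tuple (map x [0..<Suc q]) \<in> grade P n"
proof -
  have c: "Tuple (map x [0..<Suc q]) \<in> carrier P" using assms Y.grade_carrier by (intro P_carrierI) blast
  then show ?thesis
    using assms by (auto simp: path_ob_def T.tower.grade Ms_nth algebra_simps simp del: upt_Suc)
qed

lemma P_add: "i \<le> q \<Longrightarrow> entries (x \<oplus>\<^bsub>P\<^esub> y) ! i = entries x ! i \<oplus>\<^bsub>Y\<^esub> entries y ! i"
  using T.entries_add_tower[of i x y] by (simp add: path_ob_def Ms_nth)

lemma P_smult: "i \<le> q \<Longrightarrow> entries (r \<odot>\<^bsub>P\<^esub> y) ! i = r \<odot>\<^bsub>Y\<^esub> entries y ! i"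
  using T.entries_smult_tower[of i r y] by (simp add: path_ob_def Ms_nth)

lemma P_proj: "i \<le> q \<Longrightarrow> (\<lambda>z. entries z ! i) \<in> gr_hom (- 2 * int i) P Y"
proof (rule gr_homI)
  fix n x assume "x \<in> grade P n" "i \<le> q"
  then show "entries x ! i \<in> grade Y (n + - 2 * int i)"
    by (auto simp: path_ob_def T.tower.grade Ms_nth algebra_simps dest!: bspec[of _ _ i])
qed (auto simp: P_entries P_add P_smult)

lemma P_proj0: "(\<lambda>z. entries z ! 0) \<in> pdg_hom P Y"
  using P_proj[of 0] by (auto intro!: pdg_homI simp: P_dif)

sublocale PY: pdg_module_pair A P Y
  using pdg_module_P pdg_algebra_axioms Y.pdg_module_axioms by (intro pdg_module_pair.intro)

text \<open>Entry \<open>i\<close> of \<open>dif z\<close> exceeds the differential of entry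
  \<open>i\<close> by entry \<open>i - 1\<close>. Hence each commutator moves the projection down by
  one layer, from the last entry to entry 0 in \<open>q\<close> steps.\<close>

lemma dl_P_proj: "n \<le> q \<Longrightarrow> z \<in> carrier P \<Longrightarrow> (dl P Y ^^ n) (\<lambda>z. entries z ! q) z = entries z ! (q - n)"
proof (induction n arbitrary: z)
  case (Suc n)
  have *: "dif P z \<in> carrier P" using Suc.prems by (intro PY.M.dif_closed)
  have "(dl P Y ^^ Suc n) (\<lambda>z. entries z ! q) z = entries (dif P z) ! (q - n) \<ominus>\<^bsub>Y\<^esub> dif Y (entries z ! (q - n))"
    using Suc * by (simp add: dl_pow_Suc del: funpow.simps)
  also have "\<dots> = (dif Y (entries z ! (q - n)) \<oplus>\<^bsub>Y\<^esub> entries z ! (q - n - 1)) \<ominus>\<^bsub>Y\<^esub> dif Y (entries z ! (q - n))"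
    using Suc.prems by (simp add: P_dif)
  also have "\<dots> = entries z ! (q - Suc n)"
    using Suc.prems P_entries[OF Suc.prems(2)] by (simp add: Y.add_sub_cancel_left Y.dif_closed)
  finally show ?case .
qed simp

lemma null_P_proj0: "null_homotopic A P Y (\<lambda>z. entries z ! 0)"
proof -
  have "- 2 * int q = 2 - 2 * int (pchar A)" using q by simp
  then show ?thesis unfolding PY.null_homotopic_iff pred_q
    using P_proj[of q] dl_P_proj[of q] by (intro bexI[of _ "\<lambda>z. entries z ! q"]) auto
qed

text \<open>The path object is the inclusion cone of \<open>Y\<close> in itself with the identity as
  retraction, so the part that \<open>G\<close> contracts is the whole tower.\<close>

lemma null_P_ident: "null_homotopic A P P (\<lambda>z. z)"
proof -
  interpret PP: pdg_module_pair A P P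
    using pdg_module_P pdg_algebra_axioms by (intro pdg_module_pair.intro)
  have "G \<in> gr_hom (2 - 2 * int (pchar A)) P P"
    unfolding path_ob_def by (rule gr_hom_dshm[OF G_gr_hom])
  moreover have "(dl P P ^^ q) G z = z" if "z \<in> carrier P" for z
    using contraction[of z] P_entries[OF that, of q] that by (simp add: path_ob_def)
  ultimately show ?thesis unfolding PP.null_homotopic_iff pred_q by (intro bexI[of _ G]) auto
qed

definition P_sec where "P_sec y = Tuple (map (\<lambda>i. if i = 0 then y else \<zero>\<^bsub>Y\<^esub>) [0..<Suc q])"

lemma entries_P_sec: "i \<le> q \<Longrightarrow> entries (P_sec y) ! i = (if i = 0 then y else \<zero>\<^bsub>Y\<^esub>)"
  by (auto simp: P_sec_def simp del: upt_Suc)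

lemma P_sec: "P_sec \<in> gr_hom 0 Y P"
proof (rule gr_homI)
  show c: "P_sec y \<in> carrier P" if "y \<in> carrier Y" for y
    unfolding P_sec_def using that by (intro P_carrierI) auto
  show "P_sec (x \<oplus>\<^bsub>Y\<^esub> y) = P_sec x \<oplus>\<^bsub>P\<^esub> P_sec y" if "x \<in> carrier Y" "y \<in> carrier Y" for x y
    using that c PY.M.a_closed by - (rule P_eqI; auto simp: entries_P_sec P_add)
  show "P_sec (r \<odot>\<^bsub>Y\<^esub> y) = r \<odot>\<^bsub>P\<^esub> P_sec y" if "y \<in> carrier Y" for r y
    using that c PY.M.smult_closed Y.smult_closed by - (rule P_eqI; auto simp: entries_P_sec P_smult)
  show "P_sec y \<in> grade P (n + 0)" if "y \<in> grade Y n" for n y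
    unfolding P_sec_def using that by (intro P_gradeI) auto
qed

text \<open>Entry \<open>i\<close> of the lift is \<open>dl^(q - i) h\<close>. It commutes with the
  differentials because \<open>dl^(k + 1) h = (dl^k h) dif - dif (dl^k h)\<close> in the higher
  layers and because \<open>dl^p h = 0\<close> in layer 0.\<close>

lemma P_lift:
  assumes Q: "pdg_module A Q" and h: "h \<in> gr_hom (2 - 2 * int (pchar A)) Q Y"
  shows "\<exists>g\<in>pdg_hom Q P. \<forall>x\<in>carrier Q. entries (g x) ! 0 = (dl Q Y ^^ q) h x"
proof -
  interpret QY: pdg_module_pair A Q Y using Q pdg_algebra_axioms Y.pdg_module_axioms by (intro pdg_module_pair.intro)
  define g where "g x = Tuple (map (\<lambda>i. (dl Q Y ^^ (q - i)) h x) [0..<Suc q])" for x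
  have eg: "entries (g x) ! i = (dl Q Y ^^ (q - i)) h x" if "i \<le> q" for i x
    using that by (auto simp: g_def simp del: upt_Suc)
  have gh: "(dl Q Y ^^ (q - i)) h \<in> gr_hom (- 2 * int i) Q Y" if "i \<le> q" for i
    using QY.dl_pow_gr_hom[OF h, of "q - i"] that q by (simp add: of_nat_diff algebra_simps)
  have gc: "g x \<in> carrier P" if "x \<in> carrier Q" for x
    unfolding g_def using gr_hom_closed[OF gh] that by (intro P_carrierI) auto
  have "g \<in> pdg_hom Q P"
  proof (rule pdg_homI[OF gr_homI])
    show "g (x \<oplus>\<^bsub>Q\<^esub> y) = g x \<oplus>\<^bsub>P\<^esub> g y" if "x \<in> carrier Q" "y \<in> carrier Q" for x y
      using that gc PY.M.a_closed QY.M.a_closed by - (rule P_eqI; auto simp: eg P_add gr_hom_add[OF gh])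
    show "g (r \<odot>\<^bsub>Q\<^esub> x) = r \<odot>\<^bsub>P\<^esub> g x" if "x \<in> carrier Q" for x r
      using that gc PY.M.smult_closed QY.M.smult_closed by - (rule P_eqI; auto simp: eg P_smult gr_hom_smult[OF gh])
    show "g x \<in> grade P (n + 0)" if "x \<in> grade Q n" for x n
      unfolding g_def using gr_hom_grade[OF gh that] by (intro P_gradeI) auto
    show "g (dif Q x) = dif P (g x)" if x: "x \<in> carrier Q" for x
    proof (rule P_eqI)
      fix i assume i: "i \<le> q"
      let ?k = "(dl Q Y ^^ (q - i)) h"
      have kc: "?k y \<in> carrier Y" if "y \<in> carrier Q" for y using gr_hom_closed[OF gh[OF i] that] .
      have dx: "dif Q x \<in> carrier Q" using QY.M.dif_closed[OF x] .
      have "?k (dif Q x) = dif Y (?k x) \<oplus>\<^bsub>Y\<^esub> (dl Q Y ^^ Suc (q - i)) h x"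
        using kc[OF x] kc[OF dx] Y.sub_add_cancel[of "?k (dif Q x)" "dif Y (?k x)"]
        by (simp add: dl_pow_Suc Y.dif_closed Y.a_comm del: funpow.simps)
      moreover have "(dl Q Y ^^ Suc (q - i)) h x = (if i = 0 then \<zero>\<^bsub>Y\<^esub> else (dl Q Y ^^ (q - (i - 1))) h x)"
      proof (cases "i = 0")
        case True
        have "h \<zero>\<^bsub>Q\<^esub> = \<zero>\<^bsub>Y\<^esub>"
          using addmap_zero[OF QY.M.abelian_group_axioms Y.abelian_group_axioms gr_hom_addmap[OF h]] .
        then show ?thesis
          using True QY.dl_pow_pchar[OF QY.gr_hom_funcset[OF h] _ x] q by simp
      next
        case False
        then have "Suc (q - i) = q - (i - 1)" using i by simp
        then show ?thesis using False by simp
      qed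
      ultimately show "entries (g (dif Q x)) ! i = entries (dif P (g x)) ! i"
        using i kc[OF x] by (auto simp: eg P_dif Y.dif_closed simp del: One_nat_def)
    qed (use x gc QY.M.dif_closed PY.M.dif_closed in auto)
  qed (rule gc)
  then show ?thesis using eg[of 0] by auto
qed

end

section \<open>Pullbacks\<close>

definition pullb ::
  "('r, ('a, 'x) univ) pdg_mod \<Rightarrow> ('r, ('a, 'x) univ) pdg_mod \<Rightarrow> (('a, 'x) univ \<Rightarrow> 'y) \<Rightarrow>
    (('a, 'x) univ \<Rightarrow> 'y) \<Rightarrow> ('r, ('a, 'x) univ) pdg_mod" where
  "pullb X E f s =
     \<lparr>carrier = {Tuple [x, e] | x e. x \<in> carrier X \<and> e \<in> carrier E \<and> f x = s e},
      monoid.mult = (\<lambda>_ _. undefined), monoid.one = undefined,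
      ring.zero = Tuple [ring.zero X, ring.zero E],
      ring.add = (\<lambda>a b. Tuple [entries a ! 0 \<oplus>\<^bsub>X\<^esub> entries b ! 0, entries a ! 1 \<oplus>\<^bsub>E\<^esub> entries b ! 1]),
      smult = (\<lambda>r a. Tuple [r \<odot>\<^bsub>X\<^esub> entries a ! 0, r \<odot>\<^bsub>E\<^esub> entries a ! 1]),
      grade = (\<lambda>n. {Tuple [x, e] | x e. x \<in> grade X n \<and> e \<in> grade E n \<and> f x = s e}),
      dif = (\<lambda>a. Tuple [dif X (entries a ! 0), dif E (entries a ! 1)])\<rparr>"

locale pdg_pullback = pdg_algebra A + X: pdg_module A X + E: pdg_module A E + Y: pdg_module A Y
  for A :: "('k::field, 'r::{ring, monoid_mult}) pdg_alg"
    and X E :: "('r, ('a, 'x) univ) pdg_mod" and Y :: "('r, 'y) pdg_mod" +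
  fixes f s
  assumes f: "f \<in> pdg_hom X Y" and s: "s \<in> pdg_hom E Y"
begin

abbreviation "W \<equiv> pullb X E f s"

lemma W_carrier_iff: "z \<in> carrier W \<longleftrightarrow> (\<exists>x e. z = Tuple [x, e] \<and> x \<in> carrier X \<and> e \<in> carrier E \<and> f x = s e)"
  by (auto simp: pullb_def)

lemma W_ops [simp]:
  "\<zero>\<^bsub>W\<^esub> = Tuple [\<zero>\<^bsub>X\<^esub>, \<zero>\<^bsub>E\<^esub>]"
  "Tuple [x, e] \<oplus>\<^bsub>W\<^esub> Tuple [x', e'] = Tuple [x \<oplus>\<^bsub>X\<^esub> x', e \<oplus>\<^bsub>E\<^esub> e']"
  "r \<odot>\<^bsub>W\<^esub> Tuple [x, e] = Tuple [r \<odot>\<^bsub>X\<^esub> x, r \<odot>\<^bsub>E\<^esub> e]"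
  "dif W (Tuple [x, e]) = Tuple [dif X x, dif E e]"
  by (simp_all add: pullb_def)

lemma W_grade: "grade W n = {Tuple [x, e] | x e. x \<in> grade X n \<and> e \<in> grade E n \<and> f x = s e}"
  by (simp add: pullb_def)

lemma fs_zero: "f \<zero>\<^bsub>X\<^esub> = s \<zero>\<^bsub>E\<^esub>"
  using addmap_zero[OF X.abelian_group_axioms Y.abelian_group_axioms pdg_hom_addmap[OF f]]
    addmap_zero[OF E.abelian_group_axioms Y.abelian_group_axioms pdg_hom_addmap[OF s]] by simp

sublocale W: coord_module A W "{False, True}" "\<lambda>j. if j then E else X" "\<lambda>j z. entries z ! (if j then 1 else 0)" "\<lambda>_. 0"
proof (rule coord_module.intro)
  fix z z' assume z: "z \<in> carrier W" "z' \<in> carrier W"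
    and eq: "\<And>j. j \<in> {False, True} \<Longrightarrow> entries z ! (if j then 1 else 0) = entries z' ! (if j then 1 else 0)"
  show "z = z'" using z eq[of False] eq[of True] by (auto simp: W_carrier_iff)
next
  fix z n assume z: "z \<in> carrier W"
  then obtain x e where xe: "z = Tuple [x, e]" "x \<in> carrier X" "e \<in> carrier E" "f x = s e" by (auto simp: W_carrier_iff)
  have "f (cpt X n x) = s (cpt E n e)"
    using cpt_hom[OF X.pdg_module_axioms Y.pdg_module_axioms pdg_hom_gr[OF f] xe(2), of n]
      cpt_hom[OF E.pdg_module_axioms Y.pdg_module_axioms pdg_hom_gr[OF s] xe(3), of n] xe(4) by simp
  then show "\<exists>y\<in>carrier W. \<forall>j\<in>{False, True}. entries y ! (if j then 1 else 0) =
     cpt (if j then E else X) (n + 0) (entries z ! (if j then 1 else 0))"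
    using xe by (intro bexI[of _ "Tuple [cpt X n x, cpt E n e]"]) (auto simp: W_carrier_iff X.cpt_closed E.cpt_closed)
next
  fix z assume z: "z \<in> carrier W"
  then obtain x e where xe: "z = Tuple [x, e]" "x \<in> carrier X" "e \<in> carrier E" "f x = s e" by (auto simp: W_carrier_iff)
  have "{n. \<exists>j\<in>{False, True}. cpt (if j then E else X) (n + 0) (entries z ! (if j then 1 else 0)) \<noteq> \<zero>\<^bsub>if j then E else X\<^esub>}
    = {n. cpt X n x \<noteq> \<zero>\<^bsub>X\<^esub>} \<union> {n. cpt E n e \<noteq> \<zero>\<^bsub>E\<^esub>}" using xe by auto
  then show "finite {n. \<exists>j\<in>{False, True}. cpt (if j then E else X) (n + 0) (entries z ! (if j then 1 else 0)) \<noteq> \<zero>\<^bsub>if j then E else X\<^esub>}"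
    using xe X.cpt_finite E.cpt_finite by simp
qed (auto simp: W_carrier_iff W_grade X.pdg_module_axioms E.pdg_module_axioms fs_zero pdg_hom_add[OF f] pdg_hom_add[OF s]
    pdg_hom_smult[OF f] pdg_hom_smult[OF s] X.smult_closed E.smult_closed X.grade_carrier E.grade_carrier)

lemma pdg_module_W: "pdg_module A W"
  by (rule W.pdg_moduleI_strict[OF pdg_algebra_axioms])
    (auto simp: W_carrier_iff X.dif_closed E.dif_closed pdg_hom_dif[OF f] pdg_hom_dif[OF s])

lemma W_fst: "(\<lambda>z. entries z ! 0) \<in> pdg_hom W X"
  by (intro pdg_homI gr_homI) (auto simp: W_carrier_iff W_grade)

lemma W_snd: "(\<lambda>z. entries z ! 1) \<in> pdg_hom W E"
  by (intro pdg_homI gr_homI) (auto simp: W_carrier_iff W_grade)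

lemma W_commutes: "z \<in> carrier W \<Longrightarrow> f (entries z ! 0) = s (entries z ! 1)"
  by (auto simp: W_carrier_iff)

lemma W_pair_gr:
  assumes "a \<in> gr_hom d Q X" "b \<in> gr_hom d Q E" "\<And>x. x \<in> carrier Q \<Longrightarrow> f (a x) = s (b x)" "pdg_module B Q"
  shows "(\<lambda>x. Tuple [a x, b x]) \<in> gr_hom d Q W"
proof (rule gr_homI)
  show "Tuple [a x, b x] \<in> grade W (n + d)" if "x \<in> grade Q n" for x n
    using assms that pdg_module.grade_carrier[OF assms(4) that] by (auto simp: W_grade gr_hom_grade)
qed (use assms in \<open>auto simp: W_carrier_iff gr_hom_closed gr_hom_add gr_hom_smult\<close>)

lemma W_pair:
  assumes "a \<in> pdg_hom Q X" "b \<in> pdg_hom Q E" "\<And>x. x \<in> carrier Q \<Longrightarrow> f (a x) = s (b x)" "pdg_module B Q"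
  shows "(\<lambda>x. Tuple [a x, b x]) \<in> pdg_hom Q W"
  using assms by (intro pdg_homI[OF W_pair_gr]) (auto simp: pdg_hom_dif intro: pdg_hom_gr)

end

section \<open>Quasi-isomorphisms, acyclic fibrations and the Ore condition\<close>

section \<open>Homotopy equivalences\<close>

definition heq where
  "heq A M N f \<longleftrightarrow> f \<in> pdg_hom M N \<and>
    (\<exists>g\<in>pdg_hom N M. homotopic A M M (\<lambda>x. g (f x)) (\<lambda>x. x) \<and> homotopic A N N (\<lambda>x. f (g x)) (\<lambda>x. x))"

lemma heqI:
  "f \<in> pdg_hom M N \<Longrightarrow> g \<in> pdg_hom N M \<Longrightarrow> homotopic A M M (\<lambda>x. g (f x)) (\<lambda>x. x) \<Longrightarrow>
    homotopic A N N (\<lambda>x. f (g x)) (\<lambda>x. x) \<Longrightarrow> heq A M N f"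
  unfolding heq_def by blast

lemma heq_comp:
  assumes "pdg_algebra A" "pdg_module A L" "pdg_module A M" "pdg_module A N" "heq A L M f" "heq A M N g"
  shows "heq A L N (\<lambda>x. g (f x))"
proof -
  interpret LL: pdg_module_pair A L L by (intro pdg_module_pair.intro assms)
  interpret NN: pdg_module_pair A N N by (intro pdg_module_pair.intro assms)
  obtain f' where f: "f \<in> pdg_hom L M" and f': "f' \<in> pdg_hom M L"
    "homotopic A L L (\<lambda>x. f' (f x)) (\<lambda>x. x)" "homotopic A M M (\<lambda>x. f (f' x)) (\<lambda>x. x)"
    using assms(5) unfolding heq_def by blast
  obtain g' where g: "g \<in> pdg_hom M N" and g': "g' \<in> pdg_hom N M"
    "homotopic A M M (\<lambda>x. g' (g x)) (\<lambda>x. x)" "homotopic A N N (\<lambda>x. g (g' x)) (\<lambda>x. x)"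
    using assms(6) unfolding heq_def by blast
  have "homotopic A L M (\<lambda>x. g' (g (f x))) f"
    using homotopic_precomp[OF assms(1,3,3,2) f g'(2)] .
  then have "homotopic A L L (\<lambda>x. f' (g' (g (f x)))) (\<lambda>x. f' (f x))"
    using homotopic_postcomp[OF assms(1,2,3,2) f'(1)] pdg_hom_comp[OF pdg_hom_comp[OF f g] g'(1)] f by blast
  then have 1: "homotopic A L L (\<lambda>x. f' (g' (g (f x)))) (\<lambda>x. x)"
    using LL.homotopic_trans[OF pdg_hom_comp[OF pdg_hom_comp[OF pdg_hom_comp[OF f g] g'(1)] f'(1)]
       pdg_hom_comp[OF f f'(1)] pdg_hom_ident _ f'(2)] by blast
  have "homotopic A N M (\<lambda>x. f (f' (g' x))) g'"
    using homotopic_precomp[OF assms(1,3,3,4) g'(1) f'(3)] .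
  then have "homotopic A N N (\<lambda>x. g (f (f' (g' x)))) (\<lambda>x. g (g' x))"
    using homotopic_postcomp[OF assms(1,4,3,4) g] pdg_hom_comp[OF pdg_hom_comp[OF g'(1) f'(1)] f] g'(1) by blast
  then have 2: "homotopic A N N (\<lambda>x. g (f (f' (g' x)))) (\<lambda>x. x)"
    using NN.homotopic_trans[OF pdg_hom_comp[OF pdg_hom_comp[OF pdg_hom_comp[OF g'(1) f'(1)] f] g]
       pdg_hom_comp[OF g'(1) g] pdg_hom_ident _ g'(3)] by blast
  show ?thesis
    unfolding heq_def using 1 2 pdg_hom_comp[OF f g] pdg_hom_comp[OF g'(1) f'(1)]
    by (intro conjI bexI[of _ "\<lambda>x. f' (g' x)"])
qed

lemma heq_homotopic:
  assumes "pdg_algebra A" "pdg_module A M" "pdg_module A N" "heq A M N f" "f' \<in> pdg_hom M N" "homotopic A M N f f'"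
  shows "heq A M N f'"
proof -
  interpret MM: pdg_module_pair A M M by (intro pdg_module_pair.intro assms)
  interpret NN: pdg_module_pair A N N by (intro pdg_module_pair.intro assms)
  interpret MN: pdg_module_pair A M N by (intro pdg_module_pair.intro assms)
  obtain g where f: "f \<in> pdg_hom M N" and g: "g \<in> pdg_hom N M"
    "homotopic A M M (\<lambda>x. g (f x)) (\<lambda>x. x)" "homotopic A N N (\<lambda>x. f (g x)) (\<lambda>x. x)"
    using assms(4) unfolding heq_def by blast
  have s: "homotopic A M N f' f" using MN.homotopic_sym[OF f assms(5,6)] .
  have "homotopic A M M (\<lambda>x. g (f' x)) (\<lambda>x. x)"
    using MM.homotopic_trans[OF pdg_hom_comp[OF assms(5) g(1)] pdg_hom_comp[OF f g(1)] pdg_hom_ident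
      homotopic_postcomp[OF assms(1,2,3,2) g(1) assms(5) f s] g(2)] .
  moreover have "homotopic A N N (\<lambda>x. f' (g x)) (\<lambda>x. x)"
    using NN.homotopic_trans[OF pdg_hom_comp[OF g(1) assms(5)] pdg_hom_comp[OF g(1) f] pdg_hom_ident
      homotopic_precomp[OF assms(1,2,3,3) g(1) s] g(3)] .
  ultimately show ?thesis unfolding heq_def using assms(5) g(1) by blast
qed

lemma null_homotopic_underlying:
  assumes "pdg_algebra (A :: ('k::field, 'r::{ring, monoid_mult}) pdg_alg)" "pdg_module A M" "pdg_module A N" "null_homotopic A M N f"
  shows "null_homotopic (ground :: ('k, 'k) pdg_alg) (underlying A M) (underlying A N) f"
proof -
  interpret MN: pdg_module_pair A M N by (intro pdg_module_pair.intro assms)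
  interpret U: pdg_module_pair "ground :: ('k, 'k) pdg_alg" "underlying A M" "underlying A N"
    by (intro pdg_module_pair.intro assms(2,3) pdg_algebra_ground[OF assms(1)] pdg_module_underlying[OF assms(1)])
  obtain h where "h \<in> gr_hom (2 - 2 * int (pchar A)) M N" "\<forall>x\<in>carrier M. f x = (dl M N ^^ (pchar A - 1)) h x"
    using assms(4) MN.null_homotopic_iff by auto
  then show ?thesis
    unfolding U.null_homotopic_iff pchar_ground[of A]
    by (intro bexI[of _ h]) (auto intro: gr_hom_underlying)
qed

lemma homotopic_underlying:
  assumes "pdg_algebra (A :: ('k::field, 'r::{ring, monoid_mult}) pdg_alg)" "pdg_module A M" "pdg_module A N" "homotopic A M N f g"
  shows "homotopic (ground :: ('k, 'k) pdg_alg) (underlying A M) (underlying A N) f g"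
  using null_homotopic_underlying[OF assms(1-3)] assms(4) unfolding homotopic_def by simp

lemma heq_underlying:
  assumes "pdg_algebra (A :: ('k::field, 'r::{ring, monoid_mult}) pdg_alg)" "pdg_module A M" "pdg_module A N" "heq A M N f"
  shows "heq (ground :: ('k, 'k) pdg_alg) (underlying A M) (underlying A N) f"
proof -
  obtain g where "f \<in> pdg_hom M N" "g \<in> pdg_hom N M"
    "homotopic A M M (\<lambda>x. g (f x)) (\<lambda>x. x)" "homotopic A N N (\<lambda>x. f (g x)) (\<lambda>x. x)"
    using assms(4) unfolding heq_def by blast
  then show ?thesis
    unfolding heq_def using assms(1-3) by (auto intro!: bexI[of _ g] homotopic_underlying pdg_hom_underlying)
qed

lemma heq_ident: "pdg_algebra A \<Longrightarrow> pdg_module A M \<Longrightarrow> heq A M M (\<lambda>x. x)"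
  unfolding heq_def
  by (intro conjI bexI[of _ "\<lambda>x. x"] pdg_hom_ident pdg_module_pair.homotopic_refl pdg_module_pair.intro)

section \<open>Split surjections with contractible kernel\<close>

text \<open>\<open>G\<close> lives on all of \<open>W\<close> but takes values in the kernel of
  \<open>w\<close>, and its restriction to the kernel is a null-homotopy of the identity there. In
  this form the kernel never has to be made into a module of its own.\<close>

definition contraction where
  "contraction A W X w G \<longleftrightarrow> G \<in> gr_hom (2 - 2 * int (pchar A)) W W \<and> (\<forall>z\<in>carrier W. w (G z) = \<zero>\<^bsub>X\<^esub>) \<and>
     (\<forall>z\<in>carrier W. w z = \<zero>\<^bsub>X\<^esub> \<longrightarrow> (dl W W ^^ (pchar A - 1)) G z = z)"

text \<open>The defect \<open>1 - s t\<close> of a homotopy inverse \<open>t\<close> is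
  null-homotopic, and its homotopy lifts through the graded section; subtracting the defect this way
  gives a morphism \<open>t'\<close> with \<open>s t' = 1\<close>. Then \<open>1 - t' s\<close>
  projects onto the kernel and is null-homotopic; following its homotopy by this projection gives a
  contraction.\<close>

lemma contraction_exists:
  assumes A: "pdg_algebra A" "pdg_module A E" "pdg_module A Y" and s: "heq A E Y s"
    and \<sigma>: "\<sigma> \<in> gr_hom 0 Y E" "\<And>y. y \<in> carrier Y \<Longrightarrow> s (\<sigma> y) = y"
  shows "\<exists>G. contraction A E Y s G"
proof -
  interpret EE: pdg_module_pair A E E by (intro pdg_module_pair.intro assms)
  interpret YY: pdg_module_pair A Y Y by (intro pdg_module_pair.intro assms)
  interpret EY: pdg_module_pair A E Y by (intro pdg_module_pair.intro assms)
  interpret YE: pdg_module_pair A Y E by (intro pdg_module_pair.intro assms)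
  let ?q = "pchar A - 1" and ?d = "2 - 2 * int (pchar A)"
  obtain t where s: "s \<in> pdg_hom E Y" and t: "t \<in> pdg_hom Y E"
    "homotopic A E E (\<lambda>x. t (s x)) (\<lambda>x. x)" "homotopic A Y Y (\<lambda>x. s (t x)) (\<lambda>x. x)"
    using s unfolding heq_def by blast
  have "homotopic A Y Y (\<lambda>x. x) (\<lambda>x. s (t x))"
    by (rule YY.homotopic_sym[OF pdg_hom_comp[OF t(1) s] pdg_hom_ident t(3)])
  then obtain h where h: "h \<in> gr_hom ?d Y Y" "\<And>y. y \<in> carrier Y \<Longrightarrow> y \<ominus>\<^bsub>Y\<^esub> s (t y) = (dl Y Y ^^ ?q) h y"
    using YY.homotopic_iff by auto
  define h' where "h' y = \<sigma> (h y)" for y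
  have h': "h' \<in> gr_hom ?d Y E" unfolding h'_def by (rule gr_hom_comp0[OF h(1) \<sigma>(1)])
  have dh': "(dl Y E ^^ ?q) h' \<in> pdg_hom Y E" by (rule YE.dl_pow_pred_pdg_hom[OF h'])
  \<comment> \<open>The correction is the null-homotopic map attached to the lifted homotopy
    \<open>h'\<close>; \<open>s\<close> maps it to \<open>y - s (t y)\<close>.\<close>
  define t' where "t' y = t y \<oplus>\<^bsub>E\<^esub> (dl Y E ^^ ?q) h' y" for y
  have t': "t' \<in> pdg_hom Y E" unfolding t'_def by (rule YE.add_pdg_hom[OF t(1) dh'])
  have st': "s (t' y) = y" if y: "y \<in> carrier Y" for y
  proof -
    have "s ((dl Y E ^^ ?q) h' y) = (dl Y Y ^^ ?q) (\<lambda>x. s (h' x)) y"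
      using dl_pow_postcomp[OF YE.pdg_module_pair_axioms assms(3) s YE.gr_hom_funcset[OF h'] y] by simp
    also have "\<dots> = (dl Y Y ^^ ?q) h y"
      using y by (intro YY.dl_pow_cong) (auto simp: h'_def \<sigma>(2) gr_hom_closed[OF h(1)])
    also have "\<dots> = y \<ominus>\<^bsub>Y\<^esub> s (t y)" using h(2)[OF y] by simp
    finally have "s (t' y) = s (t y) \<oplus>\<^bsub>Y\<^esub> (y \<ominus>\<^bsub>Y\<^esub> s (t y))"
      using y by (simp add: t'_def pdg_hom_add[OF s] pdg_hom_closed[OF t(1)] pdg_hom_closed[OF dh'] del: One_nat_def)
    then show ?thesis
      using y YY.M.a_comm[of "s (t y)" "y \<ominus>\<^bsub>Y\<^esub> s (t y)"]
      by (simp add: YY.M.sub_add_cancel pdg_hom_closed[OF s] pdg_hom_closed[OF t(1)])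
  qed
  have "homotopic A Y E t' t"
  proof -
    have "t' y \<ominus>\<^bsub>E\<^esub> t y = (dl Y E ^^ ?q) h' y" if "y \<in> carrier Y" for y
      using that by (simp add: t'_def EE.M.add_sub_cancel_left pdg_hom_closed[OF t(1)] pdg_hom_closed[OF dh']
          del: One_nat_def)
    then show ?thesis unfolding YE.homotopic_iff using h' by blast
  qed
  from homotopic_precomp[OF assms(1,3,2,2) s this]
  have "homotopic A E E (\<lambda>x. t' (s x)) (\<lambda>x. x)"
    by (rule EE.homotopic_trans[OF pdg_hom_comp[OF s t'] pdg_hom_comp[OF s t(1)] pdg_hom_ident _ t(2)])
  then have "homotopic A E E (\<lambda>x. x) (\<lambda>x. t' (s x))"
    by (rule EE.homotopic_sym[OF pdg_hom_comp[OF s t'] pdg_hom_ident])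
  then obtain H where H: "H \<in> gr_hom ?d E E" "\<And>z. z \<in> carrier E \<Longrightarrow> z \<ominus>\<^bsub>E\<^esub> t' (s z) = (dl E E ^^ ?q) H z"
    unfolding EE.homotopic_iff by auto
  define r where "r z = z \<ominus>\<^bsub>E\<^esub> t' (s z)" for z
  have r: "r \<in> pdg_hom E E" unfolding r_def by (rule EE.sub_pdg_hom[OF pdg_hom_ident pdg_hom_comp[OF s t']])
  have sr: "s (r z) = \<zero>\<^bsub>Y\<^esub>" if "z \<in> carrier E" for z
    using that addmap_sub[OF EE.M.abelian_group_axioms YY.M.abelian_group_axioms pdg_hom_addmap[OF s], of z "t' (s z)"]
    by (simp add: r_def st' pdg_hom_closed[OF s] pdg_hom_closed[OF t'])
  have rk: "r z = z" if "z \<in> carrier E" "s z = \<zero>\<^bsub>Y\<^esub>" for z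
    using that addmap_zero[OF YY.M.abelian_group_axioms EE.M.abelian_group_axioms pdg_hom_addmap[OF t']] by (simp add: r_def)
  have "(dl E E ^^ ?q) (\<lambda>z. r (H z)) z = z" if z: "z \<in> carrier E" "s z = \<zero>\<^bsub>Y\<^esub>" for z
  proof -
    have "(dl E E ^^ ?q) (\<lambda>z. r (H z)) z = r ((dl E E ^^ ?q) H z)"
      using dl_pow_postcomp[OF EE.pdg_module_pair_axioms assms(2) r EE.gr_hom_funcset[OF H(1)] z(1)] .
    also have "\<dots> = r (r z)" using H(2)[OF z(1)] by (simp add: r_def)
    finally show ?thesis using rk z by simp
  qed
  then show ?thesis
    unfolding contraction_def using gr_hom_comp0[OF H(1) pdg_hom_gr[OF r]] sr gr_hom_closed[OF H(1)]
    by (intro exI[of _ "\<lambda>z. r (H z)"]) auto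
qed

text \<open>\<open>dl^(p - 1) G\<close> is a morphism \<open>r\<close> into the kernel that is the
  identity there, so \<open>c = 1 - r\<close> vanishes on the kernel. Hence \<open>c\<close> applied
  to a lift depends only on the point below, and \<open>\<tau>\<close> commutes with the
  differentials although \<open>\<sigma>\<close> need not. The homotopy between the identity and
  \<open>\<tau>\<close> after \<open>w\<close> is \<open>G\<close> itself.\<close>

lemma heq_contraction:
  assumes A: "pdg_algebra A" "pdg_module A W" "pdg_module A X" and w: "w \<in> pdg_hom W X"
    and \<sigma>: "\<sigma> \<in> gr_hom 0 X W" "\<And>x. x \<in> carrier X \<Longrightarrow> w (\<sigma> x) = x"
    and G: "contraction A W X w G"
  shows "heq A W X w"
proof -
  interpret WW: pdg_module_pair A W W by (intro pdg_module_pair.intro assms)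
  interpret XX: pdg_module_pair A X X by (intro pdg_module_pair.intro assms)
  interpret XW: pdg_module_pair A X W by (intro pdg_module_pair.intro assms)
  let ?q = "pchar A - 1" and ?d = "2 - 2 * int (pchar A)"
  have G: "G \<in> gr_hom ?d W W" "\<And>z. z \<in> carrier W \<Longrightarrow> w (G z) = \<zero>\<^bsub>X\<^esub>"
    "\<And>z. z \<in> carrier W \<Longrightarrow> w z = \<zero>\<^bsub>X\<^esub> \<Longrightarrow> (dl W W ^^ ?q) G z = z"
    using G unfolding contraction_def by auto
  define r where "r = (dl W W ^^ ?q) G"
  have r: "r \<in> pdg_hom W W" unfolding r_def by (rule WW.dl_pow_pred_pdg_hom[OF G(1)])
  have w0: "w \<zero>\<^bsub>W\<^esub> = \<zero>\<^bsub>X\<^esub>" by (rule addmap_zero[OF WW.M.abelian_group_axioms XX.M.abelian_group_axioms pdg_hom_addmap[OF w]])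
  have wr: "w (r z) = \<zero>\<^bsub>X\<^esub>" if z: "z \<in> carrier W" for z
  proof -
    interpret WX: pdg_module_pair A W X by (intro pdg_module_pair.intro assms)
    have "w (r z) = (dl W X ^^ ?q) (\<lambda>z. w (G z)) z"
      using dl_pow_postcomp[OF WW.pdg_module_pair_axioms assms(3) w WW.gr_hom_funcset[OF G(1)] z] by (simp add: r_def)
    also have "\<dots> = (dl W X ^^ ?q) (\<lambda>z. \<zero>\<^bsub>X\<^esub>) z" using z G(2) by (intro WX.dl_pow_cong) auto
    also have "\<dots> = \<zero>\<^bsub>X\<^esub>" 
    proof -
      have "(dl W X ^^ n) (\<lambda>_. \<zero>\<^bsub>X\<^esub>) x = \<zero>\<^bsub>X\<^esub>" for n x by (induction n arbitrary: x) (auto simp: dl_def)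
      then show ?thesis .
    qed
    finally show ?thesis .
  qed
  define c where "c z = z \<ominus>\<^bsub>W\<^esub> r z" for z
  have c: "c \<in> pdg_hom W W" unfolding c_def by (rule WW.sub_pdg_hom[OF pdg_hom_ident r])
  have ck: "c z = \<zero>\<^bsub>W\<^esub>" if "z \<in> carrier W" "w z = \<zero>\<^bsub>X\<^esub>" for z
    using that G(3) by (simp add: c_def r_def)
  have wc: "w (c z) = w z" if "z \<in> carrier W" for z
    using that addmap_sub[OF WW.M.abelian_group_axioms XX.M.abelian_group_axioms pdg_hom_addmap[OF w], of z "r z"]
    by (simp add: c_def wr pdg_hom_closed[OF r] pdg_hom_closed[OF w])
  define \<tau> where "\<tau> x = c (\<sigma> x)" for x
  have \<tau>gr: "\<tau> \<in> gr_hom 0 X W" unfolding \<tau>_def by (rule gr_hom_comp0[OF \<sigma>(1) pdg_hom_gr[OF c]])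
  have c_eq: "c z = c z'" if "z \<in> carrier W" "z' \<in> carrier W" "w z = w z'" for z z'
  proof -
    have "w (z \<ominus>\<^bsub>W\<^esub> z') = \<zero>\<^bsub>X\<^esub>"
      using that addmap_sub[OF WW.M.abelian_group_axioms XX.M.abelian_group_axioms pdg_hom_addmap[OF w], of z z']
        pdg_hom_closed[OF w] by simp
    then have "c (z \<ominus>\<^bsub>W\<^esub> z') = \<zero>\<^bsub>W\<^esub>" using ck that by simp
    then show ?thesis
      using that addmap_sub[OF WW.M.abelian_group_axioms WW.M.abelian_group_axioms pdg_hom_addmap[OF c], of z z']
        WW.M.sub_eq_zero_iff pdg_hom_closed[OF c] by simp
  qed
  have \<sigma>c: "\<sigma> x \<in> carrier W" if "x \<in> carrier X" for x using gr_hom_closed[OF \<sigma>(1) that] .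
  have \<tau>: "\<tau> \<in> pdg_hom X W"
  proof (rule pdg_homI[OF \<tau>gr])
    fix x assume x: "x \<in> carrier X"
    have "c (\<sigma> (dif X x)) = c (dif W (\<sigma> x))"
      using x \<sigma>c XX.M.dif_closed WW.M.dif_closed by (intro c_eq) (auto simp: \<sigma>(2) pdg_hom_dif[OF w])
    then show "\<tau> (dif X x) = dif W (\<tau> x)" using x \<sigma>c by (simp add: \<tau>_def pdg_hom_dif[OF c])
  qed
  have 1: "homotopic A X X (\<lambda>x. w (\<tau> x)) (\<lambda>x. x)"
    using XX.homotopicI_eq[OF pdg_hom_comp[OF \<tau> w]] by (simp add: \<tau>_def wc \<sigma>c \<sigma>(2))
  have "homotopic A W W (\<lambda>z. z) (\<lambda>z. \<tau> (w z))"
  proof -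
    have "z \<ominus>\<^bsub>W\<^esub> \<tau> (w z) = r z" if z: "z \<in> carrier W" for z
    proof -
      have "\<tau> (w z) = c z"
        unfolding \<tau>_def using z pdg_hom_closed[OF w z] by (intro c_eq) (auto simp: \<sigma>c \<sigma>(2))
      then show ?thesis using z by (simp add: c_def WW.M.sub_sub_cancel pdg_hom_closed[OF r])
    qed
    then show ?thesis unfolding WW.homotopic_iff using G(1) by (auto simp: r_def)
  qed
  then have "homotopic A W W (\<lambda>z. \<tau> (w z)) (\<lambda>z. z)"
    by (rule WW.homotopic_sym[OF pdg_hom_ident pdg_hom_comp[OF w \<tau>]])
  then show ?thesis using 1 w \<tau> unfolding heq_def by blast
qed

section \<open>Acyclic fibrations and the Ore condition\<close>

text \<open>A split acyclic fibration. The splitting is linear over the algebra, the contraction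
  over the ground field, since a quasi-isomorphism supplies homotopies of underlying
  \<open>p\<close>-complexes.\<close>

definition saf where
  "saf (A :: ('k::field, 'r::{ring, monoid_mult}) pdg_alg) W X w \<longleftrightarrow> w \<in> pdg_hom W X \<and>
    (\<exists>\<sigma>\<in>gr_hom 0 X W. \<forall>x\<in>carrier X. w (\<sigma> x) = x) \<and>
    (\<exists>G. contraction (ground :: ('k, 'k) pdg_alg) (underlying A W) (underlying A X) w G)"

text \<open>The condition \<open>qis\<close> for a representative instead of a homotopy class; see
  \<open>qis_iff\<close>.\<close>

definition kheq where
  "kheq (A :: ('k::field, 'r::{ring, monoid_mult}) pdg_alg) M N f \<longleftrightarrow> f \<in> pdg_hom M N \<and>
    heq (ground :: ('k, 'k) pdg_alg) (underlying A M) (underlying A N) f"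

lemma saf_kheq:
  assumes "pdg_algebra A" "pdg_module A W" "pdg_module A X" "saf A W X w"
  shows "kheq A W X w"
proof -
  obtain \<sigma> G where *: "w \<in> pdg_hom W X" "\<sigma> \<in> gr_hom 0 X W" "\<forall>x\<in>carrier X. w (\<sigma> x) = x"
    "contraction (ground :: ('a, 'a) pdg_alg) (underlying A W) (underlying A X) w G"
    using assms(4) unfolding saf_def by blast
  have "heq (ground :: ('a, 'a) pdg_alg) (underlying A W) (underlying A X) w"
    by (rule heq_contraction[OF pdg_algebra_ground[OF assms(1)] pdg_module_underlying[OF assms(1,2)]
        pdg_module_underlying[OF assms(1,3)] pdg_hom_underlying[OF *(1)] gr_hom_underlying[OF *(2)] _ *(4)])
      (use *(3) in auto)
  then show ?thesis using *(1) by (simp add: kheq_def)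
qed

text \<open>\<open>E\<close> is the direct sum of \<open>Z\<close> and the path object of
  \<open>Y\<close>, and \<open>s'\<close> is \<open>s\<close> minus entry 0. The path object
  supplies a graded section of \<open>s'\<close> and, being contractible, does not change the
  homotopy type; \<open>pr\<close> is the projection to \<open>Z\<close>. The last clause holds
  because a null-homotopy of \<open>s\<close> after \<open>y\<close> is a map to the path object
  whose entry 0 equals \<open>s (y x)\<close>, so that the pair of \<open>y\<close> and this map is
  sent to zero by \<open>s'\<close>.\<close>

lemma fibrant_replacement:
  fixes A :: "('k::field, 'r::{ring, monoid_mult}) pdg_alg"
    and Y Z :: "('r, ('a, 'x) univ) pdg_mod"
  assumes A: "pdg_algebra A" and M: "pdg_module A Y" "pdg_module A Z" and s: "kheq A Z Y s"
  shows "\<exists>(E :: ('r, ('a, 'x) univ) pdg_mod) s' \<sigma> G pr. pdg_module A E \<and> s' \<in> pdg_hom E Y \<and>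
     \<sigma> \<in> gr_hom 0 Y E \<and> (\<forall>y\<in>carrier Y. s' (\<sigma> y) = y) \<and>
     contraction (ground :: ('k, 'k) pdg_alg) (underlying A E) (underlying A Y) s' G \<and>
     pr \<in> pdg_hom E Z \<and> homotopic A E Y (\<lambda>z. s (pr z)) s' \<and>
     (\<forall>(Q :: ('r, ('a, 'x) univ) pdg_mod). \<forall>y\<in>pdg_hom Q Z. pdg_module A Q \<longrightarrow> null_homotopic A Q Y (\<lambda>x. s (y x)) \<longrightarrow>
        (\<exists>\<kappa>\<in>pdg_hom Q E. \<forall>x\<in>carrier Q. s' (\<kappa> x) = \<zero>\<^bsub>Y\<^esub> \<and> pr (\<kappa> x) = y x))"
proof -
  interpret pdg_algebra A by fact
  obtain q where q: "pchar A = Suc q" using pchar_ge2 by (cases "pchar A") auto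
  interpret Z: pdg_module A Z by fact
  interpret Ym: pdg_module A Y by fact
  interpret C: path_object A Y q by (intro path_object.intro path_object_axioms.intro A M q)
  let ?P = "path_ob A Y"
  \<comment> \<open>The pullback along two zero maps is the direct sum.\<close>
  let ?zero = "\<lambda>_ :: ('a, 'x) univ. \<zero>\<^bsub>Z\<^esub>"
  have PM: "pdg_module A ?P" by (rule C.pdg_module_P)
  have ZZ: "pdg_module_pair A Z Z" "pdg_module_pair A ?P Z"
    by (intro pdg_module_pair.intro A M PM)+
  interpret S: pdg_pullback A Z ?P Z ?zero ?zero
    by (intro pdg_pullback.intro pdg_pullback_axioms.intro A M PM pdg_module_pair.zero_pdg_hom[OF ZZ(1)]
        pdg_module_pair.zero_pdg_hom[OF ZZ(2)])
  let ?E = "pullb Z ?P ?zero ?zero"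
  have EM: "pdg_module A ?E" by (rule S.pdg_module_W)
  interpret Em: pdg_module A ?E by (rule EM)
  have sm: "s \<in> pdg_hom Z Y" using s by (simp add: kheq_def)
  define n0 where "n0 z = entries (entries z ! 1) ! 0" for z :: "('a, 'x) univ"
  define s' where "s' z = s (entries z ! 0) \<ominus>\<^bsub>Y\<^esub> n0 z" for z
  have EY: "pdg_module_pair A ?E Y" by (intro pdg_module_pair.intro A M EM)
  interpret EY: pdg_module_pair A ?E Y by (rule EY)
  have n0: "n0 \<in> pdg_hom ?E Y" unfolding n0_def by (rule pdg_hom_comp[OF S.W_snd C.P_proj0])
  have n0null: "null_homotopic A ?E Y n0"
    unfolding n0_def by (rule null_homotopic_precomp[OF A PM M(1) EM S.W_snd C.null_P_proj0])
  have s0: "(\<lambda>z. s (entries z ! 0)) \<in> pdg_hom ?E Y" by (rule pdg_hom_comp[OF S.W_fst sm])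
  have s': "s' \<in> pdg_hom ?E Y" unfolding s'_def by (rule EY.sub_pdg_hom[OF s0 n0])
  have s'h: "homotopic A ?E Y (\<lambda>z. s (entries z ! 0)) s'"
    unfolding homotopic_def
  proof (rule iffD2[OF EY.null_homotopic_cong n0null])
    fix z assume z: "z \<in> carrier ?E"
    then show "s (entries z ! 0) \<ominus>\<^bsub>Y\<^esub> s' z = n0 z"
      unfolding s'_def using pdg_hom_closed[OF s0] pdg_hom_closed[OF n0] 
      by (simp add: Ym.sub_sub_cancel)
  qed
  have "heq A ?E Z (\<lambda>z. entries z ! 0)"
  proof -
    interpret EE: pdg_module_pair A ?E ?E by (intro pdg_module_pair.intro A EM)
    interpret PP: pdg_module_pair A ?P ?P by (intro pdg_module_pair.intro A PM)
    interpret ZP: pdg_module_pair A Z ?P by (intro pdg_module_pair.intro A M PM)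
    interpret PZ: pdg_module_pair A ?P Z by (intro pdg_module_pair.intro A M PM)
    interpret ZZ: pdg_module_pair A Z Z by (rule ZZ)
    have i: "(\<lambda>z. Tuple [z, \<zero>\<^bsub>?P\<^esub>]) \<in> pdg_hom Z ?E"
      using S.W_pair[OF pdg_hom_ident ZP.zero_pdg_hom _ M(2)] by simp
    have j: "(\<lambda>z. Tuple [\<zero>\<^bsub>Z\<^esub>, z]) \<in> pdg_hom ?P ?E"
      using S.W_pair[OF PZ.zero_pdg_hom pdg_hom_ident _ PM] by simp
    have nu: "null_homotopic A ?E ?E (\<lambda>z. Tuple [\<zero>\<^bsub>Z\<^esub>, entries z ! 1])"
      using null_homotopic_postcomp[OF A EM PM EM j null_homotopic_precomp[OF A PM PM EM S.W_snd C.null_P_ident]] by simp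
    have "homotopic A ?E ?E (\<lambda>z. z) (\<lambda>z. Tuple [entries z ! 0, \<zero>\<^bsub>?P\<^esub>])"
      unfolding homotopic_def
    proof (rule iffD2[OF EE.null_homotopic_cong nu])
      fix z assume "z \<in> carrier ?E"
      then obtain x e where xe: "z = Tuple [x, e]" "x \<in> carrier Z" "e \<in> carrier ?P" by (auto simp: S.W_carrier_iff)
      have t: "Tuple [\<zero>\<^bsub>Z\<^esub>, e] \<in> carrier ?E" "Tuple [x, \<zero>\<^bsub>?P\<^esub>] \<in> carrier ?E"
        using xe C.PY.M.zero_closed by (auto simp: S.W_carrier_iff)
      have zz: "z = Tuple [\<zero>\<^bsub>Z\<^esub>, e] \<oplus>\<^bsub>?E\<^esub> Tuple [x, \<zero>\<^bsub>?P\<^esub>]" using xe by simp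
      have "z \<ominus>\<^bsub>?E\<^esub> Tuple [x, \<zero>\<^bsub>?P\<^esub>] = Tuple [\<zero>\<^bsub>Z\<^esub>, e]"
        by (subst zz) (rule Em.add_sub_cancel[OF t])
      then show "z \<ominus>\<^bsub>?E\<^esub> Tuple [entries z ! 0, \<zero>\<^bsub>?P\<^esub>] = Tuple [\<zero>\<^bsub>Z\<^esub>, entries z ! 1]"
        using xe(1) by simp
    qed
    then have "homotopic A ?E ?E (\<lambda>z. Tuple [entries z ! 0, \<zero>\<^bsub>?P\<^esub>]) (\<lambda>z. z)"
      by (rule EE.homotopic_sym[OF pdg_hom_ident pdg_hom_comp[OF S.W_fst i]])
    moreover have "homotopic A Z Z (\<lambda>z. entries (Tuple [z, \<zero>\<^bsub>?P\<^esub>] :: ('a, 'x) univ) ! 0) (\<lambda>z. z)"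
      using ZZ.homotopic_refl[OF pdg_hom_ident] by simp
    ultimately show ?thesis by (rule heqI[OF S.W_fst i])
  qed
  note h1 = heq_underlying[OF A EM M(2) this]
  have kE: "heq (ground :: ('k, 'k) pdg_alg) (underlying A ?E) (underlying A Y) s'"
    by (rule heq_homotopic[OF pdg_algebra_ground[OF A] pdg_module_underlying[OF A EM] pdg_module_underlying[OF A M(1)]
       heq_comp[OF pdg_algebra_ground[OF A] pdg_module_underlying[OF A EM] pdg_module_underlying[OF A M(2)] pdg_module_underlying[OF A M(1)]
         h1 conjunct2[OF s[unfolded kheq_def]]] pdg_hom_underlying[OF s'] homotopic_underlying[OF A EM M(1) s'h]])
  \<comment> \<open>The sign compensates for the subtraction in \<open>s'\<close>.\<close>
  define \<sigma> where "\<sigma> y = Tuple [\<zero>\<^bsub>Z\<^esub>, C.P_sec (\<ominus>\<^bsub>Y\<^esub> y)]" for y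
  interpret YZ: pdg_module_pair A Y Z by (intro pdg_module_pair.intro A M)
  have YY: "pdg_module_pair A Y Y" by (intro pdg_module_pair.intro A M)
  have \<sigma>: "\<sigma> \<in> gr_hom 0 Y ?E"
    unfolding \<sigma>_def by (rule S.W_pair_gr[OF YZ.zero_gr_hom gr_hom_comp0[OF pdg_module_pair.neg_gr_hom[OF YY gr_hom_ident] C.P_sec] _ M(1)]) simp
  have s\<sigma>: "s' (\<sigma> y) = y" if "y \<in> carrier Y" for y
  proof -
    have "s \<zero>\<^bsub>Z\<^esub> = \<zero>\<^bsub>Y\<^esub>" by (rule addmap_zero[OF Z.abelian_group_axioms Ym.abelian_group_axioms pdg_hom_addmap[OF sm]])
    then show ?thesis using that
      by (simp add: s'_def \<sigma>_def n0_def C.entries_P_sec a_minus_def)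
  qed
  obtain G where G: "contraction (ground :: ('k, 'k) pdg_alg) (underlying A ?E) (underlying A Y) s' G"
    using contraction_exists[OF pdg_algebra_ground[OF A] pdg_module_underlying[OF A EM] pdg_module_underlying[OF A M(1)] kE
      gr_hom_underlying[OF \<sigma>]] s\<sigma> by auto
  have lift: "\<exists>\<kappa>\<in>pdg_hom Q ?E. \<forall>x\<in>carrier Q. s' (\<kappa> x) = \<zero>\<^bsub>Y\<^esub> \<and> entries (\<kappa> x) ! 0 = y x"
    if y: "y \<in> pdg_hom Q Z" and Q: "pdg_module A Q" and null: "null_homotopic A Q Y (\<lambda>x. s (y x))"
    for Q :: "('r, ('a, 'x) univ) pdg_mod" and y
  proof -
    interpret QY: pdg_module_pair A Q Y by (intro pdg_module_pair.intro A Q M)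
    obtain h where h: "h \<in> gr_hom (2 - 2 * int (pchar A)) Q Y" "\<And>x. x \<in> carrier Q \<Longrightarrow> s (y x) = (dl Q Y ^^ (pchar A - 1)) h x"
      using null unfolding QY.null_homotopic_iff by blast
    obtain g where g: "g \<in> pdg_hom Q ?P" "\<And>x. x \<in> carrier Q \<Longrightarrow> entries (g x) ! 0 = (dl Q Y ^^ q) h x"
      using C.P_lift[OF Q h(1)] by blast
    have "(\<lambda>x. Tuple [y x, g x]) \<in> pdg_hom Q ?E" by (rule S.W_pair[OF y g(1) _ Q]) simp
    moreover have "s' (Tuple [y x, g x]) = \<zero>\<^bsub>Y\<^esub>" if x: "x \<in> carrier Q" for x
    proof -
      have "entries (g x) ! 0 = s (y x)" using g(2)[OF x] h(2)[OF x] by (simp add: q)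
      moreover have "s (y x) \<in> carrier Y" using pdg_hom_closed[OF sm pdg_hom_closed[OF y x]] .
      ultimately show ?thesis by (simp add: s'_def n0_def)
    qed
    ultimately show ?thesis by (intro bexI[of _ "\<lambda>x. Tuple [y x, g x]"]) auto
  qed
  show ?thesis
    by (intro exI[of _ ?E] exI[of _ s'] exI[of _ \<sigma>] exI[of _ G] exI[of _ "\<lambda>z. entries z ! 0"] conjI allI ballI impI
        EM s' \<sigma> s\<sigma> G S.W_fst s'h lift)
qed

text \<open>The kernel of the projection to \<open>X\<close> is the kernel of \<open>s'\<close>,
  which is contractible. To define the contraction on the whole pullback, a pair
  \<open>(x, e)\<close> is first moved into that kernel by \<open>r0\<close>, which subtracts from
  \<open>e\<close> the section over \<open>f x\<close>.\<close>

lemma pullback_saf: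
  fixes A :: "('k::field, 'r::{ring, monoid_mult}) pdg_alg"
    and X Y E :: "('r, ('a, 'x) univ) pdg_mod"
  assumes A: "pdg_algebra A" and M: "pdg_module A X" "pdg_module A Y" and EM: "pdg_module A E"
    and f: "f \<in> pdg_hom X Y" and s': "s' \<in> pdg_hom E Y"
    and \<sigma>: "\<sigma> \<in> gr_hom 0 Y E" and s\<sigma>: "\<And>y. y \<in> carrier Y \<Longrightarrow> s' (\<sigma> y) = y"
    and G: "contraction (ground :: ('k, 'k) pdg_alg) (underlying A E) (underlying A Y) s' G"
  shows "saf A (pullb X E f s') X (\<lambda>z. entries z ! 0)"
proof -
  interpret pdg_algebra A by fact
  interpret X: pdg_module A X by fact
  interpret Ym: pdg_module A Y by fact
  interpret Em: pdg_module A E by fact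
  interpret EY: pdg_module_pair A E Y by (intro pdg_module_pair.intro A M EM)
  interpret W: pdg_pullback A X E Y f s'
    by (intro pdg_pullback.intro pdg_pullback_axioms.intro A M EM f s')
  let ?W = "pullb X E f s'"
  have WM: "pdg_module A ?W" by (rule W.pdg_module_W)
  interpret Wm: pdg_module A ?W by (rule WM)
  show ?thesis
    unfolding saf_def
  proof (intro conjI)
    show "(\<lambda>z. entries z ! 0) \<in> pdg_hom ?W X" by (rule W.W_fst)
    have "(\<lambda>x. Tuple [x, \<sigma> (f x)]) \<in> gr_hom 0 X ?W"
      using W.W_pair_gr[OF gr_hom_ident gr_hom_comp0[OF pdg_hom_gr[OF f] \<sigma>] _ M(1)] s\<sigma> pdg_hom_closed[OF f] by auto
    then show "\<exists>\<sigma>\<in>gr_hom 0 X ?W. \<forall>x\<in>carrier X. entries (\<sigma> x) ! 0 = x" by (rule rev_bexI) simp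
    define r0 where "r0 z = entries z ! 1 \<ominus>\<^bsub>E\<^esub> \<sigma> (f (entries z ! 0))" for z
    interpret WE: pdg_module_pair A ?W E by (intro pdg_module_pair.intro A WM EM)
    have r0: "r0 \<in> gr_hom 0 ?W E"
      unfolding r0_def
      by (rule WE.sub_gr_hom[OF pdg_hom_gr[OF W.W_snd] gr_hom_comp0[OF gr_hom_comp0[OF pdg_hom_gr[OF W.W_fst] pdg_hom_gr[OF f]] \<sigma>]])
    have fX0: "f \<zero>\<^bsub>X\<^esub> = \<zero>\<^bsub>Y\<^esub>" by (rule addmap_zero[OF X.abelian_group_axioms Ym.abelian_group_axioms pdg_hom_addmap[OF f]])
    have \<sigma>0: "\<sigma> \<zero>\<^bsub>Y\<^esub> = \<zero>\<^bsub>E\<^esub>" by (rule addmap_zero[OF Ym.abelian_group_axioms Em.abelian_group_axioms gr_hom_addmap[OF \<sigma>]])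
    have sr0: "s' (r0 z) = \<zero>\<^bsub>Y\<^esub>" if z: "z \<in> carrier ?W" for z
    proof -
      have c: "entries z ! 0 \<in> carrier X" "entries z ! 1 \<in> carrier E" "f (entries z ! 0) \<in> carrier Y"
        "\<sigma> (f (entries z ! 0)) \<in> carrier E"
        using pdg_hom_closed[OF W.W_fst z] pdg_hom_closed[OF W.W_snd z] pdg_hom_closed[OF f] gr_hom_closed[OF \<sigma>] by auto
      show ?thesis
        unfolding r0_def
        using addmap_sub[OF Em.abelian_group_axioms Ym.abelian_group_axioms pdg_hom_addmap[OF s'] c(2) c(4)]
          s\<sigma>[OF c(3)] W.W_commutes[OF z] c(3) by simp
    qed
    have G1: "G \<in> gr_hom (2 - 2 * int (pchar A)) (underlying A E) (underlying A E)"
      "\<And>e. e \<in> carrier E \<Longrightarrow> s' (G e) = \<zero>\<^bsub>Y\<^esub>"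
      "\<And>e. e \<in> carrier E \<Longrightarrow> s' e = \<zero>\<^bsub>Y\<^esub> \<Longrightarrow> (dl E E ^^ (pchar A - 1)) G e = e"
      using G unfolding contraction_def pchar_ground[of A] by auto
    let ?G = "\<lambda>z. Tuple [\<zero>\<^bsub>X\<^esub>, G (r0 z)]"
    have GE: "(\<lambda>z. G (r0 z)) \<in> gr_hom (2 - 2 * int (pchar A)) (underlying A ?W) (underlying A E)"
      by (rule gr_hom_0comp[OF gr_hom_underlying[OF r0] G1(1)])
    have GEc: "G (r0 z) \<in> carrier E" if "z \<in> carrier ?W" for z using gr_hom_closed[OF GE] that by simp
    have Gadd: "G (r0 (x \<oplus>\<^bsub>?W\<^esub> y)) = G (r0 x) \<oplus>\<^bsub>E\<^esub> G (r0 y)" if "x \<in> carrier ?W" "y \<in> carrier ?W" for x y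
      using gr_hom_add[OF GE, of x y] that by simp
    have Gsm: "G (r0 (scal A c 1 \<odot>\<^bsub>?W\<^esub> x)) = scal A c 1 \<odot>\<^bsub>E\<^esub> G (r0 x)" if "x \<in> carrier ?W" for x c
      using gr_hom_smult[OF GE, of x c] that by simp
    have Ggr: "G (r0 x) \<in> grade E (n + (2 - 2 * int (pchar A)))" if "x \<in> grade ?W n" for x n
      using gr_hom_grade[OF GE, of x n] that by simp
    have GW: "?G z \<in> carrier ?W" if z: "z \<in> carrier ?W" for z
      using GEc[OF z] G1(2)[of "r0 z"] gr_hom_closed[OF r0 z] fX0 by (auto simp: W.W_carrier_iff)
    have "?G \<in> gr_hom (2 - 2 * int (pchar A)) (underlying A ?W) (underlying A ?W)"
    proof (rule gr_homI)
      fix x n assume x: "x \<in> grade (underlying A ?W) n"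
      then have xc: "x \<in> carrier ?W" using pdg_module.grade_carrier[OF WM] by simp
      show "?G x \<in> grade (underlying A ?W) (n + (2 - 2 * int (pchar A)))"
        using x Ggr GW[OF xc] by (simp add: W.W_grade W.W_carrier_iff)
    qed (use GW Gadd Gsm in \<open>auto\<close>)
    \<comment> \<open>\<open>r0\<close> need not commute with the differentials, so powers of
      \<open>dl\<close> are computed only on pairs with first entry zero. These are stable under the
      differential, and on them \<open>r0\<close> is the second projection.\<close>
    moreover have dG: "(dl ?W ?W ^^ n) ?G (Tuple [\<zero>\<^bsub>X\<^esub>, e]) = Tuple [\<zero>\<^bsub>X\<^esub>, (dl E E ^^ n) G e]"
      if "e \<in> carrier E" "s' e = \<zero>\<^bsub>Y\<^esub>" for n e
      using that
    proof (induction n arbitrary: e)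
      case 0
      have "Tuple [\<zero>\<^bsub>X\<^esub>, e] \<in> carrier ?W" using 0 fX0 by (auto simp: W.W_carrier_iff)
      then show ?case using 0 by (simp add: r0_def fX0 \<sigma>0 )
    next
      case (Suc n)
      have Gf: "G \<in> carrier E \<rightarrow> carrier E" using gr_hom_closed[OF G1(1)] by auto
      interpret EE: pdg_module_pair A E E by (intro pdg_module_pair.intro A EM)
      let ?H = "(dl E E ^^ n) G"
      have de: "dif E e \<in> carrier E" "s' (dif E e) = \<zero>\<^bsub>Y\<^esub>"
        using Suc.prems by (simp_all add: Em.dif_closed pdg_hom_dif[OF s'] )
      have Hc: "?H e \<in> carrier E" "?H (dif E e) \<in> carrier E"
        using EE.dl_pow_closed'[OF Gf] Suc.prems de by auto
      have sH: "s' (?H e) = \<zero>\<^bsub>Y\<^esub>" if e: "e \<in> carrier E" for e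
      proof -
        have "s' (?H e) = (dl E Y ^^ n) (\<lambda>z. s' (G z)) e"
          using dl_pow_postcomp[OF EE.pdg_module_pair_axioms M(2) s' Gf e] by simp
        also have "\<dots> = (dl E Y ^^ n) (\<lambda>z. \<zero>\<^bsub>Y\<^esub>) e" using e G1(2) by (intro EY.dl_pow_cong) auto
        also have "\<dots> = \<zero>\<^bsub>Y\<^esub>" by (induction n arbitrary: e) (auto simp: dl_def)
        finally show ?thesis .
      qed
      have Wc: "Tuple [\<zero>\<^bsub>X\<^esub>, ?H (dif E e)] \<in> carrier ?W" "Tuple [\<zero>\<^bsub>X\<^esub>, dif E (?H e)] \<in> carrier ?W"
        using Hc sH[OF de(1)] sH[OF Suc.prems(1)] fX0
        by (auto simp: W.W_carrier_iff Em.dif_closed pdg_hom_dif[OF s'])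
      have "Tuple [\<zero>\<^bsub>X\<^esub>, ?H (dif E e)] \<ominus>\<^bsub>?W\<^esub> Tuple [\<zero>\<^bsub>X\<^esub>, dif E (?H e)] = Tuple [\<zero>\<^bsub>X\<^esub>, ?H (dif E e) \<ominus>\<^bsub>E\<^esub> dif E (?H e)]"
        using W.W.\<pi>_sub[OF _ Wc, of False] W.W.\<pi>_sub[OF _ Wc, of True] Wm.minus_closed[OF Wc] by (auto simp: W.W_carrier_iff)
      then show ?case
        using Suc.IH[OF Suc.prems] Suc.IH[OF de] by (simp add: dl_pow_Suc del: funpow.simps)
    qed
    moreover have "(dl ?W ?W ^^ (pchar A - 1)) ?G z = z" if z: "z \<in> carrier ?W" "entries z ! 0 = \<zero>\<^bsub>X\<^esub>" for z
    proof -
      obtain e where e: "z = Tuple [\<zero>\<^bsub>X\<^esub>, e]" "e \<in> carrier E" "s' e = \<zero>\<^bsub>Y\<^esub>"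
        using z fX0 by (auto simp: W.W_carrier_iff)
      show ?thesis using dG[OF e(2,3), of "pchar A - 1"] G1(3)[OF e(2,3)] e(1) by simp
    qed
    ultimately show "\<exists>G. contraction (ground :: ('k, 'k) pdg_alg) (underlying A ?W) (underlying A X) (\<lambda>z. entries z ! 0) G"
      unfolding contraction_def pchar_ground[of A] by (intro exI[of _ ?G]) auto
  qed
qed

text \<open>The pullback square of the fibration \<open>s'\<close> commutes strictly; it commutes up
  to homotopy once \<open>s'\<close> is exchanged for \<open>s\<close> after
  \<open>pr\<close>.\<close>

lemma ore_fibration:
  fixes A :: "('k::field, 'r::{ring, monoid_mult}) pdg_alg"
    and X Y Z :: "('r, ('a, 'x) univ) pdg_mod"
  assumes A: "pdg_algebra A" and M: "pdg_module A X" "pdg_module A Y" "pdg_module A Z"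
    and f: "f \<in> pdg_hom X Y" and s: "kheq A Z Y s"
  shows "\<exists>(W :: ('r, ('a, 'x) univ) pdg_mod) w g. pdg_module A W \<and> saf A W X w \<and> g \<in> pdg_hom W Z \<and>
     homotopic A W Y (\<lambda>z. s (g z)) (\<lambda>z. f (w z))"
proof -
  have sm: "s \<in> pdg_hom Z Y" using s by (simp add: kheq_def)
  obtain E :: "('r, ('a, 'x) univ) pdg_mod" and s' \<sigma> G pr where E: "pdg_module A E" "s' \<in> pdg_hom E Y"
     "\<sigma> \<in> gr_hom 0 Y E" "\<And>y. y \<in> carrier Y \<Longrightarrow> s' (\<sigma> y) = y"
     "contraction (ground :: ('k, 'k) pdg_alg) (underlying A E) (underlying A Y) s' G"
     "pr \<in> pdg_hom E Z" "homotopic A E Y (\<lambda>z. s (pr z)) s'"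
    using fibrant_replacement[OF A M(2,3) s] by blast
  interpret W: pdg_pullback A X E Y f s'
    by (intro pdg_pullback.intro pdg_pullback_axioms.intro A M E f)
  let ?W = "pullb X E f s'"
  have WM: "pdg_module A ?W" by (rule W.pdg_module_W)
  interpret WY: pdg_module_pair A ?W Y by (intro pdg_module_pair.intro A WM M)
  have "homotopic A ?W Y (\<lambda>z. s (pr (entries z ! 1))) (\<lambda>z. s' (entries z ! 1))"
    by (rule homotopic_precomp[OF A E(1) M(2) WM W.W_snd E(7)])
  moreover have "homotopic A ?W Y (\<lambda>z. s' (entries z ! 1)) (\<lambda>z. f (entries z ! 0))"
    by (rule WY.homotopicI_eq[OF pdg_hom_comp[OF W.W_snd E(2)]]) (simp add: W.W_commutes)
  ultimately have "homotopic A ?W Y (\<lambda>z. s (pr (entries z ! 1))) (\<lambda>z. f (entries z ! 0))"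
    by (rule WY.homotopic_trans[OF pdg_hom_comp[OF pdg_hom_comp[OF W.W_snd E(6)] sm] pdg_hom_comp[OF W.W_snd E(2)] pdg_hom_comp[OF W.W_fst f]])
  then show ?thesis
    by (intro exI[of _ ?W] exI[of _ "\<lambda>z. entries z ! 0"] exI[of _ "\<lambda>z. pr (entries z ! 1)"] conjI WM
        pullback_saf[OF A M(1,2) E(1) f E(2-5)] pdg_hom_comp[OF W.W_snd E(6)])
qed

section \<open>Arbitrary direct sums and their compatibility with quasi-isomorphisms\<close>

section \<open>Direct sums\<close>

text \<open>A finitely supported family is encoded as the tuple of its nonzero entries, in an arbitrary order.\<close>

definition finfam :: "'j set \<Rightarrow> ('j \<Rightarrow> ('r, 'm) pdg_mod) \<Rightarrow> ('j \<Rightarrow> 'm) \<Rightarrow> bool" where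
  "finfam J N F \<longleftrightarrow> (\<forall>j\<in>J. F j \<in> carrier (N j)) \<and> finite {j \<in> J. F j \<noteq> \<zero>\<^bsub>N j\<^esub>}"

definition denc :: "('a, 'x) univ set \<Rightarrow> (('a, 'x) univ \<Rightarrow> ('r, ('a, 'x) univ) pdg_mod) \<Rightarrow>
    (('a, 'x) univ \<Rightarrow> ('a, 'x) univ) \<Rightarrow> ('a, 'x) univ" where
  "denc J N F = Tuple (SOME l. set l = (\<lambda>j. Tuple [j, F j]) ` {j \<in> J. F j \<noteq> \<zero>\<^bsub>N j\<^esub>})"

definition ddec :: "(('a, 'x) univ \<Rightarrow> ('r, ('a, 'x) univ) pdg_mod) \<Rightarrow> ('a, 'x) univ \<Rightarrow> ('a, 'x) univ \<Rightarrow> ('a, 'x) univ" where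
  "ddec N c j = (if \<exists>y. Tuple [j, y] \<in> set (entries c) then (THE y. Tuple [j, y] \<in> set (entries c)) else \<zero>\<^bsub>N j\<^esub>)"

lemma ddec_denc:
  assumes "finfam J N F" "j \<in> J"
  shows "ddec N (denc J N F) j = F j"
proof -
  have "\<exists>l. set l = (\<lambda>j. Tuple [j, F j]) ` {j \<in> J. F j \<noteq> \<zero>\<^bsub>N j\<^esub>}"
    using assms(1) by (intro finite_list) (auto simp: finfam_def)
  then have "set (entries (denc J N F)) = (\<lambda>j. Tuple [j, F j]) ` {j \<in> J. F j \<noteq> \<zero>\<^bsub>N j\<^esub>}"
    unfolding denc_def univ.sel by (rule someI_ex)
  then have "Tuple [j, y] \<in> set (entries (denc J N F)) \<longleftrightarrow> F j \<noteq> \<zero>\<^bsub>N j\<^esub> \<and> y = F j" for y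
    using assms(2) by auto
  then show ?thesis by (auto simp: ddec_def)
qed

text \<open>The choice in \<open>denc\<close> sees only the set of indexed nonzero entries, so
  families that agree on \<open>J\<close> receive the same code.\<close>

lemma denc_cong:
  assumes "\<And>j. j \<in> J \<Longrightarrow> F j = F' j"
  shows "denc J N F = denc J N F'"
proof -
  have "(\<lambda>j. Tuple [j, F j]) ` {j \<in> J. F j \<noteq> \<zero>\<^bsub>N j\<^esub>} = (\<lambda>j. Tuple [j, F' j]) ` {j \<in> J. F' j \<noteq> \<zero>\<^bsub>N j\<^esub>}"
    using assms by (intro image_cong) auto
  then show ?thesis by (simp add: denc_def)
qed

definition dsum :: "('a, 'x) univ set \<Rightarrow> (('a, 'x) univ \<Rightarrow> ('r, ('a, 'x) univ) pdg_mod) \<Rightarrow> ('r, ('a, 'x) univ) pdg_mod" where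
  "dsum J N =
     \<lparr>carrier = {denc J N F | F. finfam J N F},
      monoid.mult = (\<lambda>_ _. undefined), monoid.one = undefined,
      ring.zero = denc J N (\<lambda>j. \<zero>\<^bsub>N j\<^esub>),
      ring.add = (\<lambda>a b. denc J N (\<lambda>j. ddec N a j \<oplus>\<^bsub>N j\<^esub> ddec N b j)),
      smult = (\<lambda>r a. denc J N (\<lambda>j. r \<odot>\<^bsub>N j\<^esub> ddec N a j)),
      grade = (\<lambda>n. {denc J N F | F. finfam J N F \<and> (\<forall>j\<in>J. F j \<in> grade (N j) n)}),
      dif = (\<lambda>a. denc J N (\<lambda>j. dif (N j) (ddec N a j)))\<rparr>"

lemma dsum_simps:
  "carrier (dsum J N) = {denc J N F | F. finfam J N F}"
  "\<zero>\<^bsub>dsum J N\<^esub> = denc J N (\<lambda>j. \<zero>\<^bsub>N j\<^esub>)"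
  "a \<oplus>\<^bsub>dsum J N\<^esub> b = denc J N (\<lambda>j. ddec N a j \<oplus>\<^bsub>N j\<^esub> ddec N b j)"
  "r \<odot>\<^bsub>dsum J N\<^esub> a = denc J N (\<lambda>j. r \<odot>\<^bsub>N j\<^esub> ddec N a j)"
  "grade (dsum J N) n = {denc J N F | F. finfam J N F \<and> (\<forall>j\<in>J. F j \<in> grade (N j) n)}"
  "dif (dsum J N) a = denc J N (\<lambda>j. dif (N j) (ddec N a j))"
  by (simp_all add: dsum_def)

lemma ddec_finfam:
  assumes "a \<in> carrier (dsum J N)"
  shows "finfam J N (ddec N a)"
proof -
  obtain F where F: "finfam J N F" "a = denc J N F" using assms by (auto simp: dsum_simps)
  then have "\<And>j. j \<in> J \<Longrightarrow> ddec N a j = F j" using ddec_denc by blast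
  then show ?thesis using F(1) unfolding finfam_def by (auto cong: conj_cong)
qed

lemma finfam_map:
  assumes "finfam J N F" "\<And>j. j \<in> J \<Longrightarrow> h j (F j) \<in> carrier (M j)" "\<And>j. j \<in> J \<Longrightarrow> h j \<zero>\<^bsub>N j\<^esub> = \<zero>\<^bsub>M j\<^esub>"
  shows "finfam J M (\<lambda>j. h j (F j))"
proof -
  have "{j \<in> J. h j (F j) \<noteq> \<zero>\<^bsub>M j\<^esub>} \<subseteq> {j \<in> J. F j \<noteq> \<zero>\<^bsub>N j\<^esub>}" using assms(3) by auto
  then show ?thesis using assms(1,2) finite_subset unfolding finfam_def by blast
qed

locale pdg_dsum = pdg_algebra A
  for A :: "('k::field, 'r::{ring, monoid_mult}) pdg_alg" +
  fixes J :: "('a, 'x) univ set" and N :: "('a, 'x) univ \<Rightarrow> ('r, ('a, 'x) univ) pdg_mod"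
  assumes mods: "\<And>j. j \<in> J \<Longrightarrow> pdg_module A (N j)"
begin

lemma am: "j \<in> J \<Longrightarrow> abelian_monoid (N j)"
  using mods by (auto simp: pdg_module_def abelian_group_def)

lemma zero_finfam: "finfam J N (\<lambda>j. \<zero>\<^bsub>N j\<^esub>)"
  using abelian_monoid.zero_closed[OF am] by (auto simp: finfam_def)

lemma dif_finfam: "a \<in> carrier (dsum J N) \<Longrightarrow> finfam J N (\<lambda>j. dif (N j) (ddec N a j))"
  using ddec_finfam[of a J N] pdg_module.dif_closed[OF mods] pdg_module.dif_zero[OF mods]
  by (intro finfam_map[where h = "\<lambda>j. dif (N j)" and N = N and F = "ddec N a"]) (auto simp: finfam_def)

lemma smult_finfam: "a \<in> carrier (dsum J N) \<Longrightarrow> finfam J N (\<lambda>j. r \<odot>\<^bsub>N j\<^esub> ddec N a j)"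
  using ddec_finfam[of a J N] pdg_module.smult_closed[OF mods] pdg_module.smult_zero[OF mods]
  by (intro finfam_map[where h = "\<lambda>j. (\<odot>\<^bsub>N j\<^esub>) r" and N = N and F = "ddec N a"]) (auto simp: finfam_def)

lemma add_finfam:
  assumes "a \<in> carrier (dsum J N)" "b \<in> carrier (dsum J N)"
  shows "finfam J N (\<lambda>j. ddec N a j \<oplus>\<^bsub>N j\<^esub> ddec N b j)"
proof -
  note f = ddec_finfam[OF assms(1)] ddec_finfam[OF assms(2)]
  have "{j \<in> J. ddec N a j \<oplus>\<^bsub>N j\<^esub> ddec N b j \<noteq> \<zero>\<^bsub>N j\<^esub>} \<subseteq> {j \<in> J. ddec N a j \<noteq> \<zero>\<^bsub>N j\<^esub>} \<union> {j \<in> J. ddec N b j \<noteq> \<zero>\<^bsub>N j\<^esub>}"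
    using am abelian_monoid.l_zero abelian_monoid.zero_closed by fastforce
  then show ?thesis
    using f abelian_monoid.a_closed[OF am] finite_subset unfolding finfam_def by blast
qed

sublocale D: coord_module A "dsum J N" J N "\<lambda>j c. ddec N c j" "\<lambda>_. 0"
proof (rule coord_module.intro)
  fix x y assume x: "x \<in> carrier (dsum J N)" "y \<in> carrier (dsum J N)" and eq: "\<And>j. j \<in> J \<Longrightarrow> ddec N x j = ddec N y j"
  obtain F G where F: "finfam J N F" "x = denc J N F" "finfam J N G" "y = denc J N G"
    using x by (auto simp: dsum_simps)
  show "x = y" unfolding F(2,4)
  proof (rule denc_cong)
    fix j assume "j \<in> J"
    then show "F j = G j" using eq[of j] ddec_denc[OF F(1)] ddec_denc[OF F(3)] F(2,4) by simp
  qed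
next
  fix x n assume x: "x \<in> carrier (dsum J N)"
  note f = ddec_finfam[OF x]
  have "finfam J N (\<lambda>j. cpt (N j) n (ddec N x j))"
    using f pdg_module.cpt_closed[OF mods] addmap_zero[OF _ _ pdg_module.cpt_addmap[OF mods]] mods
    by (intro finfam_map[OF f, where h = "\<lambda>j. cpt (N j) n"]) (auto simp: finfam_def pdg_module_def)
  then show "\<exists>y\<in>carrier (dsum J N). \<forall>j\<in>J. ddec N y j = cpt (N j) (n + 0) (ddec N x j)"
    by (intro bexI[of _ "denc J N (\<lambda>j. cpt (N j) n (ddec N x j))"]) (auto simp: ddec_denc dsum_simps)
next
  fix x assume x: "x \<in> carrier (dsum J N)"
  note f = ddec_finfam[OF x]
  let ?S = "{j \<in> J. ddec N x j \<noteq> \<zero>\<^bsub>N j\<^esub>}"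
  have z: "cpt (N j) n \<zero>\<^bsub>N j\<^esub> = \<zero>\<^bsub>N j\<^esub>" if "j \<in> J" for j n
    using addmap_zero[OF _ _ pdg_module.cpt_addmap[OF mods[OF that]]] mods[OF that] by (auto simp: pdg_module_def)
  have "finite (\<Union>j\<in>?S. {n. cpt (N j) (n + 0) (ddec N x j) \<noteq> \<zero>\<^bsub>N j\<^esub>})"
    using f pdg_module.cpt_finite[OF mods] by (auto simp: finfam_def)
  moreover have "{n. \<exists>j\<in>J. cpt (N j) (n + 0) (ddec N x j) \<noteq> \<zero>\<^bsub>N j\<^esub>} \<subseteq> (\<Union>j\<in>?S. {n. cpt (N j) (n + 0) (ddec N x j) \<noteq> \<zero>\<^bsub>N j\<^esub>})"
    using z by auto
  ultimately show "finite {n. \<exists>j\<in>J. cpt (N j) (n + 0) (ddec N x j) \<noteq> \<zero>\<^bsub>N j\<^esub>}" by (rule rev_finite_subset)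
next
  fix n
  show "grade (dsum J N) n = {x \<in> carrier (dsum J N). \<forall>j\<in>J. ddec N x j \<in> grade (N j) (n + 0)}"
    by (auto simp: dsum_simps ddec_denc)
next
  fix j x assume "j \<in> J" "x \<in> carrier (dsum J N)"
  then show "ddec N x j \<in> carrier (N j)" using ddec_finfam[of x J N] by (auto simp: finfam_def)
next
  show "\<zero>\<^bsub>dsum J N\<^esub> \<in> carrier (dsum J N)" using zero_finfam by (auto simp: dsum_simps)
  show "ddec N \<zero>\<^bsub>dsum J N\<^esub> j = \<zero>\<^bsub>N j\<^esub>" if "j \<in> J" for j using ddec_denc[OF zero_finfam that] by (simp add: dsum_simps)
  fix x assume x: "x \<in> carrier (dsum J N)"
  show "r \<odot>\<^bsub>dsum J N\<^esub> x \<in> carrier (dsum J N)" for r using smult_finfam[OF x] by (auto simp: dsum_simps)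
  show "ddec N (r \<odot>\<^bsub>dsum J N\<^esub> x) j = r \<odot>\<^bsub>N j\<^esub> ddec N x j" if "j \<in> J" for j r
    using ddec_denc[OF smult_finfam[OF x] that] by (simp add: dsum_simps)
  fix y assume y: "y \<in> carrier (dsum J N)"
  show "x \<oplus>\<^bsub>dsum J N\<^esub> y \<in> carrier (dsum J N)" using add_finfam[OF x y] by (auto simp: dsum_simps(1,3))
  show "ddec N (x \<oplus>\<^bsub>dsum J N\<^esub> y) j = ddec N x j \<oplus>\<^bsub>N j\<^esub> ddec N y j" if "j \<in> J" for j
    using ddec_denc[OF add_finfam[OF x y] that] by (simp add: dsum_simps)
qed (rule mods)

lemma ddec_dif: "j \<in> J \<Longrightarrow> a \<in> carrier (dsum J N) \<Longrightarrow> ddec N (dif (dsum J N) a) j = dif (N j) (ddec N a j)"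
  using ddec_denc[OF dif_finfam] by (simp add: dsum_simps)

lemma pdg_module_dsum: "pdg_module A (dsum J N)"
  by (rule D.pdg_moduleI_strict[OF pdg_algebra_axioms])
    (use dif_finfam ddec_dif in \<open>auto simp: dsum_simps(1,6)\<close>)

definition dinc where "dinc j x = denc J N (\<lambda>k. if k = j then x else \<zero>\<^bsub>N k\<^esub>)"

lemma dinc_finfam:
  assumes "j \<in> J" "x \<in> carrier (N j)"
  shows "finfam J N (\<lambda>k. if k = j then x else \<zero>\<^bsub>N k\<^esub>)"
proof -
  have "{k \<in> J. (if k = j then x else \<zero>\<^bsub>N k\<^esub>) \<noteq> \<zero>\<^bsub>N k\<^esub>} \<subseteq> {j}" by auto
  then show ?thesis
    using assms abelian_monoid.zero_closed[OF am] finite_subset by (fastforce simp: finfam_def)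
qed

lemma ddec_dinc: "j \<in> J \<Longrightarrow> x \<in> carrier (N j) \<Longrightarrow> k \<in> J \<Longrightarrow> ddec N (dinc j x) k = (if k = j then x else \<zero>\<^bsub>N k\<^esub>)"
  unfolding dinc_def by (simp only: ddec_denc[OF dinc_finfam])

lemma dinc_closed: "j \<in> J \<Longrightarrow> x \<in> carrier (N j) \<Longrightarrow> dinc j x \<in> carrier (dsum J N)"
  unfolding dinc_def dsum_simps using dinc_finfam by blast

lemma dinc_pdg_hom:
  assumes j: "j \<in> J"
  shows "dinc j \<in> pdg_hom (N j) (dsum J N)"
proof -
  interpret Nj: pdg_module A "N j" using mods[OF j] .
  have z: "\<zero>\<^bsub>N k\<^esub> \<oplus>\<^bsub>N k\<^esub> \<zero>\<^bsub>N k\<^esub> = \<zero>\<^bsub>N k\<^esub>" if "k \<in> J" for k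
    using am[OF that] by (simp add: abelian_monoid.l_zero abelian_monoid.zero_closed)
  show ?thesis
  proof (intro pdg_homI gr_homI)
    fix x y assume xy: "x \<in> carrier (N j)" "y \<in> carrier (N j)"
    show "dinc j (x \<oplus>\<^bsub>N j\<^esub> y) = dinc j x \<oplus>\<^bsub>dsum J N\<^esub> dinc j y"
      using xy j z by - (rule D.inj; auto simp: ddec_dinc dinc_closed D.add)
  next
    fix r x assume x: "x \<in> carrier (N j)"
    show "dinc j (r \<odot>\<^bsub>N j\<^esub> x) = r \<odot>\<^bsub>dsum J N\<^esub> dinc j x"
      using x j pdg_module.smult_zero[OF mods] by - (rule D.inj; auto simp: ddec_dinc dinc_closed D.smult Nj.smult_closed)
  next
    fix n x assume x: "x \<in> grade (N j) n"
    then show "dinc j x \<in> grade (dsum J N) (n + 0)"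
      using j Nj.grade_carrier[OF x] pdg_module.grade_zero[OF mods] by (auto simp: D.grade ddec_dinc dinc_closed)
  next
    fix x assume x: "x \<in> carrier (N j)"
    show "dinc j (dif (N j) x) = dif (dsum J N) (dinc j x)"
      using x j pdg_module.dif_zero[OF mods] pdg_module.dif_closed[OF pdg_module_dsum]
      by - (rule D.inj; auto simp: ddec_dinc dinc_closed ddec_dif Nj.dif_closed)
  qed (use j dinc_closed in auto)
qed

lemma ddec_pdg_hom: "j \<in> J \<Longrightarrow> (\<lambda>c. ddec N c j) \<in> pdg_hom (dsum J N) (N j)"
  by (intro pdg_homI gr_homI) (auto simp: D.\<pi>_closed D.add D.smult D.grade ddec_dif)

lemma dsum_decomp:
  assumes c: "c \<in> carrier (dsum J N)" and S: "finite S" "S \<subseteq> J" "\<And>j. j \<in> J - S \<Longrightarrow> ddec N c j = \<zero>\<^bsub>N j\<^esub>"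
  shows "c = (\<Oplus>\<^bsub>dsum J N\<^esub>j\<in>S. dinc j (ddec N c j))"
proof -
  interpret P: pdg_module A "dsum J N" by (rule pdg_module_dsum)
  have cl: "dinc j (ddec N c j) \<in> carrier (dsum J N)" if "j \<in> S" for j
    using that S(2) c by (auto intro!: dinc_closed D.\<pi>_closed)
  show ?thesis
  proof (rule D.inj[OF c P.finsum_closed])
    fix k assume k: "k \<in> J"
    interpret Nk: pdg_module A "N k" using mods[OF k] .
    have dk: "ddec N c k \<in> carrier (N k)" using D.\<pi>_closed[OF k c] .
    have "ddec N (\<Oplus>\<^bsub>dsum J N\<^esub>j\<in>S. dinc j (ddec N c j)) k = (\<Oplus>\<^bsub>N k\<^esub>j\<in>S. ddec N (dinc j (ddec N c j)) k)"
      using cl by (intro D.\<pi>_finsum[OF k]) auto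
    also have "\<dots> = (\<Oplus>\<^bsub>N k\<^esub>j\<in>S. if k = j then ddec N c j else \<zero>\<^bsub>N k\<^esub>)"
      using S(2) k c dk by (intro Nk.finsum_cong') (auto simp: ddec_dinc D.\<pi>_closed)
    also have "\<dots> = ddec N c k"
    proof (cases "k \<in> S")
      case True
      show ?thesis
      proof (subst finsum_pick[of "N k" S k])
        show "abelian_group (N k)" by unfold_locales
      qed (use True S dk in auto)
    next
      case False
      then have "(\<Oplus>\<^bsub>N k\<^esub>j\<in>S. if k = j then ddec N c j else \<zero>\<^bsub>N k\<^esub>) = (\<Oplus>\<^bsub>N k\<^esub>j\<in>S. \<zero>\<^bsub>N k\<^esub>)"
        by (intro Nk.finsum_cong') auto
      then show ?thesis using False S(3) k by simp
    qed
    finally show "ddec N c k = ddec N (\<Oplus>\<^bsub>dsum J N\<^esub>j\<in>S. dinc j (ddec N c j)) k" ..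
  qed (use cl in auto)
qed

definition dfold where "dfold Y g c = (\<Oplus>\<^bsub>Y\<^esub>j\<in>{j \<in> J. ddec N c j \<noteq> \<zero>\<^bsub>N j\<^esub>}. g j (ddec N c j))"

text \<open>Supports differ from element to element; sums over a common finite superset can be added
  and compared.\<close>

lemma dfold_superset:
  assumes "pdg_module A Y" and g: "\<And>j. j \<in> J \<Longrightarrow> g j \<in> pdg_hom (N j) Y" and c: "c \<in> carrier (dsum J N)"
    and S: "finite S" "S \<subseteq> J" "{j \<in> J. ddec N c j \<noteq> \<zero>\<^bsub>N j\<^esub>} \<subseteq> S"
  shows "dfold Y g c = (\<Oplus>\<^bsub>Y\<^esub>j\<in>S. g j (ddec N c j))"
proof -
  interpret Y: pdg_module A Y by fact
  have g0: "g j \<zero>\<^bsub>N j\<^esub> = \<zero>\<^bsub>Y\<^esub>" if "j \<in> J" for j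
    using addmap_zero[OF _ Y.abelian_group_axioms pdg_hom_addmap[OF g[OF that]]] mods[OF that] by (auto simp: pdg_module_def)
  have gc: "g j (ddec N c j) \<in> carrier Y" if "j \<in> J" for j
    using pdg_hom_closed[OF g[OF that] D.\<pi>_closed[OF that c]] .
  show ?thesis unfolding dfold_def
  proof (rule Y.add.finprod_mono_neutral_cong_left)
    fix i assume "i \<in> S - {j \<in> J. ddec N c j \<noteq> \<zero>\<^bsub>N j\<^esub>}"
    then show "g i (ddec N c i) = \<zero>\<^bsub>Y\<^esub>" using S(2) g0 by auto
  qed (use S gc in auto)
qed

lemma dfold_pdg_hom:
  assumes Y: "pdg_module A Y" and g: "\<And>j. j \<in> J \<Longrightarrow> g j \<in> pdg_hom (N j) Y"
  shows "dfold Y g \<in> pdg_hom (dsum J N) Y"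
proof -
  interpret Y: pdg_module A Y by fact
  interpret P: pdg_module A "dsum J N" by (rule pdg_module_dsum)
  let ?supp = "\<lambda>c. {j \<in> J. ddec N c j \<noteq> \<zero>\<^bsub>N j\<^esub>}"
  have fs: "finite (?supp c)" if "c \<in> carrier (dsum J N)" for c using ddec_finfam[OF that] by (auto simp: finfam_def)
  have gc: "g j (ddec N c j) \<in> carrier Y" if "j \<in> J" "c \<in> carrier (dsum J N)" for j c
    using pdg_hom_closed[OF g[OF that(1)] D.\<pi>_closed[OF that]] .
  show ?thesis
  proof (intro pdg_homI gr_homI)
    show "dfold Y g c \<in> carrier Y" if "c \<in> carrier (dsum J N)" for c
      unfolding dfold_def using gc that by auto
    fix a b assume a: "a \<in> carrier (dsum J N)" and b: "b \<in> carrier (dsum J N)"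
    let ?S = "?supp a \<union> ?supp b \<union> ?supp (a \<oplus>\<^bsub>dsum J N\<^esub> b)"
    have S: "finite ?S" "?S \<subseteq> J" using fs[OF a] fs[OF b] fs[OF P.a_closed[OF a b]] by auto
    have "dfold Y g (a \<oplus>\<^bsub>dsum J N\<^esub> b) = (\<Oplus>\<^bsub>Y\<^esub>j\<in>?S. g j (ddec N (a \<oplus>\<^bsub>dsum J N\<^esub> b) j))"
      using a b by (intro dfold_superset[OF Y g _ S]) auto
    also have "\<dots> = (\<Oplus>\<^bsub>Y\<^esub>j\<in>?S. g j (ddec N a j) \<oplus>\<^bsub>Y\<^esub> g j (ddec N b j))"
      using a b gc by (intro Y.finsum_cong') (auto simp: D.add pdg_hom_add[OF g] D.\<pi>_closed)
    also have "\<dots> = (\<Oplus>\<^bsub>Y\<^esub>j\<in>?S. g j (ddec N a j)) \<oplus>\<^bsub>Y\<^esub> (\<Oplus>\<^bsub>Y\<^esub>j\<in>?S. g j (ddec N b j))"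
      using a b gc by (intro Y.finsum_addf) auto
    also have "(\<Oplus>\<^bsub>Y\<^esub>j\<in>?S. g j (ddec N a j)) = dfold Y g a"
      using a by (intro dfold_superset[OF Y g _ S, symmetric]) auto
    also have "(\<Oplus>\<^bsub>Y\<^esub>j\<in>?S. g j (ddec N b j)) = dfold Y g b"
      using b by (intro dfold_superset[OF Y g _ S, symmetric]) auto
    finally show "dfold Y g (a \<oplus>\<^bsub>dsum J N\<^esub> b) = dfold Y g a \<oplus>\<^bsub>Y\<^esub> dfold Y g b" .
  next
    fix r a assume a: "a \<in> carrier (dsum J N)"
    have sub: "?supp (r \<odot>\<^bsub>dsum J N\<^esub> a) \<subseteq> ?supp a"
      using a pdg_module.smult_zero[OF mods] by (auto simp: D.smult)
    have "dfold Y g (r \<odot>\<^bsub>dsum J N\<^esub> a) = (\<Oplus>\<^bsub>Y\<^esub>j\<in>?supp a. g j (ddec N (r \<odot>\<^bsub>dsum J N\<^esub> a) j))"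
      by (rule dfold_superset[OF Y g P.smult_closed[OF a] fs[OF a] _ sub]) auto
    also have "\<dots> = (\<Oplus>\<^bsub>Y\<^esub>j\<in>?supp a. r \<odot>\<^bsub>Y\<^esub> g j (ddec N a j))"
      using a gc Y.smult_closed by (intro Y.finsum_cong') (auto simp: D.smult pdg_hom_smult[OF g] D.\<pi>_closed)
    also have "\<dots> = r \<odot>\<^bsub>Y\<^esub> dfold Y g a"
      unfolding dfold_def using a gc
      by (intro addmap_finsum[OF Y.abelian_group_axioms Y.abelian_group_axioms Y.addmap_smult, symmetric]) auto
    finally show "dfold Y g (r \<odot>\<^bsub>dsum J N\<^esub> a) = r \<odot>\<^bsub>Y\<^esub> dfold Y g a" .
  next
    fix n a assume a: "a \<in> grade (dsum J N) n"
    have "g j (ddec N a j) \<in> grade Y n" if "j \<in> J" for j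
      using a that pdg_hom_grade[OF g[OF that]] by (auto simp: D.grade)
    then have "(\<Oplus>\<^bsub>Y\<^esub>j\<in>T. g j (ddec N a j)) \<in> grade Y n" if "T \<subseteq> J" for T
      using that
    proof (induction T rule: infinite_finite_induct)
      case (insert j T)
      then have "(\<lambda>j. g j (ddec N a j)) \<in> T \<rightarrow> carrier Y" "g j (ddec N a j) \<in> carrier Y"
        using Y.grade_carrier by blast+
      then show ?case using insert by (simp add: Y.finsum_insert Y.grade_add)
    qed (auto)
    then show "dfold Y g a \<in> grade Y (n + 0)" unfolding dfold_def by auto
  next
    fix a assume a: "a \<in> carrier (dsum J N)"
    have sub: "?supp (dif (dsum J N) a) \<subseteq> ?supp a"
      using a pdg_module.dif_zero[OF mods] by (auto simp: ddec_dif)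
    have "dfold Y g (dif (dsum J N) a) = (\<Oplus>\<^bsub>Y\<^esub>j\<in>?supp a. g j (ddec N (dif (dsum J N) a) j))"
      by (rule dfold_superset[OF Y g P.dif_closed[OF a] fs[OF a] _ sub]) auto
    also have "\<dots> = (\<Oplus>\<^bsub>Y\<^esub>j\<in>?supp a. dif Y (g j (ddec N a j)))"
      using a gc Y.dif_closed by (intro Y.finsum_cong') (auto simp: ddec_dif pdg_hom_dif[OF g] D.\<pi>_closed)
    also have "\<dots> = dif Y (dfold Y g a)"
      unfolding dfold_def using a gc
      by (intro addmap_finsum[OF Y.abelian_group_axioms Y.abelian_group_axioms Y.addmap_dif, symmetric]) auto
    finally show "dfold Y g (dif (dsum J N) a) = dif Y (dfold Y g a)" .
  qed
qed

lemma dfold_dinc: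
  assumes Y: "pdg_module A Y" and g: "\<And>j. j \<in> J \<Longrightarrow> g j \<in> pdg_hom (N j) Y" and j: "j \<in> J" "x \<in> carrier (N j)"
  shows "dfold Y g (dinc j x) = g j x"
proof -
  interpret Y: pdg_module A Y by fact
  have "dfold Y g (dinc j x) = (\<Oplus>\<^bsub>Y\<^esub>k\<in>{j}. g k (ddec N (dinc j x) k))"
    using j by (intro dfold_superset[OF Y g dinc_closed[OF j]]) (auto simp: ddec_dinc split: if_splits)
  then show ?thesis using j pdg_hom_closed[OF g[OF j(1)] j(2)] by (simp add: Y.finsum_insert ddec_dinc)
qed

end

section \<open>Direct sums of homotopy equivalences\<close>

definition dmap where "dmap J N M h c = denc J M (\<lambda>j. h j (ddec N c j))"

locale pdg_dsum_pair = N: pdg_dsum A J N + M: pdg_dsum A J M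
  for A :: "('k::field, 'r::{ring, monoid_mult}) pdg_alg" and J :: "('a, 'x) univ set" and N M
begin

lemma dmap_finfam:
  assumes h: "\<And>j. j \<in> J \<Longrightarrow> h j \<in> gr_hom d (N j) (M j)" and c: "c \<in> carrier (dsum J N)"
  shows "finfam J M (\<lambda>j. h j (ddec N c j))"
proof (rule finfam_map[OF ddec_finfam[OF c], where h = h])
  fix j assume j: "j \<in> J"
  show "h j (ddec N c j) \<in> carrier (M j)" using gr_hom_closed[OF h[OF j] N.D.\<pi>_closed[OF j c]] .
  show "h j \<zero>\<^bsub>N j\<^esub> = \<zero>\<^bsub>M j\<^esub>"
    using addmap_zero[OF _ _ gr_hom_addmap[OF h[OF j]]] N.mods[OF j] M.mods[OF j] by (auto simp: pdg_module_def)
qed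

lemma ddec_dmap:
  assumes "\<And>j. j \<in> J \<Longrightarrow> h j \<in> gr_hom d (N j) (M j)" "c \<in> carrier (dsum J N)" "j \<in> J"
  shows "ddec M (dmap J N M h c) j = h j (ddec N c j)"
  unfolding dmap_def by (rule ddec_denc[OF dmap_finfam[OF assms(1,2)] assms(3)])

lemma dmap_closed:
  assumes "\<And>j. j \<in> J \<Longrightarrow> h j \<in> gr_hom d (N j) (M j)" "c \<in> carrier (dsum J N)"
  shows "dmap J N M h c \<in> carrier (dsum J M)"
  unfolding dmap_def dsum_simps using dmap_finfam[OF assms] by blast

lemma dmap_gr_hom:
  assumes h: "\<And>j. j \<in> J \<Longrightarrow> h j \<in> gr_hom d (N j) (M j)"
  shows "dmap J N M h \<in> gr_hom d (dsum J N) (dsum J M)"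
proof (rule gr_homI)
  note [simp] = ddec_dmap[OF h] dmap_closed[OF h] N.D.\<pi>_closed
  show "dmap J N M h (x \<oplus>\<^bsub>dsum J N\<^esub> y) = dmap J N M h x \<oplus>\<^bsub>dsum J M\<^esub> dmap J N M h y"
    if "x \<in> carrier (dsum J N)" "y \<in> carrier (dsum J N)" for x y
    using that by - (rule M.D.inj; auto simp: N.D.add M.D.add gr_hom_add[OF h])
  show "dmap J N M h (r \<odot>\<^bsub>dsum J N\<^esub> x) = r \<odot>\<^bsub>dsum J M\<^esub> dmap J N M h x" if "x \<in> carrier (dsum J N)" for r x
    using that by - (rule M.D.inj; auto simp: N.D.smult M.D.smult gr_hom_smult[OF h])
  show "dmap J N M h x \<in> grade (dsum J M) (n + d)" if "x \<in> grade (dsum J N) n" for x n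
    using that gr_hom_grade[OF h] by (auto simp: N.D.grade M.D.grade)
qed (rule dmap_closed[OF h])

lemma dmap_pdg_hom:
  assumes h: "\<And>j. j \<in> J \<Longrightarrow> h j \<in> pdg_hom (N j) (M j)"
  shows "dmap J N M h \<in> pdg_hom (dsum J N) (dsum J M)"
proof (rule pdg_homI[OF dmap_gr_hom])
  show g: "h j \<in> gr_hom 0 (N j) (M j)" if "j \<in> J" for j using pdg_hom_gr[OF h[OF that]] .
  fix x assume x: "x \<in> carrier (dsum J N)"
  have dx: "dif (dsum J N) x \<in> carrier (dsum J N)" using pdg_module.dif_closed[OF N.pdg_module_dsum x] .
  show "dmap J N M h (dif (dsum J N) x) = dif (dsum J M) (dmap J N M h x)"
  proof (rule M.D.inj)
    show "dmap J N M h (dif (dsum J N) x) \<in> carrier (dsum J M)" by (rule dmap_closed[OF g dx])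
    show "dif (dsum J M) (dmap J N M h x) \<in> carrier (dsum J M)"
      by (rule pdg_module.dif_closed[OF M.pdg_module_dsum dmap_closed[OF g x]])
    fix j assume j: "j \<in> J"
    show "ddec M (dmap J N M h (dif (dsum J N) x)) j = ddec M (dif (dsum J M) (dmap J N M h x)) j"
      using j x ddec_dmap[OF g dx j] ddec_dmap[OF g x j] dmap_closed[OF g x]
      by (simp add: N.ddec_dif M.ddec_dif pdg_hom_dif[OF h] N.D.\<pi>_closed)
  qed
qed

lemma dmap_dinc:
  assumes h: "\<And>j. j \<in> J \<Longrightarrow> h j \<in> pdg_hom (N j) (M j)" and j: "j \<in> J" "x \<in> carrier (N j)"
  shows "dmap J N M h (N.dinc j x) = M.dinc j (h j x)"
proof (rule M.D.inj)
  have g: "h j \<in> gr_hom 0 (N j) (M j)" if "j \<in> J" for j using pdg_hom_gr[OF h[OF that]] .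
  show "dmap J N M h (N.dinc j x) \<in> carrier (dsum J M)" by (rule dmap_closed[OF g N.dinc_closed[OF j]])
  show "M.dinc j (h j x) \<in> carrier (dsum J M)" by (rule M.dinc_closed[OF j(1) pdg_hom_closed[OF h[OF j(1)] j(2)]])
  fix k assume k: "k \<in> J"
  have "h k \<zero>\<^bsub>N k\<^esub> = \<zero>\<^bsub>M k\<^esub>"
    using addmap_zero[OF _ _ pdg_hom_addmap[OF h[OF k]]] N.mods[OF k] M.mods[OF k] by (auto simp: pdg_module_def)
  then show "ddec M (dmap J N M h (N.dinc j x)) k = ddec M (M.dinc j (h j x)) k"
    using ddec_dmap[OF g N.dinc_closed[OF j] k] j k pdg_hom_closed[OF h[OF j(1)] j(2)]
    by (simp add: N.ddec_dinc M.ddec_dinc)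
qed

lemma ddec_dl_dmap:
  assumes h: "\<And>j. j \<in> J \<Longrightarrow> h j \<in> gr_hom d (N j) (M j)" and "c \<in> carrier (dsum J N)" and j: "j \<in> J"
  shows "ddec M ((dl (dsum J N) (dsum J M) ^^ n) (dmap J N M h) c) j = (dl (N j) (M j) ^^ n) (h j) (ddec N c j)"
  using assms(2)
proof (induction n arbitrary: c)
  case 0
  then show ?case using ddec_dmap[OF h _ j] by simp
next
  case (Suc n)
  interpret NM: pdg_module_pair A "dsum J N" "dsum J M"
    by (intro pdg_module_pair.intro N.pdg_algebra_axioms N.pdg_module_dsum M.pdg_module_dsum)
  have f: "dmap J N M h \<in> carrier (dsum J N) \<rightarrow> carrier (dsum J M)" using dmap_closed[OF h] by blast
  have dc: "dif (dsum J N) c \<in> carrier (dsum J N)" using NM.M.dif_closed[OF Suc.prems] .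
  note cl = NM.dl_pow_closed'[OF f Suc.prems, of n] NM.dl_pow_closed'[OF f dc, of n]
  show ?case
    unfolding dl_pow_Suc
    using j Suc.IH[OF Suc.prems] Suc.IH[OF dc] cl NM.N.dif_closed[OF cl(1)] Suc.prems
    by (simp add: M.D.\<pi>_sub N.ddec_dif M.ddec_dif)
qed

end

text \<open>One homotopy is chosen for each index. Homotopies preserve zero, so together they act on
  finitely supported families, and \<open>dl\<close> is computed entrywise.\<close>

lemma homotopic_dmap:
  assumes A: "pdg_algebra A" and mods: "\<And>j. j \<in> J \<Longrightarrow> pdg_module A (N j)"
    and t: "\<And>j. j \<in> J \<Longrightarrow> t j \<in> pdg_hom (N j) (N j)" "\<And>j. j \<in> J \<Longrightarrow> homotopic A (N j) (N j) (t j) (\<lambda>x. x)"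
    and f: "f \<in> pdg_hom (dsum J N) (dsum J N)" "\<And>c j. c \<in> carrier (dsum J N) \<Longrightarrow> j \<in> J \<Longrightarrow> ddec N (f c) j = t j (ddec N c j)"
  shows "homotopic A (dsum J N) (dsum J N) f (\<lambda>x. x)"
proof -
  interpret NN: pdg_dsum_pair A J N N
    using A mods by (intro pdg_dsum_pair.intro pdg_dsum.intro pdg_dsum_axioms.intro)
  interpret P: pdg_module_pair A "dsum J N" "dsum J N"
    by (intro pdg_module_pair.intro A NN.N.pdg_module_dsum)
  have "\<exists>h\<in>gr_hom (2 - 2 * int (pchar A)) (N j) (N j). \<forall>x\<in>carrier (N j). t j x \<ominus>\<^bsub>N j\<^esub> x = (dl (N j) (N j) ^^ (pchar A - 1)) h x"
    if "j \<in> J" for j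
    using t(2)[OF that] unfolding pdg_module_pair.homotopic_iff[OF pdg_module_pair.intro[OF A mods[OF that] mods[OF that]]] .
  then obtain h where h: "\<And>j. j \<in> J \<Longrightarrow> h j \<in> gr_hom (2 - 2 * int (pchar A)) (N j) (N j)"
    "\<And>j x. j \<in> J \<Longrightarrow> x \<in> carrier (N j) \<Longrightarrow> t j x \<ominus>\<^bsub>N j\<^esub> x = (dl (N j) (N j) ^^ (pchar A - 1)) (h j) x"
    by metis
  have "f c \<ominus>\<^bsub>dsum J N\<^esub> c = (dl (dsum J N) (dsum J N) ^^ (pchar A - 1)) (dmap J N N h) c" if c: "c \<in> carrier (dsum J N)" for c
  proof (rule NN.N.D.inj)
    have fc: "f c \<in> carrier (dsum J N)" using pdg_hom_closed[OF f(1) c] .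
    then show "f c \<ominus>\<^bsub>dsum J N\<^esub> c \<in> carrier (dsum J N)" using P.M.minus_closed[OF _ c] by blast
    have "dmap J N N h \<in> carrier (dsum J N) \<rightarrow> carrier (dsum J N)" using NN.dmap_closed[OF h(1)] by blast
    then show "(dl (dsum J N) (dsum J N) ^^ (pchar A - 1)) (dmap J N N h) c \<in> carrier (dsum J N)"
      by (rule P.dl_pow_closed'[OF _ c])
    fix j assume j: "j \<in> J"
    show "ddec N (f c \<ominus>\<^bsub>dsum J N\<^esub> c) j = ddec N ((dl (dsum J N) (dsum J N) ^^ (pchar A - 1)) (dmap J N N h) c) j"
      using NN.ddec_dl_dmap[OF h(1) c j, of "pchar A - 1"] h(2)[OF j NN.N.D.\<pi>_closed[OF j c]]
        NN.N.D.\<pi>_sub[OF j fc c] f(2)[OF c j] by simp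
  qed
  then show ?thesis
    unfolding P.homotopic_iff using NN.dmap_gr_hom[OF h(1)] by blast
qed

lemma heq_dmap:
  assumes A: "pdg_algebra A" and mods: "\<And>j. j \<in> J \<Longrightarrow> pdg_module A (N j)" "\<And>j. j \<in> J \<Longrightarrow> pdg_module A (M j)"
    and w: "\<And>j. j \<in> J \<Longrightarrow> heq A (N j) (M j) (w j)"
  shows "heq A (dsum J N) (dsum J M) (dmap J N M w)"
proof -
  interpret NM: pdg_dsum_pair A J N M
    using A mods by (intro pdg_dsum_pair.intro pdg_dsum.intro pdg_dsum_axioms.intro)
  interpret MN: pdg_dsum_pair A J M N
    using A mods by (intro pdg_dsum_pair.intro pdg_dsum.intro pdg_dsum_axioms.intro)
  have wm: "\<And>j. j \<in> J \<Longrightarrow> w j \<in> pdg_hom (N j) (M j)" using w by (auto simp: heq_def)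
  obtain t where t: "\<And>j. j \<in> J \<Longrightarrow> t j \<in> pdg_hom (M j) (N j)"
    "\<And>j. j \<in> J \<Longrightarrow> homotopic A (N j) (N j) (\<lambda>x. t j (w j x)) (\<lambda>x. x)"
    "\<And>j. j \<in> J \<Longrightarrow> homotopic A (M j) (M j) (\<lambda>x. w j (t j x)) (\<lambda>x. x)"
    using w unfolding heq_def by metis
  note W = NM.dmap_pdg_hom[OF wm] and T = MN.dmap_pdg_hom[OF t(1)]
  show ?thesis
  proof (rule heqI[OF W T])
    show "homotopic A (dsum J N) (dsum J N) (\<lambda>x. dmap J M N t (dmap J N M w x)) (\<lambda>x. x)"
      by (rule homotopic_dmap[OF A mods(1) pdg_hom_comp[OF wm t(1)] t(2) pdg_hom_comp[OF W T]])
        (simp_all add: MN.ddec_dmap[OF pdg_hom_gr[OF t(1)]] NM.ddec_dmap[OF pdg_hom_gr[OF wm]] pdg_hom_closed[OF W])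
    show "homotopic A (dsum J M) (dsum J M) (\<lambda>x. dmap J N M w (dmap J M N t x)) (\<lambda>x. x)"
      by (rule homotopic_dmap[OF A mods(2) pdg_hom_comp[OF t(1) wm] t(3) pdg_hom_comp[OF T W]])
        (simp_all add: MN.ddec_dmap[OF pdg_hom_gr[OF t(1)]] NM.ddec_dmap[OF pdg_hom_gr[OF wm]] pdg_hom_closed[OF T])
  qed
qed

lemma underlying_dsum: "underlying A (dsum J N) = dsum J (\<lambda>j. underlying A (N j))"
proof -
  have d: "denc J (\<lambda>j. underlying A (N j)) = denc J N" by (intro ext) (simp add: denc_def)
  have e: "ddec (\<lambda>j. underlying A (N j)) = ddec N" by (intro ext) (simp add: ddec_def)
  have f: "finfam J (\<lambda>j. underlying A (N j)) = finfam J N" by (intro ext) (simp add: finfam_def)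
  show ?thesis
    unfolding underlying_def[of A "dsum J N"] dsum_def[of J "\<lambda>j. underlying A (N j)"] d e f
    by (simp add: dsum_def)
qed

text \<open>Restriction to the ground field commutes with direct sums. In this way a whole family of
  quasi-isomorphisms, possibly infinite, is replaced by a single one.\<close>

lemma kheq_dmap:
  assumes A: "pdg_algebra A" and mods: "\<And>j. j \<in> J \<Longrightarrow> pdg_module A (N j)" "\<And>j. j \<in> J \<Longrightarrow> pdg_module A (M j)"
    and w: "\<And>j. j \<in> J \<Longrightarrow> kheq A (N j) (M j) (w j)"
  shows "kheq A (dsum J N) (dsum J M) (dmap J N M w)"
proof -
  interpret NM: pdg_dsum_pair A J N M
    using A mods by (intro pdg_dsum_pair.intro pdg_dsum.intro pdg_dsum_axioms.intro)
  have "dmap J (\<lambda>j. underlying A (N j)) (\<lambda>j. underlying A (M j)) w = dmap J N M w"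
  proof -
    have d: "denc J (\<lambda>j. underlying A (M j)) = denc J M" by (intro ext) (simp add: denc_def)
    have e: "ddec (\<lambda>j. underlying A (N j)) = ddec N" by (intro ext) (simp add: ddec_def)
    show ?thesis by (intro ext) (simp only: dmap_def d e)
  qed
  moreover have "heq (ground :: ('a, 'a) pdg_alg) (dsum J (\<lambda>j. underlying A (N j))) (dsum J (\<lambda>j. underlying A (M j)))
      (dmap J (\<lambda>j. underlying A (N j)) (\<lambda>j. underlying A (M j)) w)"
    by (rule heq_dmap[OF pdg_algebra_ground[OF A]])
      (use w mods in \<open>auto intro: pdg_module_underlying[OF A] simp: kheq_def\<close>)
  moreover have "dmap J N M w \<in> pdg_hom (dsum J N) (dsum J M)"
    using w by (intro NM.dmap_pdg_hom) (auto simp: kheq_def)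
  ultimately show ?thesis
    by (simp add: kheq_def underlying_dsum)
qed

section \<open>Localization: calculus of fractions and local objects\<close>

section \<open>Localization of categories\<close>

declare loc_eq.le_trans [trans]

locale category =
  fixes C :: "('o, 'a) cat"
  assumes ident_in: "X \<in> Ob C \<Longrightarrow> ident C X \<in> Hom C X X"
    and cmp_in: "\<lbrakk>X \<in> Ob C; Y \<in> Ob C; Z \<in> Ob C; f \<in> Hom C X Y; g \<in> Hom C Y Z\<rbrakk> \<Longrightarrow> cmp C X Y Z g f \<in> Hom C X Z"
    and cmp_assoc: "\<lbrakk>X \<in> Ob C; Y \<in> Ob C; Z \<in> Ob C; V \<in> Ob C; f \<in> Hom C X Y; g \<in> Hom C Y Z; h \<in> Hom C Z V\<rbrakk> \<Longrightarrow>
      cmp C X Z V h (cmp C X Y Z g f) = cmp C X Y V (cmp C Y Z V h g) f"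
    and ident_left: "\<lbrakk>X \<in> Ob C; Y \<in> Ob C; f \<in> Hom C X Y\<rbrakk> \<Longrightarrow> cmp C X Y Y (ident C Y) f = f"
    and ident_right: "\<lbrakk>X \<in> Ob C; Y \<in> Ob C; f \<in> Hom C X Y\<rbrakk> \<Longrightarrow> cmp C X X Y f (ident C X) = f"

lemma zigzag_Ob: "zigzag C W X a Y \<Longrightarrow> X \<in> Ob C \<and> Y \<in> Ob C"
  by (induction rule: zigzag.induct) auto

lemma zigzag_append: "zigzag C W X a Y \<Longrightarrow> zigzag C W Y b Z \<Longrightarrow> zigzag C W X (a @ b) Z"
  by (induction rule: zigzag.induct) (auto intro: zigzag.intros)

lemma zigzag_appendD: "zigzag C W X (a @ b) Z \<Longrightarrow> \<exists>Y. zigzag C W X a Y \<and> zigzag C W Y b Z"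
proof (induction a arbitrary: X)
  case Nil
  then show ?case using zigzag_Ob[OF Nil] by (auto intro: zz_Nil)
next
  case (Cons st a)
  from Cons.prems show ?case
    by (cases rule: zigzag.cases) (use Cons.IH in \<open>(auto intro: zz_Fwd zz_Bwd; blast intro: zz_Fwd zz_Bwd)+\<close>)
qed

lemma zigzag_Nil_iff: "zigzag C W X [] Y \<longleftrightarrow> X = Y \<and> X \<in> Ob C"
  by (subst zigzag.simps) auto

lemma zigzag_Fwd_iff: "zigzag C W X (Fwd X' f Y # a) Z \<longleftrightarrow> X' = X \<and> X \<in> Ob C \<and> f \<in> Hom C X Y \<and> zigzag C W Y a Z"
  by (subst zigzag.simps) auto

lemma zigzag_Bwd_iff: "zigzag C W X (Bwd X' s Y # a) Z \<longleftrightarrow> X' = X \<and> X \<in> Ob C \<and> s \<in> Hom C Y X \<and> W Y X s \<and> zigzag C W Y a Z"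
  by (subst zigzag.simps) auto

lemmas zigzag_iffs = zigzag_Nil_iff zigzag_Fwd_iff zigzag_Bwd_iff

lemma loc_eq_zigzag: "loc_eq C W X Y a b \<Longrightarrow> zigzag C W X a Y \<and> zigzag C W X b Y"
  by (induction rule: loc_eq.induct) auto

lemma loc_eq_cong:
  assumes "loc_eq C W X' Y' a b" "zigzag C W X c X'" "zigzag C W Y' d Y"
  shows "loc_eq C W X Y (c @ a @ d) (c @ b @ d)"
  using assms(1)
proof (induction rule: loc_eq.induct)
  case (le_rel l r a b)
  have "zigzag C W X ((c @ a) @ l @ (b @ d)) Y" "zigzag C W X ((c @ a) @ r @ (b @ d)) Y"
    using zigzag_append[OF zigzag_append[OF assms(2) le_rel(2)] assms(3)]
      zigzag_append[OF zigzag_append[OF assms(2) le_rel(3)] assms(3)] by simp_all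
  from loc_eq.le_rel[OF le_rel(1) this] show ?case by simp
next
  case (le_refl a)
  show ?case using zigzag_append[OF assms(2) zigzag_append[OF le_refl assms(3)]] by (rule loc_eq.le_refl)
qed (blast intro: loc_eq.le_sym loc_eq.le_trans)+

lemma loc_eq_append:
  assumes "loc_eq C W X Y a a'" "loc_eq C W Y Z b b'"
  shows "loc_eq C W X Z (a @ b) (a' @ b')"
proof -
  note za = loc_eq_zigzag[OF assms(1)] and zb = loc_eq_zigzag[OF assms(2)]
  have "loc_eq C W X Z (a @ b) (a' @ b)"
    using loc_eq_cong[OF assms(1) zz_Nil conjunct1[OF zb]] zigzag_Ob[OF conjunct1[OF za]] by simp
  moreover have "loc_eq C W X Z (a' @ b) (a' @ b')"
    using loc_eq_cong[OF assms(2) conjunct2[OF za] zz_Nil] zigzag_Ob[OF conjunct1[OF zb]] by simp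
  ultimately show ?thesis by (rule le_trans)
qed

definition lc where "lc C W X Y a = Collect (loc_eq C W X Y a)"

lemma lc_eq_iff: "zigzag C W X a Y \<Longrightarrow> lc C W X Y a = lc C W X Y b \<longleftrightarrow> loc_eq C W X Y a b"
  unfolding lc_def by (auto intro: le_refl le_sym le_trans)

lemma localization_simps:
  "Ob (localization C W) = Ob C"
  "Hom (localization C W) X Y = {lc C W X Y a | a. zigzag C W X a Y}"
  "ident (localization C W) X = lc C W X X []"
  by (simp_all add: localization_def lc_def)

text \<open>Composition in \<open>localization\<close> ranges over all representatives of both
  classes; it reduces to the given ones because concatenation respects
  \<open>loc_eq\<close>.\<close>

lemma cmp_lc:
  assumes "zigzag C W X a Y" "zigzag C W Y b Z"
  shows "cmp (localization C W) X Y Z (lc C W Y Z b) (lc C W X Y a) = lc C W X Z (a @ b)"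
proof -
  have "loc_eq C W X Z (a @ b) c \<longleftrightarrow> (\<exists>a'. loc_eq C W X Y a a' \<and> (\<exists>b'. loc_eq C W Y Z b b' \<and> loc_eq C W X Z (a' @ b') c))" for c
    using assms by (meson le_refl le_sym le_trans loc_eq_append)
  then show ?thesis unfolding localization_def lc_def by auto
qed

context category begin

lemma loc_eq_comp:
  assumes "X \<in> Ob C" "Y \<in> Ob C" "Z \<in> Ob C" "f \<in> Hom C X Y" "g \<in> Hom C Y Z"
  shows "loc_eq C W X Z [Fwd X f Y, Fwd Y g Z] [Fwd X (cmp C X Y Z g f) Z]"
  using le_rel[OF lr_comp[OF assms(4,5)], where W = W and X = X and a = "[]" and b = "[]" and Y = Z] assms cmp_in[OF assms] by (simp add: zigzag_iffs)

lemma loc_eq_ident: "X \<in> Ob C \<Longrightarrow> loc_eq C W X X [Fwd X (ident C X) X] []"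
  using le_rel[OF lr_ident[of C X], where W = W and X = X and a = "[]" and b = "[]" and Y = X] ident_in by (simp add: zigzag_iffs)

lemma loc_eq_cancel:
  "X \<in> Ob C \<Longrightarrow> Y \<in> Ob C \<Longrightarrow> s \<in> Hom C X Y \<Longrightarrow> W X Y s \<Longrightarrow> loc_eq C W X X [Fwd X s Y, Bwd Y s X] []"
  using le_rel[OF lr_cancel[of C X s Y], where W = W and X = X and a = "[]" and b = "[]" and Y = X] by (simp add: zigzag_iffs)

lemma loc_eq_cancel':
  "X \<in> Ob C \<Longrightarrow> Y \<in> Ob C \<Longrightarrow> s \<in> Hom C X Y \<Longrightarrow> W X Y s \<Longrightarrow> loc_eq C W Y Y [Bwd Y s X, Fwd X s Y] []"
  using le_rel[OF lr_cancel'[of C Y s X], where W = W and X = Y and a = "[]" and b = "[]" and Y = Y] by (simp add: zigzag_iffs)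

lemma is_iso_Bwd:
  assumes "X \<in> Ob C" "Y \<in> Ob C" "s \<in> Hom C X Y" "W X Y s"
  shows "is_iso (localization C W) Y X (lc C W Y X [Bwd Y s X])"
proof -
  have z: "zigzag C W X [Fwd X s Y] Y" "zigzag C W Y [Bwd Y s X] X" using assms by (auto simp: zigzag_iffs)
  have n: "zigzag C W X [] X" "zigzag C W Y [] Y" using assms by (auto simp: zigzag_iffs)
  have "lc C W Y Y [Bwd Y s X, Fwd X s Y] = lc C W Y Y []" "lc C W X X [Fwd X s Y, Bwd Y s X] = lc C W X X []"
    using lc_eq_iff[OF n(1)] lc_eq_iff[OF n(2)] loc_eq_cancel[where W = W, OF assms] loc_eq_cancel'[where W = W, OF assms] le_sym by metis+
  then show ?thesis
    unfolding is_iso_def localization_simps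
    using assms z cmp_lc[OF z(1) z(2)] cmp_lc[OF z(2) z(1)] by (auto intro!: exI[of _ "lc C W X Y [Fwd X s Y]"])
qed

lemma is_iso_ident:
  assumes "X \<in> Ob C"
  shows "is_iso (localization C W) X X (lc C W X X [])"
proof -
  have n: "zigzag C W X [] X" using assms by (auto simp: zigzag_iffs)
  then show ?thesis unfolding is_iso_def localization_simps using assms cmp_lc[OF n n] by auto
qed

end

text \<open>These conditions reduce each zigzag to a roof, one backward step followed by one forward
  step. Equality of morphisms is decided by other means, through
  \<open>local_object\<close>.\<close>

locale ore_category = category C
  for C :: "('o, 'a) cat" +
  fixes W :: "'o \<Rightarrow> 'o \<Rightarrow> 'a \<Rightarrow> bool"
  assumes W_ident: "X \<in> Ob C \<Longrightarrow> W X X (ident C X)"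
    and W_comp: "\<lbrakk>X \<in> Ob C; Y \<in> Ob C; Z \<in> Ob C; s \<in> Hom C X Y; t \<in> Hom C Y Z; W X Y s; W Y Z t\<rbrakk> \<Longrightarrow> W X Z (cmp C X Y Z t s)"
    and ore: "\<lbrakk>X \<in> Ob C; Y \<in> Ob C; Z \<in> Ob C; f \<in> Hom C X Y; s \<in> Hom C Z Y; W Z Y s\<rbrakk> \<Longrightarrow>
      \<exists>V w g. V \<in> Ob C \<and> w \<in> Hom C V X \<and> W V X w \<and> g \<in> Hom C V Z \<and> cmp C V Z Y s g = cmp C V X Y f w"
begin

abbreviation leq where "leq \<equiv> loc_eq C W"

text \<open>Insert \<open>v\<close> and its formal inverse in front, rewrite by the commuting
  square, and cancel \<open>w\<close> against its formal inverse.\<close>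

lemma ore_square:
  assumes O: "X \<in> Ob C" "Y \<in> Ob C" "U \<in> Ob C" "V \<in> Ob C"
    and f: "f \<in> Hom C X Y" and h: "h \<in> Hom C U V" and v: "v \<in> Hom C U X" "W U X v" and w: "w \<in> Hom C V Y" "W V Y w"
    and eq: "cmp C U V Y w h = cmp C U X Y f v"
  shows "leq X V [Fwd X f Y, Bwd Y w V] [Bwd X v U, Fwd U h V]"
proof -
  have z: "zigzag C W X [Bwd X v U] U" "zigzag C W X [Fwd X f Y, Bwd Y w V] V" "zigzag C W Y [Bwd Y w V] V" "zigzag C W V [] V"
    "zigzag C W X [Bwd X v U, Fwd U h V] V"
    using O f h v w by (auto simp: zigzag_iffs)
  have "leq X V [Fwd X f Y, Bwd Y w V] [Bwd X v U, Fwd U v X, Fwd X f Y, Bwd Y w V]"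
    using le_sym[OF loc_eq_append[OF loc_eq_cancel'[where W = W, OF O(3,1) v] le_refl[OF z(2)]]] by simp
  also have "leq X V [Bwd X v U, Fwd U v X, Fwd X f Y, Bwd Y w V] [Bwd X v U, Fwd U (cmp C U X Y f v) Y, Bwd Y w V]"
    using loc_eq_cong[OF loc_eq_comp[where W = W, OF O(3,1,2) v(1) f] z(1) z(3)] by simp
  also have "leq X V [Bwd X v U, Fwd U (cmp C U X Y f v) Y, Bwd Y w V] [Bwd X v U, Fwd U h V, Fwd V w Y, Bwd Y w V]"
    using le_sym[OF loc_eq_cong[OF loc_eq_comp[where W = W, OF O(3,4,2) h w(1)] z(1) z(3)]] by (simp add: eq)
  also have "leq X V [Bwd X v U, Fwd U h V, Fwd V w Y, Bwd Y w V] [Bwd X v U, Fwd U h V]"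
    using loc_eq_cong[OF loc_eq_cancel[where W = W, OF O(4,2) w] z(5) z(4)] by simp
  finally show ?thesis .
qed

text \<open>The first step of the zigzag is absorbed into a roof for the rest: a forward step is
  moved past the backward leg by an Ore square, a backward step is composed with that leg.\<close>

lemma roof:
  assumes "zigzag C W X a Y"
  shows "\<exists>V w g. V \<in> Ob C \<and> w \<in> Hom C V X \<and> W V X w \<and> g \<in> Hom C V Y \<and> leq X Y a [Bwd X w V, Fwd V g Y]"
  using assms
proof (induction rule: zigzag.induct)
  case (zz_Nil X)
  have "leq X X [Bwd X (ident C X) X, Fwd X (ident C X) X] []"
    by (rule loc_eq_cancel'[where W = W, OF zz_Nil zz_Nil ident_in[OF zz_Nil] W_ident[OF zz_Nil]])
  then have "leq X X [] [Bwd X (ident C X) X, Fwd X (ident C X) X]" by (rule le_sym)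
  then show ?case by (intro exI[of _ X] exI[of _ "ident C X"] conjI ident_in W_ident zz_Nil)
next
  case (zz_Fwd X f Y a Z)
  then obtain V w g where V: "V \<in> Ob C" "w \<in> Hom C V Y" "W V Y w" "g \<in> Hom C V Z" "leq Y Z a [Bwd Y w V, Fwd V g Z]" by blast
  have O: "X \<in> Ob C" "Y \<in> Ob C" "Z \<in> Ob C" using zigzag_Ob[OF zz_Fwd(3)] zz_Fwd(1) by auto
  obtain U v h where U: "U \<in> Ob C" "v \<in> Hom C U X" "W U X v" "h \<in> Hom C U V" "cmp C U V Y w h = cmp C U X Y f v"
    using ore[OF O(1,2) V(1) zz_Fwd(2) V(2,3)] by blast
  have z: "zigzag C W X [Fwd X f Y] Y" "zigzag C W V [Fwd V g Z] Z" "zigzag C W X [Bwd X v U] U" "zigzag C W Z [] Z"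
    using O U V zz_Fwd(2) by (auto simp: zigzag_iffs)
  have "leq X Z (Fwd X f Y # a) [Fwd X f Y, Bwd Y w V, Fwd V g Z]"
    using loc_eq_append[OF le_refl[OF z(1)] V(5)] by simp
  also have "leq X Z [Fwd X f Y, Bwd Y w V, Fwd V g Z] [Bwd X v U, Fwd U h V, Fwd V g Z]"
    using loc_eq_append[OF ore_square[OF O(1,2) U(1) V(1) zz_Fwd(2) U(4) U(2,3) V(2,3) U(5)] le_refl[OF z(2)]] by simp
  also have "leq X Z [Bwd X v U, Fwd U h V, Fwd V g Z] [Bwd X v U, Fwd U (cmp C U V Z g h) Z]"
    using loc_eq_cong[OF loc_eq_comp[where W = W, OF U(1) V(1) O(3) U(4) V(4)] z(3,4)] by simp
  finally show ?case
    by (intro exI[of _ U] exI[of _ v] exI[of _ "cmp C U V Z g h"] conjI U(1,2,3) cmp_in[OF U(1) V(1) O(3) U(4) V(4)])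
next
  case (zz_Bwd X s Y a Z)
  then obtain V w g where V: "V \<in> Ob C" "w \<in> Hom C V Y" "W V Y w" "g \<in> Hom C V Z" "leq Y Z a [Bwd Y w V, Fwd V g Z]" by blast
  have O: "X \<in> Ob C" "Y \<in> Ob C" "Z \<in> Ob C" using zigzag_Ob[OF zz_Bwd(4)] zz_Bwd(1) by auto
  let ?t = "cmp C V Y X s w"
  have t: "?t \<in> Hom C V X" "W V X ?t"
    using cmp_in[OF V(1) O(2,1) V(2) zz_Bwd(2)] W_comp[OF V(1) O(2,1) V(2) zz_Bwd(2) V(3) zz_Bwd(3)] by auto
  have z: "zigzag C W X [Bwd X s Y] Y" "zigzag C W X [Bwd X s Y, Bwd Y w V] V" "zigzag C W V [Fwd V g Z] Z" "zigzag C W X [Bwd X ?t V] V"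
    "zigzag C W V [] V" "zigzag C W X [] X"
    using zz_Bwd O V t by (auto simp: zigzag_iffs)
  have "leq X V [Bwd X s Y, Bwd Y w V] [Bwd X s Y, Bwd Y w V, Fwd V ?t X, Bwd X ?t V]"
    using le_sym[OF loc_eq_append[OF le_refl[OF z(2)] loc_eq_cancel[where W = W, OF V(1) O(1) t]]] by simp
  also have "leq X V [Bwd X s Y, Bwd Y w V, Fwd V ?t X, Bwd X ?t V] [Bwd X s Y, Bwd Y w V, Fwd V w Y, Fwd Y s X, Bwd X ?t V]"
    using le_sym[OF loc_eq_cong[OF loc_eq_comp[where W = W, OF V(1) O(2,1) V(2) zz_Bwd(2)] z(2) z(4)]] by simp
  also have "leq X V [Bwd X s Y, Bwd Y w V, Fwd V w Y, Fwd Y s X, Bwd X ?t V] [Bwd X s Y, Fwd Y s X, Bwd X ?t V]"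
    using loc_eq_cong[OF loc_eq_cancel'[where W = W, OF V(1) O(2) V(2,3)] z(1), of "[Fwd Y s X, Bwd X ?t V]" V] O V t zz_Bwd(2) by (simp add: zigzag_iffs)
  also have "leq X V [Bwd X s Y, Fwd Y s X, Bwd X ?t V] [Bwd X ?t V]"
    using loc_eq_append[OF loc_eq_cancel'[where W = W, OF O(2,1) zz_Bwd(2,3)] le_refl[OF z(4)]] by simp
  finally have 1: "leq X V [Bwd X s Y, Bwd Y w V] [Bwd X ?t V]" .
  have "leq X Z (Bwd X s Y # a) [Bwd X s Y, Bwd Y w V, Fwd V g Z]"
    using loc_eq_append[OF le_refl[OF z(1)] V(5)] by simp
  also have "leq X Z [Bwd X s Y, Bwd Y w V, Fwd V g Z] [Bwd X ?t V, Fwd V g Z]"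
    using loc_eq_append[OF 1 le_refl[OF z(3)]] by simp
  finally show ?case
    by (intro exI[of _ V] exI[of _ ?t] exI[of _ g] conjI V(1,4) t)
qed

end

text \<open>Objects \<open>Q\<close> that see the morphisms in \<open>W\<close> as isomorphisms: morphisms out of them need no inversion.\<close>

locale local_object = category C
  for C :: "('o, 'a) cat" +
  fixes W :: "'o \<Rightarrow> 'o \<Rightarrow> 'a \<Rightarrow> bool" and Q :: 'o
  assumes Q: "Q \<in> Ob C"
    and bij: "\<lbrakk>Y \<in> Ob C; M \<in> Ob C; s \<in> Hom C Y M; W Y M s\<rbrakk> \<Longrightarrow> bij_betw (cmp C Q Y M s) (Hom C Q Y) (Hom C Q M)"
begin

text \<open>\<open>Hom C Q\<close> sends the morphisms in \<open>W\<close> to bijections, so zigzags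
  act on it, a backward step by the inverse bijection. This is the functor that
  \<open>Hom C Q\<close> induces on the localization.\<close>

fun act1 where
  "act1 (Fwd X f Y) x = cmp C Q X Y f x"
| "act1 (Bwd X s Y) x = inv_into (Hom C Q Y) (cmp C Q Y X s) x"

fun acts where
  "acts [] x = x"
| "acts (st # a) x = acts a (act1 st x)"

lemma acts_append: "acts (a @ b) x = acts b (acts a x)"
  by (induction a arbitrary: x) auto

lemma act1_Bwd:
  assumes "X \<in> Ob C" "Y \<in> Ob C" "s \<in> Hom C Y X" "W Y X s" "x \<in> Hom C Q X"
  shows "act1 (Bwd X s Y) x \<in> Hom C Q Y" "cmp C Q Y X s (act1 (Bwd X s Y) x) = x"
  using bij[OF assms(2,1,3,4)] assms(5) by (auto simp: bij_betw_def intro: inv_into_into f_inv_into_f)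

lemma act1_Bwd_cmp:
  assumes "X \<in> Ob C" "Y \<in> Ob C" "s \<in> Hom C Y X" "W Y X s" "y \<in> Hom C Q Y"
  shows "act1 (Bwd X s Y) (cmp C Q Y X s y) = y"
  using bij[OF assms(2,1,3,4)] assms(5) by (auto simp: bij_betw_def)

lemma acts_in: "zigzag C W X a Z \<Longrightarrow> x \<in> Hom C Q X \<Longrightarrow> acts a x \<in> Hom C Q Z"
proof (induction arbitrary: x rule: zigzag.induct)
  case (zz_Fwd X f Y a Z)
  then show ?case using cmp_in[OF Q zz_Fwd(1) _ zz_Fwd(5) zz_Fwd(2)] zigzag_Ob[OF zz_Fwd(3)] by simp
next
  case (zz_Bwd X s Y a Z)
  then show ?case using act1_Bwd(1)[OF zz_Bwd(1) _ zz_Bwd(2,3,6)] zigzag_Ob[OF zz_Bwd(4)] by simp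
qed simp

lemma acts_loc_rel:
  assumes "loc_rel C l r" "zigzag C W X l Y" "x \<in> Hom C Q X"
  shows "acts l x = acts r x"
  using assms
proof (cases rule: loc_rel.cases)
  case (lr_comp f X' Y' g Z)
  then show ?thesis using assms(2,3) cmp_assoc[OF Q, of X' Y' Z x f g] by (auto simp: zigzag_iffs)
next
  case (lr_ident X')
  then show ?thesis using assms(2,3) ident_left[OF Q, of X' x] by (auto simp: zigzag_iffs)
next
  case (lr_cancel X' s Y')
  then show ?thesis using assms(2,3) act1_Bwd_cmp[of Y' X' s x] by (auto simp: zigzag_iffs)
next
  case (lr_cancel' Y' s X')
  then show ?thesis using assms(2,3) act1_Bwd(2)[of Y' X' s x] by (auto simp: zigzag_iffs)
qed

lemma acts_loc_eq: "loc_eq C W X Y a b \<Longrightarrow> x \<in> Hom C Q X \<Longrightarrow> acts a x = acts b x"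
proof (induction rule: loc_eq.induct)
  case (le_rel l r a b)
  obtain X1 where X1: "zigzag C W X a X1" "zigzag C W X1 (l @ b) Y" using zigzag_appendD[OF le_rel(2)] by blast
  obtain X2 where X2: "zigzag C W X1 l X2" using zigzag_appendD[OF X1(2)] by blast
  show ?case using acts_loc_rel[OF le_rel(1) X2 acts_in[OF X1(1) le_rel(4)]] by (simp add: acts_append)
qed auto

text \<open>The action is realized inside the localization: an arrow out of \<open>Q\<close>
  followed by a zigzag equals the single arrow that the action produces. Together with
  \<open>acts_loc_eq\<close> this says that morphisms out of \<open>Q\<close> are the same before
  and after localizing.\<close>

lemma loc_eq_acts:
  assumes "zigzag C W X a Z" "x \<in> Hom C Q X"
  shows "loc_eq C W Q Z (Fwd Q x X # a) [Fwd Q (acts a x) Z]"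
  using assms
proof (induction arbitrary: x rule: zigzag.induct)
  case (zz_Nil X)
  then show ?case using Q by (auto intro!: le_refl simp: zigzag_iffs)
next
  case (zz_Fwd X f Y a Z)
  have O: "Y \<in> Ob C" using zigzag_Ob[OF zz_Fwd(3)] by simp
  have "loc_eq C W Q Z (Fwd Q x X # Fwd X f Y # a) (Fwd Q (cmp C Q X Y f x) Y # a)"
    using loc_eq_append[OF loc_eq_comp[where W = W, OF Q zz_Fwd(1) O zz_Fwd(5,2)] le_refl[OF zz_Fwd(3)]] by simp
  then show ?case
    using zz_Fwd.IH[OF cmp_in[OF Q zz_Fwd(1) O zz_Fwd(5,2)]] by (auto intro: le_trans)
next
  case (zz_Bwd X s Y a Z)
  have O: "Y \<in> Ob C" using zigzag_Ob[OF zz_Bwd(4)] by simp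
  let ?y = "act1 (Bwd X s Y) x"
  have y: "?y \<in> Hom C Q Y" "cmp C Q Y X s ?y = x" using act1_Bwd[OF zz_Bwd(1) O zz_Bwd(2,3,6)] by auto
  have z: "zigzag C W Q [Fwd Q ?y Y] Y" "zigzag C W X (Bwd X s Y # a) Z" using y(1) Q O zz_Bwd by (auto simp: zigzag_iffs)
  have "loc_eq C W Q Z (Fwd Q x X # Bwd X s Y # a) (Fwd Q ?y Y # Fwd Y s X # Bwd X s Y # a)"
    using le_sym[OF loc_eq_append[OF loc_eq_comp[where W = W, OF Q O zz_Bwd(1) y(1) zz_Bwd(2)] le_refl[OF z(2)]]] y(2) by simp
  also have "loc_eq C W Q Z (Fwd Q ?y Y # Fwd Y s X # Bwd X s Y # a) (Fwd Q ?y Y # a)"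
    using loc_eq_cong[OF loc_eq_cancel[where W = W, OF O zz_Bwd(1,2,3)] z(1) zz_Bwd(4)] by simp
  finally show ?case
    using zz_Bwd.IH[OF y(1)] by (auto intro: le_trans)
qed

lemma loc_eq_single:
  assumes "zigzag C W Q a Z"
  shows "loc_eq C W Q Z a [Fwd Q (acts a (ident C Q)) Z]"
proof -
  have "loc_eq C W Q Z a (Fwd Q (ident C Q) Q # a)"
    using le_sym[OF loc_eq_append[OF loc_eq_ident[where W = W, OF Q] le_refl[OF assms]]] by simp
  then show ?thesis using loc_eq_acts[OF assms ident_in[OF Q]] by (rule le_trans)
qed

end

section \<open>From the homotopy category to compact objects of the derived category\<close>

section \<open>The homotopy category\<close>

locale pdg_category = pdg_algebra A
  for A :: "('k::field, 'r::{ring, monoid_mult}) pdg_alg"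
begin

lemma pair: "pdg_module A M \<Longrightarrow> pdg_module A N \<Longrightarrow> pdg_module_pair A M N"
  by (intro pdg_module_pair.intro pdg_algebra_axioms)

lemma mem_hclass: "pdg_module A M \<Longrightarrow> pdg_module A N \<Longrightarrow> f \<in> pdg_hom M N \<Longrightarrow> f \<in> hclass A M N f"
  by (simp add: hclass_def pdg_module_pair.homotopic_refl[OF pair])

lemma hclass_eq_iff:
  assumes M: "pdg_module A M" "pdg_module A N" and f: "f \<in> pdg_hom M N" "g \<in> pdg_hom M N"
  shows "hclass A M N f = hclass A M N g \<longleftrightarrow> homotopic A M N f g"
proof
  assume "hclass A M N f = hclass A M N g"
  then show "homotopic A M N f g" using mem_hclass[OF M f(2)] by (auto simp: hclass_def)
next
  interpret pdg_module_pair A M N by (rule pair[OF M])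
  assume fg: "homotopic A M N f g"
  have "homotopic A M N f k \<longleftrightarrow> homotopic A M N g k" if k: "k \<in> pdg_hom M N" for k
    using homotopic_trans[OF f k fg] homotopic_trans[OF f(2,1) k homotopic_sym[OF f fg]]
      homotopic_trans[OF f(1,2) k fg] homotopic_trans[OF f(2) f(1) k homotopic_sym[OF f fg]] by blast
  then show "hclass A M N f = hclass A M N g" by (auto simp: hclass_def)
qed

lemma cmp_hclass:
  assumes M: "pdg_module A L" "pdg_module A M" "pdg_module A N" and f: "f \<in> pdg_hom L M" and g: "g \<in> pdg_hom M N"
  shows "cmp (homotopy_cat A) L M N (hclass A M N g) (hclass A L M f) = hclass A L N (\<lambda>x. g (f x))"
proof -
  have "hclass A L N (\<lambda>x. g' (f' x)) = hclass A L N (\<lambda>x. g (f x))" if "f' \<in> hclass A L M f" "g' \<in> hclass A M N g" for f' g'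
  proof -
    have f': "f' \<in> pdg_hom L M" "homotopic A L M f f'" and g': "g' \<in> pdg_hom M N" "homotopic A M N g g'"
      using that by (auto simp: hclass_def)
    show ?thesis
      using hclass_eq_iff[OF M(1,3) pdg_hom_comp[OF f g] pdg_hom_comp[OF f'(1) g'(1)]]
        homotopic_comp[OF pdg_algebra_axioms M f f'(1) g g'(1) f'(2) g'(2)] by simp
  qed
  then have "(\<Union>f'\<in>hclass A L M f. \<Union>g'\<in>hclass A M N g. hclass A L N (\<lambda>x. g' (f' x)))
      = (\<Union>f'\<in>hclass A L M f. \<Union>g'\<in>hclass A M N g. hclass A L N (\<lambda>x. g (f x)))"
    by (intro SUP_cong refl)
  also have "\<dots> = hclass A L N (\<lambda>x. g (f x))"
    using mem_hclass[OF M(1,2) f] mem_hclass[OF M(2,3) g] by blast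
  finally show ?thesis by (simp add: homotopy_cat_def)
qed

lemma homotopy_cat_simps:
  "Ob (homotopy_cat A) = {M. pdg_module A M}"
  "Hom (homotopy_cat A) M N = hclass A M N ` pdg_hom M N"
  "ident (homotopy_cat A) M = hclass A M M (\<lambda>x. x)"
  by (simp_all add: homotopy_cat_def)

lemma category_homotopy_cat: "category (homotopy_cat A)"
  by (rule category.intro)
    (auto simp: homotopy_cat_simps cmp_hclass pdg_hom_ident pdg_hom_comp intro!: imageI)

text \<open>The union in \<open>qis\<close> runs over all representatives of a class; homotopies
  survive restriction to the ground field, so all its members coincide.\<close>

lemma union_hclass_underlying:
  assumes M: "pdg_module A M" "pdg_module A N" and f: "f \<in> pdg_hom M N"
  shows "(\<Union>g\<in>hclass A M N f. hclass (ground :: ('k, 'k) pdg_alg) (underlying A M) (underlying A N) g)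
    = hclass (ground :: ('k, 'k) pdg_alg) (underlying A M) (underlying A N) f"
proof -
  interpret G: pdg_category "ground :: ('k, 'k) pdg_alg" by (intro pdg_category.intro pdg_algebra_ground[OF pdg_algebra_axioms])
  have "hclass (ground :: ('k, 'k) pdg_alg) (underlying A M) (underlying A N) g
    = hclass (ground :: ('k, 'k) pdg_alg) (underlying A M) (underlying A N) f" if "g \<in> hclass A M N f" for g
    using that G.hclass_eq_iff[OF pdg_module_underlying[OF pdg_algebra_axioms M(1)] pdg_module_underlying[OF pdg_algebra_axioms M(2)]
      pdg_hom_underlying[OF f] pdg_hom_underlying, of g]
      homotopic_underlying[OF pdg_algebra_axioms M, of f g] by (auto simp: hclass_def)
  then have "(\<Union>g\<in>hclass A M N f. hclass (ground :: ('k, 'k) pdg_alg) (underlying A M) (underlying A N) g)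
    = (\<Union>g\<in>hclass A M N f. hclass (ground :: ('k, 'k) pdg_alg) (underlying A M) (underlying A N) f)"
    by (intro SUP_cong refl)
  then show ?thesis using mem_hclass[OF M f] by blast
qed

lemma is_iso_hclass:
  assumes M: "pdg_module A M" "pdg_module A N" and f: "f \<in> pdg_hom M N"
  shows "is_iso (homotopy_cat A) M N (hclass A M N f) \<longleftrightarrow> heq A M N f"
proof -
  have "cmp (homotopy_cat A) M N M (hclass A N M g) (hclass A M N f) = ident (homotopy_cat A) M \<longleftrightarrow> homotopic A M M (\<lambda>x. g (f x)) (\<lambda>x. x)"
    "cmp (homotopy_cat A) N M N (hclass A M N f) (hclass A N M g) = ident (homotopy_cat A) N \<longleftrightarrow> homotopic A N N (\<lambda>x. f (g x)) (\<lambda>x. x)"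
    if g: "g \<in> pdg_hom N M" for g
    using cmp_hclass[OF M(1,2,1) f g] cmp_hclass[OF M(2,1,2) g f] hclass_eq_iff[OF M(1,1) pdg_hom_comp[OF f g] pdg_hom_ident]
      hclass_eq_iff[OF M(2,2) pdg_hom_comp[OF g f] pdg_hom_ident] by (auto simp: homotopy_cat_simps)
  then show ?thesis
    unfolding is_iso_def heq_def using M f by (auto simp: homotopy_cat_simps)
qed

lemma qis_iff:
  assumes M: "pdg_module A M" "pdg_module A N" and f: "f \<in> pdg_hom M N"
  shows "qis A M N (hclass A M N f) \<longleftrightarrow> kheq A M N f"
proof -
  interpret G: pdg_category "ground :: ('k, 'k) pdg_alg" by (intro pdg_category.intro pdg_algebra_ground[OF pdg_algebra_axioms])
  show ?thesis
    unfolding qis_def union_hclass_underlying[OF M f] kheq_def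
    using f G.is_iso_hclass[OF pdg_module_underlying[OF pdg_algebra_axioms M(1)] pdg_module_underlying[OF pdg_algebra_axioms M(2)]
      pdg_hom_underlying[OF f]] by simp
qed

lemma kheq_comp:
  assumes M: "pdg_module A L" "pdg_module A M" "pdg_module A N" and "kheq A L M f" "kheq A M N g"
  shows "kheq A L N (\<lambda>x. g (f x))"
  using assms heq_comp[OF pdg_algebra_ground[OF pdg_algebra_axioms] pdg_module_underlying[OF pdg_algebra_axioms M(1)]
     pdg_module_underlying[OF pdg_algebra_axioms M(2)] pdg_module_underlying[OF pdg_algebra_axioms M(3)], of f g]
  unfolding kheq_def by (auto intro: pdg_hom_comp)

lemma kheq_ident: "pdg_module A M \<Longrightarrow> kheq A M M (\<lambda>x. x)"
  unfolding kheq_def using heq_underlying[OF pdg_algebra_axioms _ _ heq_ident[OF pdg_algebra_axioms]] pdg_hom_ident by blast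

lemma ore_homotopy_cat:
  "ore_category (homotopy_cat A :: (('r, ('a, 'x) univ) pdg_mod, _) cat) (qis A)"
proof (intro ore_category.intro category_homotopy_cat ore_category_axioms.intro)
  fix X :: "('r, ('a, 'x) univ) pdg_mod" assume "X \<in> Ob (homotopy_cat A)"
  then show "qis A X X (ident (homotopy_cat A) X)"
    by (simp add: homotopy_cat_simps qis_iff pdg_hom_ident kheq_ident)
next
  fix X Y Z :: "('r, ('a, 'x) univ) pdg_mod" and s t
  assume O: "X \<in> Ob (homotopy_cat A)" "Y \<in> Ob (homotopy_cat A)" "Z \<in> Ob (homotopy_cat A)"
    and s: "s \<in> Hom (homotopy_cat A) X Y" and t: "t \<in> Hom (homotopy_cat A) Y Z" and q: "qis A X Y s" "qis A Y Z t"
  obtain s' t' where *: "s = hclass A X Y s'" "t = hclass A Y Z t'" "s' \<in> pdg_hom X Y" "t' \<in> pdg_hom Y Z"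
    using s t by (auto simp: homotopy_cat_simps)
  note O' = O[unfolded homotopy_cat_simps mem_Collect_eq]
  show "qis A X Z (cmp (homotopy_cat A) X Y Z t s)"
    using q * O' qis_iff[OF O'(1,3) pdg_hom_comp[OF *(3,4)]] qis_iff[OF O'(1,2) *(3)] qis_iff[OF O'(2,3) *(4)] kheq_comp[OF O']
    by (simp add: cmp_hclass[OF O' *(3,4)])
next
  fix X Y Z :: "('r, ('a, 'x) univ) pdg_mod" and f s
  assume O: "X \<in> Ob (homotopy_cat A)" "Y \<in> Ob (homotopy_cat A)" "Z \<in> Ob (homotopy_cat A)"
    and f: "f \<in> Hom (homotopy_cat A) X Y" and s: "s \<in> Hom (homotopy_cat A) Z Y" and q: "qis A Z Y s"
  obtain s' f' where *: "s = hclass A Z Y s'" "f = hclass A X Y f'" "s' \<in> pdg_hom Z Y" "f' \<in> pdg_hom X Y"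
    using s f by (auto simp: homotopy_cat_simps)
  note O' = O[unfolded homotopy_cat_simps mem_Collect_eq]
  have "kheq A Z Y s'" using q qis_iff[OF O'(3,2) *(3)] *(1) by simp
  from ore_fibration[OF pdg_algebra_axioms O' *(4) this]
  obtain W :: "('r, ('a, 'x) univ) pdg_mod" and w g where W: "pdg_module A W" "saf A W X w" "g \<in> pdg_hom W Z" "homotopic A W Y (\<lambda>z. s' (g z)) (\<lambda>z. f' (w z))"
    by blast
  have w: "w \<in> pdg_hom W X" using W(2) by (simp add: saf_def)
  have "qis A W X (hclass A W X w)"
    using qis_iff[OF W(1) O'(1) w] saf_kheq[OF pdg_algebra_axioms W(1) O'(1) W(2)] by simp
  moreover have "cmp (homotopy_cat A) W Z Y s (hclass A W Z g) = cmp (homotopy_cat A) W X Y f (hclass A W X w)"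
    unfolding * cmp_hclass[OF W(1) O'(3,2) W(3) *(3)] cmp_hclass[OF W(1) O'(1,2) w *(4)]
    using hclass_eq_iff[OF W(1) O'(2) pdg_hom_comp[OF W(3) *(3)] pdg_hom_comp[OF w *(4)]] W(4) by simp
  ultimately show "\<exists>V w g. V \<in> Ob (homotopy_cat A) \<and> w \<in> Hom (homotopy_cat A) V X \<and> qis A V X w \<and> g \<in> Hom (homotopy_cat A) V Z \<and>
    cmp (homotopy_cat A) V Z Y s g = cmp (homotopy_cat A) V X Y f w"
    using W(1,3) w
    by (intro exI[of _ W] exI[of _ "hclass A W X w"] exI[of _ "hclass A W Z g"]) (simp add: homotopy_cat_simps)
qed

section \<open>Cofibrant modules\<close>

definition lifts :: "('r, ('a, 'x) univ) pdg_mod \<Rightarrow> bool" where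
  "lifts Q \<longleftrightarrow> pdg_module A Q \<and>
    (\<forall>(W :: ('r, ('a, 'x) univ) pdg_mod) w. pdg_module A W \<longrightarrow> saf A W Q w \<longrightarrow> (\<exists>\<sigma>\<in>pdg_hom Q W. \<forall>x\<in>carrier Q. w (\<sigma> x) = x))"

text \<open>Completing \<open>x\<close> and \<open>s\<close> to an Ore square gives a fibration that
  ends in \<open>Q\<close> and hence has a section; the section followed by the other leg of the
  square is the lift.\<close>

lemma lift_through_kheq:
  fixes Q Y M :: "('r, ('a, 'x) univ) pdg_mod"
  assumes Q: "lifts Q" and M: "pdg_module A Y" "pdg_module A M" and s: "kheq A Y M s" and x: "x \<in> pdg_hom Q M"
  shows "\<exists>y\<in>pdg_hom Q Y. homotopic A Q M (\<lambda>q. s (y q)) x"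
proof -
  have QM: "pdg_module A Q" using Q by (simp add: lifts_def)
  interpret QMp: pdg_module_pair A Q M by (rule pair[OF QM M(2)])
  have sm: "s \<in> pdg_hom Y M" using s by (simp add: kheq_def)
  obtain W :: "('r, ('a, 'x) univ) pdg_mod" and w g where W: "pdg_module A W" "saf A W Q w" "g \<in> pdg_hom W Y" "homotopic A W M (\<lambda>z. s (g z)) (\<lambda>z. x (w z))"
    using ore_fibration[OF pdg_algebra_axioms QM M(2,1) x s] by blast
  obtain \<sigma> where \<sigma>: "\<sigma> \<in> pdg_hom Q W" "\<And>q. q \<in> carrier Q \<Longrightarrow> w (\<sigma> q) = q"
    using Q W(1,2) unfolding lifts_def by blast
  have w: "w \<in> pdg_hom W Q" using W(2) by (simp add: saf_def)
  have 1: "homotopic A Q M (\<lambda>q. s (g (\<sigma> q))) (\<lambda>q. x (w (\<sigma> q)))"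
    by (rule homotopic_precomp[OF pdg_algebra_axioms W(1) M(2) QM \<sigma>(1) W(4)])
  have 2: "homotopic A Q M (\<lambda>q. x (w (\<sigma> q))) x"
    by (rule QMp.homotopicI_eq[OF pdg_hom_comp[OF pdg_hom_comp[OF \<sigma>(1) w] x]]) (simp add: \<sigma>(2))
  have "homotopic A Q M (\<lambda>q. s (g (\<sigma> q))) x"
    by (rule QMp.homotopic_trans[OF pdg_hom_comp[OF pdg_hom_comp[OF \<sigma>(1) W(3)] sm] pdg_hom_comp[OF pdg_hom_comp[OF \<sigma>(1) w] x] x 1 2])
  then show ?thesis using pdg_hom_comp[OF \<sigma>(1) W(3)] by (intro bexI[of _ "\<lambda>q. g (\<sigma> q)"])
qed

definition zmod :: "('r, ('a, 'x) univ) pdg_mod" where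
  "zmod = tower A [] (\<lambda>_ x. x)"

lemma pdg_module_zmod: "pdg_module A zmod"
proof -
  interpret pdg_tower A "[]" "\<lambda>_ x. x" by unfold_locales auto
  show ?thesis unfolding zmod_def by (rule pdg_module_tower)
qed

lemma carrier_zmod: "carrier zmod = {\<zero>\<^bsub>zmod\<^esub>}"
  by (auto simp: zmod_def tower_def)

text \<open>If \<open>s \<circ> y\<close> is null-homotopic then \<open>y\<close> factors through the homotopy kernel \<open>K\<close> of \<open>s\<close>, and the
  inclusion of 0 into \<open>K\<close> is inverted, so that \<open>y\<close> lifts to 0.\<close>

lemma null_of_kheq:
  fixes Q Y M :: "('r, ('a, 'x) univ) pdg_mod"
  assumes Q: "lifts Q" and M: "pdg_module A Y" "pdg_module A M" and s: "kheq A Y M s" and y: "y \<in> pdg_hom Q Y"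
    and null: "null_homotopic A Q M (\<lambda>q. s (y q))"
  shows "null_homotopic A Q Y y"
proof -
  have QM: "pdg_module A Q" using Q by (simp add: lifts_def)
  let ?O = "zmod :: ('r, ('a, 'x) univ) pdg_mod"
  have OM: "pdg_module A ?O" by (rule pdg_module_zmod)
  from fibrant_replacement[OF pdg_algebra_axioms M(2,1) s]
  obtain E :: "('r, ('a, 'x) univ) pdg_mod" and s' \<sigma> G pr where E: "pdg_module A E" "s' \<in> pdg_hom E M"
     "\<sigma> \<in> gr_hom 0 M E" "\<forall>y\<in>carrier M. s' (\<sigma> y) = y"
     "contraction (ground :: ('k, 'k) pdg_alg) (underlying A E) (underlying A M) s' G"
     "pr \<in> pdg_hom E Y" "\<forall>(Q :: ('r, ('a, 'x) univ) pdg_mod). \<forall>y\<in>pdg_hom Q Y. pdg_module A Q \<longrightarrow>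
        null_homotopic A Q M (\<lambda>x. s (y x)) \<longrightarrow>
        (\<exists>\<kappa>\<in>pdg_hom Q E. \<forall>x\<in>carrier Q. s' (\<kappa> x) = \<zero>\<^bsub>M\<^esub> \<and> pr (\<kappa> x) = y x)"
    by (elim exE conjE) (rule that; assumption)
  obtain \<kappa> where \<kappa>: "\<kappa> \<in> pdg_hom Q E" "\<And>x. x \<in> carrier Q \<Longrightarrow> s' (\<kappa> x) = \<zero>\<^bsub>M\<^esub>" "\<And>x. x \<in> carrier Q \<Longrightarrow> pr (\<kappa> x) = y x"
    using E(7)[rule_format, OF y QM null] by blast
  let ?z = "\<lambda>_ :: ('a, 'x) univ. \<zero>\<^bsub>M\<^esub>"
  have z: "?z \<in> pdg_hom ?O M" by (rule pdg_module_pair.zero_pdg_hom[OF pair[OF OM M(2)]])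
  interpret K: pdg_pullback A ?O E M ?z s'
    by (intro pdg_pullback.intro pdg_pullback_axioms.intro pdg_algebra_axioms OM E M z)
  let ?K = "pullb ?O E ?z s'"
  have KM: "pdg_module A ?K" by (rule K.pdg_module_W)
  have "kheq A ?K ?O (\<lambda>z. entries z ! 0)"
    by (rule saf_kheq[OF pdg_algebra_axioms KM OM pullback_saf[OF pdg_algebra_axioms OM M(2) E(1) z E(2,3) bspec[OF E(4)] E(5)]])
  then obtain g where w: "(\<lambda>z. entries z ! 0) \<in> pdg_hom (underlying A ?K) (underlying A ?O)"
    and g: "g \<in> pdg_hom (underlying A ?O) (underlying A ?K)"
    "homotopic (ground :: ('k, 'k) pdg_alg) (underlying A ?K) (underlying A ?K) (\<lambda>x. g (entries x ! 0)) (\<lambda>x. x)"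
    "homotopic (ground :: ('k, 'k) pdg_alg) (underlying A ?O) (underlying A ?O) (\<lambda>x. entries (g x) ! 0) (\<lambda>x. x)"
    unfolding kheq_def heq_def by blast
  have z0: "(\<lambda>_. \<zero>\<^bsub>?K\<^esub>) \<in> pdg_hom ?O ?K" by (rule pdg_module_pair.zero_pdg_hom[OF pair[OF OM KM]])
  have "g \<zero>\<^bsub>?O\<^esub> = \<zero>\<^bsub>?K\<^esub>"
    using addmap_zero[OF pdg_module.axioms(1)[OF pdg_module_underlying[OF pdg_algebra_axioms OM]]
      pdg_module.axioms(1)[OF pdg_module_underlying[OF pdg_algebra_axioms KM]] pdg_hom_addmap[OF g(1)]]
    by (simp only: underlying_simps)
  then have g0: "g x = \<zero>\<^bsub>?K\<^esub>" if "x \<in> carrier ?O" for x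
    using that by (auto simp: carrier_zmod simp del: K.W_ops)
  have "heq (ground :: ('k, 'k) pdg_alg) (underlying A ?O) (underlying A ?K) g"
    by (rule heqI[OF g(1) w g(3,2)])
  \<comment> \<open>A homotopy inverse of the projection to the zero module takes only the value
    zero, so it can be exchanged for the zero map, which is linear over the algebra.\<close>
  then have kz: "kheq A ?O ?K (\<lambda>_. \<zero>\<^bsub>?K\<^esub>)"
    unfolding kheq_def
    using z0 heq_homotopic[OF pdg_algebra_ground[OF pdg_algebra_axioms] pdg_module_underlying[OF pdg_algebra_axioms OM]
      pdg_module_underlying[OF pdg_algebra_axioms KM] _ pdg_hom_underlying[OF z0], of g]
      pdg_module_pair.homotopicI_eq[OF pdg_module_pair.intro[OF pdg_algebra_ground[OF pdg_algebra_axioms] pdg_module_underlying[OF pdg_algebra_axioms OM]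
      pdg_module_underlying[OF pdg_algebra_axioms KM]] g(1)] g0 by (auto simp del: K.W_ops)
  have \<kappa>': "(\<lambda>x. Tuple [\<zero>\<^bsub>?O\<^esub>, \<kappa> x]) \<in> pdg_hom Q ?K"
    by (rule K.W_pair[OF pdg_module_pair.zero_pdg_hom[OF pair[OF QM OM]] \<kappa>(1) _ QM]) (simp add: \<kappa>(2))
  \<comment> \<open>A lift to the zero module becomes the zero map in \<open>?K\<close>, so the map
    with entries zero and \<open>\<kappa> x\<close> is homotopic to zero.\<close>
  obtain y' where "homotopic A Q ?K (\<lambda>q. \<zero>\<^bsub>?K\<^esub>) (\<lambda>x. Tuple [\<zero>\<^bsub>?O\<^esub>, \<kappa> x])"
    using lift_through_kheq[OF Q OM KM kz \<kappa>'] by blast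
  from homotopic_postcomp[OF pdg_algebra_axioms QM KM M(1) pdg_hom_comp[OF K.W_snd E(6)] _ \<kappa>' this]
  have "homotopic A Q Y (\<lambda>q. pr (entries \<zero>\<^bsub>?K\<^esub> ! 1)) (\<lambda>x. pr (\<kappa> x))"
    using pdg_module_pair.zero_pdg_hom[OF pair[OF QM KM]] by simp
  moreover have "pr (entries \<zero>\<^bsub>?K\<^esub> ! 1) = \<zero>\<^bsub>Y\<^esub>"
    using addmap_zero[OF _ _ pdg_hom_addmap[OF E(6)]] E(1) M(1) by (simp add: pdg_module_def)
  ultimately have h: "homotopic A Q Y (\<lambda>q. \<zero>\<^bsub>Y\<^esub>) (\<lambda>x. pr (\<kappa> x))" by simp
  interpret QY: pdg_module_pair A Q Y by (rule pair[OF QM M(1)])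
  have "homotopic A Q Y (\<lambda>x. pr (\<kappa> x)) (\<lambda>q. \<zero>\<^bsub>Y\<^esub>)"
    by (rule QY.homotopic_sym[OF QY.zero_pdg_hom pdg_hom_comp[OF \<kappa>(1) E(6)] h])
  then show ?thesis
    unfolding homotopic_def
    by (rule iffD1[OF QY.null_homotopic_cong, rotated]) (simp add: \<kappa>(3) pdg_hom_closed[OF y])
qed

text \<open>Surjectivity is the lifting property, and injectivity is the statement on
  null-homotopies applied to a difference of two maps.\<close>

lemma local_of_lifts:
  fixes Q :: "('r, ('a, 'x) univ) pdg_mod"
  assumes Q: "lifts Q"
  shows "local_object (homotopy_cat A) (qis A) Q"
proof (intro local_object.intro category_homotopy_cat local_object_axioms.intro)
  have QM: "pdg_module A Q" using Q by (simp add: lifts_def)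
  then show "Q \<in> Ob (homotopy_cat A)" by (simp add: homotopy_cat_simps)
  fix Y M :: "('r, ('a, 'x) univ) pdg_mod" and s
  assume O: "Y \<in> Ob (homotopy_cat A)" "M \<in> Ob (homotopy_cat A)" and s: "s \<in> Hom (homotopy_cat A) Y M" and q: "qis A Y M s"
  note O' = O[unfolded homotopy_cat_simps mem_Collect_eq]
  obtain s' where s': "s = hclass A Y M s'" "s' \<in> pdg_hom Y M" using s by (auto simp: homotopy_cat_simps)
  have k: "kheq A Y M s'" using q qis_iff[OF O' s'(2)] s'(1) by simp
  have cm: "cmp (homotopy_cat A) Q Y M s (hclass A Q Y y) = hclass A Q M (\<lambda>q. s' (y q))" if "y \<in> pdg_hom Q Y" for y
    unfolding s'(1) by (rule cmp_hclass[OF QM O' that s'(2)])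
  interpret QY: pdg_module_pair A Q Y by (rule pair[OF QM O'(1)])
  interpret QMp: pdg_module_pair A Q M by (rule pair[OF QM O'(2)])
  show "bij_betw (cmp (homotopy_cat A) Q Y M s) (Hom (homotopy_cat A) Q Y) (Hom (homotopy_cat A) Q M)"
    unfolding bij_betw_def
  proof (intro conjI equalityI subsetI)
    show "inj_on (cmp (homotopy_cat A) Q Y M s) (Hom (homotopy_cat A) Q Y)"
    proof (rule inj_onI)
      fix a b assume "a \<in> Hom (homotopy_cat A) Q Y" "b \<in> Hom (homotopy_cat A) Q Y"
        and eq: "cmp (homotopy_cat A) Q Y M s a = cmp (homotopy_cat A) Q Y M s b"
      then obtain a' b' where ab: "a = hclass A Q Y a'" "a' \<in> pdg_hom Q Y" "b = hclass A Q Y b'" "b' \<in> pdg_hom Q Y"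
        by (auto simp: homotopy_cat_simps)
      have "homotopic A Q M (\<lambda>q. s' (a' q)) (\<lambda>q. s' (b' q))"
        using eq ab cm hclass_eq_iff[OF QM O'(2) pdg_hom_comp[OF ab(2) s'(2)] pdg_hom_comp[OF ab(4) s'(2)]] by simp
      then have "null_homotopic A Q M (\<lambda>q. s' (a' q \<ominus>\<^bsub>Y\<^esub> b' q))"
        unfolding homotopic_def
        by (rule iffD1[OF QMp.null_homotopic_cong, rotated])
          (simp add: addmap_sub[OF QY.N.abelian_group_axioms QMp.N.abelian_group_axioms pdg_hom_addmap[OF s'(2)]]
             pdg_hom_closed[OF ab(2)] pdg_hom_closed[OF ab(4)])
      then have "homotopic A Q Y a' b'"
        unfolding homotopic_def by (rule null_of_kheq[OF Q O' k QY.sub_pdg_hom[OF ab(2,4)]])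
      then show "a = b" using ab hclass_eq_iff[OF QM O'(1) ab(2,4)] by simp
    qed
  next
    fix m assume "m \<in> cmp (homotopy_cat A) Q Y M s ` Hom (homotopy_cat A) Q Y"
    then show "m \<in> Hom (homotopy_cat A) Q M"
      using category.cmp_in[OF category_homotopy_cat _ O _ s] QM by (auto simp: homotopy_cat_simps)
  next
    fix m assume "m \<in> Hom (homotopy_cat A) Q M"
    then obtain x where x: "m = hclass A Q M x" "x \<in> pdg_hom Q M" by (auto simp: homotopy_cat_simps)
    obtain y where y: "y \<in> pdg_hom Q Y" "homotopic A Q M (\<lambda>q. s' (y q)) x"
      using lift_through_kheq[OF Q O' k x(2)] by blast
    have "m = cmp (homotopy_cat A) Q Y M s (hclass A Q Y y)"
      unfolding cm[OF y(1)] x(1) using hclass_eq_iff[OF QM O'(2) pdg_hom_comp[OF y(1) s'(2)] x(2)] y(2) by simp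
    then show "m \<in> cmp (homotopy_cat A) Q Y M s ` Hom (homotopy_cat A) Q Y"
      using y(1) by (auto simp: homotopy_cat_simps)
  qed
qed

end

context pdg_module_pair begin

lemma finsum_pdg_hom:
  assumes "finite S" "\<And>j. j \<in> S \<Longrightarrow> x j \<in> pdg_hom M N"
  shows "(\<lambda>q. \<Oplus>\<^bsub>N\<^esub>j\<in>S. x j q) \<in> pdg_hom M N"
  using assms
proof (induction S rule: finite_induct)
  case empty
  then show ?case using zero_pdg_hom by simp
next
  case (insert i S)
  have "(\<lambda>q. x i q \<oplus>\<^bsub>N\<^esub> (\<Oplus>\<^bsub>N\<^esub>j\<in>S. x j q)) \<in> pdg_hom M N"
    using insert by (intro add_pdg_hom) auto
  moreover have "(\<Oplus>\<^bsub>N\<^esub>j\<in>insert i S. x j q) = x i q \<oplus>\<^bsub>N\<^esub> (\<Oplus>\<^bsub>N\<^esub>j\<in>S. x j q)" if "q \<in> carrier M" for q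
    using insert.hyps insert.prems pdg_hom_closed[OF insert.prems that] by (intro N.finsum_insert) auto
  ultimately show ?case
    unfolding pdg_hom_def gr_hom_def
    using M.a_closed M.smult_closed M.dif_closed M.grade_carrier by (auto simp: Pi_iff)
qed

lemma homotopic_finsum:
  assumes "finite S" "\<And>j. j \<in> S \<Longrightarrow> x j \<in> pdg_hom M N" "\<And>j. j \<in> S \<Longrightarrow> y j \<in> pdg_hom M N"
    "\<And>j. j \<in> S \<Longrightarrow> homotopic A M N (x j) (y j)"
  shows "homotopic A M N (\<lambda>q. \<Oplus>\<^bsub>N\<^esub>j\<in>S. x j q) (\<lambda>q. \<Oplus>\<^bsub>N\<^esub>j\<in>S. y j q)"
  using assms
proof (induction S rule: finite_induct)
  case empty
  then show ?case using homotopic_refl[OF zero_pdg_hom] by simp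
next
  case (insert i S)
  have "homotopic A M N (\<lambda>q. x i q \<oplus>\<^bsub>N\<^esub> (\<Oplus>\<^bsub>N\<^esub>j\<in>S. x j q)) (\<lambda>q. y i q \<oplus>\<^bsub>N\<^esub> (\<Oplus>\<^bsub>N\<^esub>j\<in>S. y j q))"
    using insert by (intro homotopic_add finsum_pdg_hom) auto
  moreover have "(\<Oplus>\<^bsub>N\<^esub>j\<in>insert i S. x j q) = x i q \<oplus>\<^bsub>N\<^esub> (\<Oplus>\<^bsub>N\<^esub>j\<in>S. x j q)" if "q \<in> carrier M" for q
    using insert.hyps pdg_hom_closed[OF insert.prems(1) that] by (intro N.finsum_insert) auto
  moreover have "(\<Oplus>\<^bsub>N\<^esub>j\<in>insert i S. y j q) = y i q \<oplus>\<^bsub>N\<^esub> (\<Oplus>\<^bsub>N\<^esub>j\<in>S. y j q)" if "q \<in> carrier M" for q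
    using insert.hyps pdg_hom_closed[OF insert.prems(2) that] by (intro N.finsum_insert) auto
  ultimately show ?case
    unfolding homotopic_def by (rule_tac iffD1[OF null_homotopic_cong, rotated]) auto
qed

end

section \<open>Compactness\<close>

lemma is_coproduct_factor:
  assumes "is_coproduct C J N X \<iota>" "Y \<in> Ob C" "\<forall>j\<in>J. g j \<in> Hom C (N j) Y"
  shows "\<exists>m. m \<in> Hom C X Y \<and> (\<forall>j\<in>J. cmp C (N j) X Y m (\<iota> j) = g j)"
proof -
  have "\<exists>!m. m \<in> Hom C X Y \<and> (\<forall>j\<in>J. cmp C (N j) X Y m (\<iota> j) = g j)"
    using assms(1-3) unfolding is_coproduct_def by simp
  then show ?thesis by (rule ex1_implies_ex)
qed

lemma is_coproduct_unique:
  assumes "is_coproduct C J N X \<iota>" "Y \<in> Ob C" "\<forall>j\<in>J. g j \<in> Hom C (N j) Y"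
    and m: "m \<in> Hom C X Y" "\<forall>j\<in>J. cmp C (N j) X Y m (\<iota> j) = g j"
    and m': "m' \<in> Hom C X Y" "\<forall>j\<in>J. cmp C (N j) X Y m' (\<iota> j) = g j"
  shows "m = m'"
proof -
  have "\<exists>!m. m \<in> Hom C X Y \<and> (\<forall>j\<in>J. cmp C (N j) X Y m (\<iota> j) = g j)"
    using assms(1-3) unfolding is_coproduct_def by simp
  then show ?thesis by (elim ex1E) (metis m m')
qed

locale cofibrant = pdg_category A
  for A :: "('k::field, 'r::{ring, monoid_mult}) pdg_alg" +
  fixes Q :: "('r, ('a, 'x) univ) pdg_mod"
  assumes lifts: "lifts Q"
begin

sublocale L: local_object "homotopy_cat A" "qis A" Q
  by (rule local_of_lifts[OF lifts])

lemma Q_module: "pdg_module A Q" using lifts by (simp add: lifts_def)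

lemma acts_hclass:
  assumes "zigzag (homotopy_cat A) (qis A) X a Z" "x \<in> pdg_hom Q X"
  shows "\<exists>z\<in>pdg_hom Q Z. L.acts a (hclass A Q X x) = hclass A Q Z z"
  using L.acts_in[OF assms(1), of "hclass A Q X x"] assms(2) by (auto simp: homotopy_cat_simps)

text \<open>A zigzag acts by additive maps and inverses of additive bijections, hence respects
  finite sums. The action is defined on homotopy classes, so at each backward step new
  representatives \<open>y j\<close> are chosen before they are added.\<close>

lemma acts_sum:
  assumes "zigzag (homotopy_cat A) (qis A) X a Z" "finite S"
    "\<And>j. j \<in> S \<Longrightarrow> x j \<in> pdg_hom Q X" "\<And>j. j \<in> S \<Longrightarrow> z j \<in> pdg_hom Q Z"
    "\<And>j. j \<in> S \<Longrightarrow> L.acts a (hclass A Q X (x j)) = hclass A Q Z (z j)"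
  shows "L.acts a (hclass A Q X (\<lambda>q. \<Oplus>\<^bsub>X\<^esub>j\<in>S. x j q)) = hclass A Q Z (\<lambda>q. \<Oplus>\<^bsub>Z\<^esub>j\<in>S. z j q)"
  using assms
proof (induction arbitrary: x rule: zigzag.induct)
  case (zz_Nil X)
  have X: "pdg_module A X" using zz_Nil(1) by (simp add: homotopy_cat_simps)
  interpret QX: pdg_module_pair A Q X by (rule pair[OF Q_module X])
  have hz: "homotopic A Q X (x j) (z j)" if "j \<in> S" for j
    using zz_Nil(3,4,5)[OF that] hclass_eq_iff[OF Q_module X] by simp
  have "homotopic A Q X (\<lambda>q. \<Oplus>\<^bsub>X\<^esub>j\<in>S. x j q) (\<lambda>q. \<Oplus>\<^bsub>X\<^esub>j\<in>S. z j q)"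
    by (rule QX.homotopic_finsum[OF zz_Nil(2-4) hz])
  then show ?case
    using hclass_eq_iff[OF Q_module X QX.finsum_pdg_hom[OF zz_Nil(2,3)] QX.finsum_pdg_hom[OF zz_Nil(2,4)]] by simp
next
  case (zz_Fwd X F Y a Z)
  have M: "pdg_module A X" "pdg_module A Y" "pdg_module A Z"
    using zz_Fwd(1) zigzag_Ob[OF zz_Fwd(3)] by (auto simp: homotopy_cat_simps)
  interpret QX: pdg_module_pair A Q X by (rule pair[OF Q_module M(1)])
  interpret QY: pdg_module_pair A Q Y by (rule pair[OF Q_module M(2)])
  obtain f where f: "F = hclass A X Y f" "f \<in> pdg_hom X Y" using zz_Fwd(2) by (auto simp: homotopy_cat_simps)
  have c: "cmp (homotopy_cat A) Q X Y F (hclass A Q X y) = hclass A Q Y (\<lambda>q. f (y q))" if "y \<in> pdg_hom Q X" for y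
    unfolding f(1) by (rule cmp_hclass[OF Q_module M(1,2) that f(2)])
  have "f (\<Oplus>\<^bsub>X\<^esub>j\<in>S. x j q) = (\<Oplus>\<^bsub>Y\<^esub>j\<in>S. f (x j q))" if q: "q \<in> carrier Q" for q
    using pdg_hom_closed[OF zz_Fwd(6) q]
    by (intro addmap_finsum[OF QX.N.abelian_group_axioms QY.N.abelian_group_axioms pdg_hom_addmap[OF f(2)]]) auto
  then have "hclass A Q Y (\<lambda>q. f (\<Oplus>\<^bsub>X\<^esub>j\<in>S. x j q)) = hclass A Q Y (\<lambda>q. \<Oplus>\<^bsub>Y\<^esub>j\<in>S. f (x j q))"
    using QX.finsum_pdg_hom[OF zz_Fwd(5,6)] QY.finsum_pdg_hom[OF zz_Fwd(5) pdg_hom_comp[OF zz_Fwd(6) f(2)]]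
    by (subst hclass_eq_iff[OF Q_module M(2)]) (auto intro!: QY.homotopicI_eq pdg_hom_comp[OF _ f(2)])
  moreover have "L.acts a (hclass A Q Y (\<lambda>q. \<Oplus>\<^bsub>Y\<^esub>j\<in>S. f (x j q))) = hclass A Q Z (\<lambda>q. \<Oplus>\<^bsub>Z\<^esub>j\<in>S. z j q)"
    using zz_Fwd(8) c zz_Fwd(6) by (intro zz_Fwd.IH[OF zz_Fwd(5) pdg_hom_comp[OF zz_Fwd(6) f(2)] zz_Fwd(7)]) auto
  ultimately show ?case using c[OF QX.finsum_pdg_hom[OF zz_Fwd(5,6)]] by simp
next
  case (zz_Bwd X F Y a Z)
  have M: "pdg_module A X" "pdg_module A Y" "pdg_module A Z"
    using zz_Bwd(1) zigzag_Ob[OF zz_Bwd(4)] by (auto simp: homotopy_cat_simps)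
  have O: "X \<in> Ob (homotopy_cat A)" "Y \<in> Ob (homotopy_cat A)" using M by (auto simp: homotopy_cat_simps)
  interpret QX: pdg_module_pair A Q X by (rule pair[OF Q_module M(1)])
  interpret QY: pdg_module_pair A Q Y by (rule pair[OF Q_module M(2)])
  obtain f where f: "F = hclass A Y X f" "f \<in> pdg_hom Y X" using zz_Bwd(2) by (auto simp: homotopy_cat_simps)
  have c: "cmp (homotopy_cat A) Q Y X F (hclass A Q Y y) = hclass A Q X (\<lambda>q. f (y q))" if "y \<in> pdg_hom Q Y" for y
    unfolding f(1) by (rule cmp_hclass[OF Q_module M(2,1) that f(2)])
  have "\<exists>y\<in>pdg_hom Q Y. L.act1 (Bwd X F Y) (hclass A Q X (x j)) = hclass A Q Y y \<and> homotopic A Q X (\<lambda>q. f (y q)) (x j)" if j: "j \<in> S" for j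
  proof -
    have xj: "hclass A Q X (x j) \<in> Hom (homotopy_cat A) Q X" using zz_Bwd(7)[OF j] by (simp add: homotopy_cat_simps)
    obtain y where y: "y \<in> pdg_hom Q Y" "L.act1 (Bwd X F Y) (hclass A Q X (x j)) = hclass A Q Y y"
      using L.act1_Bwd(1)[OF O zz_Bwd(2,3) xj] by (auto simp: homotopy_cat_simps)
    have "hclass A Q X (\<lambda>q. f (y q)) = hclass A Q X (x j)"
      using L.act1_Bwd(2)[OF O zz_Bwd(2,3) xj] y c[OF y(1)] by simp
    then show ?thesis using y hclass_eq_iff[OF Q_module M(1) pdg_hom_comp[OF y(1) f(2)] zz_Bwd(7)[OF j]] by auto
  qed
  then obtain y where y: "\<And>j. j \<in> S \<Longrightarrow> y j \<in> pdg_hom Q Y"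
    "\<And>j. j \<in> S \<Longrightarrow> L.act1 (Bwd X F Y) (hclass A Q X (x j)) = hclass A Q Y (y j)"
    "\<And>j. j \<in> S \<Longrightarrow> homotopic A Q X (\<lambda>q. f (y j q)) (x j)" by metis
  have sy: "(\<lambda>q. \<Oplus>\<^bsub>Y\<^esub>j\<in>S. y j q) \<in> pdg_hom Q Y"
    by (rule QY.finsum_pdg_hom[OF zz_Bwd(6)]) (rule y(1))
  have sfy: "(\<lambda>q. \<Oplus>\<^bsub>X\<^esub>j\<in>S. f (y j q)) \<in> pdg_hom Q X"
    by (rule QX.finsum_pdg_hom[OF zz_Bwd(6)]) (rule pdg_hom_comp[OF y(1) f(2)])
  have sx: "(\<lambda>q. \<Oplus>\<^bsub>X\<^esub>j\<in>S. x j q) \<in> pdg_hom Q X"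
    by (rule QX.finsum_pdg_hom[OF zz_Bwd(6)]) (rule zz_Bwd(7))
  have "f (\<Oplus>\<^bsub>Y\<^esub>j\<in>S. y j q) = (\<Oplus>\<^bsub>X\<^esub>j\<in>S. f (y j q))" if q: "q \<in> carrier Q" for q
    using pdg_hom_closed[OF y(1) q]
    by (intro addmap_finsum[OF QY.N.abelian_group_axioms QX.N.abelian_group_axioms pdg_hom_addmap[OF f(2)]]) auto
  then have "homotopic A Q X (\<lambda>q. f (\<Oplus>\<^bsub>Y\<^esub>j\<in>S. y j q)) (\<lambda>q. \<Oplus>\<^bsub>X\<^esub>j\<in>S. f (y j q))"
    by (intro QX.homotopicI_eq pdg_hom_comp[OF sy f(2)])
  moreover have "homotopic A Q X (\<lambda>q. \<Oplus>\<^bsub>X\<^esub>j\<in>S. f (y j q)) (\<lambda>q. \<Oplus>\<^bsub>X\<^esub>j\<in>S. x j q)"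
    by (rule QX.homotopic_finsum[OF zz_Bwd(6)]) (auto intro: pdg_hom_comp[OF y(1) f(2)] zz_Bwd(7) y(3))
  ultimately have "homotopic A Q X (\<lambda>q. f (\<Oplus>\<^bsub>Y\<^esub>j\<in>S. y j q)) (\<lambda>q. \<Oplus>\<^bsub>X\<^esub>j\<in>S. x j q)"
    by (rule QX.homotopic_trans[OF pdg_hom_comp[OF sy f(2)] sfy sx])
  then have "hclass A Q X (\<lambda>q. \<Oplus>\<^bsub>X\<^esub>j\<in>S. x j q) = cmp (homotopy_cat A) Q Y X F (hclass A Q Y (\<lambda>q. \<Oplus>\<^bsub>Y\<^esub>j\<in>S. y j q))"
    using c[OF sy] hclass_eq_iff[OF Q_module M(1) pdg_hom_comp[OF sy f(2)] sx] by simp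
  then have "L.act1 (Bwd X F Y) (hclass A Q X (\<lambda>q. \<Oplus>\<^bsub>X\<^esub>j\<in>S. x j q)) = hclass A Q Y (\<lambda>q. \<Oplus>\<^bsub>Y\<^esub>j\<in>S. y j q)"
    using L.act1_Bwd_cmp[OF O zz_Bwd(2,3)] sy by (simp add: homotopy_cat_simps del: L.act1.simps)
  moreover have "L.acts a (hclass A Q Y (\<lambda>q. \<Oplus>\<^bsub>Y\<^esub>j\<in>S. y j q)) = hclass A Q Z (\<lambda>q. \<Oplus>\<^bsub>Z\<^esub>j\<in>S. z j q)"
  proof (rule zz_Bwd.IH[OF zz_Bwd(6) y(1) zz_Bwd(8)])
    fix j assume j: "j \<in> S"
    show "L.acts a (hclass A Q Y (y j)) = hclass A Q Z (z j)"
      using zz_Bwd(9)[OF j] y(2)[OF j] by (simp del: L.act1.simps)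
  qed
  ultimately show ?case by (simp del: L.act1.simps)
qed

end

context pdg_category begin

text \<open>The direct sum has the existence part of the universal property of a coproduct in the derived
  category: calculus of fractions represents all given morphisms by roofs.\<close>

lemma dsum_extend:
  fixes J :: "('a, 'x) univ set" and N :: "('a, 'x) univ \<Rightarrow> ('r, ('a, 'x) univ) pdg_mod" and Y :: "('r, ('a, 'x) univ) pdg_mod"
  assumes N: "\<And>j. j \<in> J \<Longrightarrow> pdg_module A (N j)" and Y: "pdg_module A Y"
    and a: "\<And>j. j \<in> J \<Longrightarrow> zigzag (homotopy_cat A) (qis A) (N j) (a j) Y"
  shows "\<exists>q. zigzag (homotopy_cat A) (qis A) (dsum J N) q Y \<and>
    (\<forall>j\<in>J. loc_eq (homotopy_cat A) (qis A) (N j) Y (Fwd (N j) (hclass A (N j) (dsum J N) (pdg_dsum.dinc J N j)) (dsum J N) # q) (a j))"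
proof -
  let ?H = "homotopy_cat A :: (('r, ('a, 'x) univ) pdg_mod, _) cat"
  interpret O: ore_category ?H "qis A" by (rule ore_homotopy_cat)
  have "\<forall>j\<in>J. \<exists>V w g. pdg_module A V \<and> w \<in> pdg_hom V (N j) \<and> kheq A V (N j) w \<and> g \<in> pdg_hom V Y \<and>
     O.leq (N j) Y (a j) [Bwd (N j) (hclass A V (N j) w) V, Fwd V (hclass A V Y g) Y]"
  proof
    fix j assume j: "j \<in> J"
    obtain V w g where V: "pdg_module A V" "w \<in> Hom ?H V (N j)" "qis A V (N j) w" "g \<in> Hom ?H V Y"
      "O.leq (N j) Y (a j) [Bwd (N j) w V, Fwd V g Y]"
      using O.roof[OF a[OF j]] by (auto simp: homotopy_cat_simps(1))
    obtain w' g' where w: "w = hclass A V (N j) w'" "w' \<in> pdg_hom V (N j)" and g: "g = hclass A V Y g'" "g' \<in> pdg_hom V Y"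
      using V(2,4) by (auto simp: homotopy_cat_simps)
    have "kheq A V (N j) w'" using V(3) qis_iff[OF V(1) N[OF j] w(2)] w(1) by simp
    then show "\<exists>V w g. pdg_module A V \<and> w \<in> pdg_hom V (N j) \<and> kheq A V (N j) w \<and> g \<in> pdg_hom V Y \<and>
     O.leq (N j) Y (a j) [Bwd (N j) (hclass A V (N j) w) V, Fwd V (hclass A V Y g) Y]"
      using V(1,5) w g by blast
  qed
  from bchoice[OF this] obtain V where "\<forall>j\<in>J. \<exists>w g. pdg_module A (V j) \<and> w \<in> pdg_hom (V j) (N j) \<and> kheq A (V j) (N j) w \<and> g \<in> pdg_hom (V j) Y \<and>
     O.leq (N j) Y (a j) [Bwd (N j) (hclass A (V j) (N j) w) (V j), Fwd (V j) (hclass A (V j) Y g) Y]" by (elim exE)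
  from bchoice[OF this] obtain w where "\<forall>j\<in>J. \<exists>g. pdg_module A (V j) \<and> w j \<in> pdg_hom (V j) (N j) \<and> kheq A (V j) (N j) (w j) \<and> g \<in> pdg_hom (V j) Y \<and>
     O.leq (N j) Y (a j) [Bwd (N j) (hclass A (V j) (N j) (w j)) (V j), Fwd (V j) (hclass A (V j) Y g) Y]" by (elim exE)
  from bchoice[OF this] obtain g where roofs: "\<forall>j\<in>J. pdg_module A (V j) \<and> w j \<in> pdg_hom (V j) (N j) \<and>
     kheq A (V j) (N j) (w j) \<and> g j \<in> pdg_hom (V j) Y \<and>
     O.leq (N j) Y (a j) [Bwd (N j) (hclass A (V j) (N j) (w j)) (V j), Fwd (V j) (hclass A (V j) Y (g j)) Y]" by (elim exE)
  have V: "\<And>j. j \<in> J \<Longrightarrow> pdg_module A (V j)" "\<And>j. j \<in> J \<Longrightarrow> w j \<in> pdg_hom (V j) (N j)"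
     "\<And>j. j \<in> J \<Longrightarrow> kheq A (V j) (N j) (w j)" "\<And>j. j \<in> J \<Longrightarrow> g j \<in> pdg_hom (V j) Y"
     "\<And>j. j \<in> J \<Longrightarrow> O.leq (N j) Y (a j) [Bwd (N j) (hclass A (V j) (N j) (w j)) (V j), Fwd (V j) (hclass A (V j) Y (g j)) Y]"
    using roofs by blast+
  interpret VN: pdg_dsum_pair A J V N
    using N V(1) by (intro pdg_dsum_pair.intro pdg_dsum.intro pdg_dsum_axioms.intro pdg_algebra_axioms)
  let ?P = "dsum J N" and ?PV = "dsum J V"
  note PM = VN.M.pdg_module_dsum and PVM = VN.N.pdg_module_dsum
  \<comment> \<open>One roof for all indices at once: the direct sum of the backward legs and the
    combination of the forward legs.\<close>
  let ?w = "dmap J V N w" and ?g = "VN.N.dfold Y g"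
  have wm: "?w \<in> pdg_hom ?PV ?P" by (rule VN.dmap_pdg_hom) (rule V(2))
  have gm: "?g \<in> pdg_hom ?PV Y" by (rule VN.N.dfold_pdg_hom[OF Y]) (rule V(4))
  have wk: "qis A ?PV ?P (hclass A ?PV ?P ?w)"
    using qis_iff[OF PVM PM wm] kheq_dmap[OF pdg_algebra_axioms V(1) N V(3)] by simp
  let ?q = "[Bwd ?P (hclass A ?PV ?P ?w) ?PV, Fwd ?PV (hclass A ?PV Y ?g) Y]"
  have zq: "zigzag ?H (qis A) ?P ?q Y"
    using PM PVM Y wk wm gm by (auto simp: zigzag_iffs homotopy_cat_simps)
  have "O.leq (N j) Y (Fwd (N j) (hclass A (N j) ?P (VN.M.dinc j)) ?P # ?q) (a j)" if j: "j \<in> J" for j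
  proof -
    note iN = VN.M.dinc_pdg_hom[OF j] and iV = VN.N.dinc_pdg_hom[OF j]
    have Obs: "N j \<in> Ob ?H" "?P \<in> Ob ?H" "V j \<in> Ob ?H" "?PV \<in> Ob ?H" "Y \<in> Ob ?H"
      using N[OF j] V(1)[OF j] PM PVM Y by (auto simp: homotopy_cat_simps)
    have homs: "hclass A (N j) ?P (VN.M.dinc j) \<in> Hom ?H (N j) ?P" "hclass A (V j) ?PV (VN.N.dinc j) \<in> Hom ?H (V j) ?PV"
      "hclass A (V j) (N j) (w j) \<in> Hom ?H (V j) (N j)" "hclass A ?PV ?P ?w \<in> Hom ?H ?PV ?P" "hclass A ?PV Y ?g \<in> Hom ?H ?PV Y"
      using iN iV V(2)[OF j] wm gm by (auto simp: homotopy_cat_simps)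
    have qw: "qis A (V j) (N j) (hclass A (V j) (N j) (w j))"
      using qis_iff[OF V(1)[OF j] N[OF j] V(2)[OF j]] V(3)[OF j] by simp
    have "?w (VN.N.dinc j x) = VN.M.dinc j (w j x)" if "x \<in> carrier (V j)" for x
      using VN.dmap_dinc[OF V(2) j that] by blast
    then have "homotopic A (V j) ?P (\<lambda>x. ?w (VN.N.dinc j x)) (\<lambda>x. VN.M.dinc j (w j x))"
      by - (rule pdg_module_pair.homotopicI_eq[OF pair[OF V(1)[OF j] PM] pdg_hom_comp[OF iV wm]], blast)
    then have "hclass A (V j) ?P (\<lambda>x. ?w (VN.N.dinc j x)) = hclass A (V j) ?P (\<lambda>x. VN.M.dinc j (w j x))"
      using hclass_eq_iff[OF V(1)[OF j] PM pdg_hom_comp[OF iV wm] pdg_hom_comp[OF V(2)[OF j] iN]] by simp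
    then have eq: "cmp ?H (V j) ?PV ?P (hclass A ?PV ?P ?w) (hclass A (V j) ?PV (VN.N.dinc j)) =
        cmp ?H (V j) (N j) ?P (hclass A (N j) ?P (VN.M.dinc j)) (hclass A (V j) (N j) (w j))"
      by (simp add: cmp_hclass[OF V(1)[OF j] PVM PM iV wm] cmp_hclass[OF V(1)[OF j] N[OF j] PM V(2)[OF j] iN])
    have "?g (VN.N.dinc j x) = g j x" if "x \<in> carrier (V j)" for x
      using VN.N.dfold_dinc[OF Y V(4) j that] by blast
    then have "homotopic A (V j) Y (\<lambda>x. ?g (VN.N.dinc j x)) (g j)"
      by - (rule pdg_module_pair.homotopicI_eq[OF pair[OF V(1)[OF j] Y] pdg_hom_comp[OF iV gm]], blast)
    then have "hclass A (V j) Y (\<lambda>x. ?g (VN.N.dinc j x)) = hclass A (V j) Y (g j)"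
      using hclass_eq_iff[OF V(1)[OF j] Y pdg_hom_comp[OF iV gm] V(4)[OF j]] by simp
    then have eq2: "cmp ?H (V j) ?PV Y (hclass A ?PV Y ?g) (hclass A (V j) ?PV (VN.N.dinc j)) = hclass A (V j) Y (g j)"
      by (simp add: cmp_hclass[OF V(1)[OF j] PVM Y iV gm])
    have z: "zigzag ?H (qis A) ?PV [Fwd ?PV (hclass A ?PV Y ?g) Y] Y" "zigzag ?H (qis A) (N j) [Bwd (N j) (hclass A (V j) (N j) (w j)) (V j)] (V j)"
      "zigzag ?H (qis A) Y [] Y"
      using Obs homs qw by (auto simp: zigzag_iffs)
    have "O.leq (N j) Y (Fwd (N j) (hclass A (N j) ?P (VN.M.dinc j)) ?P # ?q)
       [Bwd (N j) (hclass A (V j) (N j) (w j)) (V j), Fwd (V j) (hclass A (V j) ?PV (VN.N.dinc j)) ?PV, Fwd ?PV (hclass A ?PV Y ?g) Y]"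
      using loc_eq_append[OF O.ore_square[OF Obs(1,2,3,4) homs(1,2,3) qw homs(4) wk eq] le_refl[OF z(1)]] by simp
    also have "O.leq (N j) Y [Bwd (N j) (hclass A (V j) (N j) (w j)) (V j), Fwd (V j) (hclass A (V j) ?PV (VN.N.dinc j)) ?PV, Fwd ?PV (hclass A ?PV Y ?g) Y]
       [Bwd (N j) (hclass A (V j) (N j) (w j)) (V j), Fwd (V j) (hclass A (V j) Y (g j)) Y]"
      using loc_eq_cong[OF O.loc_eq_comp[where W = "qis A", OF Obs(3,4,5) homs(2,5)] z(2,3)] by (simp add: eq2)
    also have "O.leq (N j) Y [Bwd (N j) (hclass A (V j) (N j) (w j)) (V j), Fwd (V j) (hclass A (V j) Y (g j)) Y] (a j)"
      by (rule le_sym[OF V(5)[OF j]])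
    finally show ?thesis .
  qed
  then show ?thesis using zq by blast
qed

text \<open>A coproduct \<open>Y\<close> in the derived category is given by its universal property
  alone. Comparison with the direct sum makes it a retract of that module, where a morphism out of
  \<open>Q\<close> becomes a module map. The support of this map is the finite support of the image
  of \<open>g0\<close>, and the finite sum of its entries can then be formed in any coproduct
  \<open>Y'\<close> of the finite subfamily.\<close>

theorem compact_of_lifts:
  fixes Q :: "('r, ('a, 'x) univ) pdg_mod"
  assumes Q: "lifts Q" and gen: "g0 \<in> carrier Q" "\<And>q. q \<in> carrier Q \<Longrightarrow> \<exists>r. q = r \<odot>\<^bsub>Q\<^esub> g0"
  shows "is_compact TYPE(('a, 'x) univ) (derived_cat A) Q"
proof -
  let ?H = "homotopy_cat A :: (('r, ('a, 'x) univ) pdg_mod, _) cat" and ?W = "qis A"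
  let ?D = "derived_cat A :: (('r, ('a, 'x) univ) pdg_mod, _) cat"
  interpret cofibrant A Q by unfold_locales (rule Q)
  have D: "?D = localization ?H ?W" by (simp add: derived_cat_def)
  note Ds = localization_simps[where C = ?H and W = ?W, folded D]
  note Dc = cmp_lc[where C = ?H and W = ?W, folded D]
  let ?lc = "lc ?H ?W" and ?leq = "loc_eq ?H ?W" and ?zz = "zigzag ?H ?W"
  have QO: "Q \<in> Ob ?D" using Q_module by (simp add: Ds homotopy_cat_simps)
  show ?thesis unfolding is_compact_def
  proof (intro conjI QO allI impI ballI)
    fix J :: "('a, 'x) univ set" and N Y \<iota> f
    assume cop: "is_coproduct ?D J N Y \<iota>" and f: "f \<in> Hom ?D Q Y"
    have Y: "pdg_module A Y" and N: "\<And>j. j \<in> J \<Longrightarrow> pdg_module A (N j)" and \<iota>: "\<And>j. j \<in> J \<Longrightarrow> \<iota> j \<in> Hom ?D (N j) Y"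
      using cop by (auto simp: is_coproduct_def Ds homotopy_cat_simps(1))
    have "\<forall>j\<in>J. \<exists>a. \<iota> j = ?lc (N j) Y a \<and> ?zz (N j) a Y" using \<iota> by (auto simp: Ds)
    from bchoice[OF this] obtain a where a_all: "\<forall>j\<in>J. \<iota> j = ?lc (N j) Y (a j) \<and> ?zz (N j) (a j) Y" by (elim exE)
    have a: "\<And>j. j \<in> J \<Longrightarrow> \<iota> j = ?lc (N j) Y (a j)" "\<And>j. j \<in> J \<Longrightarrow> ?zz (N j) (a j) Y"
      using a_all by blast+
    interpret P: pdg_dsum A J N using N by (intro pdg_dsum.intro pdg_dsum_axioms.intro pdg_algebra_axioms)
    let ?P = "dsum J N"
    note PM = P.pdg_module_dsum
    have "\<exists>q. ?zz ?P q Y \<and> (\<forall>j\<in>J. ?leq (N j) Y (Fwd (N j) (hclass A (N j) ?P (P.dinc j)) ?P # q) (a j))"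
      by (rule dsum_extend[OF _ Y]) (rule N, assumption, rule a(2), assumption)
    then obtain q where q0: "?zz ?P q Y" "\<forall>j\<in>J. ?leq (N j) Y (Fwd (N j) (hclass A (N j) ?P (P.dinc j)) ?P # q) (a j)"
      by (elim exE conjE)
    note q = q0(1) bspec[OF q0(2)]
    have zi: "?zz (N j) [Fwd (N j) (hclass A (N j) ?P (P.dinc j)) ?P] ?P" if "j \<in> J" for j
      using N[OF that] PM P.dinc_pdg_hom[OF that] by (auto simp: zigzag_iffs homotopy_cat_simps)
    have PD: "?P \<in> Ob ?D" and YD: "Y \<in> Ob ?D" using PM Y by (simp_all add: Ds(1) homotopy_cat_simps(1))
    have "\<forall>j\<in>J. ?lc (N j) ?P [Fwd (N j) (hclass A (N j) ?P (P.dinc j)) ?P] \<in> Hom ?D (N j) ?P"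
      unfolding Ds(2) using zi by blast
    \<comment> \<open>\<open>m\<close> leads from \<open>Y\<close> to the direct sum by the
      universal property of \<open>Y\<close>, and \<open>q\<close> leads back. Their composite on
      \<open>Y\<close> fixes all \<open>\<iota> j\<close> and is therefore the identity by
      uniqueness.\<close>
    from is_coproduct_factor[OF cop PD this] obtain m' where m'0: "m' \<in> Hom ?D Y ?P"
      "\<forall>j\<in>J. cmp ?D (N j) Y ?P m' (\<iota> j) = ?lc (N j) ?P [Fwd (N j) (hclass A (N j) ?P (P.dinc j)) ?P]"
      by (elim exE conjE)
    from m'0(1) obtain m where m1: "m' = ?lc Y ?P m" "?zz Y m ?P" unfolding Ds(2) by blast
    note m = m1(2) bspec[OF m'0(2)[unfolded m1(1)]]
    have Yn: "?zz Y [] Y" using Y by (simp add: zigzag_iffs homotopy_cat_simps)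
    have hY: "?lc Y Y (m @ q) \<in> Hom ?D Y Y" "?lc Y Y [] \<in> Hom ?D Y Y"
      unfolding Ds(2) using zigzag_append[OF m(1) q(1)] Yn by blast+
    have cY: "cmp ?D (N j) Y Y (?lc Y Y (m @ q)) (\<iota> j) = \<iota> j" "cmp ?D (N j) Y Y (?lc Y Y []) (\<iota> j) = \<iota> j" if j: "j \<in> J" for j
    proof -
      have "?lc (N j) ?P (a j @ m) = ?lc (N j) ?P [Fwd (N j) (hclass A (N j) ?P (P.dinc j)) ?P]"
        using m(2)[OF j] Dc[OF a(2)[OF j] m(1)] a(1)[OF j] by simp
      then have "?leq (N j) ?P (a j @ m) [Fwd (N j) (hclass A (N j) ?P (P.dinc j)) ?P]"
        using lc_eq_iff[OF zigzag_append[OF a(2)[OF j] m(1)]] by simp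
      from loc_eq_append[OF this le_refl[OF q(1)]]
      have "?leq (N j) Y (a j @ m @ q) (Fwd (N j) (hclass A (N j) ?P (P.dinc j)) ?P # q)" by simp
      then have "?leq (N j) Y (a j @ m @ q) (a j)" using q(2)[OF j] by (rule le_trans)
      then show "cmp ?D (N j) Y Y (?lc Y Y (m @ q)) (\<iota> j) = \<iota> j"
        using Dc[OF a(2)[OF j] zigzag_append[OF m(1) q(1)]] a(1)[OF j] lc_eq_iff[OF zigzag_append[OF a(2)[OF j] zigzag_append[OF m(1) q(1)]]] by simp
      show "cmp ?D (N j) Y Y (?lc Y Y []) (\<iota> j) = \<iota> j"
        using Dc[OF a(2)[OF j] Yn] a(1)[OF j] by simp
    qed
    have \<iota>b: "\<forall>j\<in>J. \<iota> j \<in> Hom ?D (N j) Y" using \<iota> by blast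
    have "?lc Y Y (m @ q) = ?lc Y Y []"
      by (rule is_coproduct_unique[OF cop YD \<iota>b hY(1) _ hY(2)]) (use cY in blast)+
    then have mq: "?leq Y Y (m @ q) []" using lc_eq_iff[OF zigzag_append[OF m(1) q(1)]] by simp
    obtain fz where fz: "f = ?lc Q Y fz" "?zz Q fz Y" using f by (auto simp: Ds)
    have idQ: "ident ?H Q \<in> Hom ?H Q Q" "ident ?H Q = hclass A Q Q (\<lambda>x. x)"
      using L.ident_in[OF L.Q] by (auto simp: homotopy_cat_simps)
    obtain x where x: "x \<in> pdg_hom Q ?P" "L.acts (fz @ m) (ident ?H Q) = hclass A Q ?P x"
      using acts_hclass[OF zigzag_append[OF fz(2) m(1)] pdg_hom_ident] idQ(2) by auto
    \<comment> \<open>The finite set that compactness asks for. An entry outside it vanishes on the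
      generator \<open>g0\<close>, hence on every multiple of \<open>g0\<close>.\<close>
    define S where "S = {j \<in> J. ddec N (x g0) j \<noteq> \<zero>\<^bsub>N j\<^esub>}"
    have S: "finite S" "S \<subseteq> J" using ddec_finfam[OF pdg_hom_closed[OF x(1) gen(1)]] by (auto simp: S_def finfam_def)
    define xj where "xj j c = ddec N (x c) j" for j c
    have xj: "xj j \<in> pdg_hom Q (N j)" if "j \<in> J" for j
      unfolding xj_def by (rule pdg_hom_comp[OF x(1) P.ddec_pdg_hom[OF that]])
    have supp: "ddec N (x c) j = \<zero>\<^bsub>N j\<^esub>" if cQ: "c \<in> carrier Q" and jS: "j \<in> J - S" for c j
    proof -
      interpret Nj: pdg_module A "N j" using jS N by auto
      obtain r where r: "c = r \<odot>\<^bsub>Q\<^esub> g0" using gen(2)[OF cQ] by blast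
      have "xj j g0 = \<zero>\<^bsub>N j\<^esub>" using jS by (auto simp: S_def xj_def)
      then have "xj j c = \<zero>\<^bsub>N j\<^esub>" unfolding r using pdg_hom_smult[OF xj gen(1), of j r] jS by simp
      then show ?thesis by (simp add: xj_def)
    qed
    have xsum: "x c = (\<Oplus>\<^bsub>?P\<^esub>j\<in>S. P.dinc j (xj j c))" if c: "c \<in> carrier Q" for c
      unfolding xj_def using P.dsum_decomp[OF pdg_hom_closed[OF x(1) c] S supp[OF c]] .
    interpret QP: pdg_module_pair A Q ?P by (rule pair[OF Q_module PM])
    have xi: "(\<lambda>c. P.dinc j (xj j c)) \<in> pdg_hom Q ?P" if "j \<in> S" for j
      using pdg_hom_comp[OF xj P.dinc_pdg_hom] that S(2) by blast
    have hx: "hclass A Q ?P x = hclass A Q ?P (\<lambda>c. \<Oplus>\<^bsub>?P\<^esub>j\<in>S. P.dinc j (xj j c))"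
      by (subst hclass_eq_iff[OF Q_module PM x(1) QP.finsum_pdg_hom[OF S(1) xi]]) (auto intro: QP.homotopicI_eq[OF x(1)] xsum)
    have "\<forall>j\<in>S. \<exists>y. y \<in> pdg_hom Q Y \<and> L.acts (a j) (hclass A Q (N j) (xj j)) = hclass A Q Y y"
      using acts_hclass[OF a(2) xj] S(2) by blast
    from bchoice[OF this] obtain y where y_all: "\<forall>j\<in>S. y j \<in> pdg_hom Q Y \<and> L.acts (a j) (hclass A Q (N j) (xj j)) = hclass A Q Y (y j)" by (elim exE)
    have y: "\<And>j. j \<in> S \<Longrightarrow> y j \<in> pdg_hom Q Y"
      "\<And>j. j \<in> S \<Longrightarrow> L.acts (a j) (hclass A Q (N j) (xj j)) = hclass A Q Y (y j)"
      using y_all by blast+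
    have xjH: "hclass A Q (N j) (xj j) \<in> Hom ?H Q (N j)" if "j \<in> S" for j
      using xj S(2) that by (auto simp: homotopy_cat_simps)
    have aq: "L.acts q (hclass A Q ?P (\<lambda>c. P.dinc j (xj j c))) = hclass A Q Y (y j)" if j: "j \<in> S" for j
    proof -
      have jJ: "j \<in> J" using j S(2) by auto
      have "L.acts (a j) (hclass A Q (N j) (xj j)) = L.acts (Fwd (N j) (hclass A (N j) ?P (P.dinc j)) ?P # q) (hclass A Q (N j) (xj j))"
        by (rule L.acts_loc_eq[OF q(2)[OF jJ] xjH[OF j], symmetric])
      also have "\<dots> = L.acts q (hclass A Q ?P (\<lambda>c. P.dinc j (xj j c)))"
        by (simp add: cmp_hclass[OF Q_module N[OF jJ] PM xj[OF jJ] P.dinc_pdg_hom[OF jJ]])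
      finally show ?thesis using y(2)[OF j] by simp
    qed
    let ?y = "\<lambda>c. \<Oplus>\<^bsub>Y\<^esub>j\<in>S. y j c"
    \<comment> \<open>Pass to the direct sum along \<open>m\<close>, split the resulting map into
      finitely many entries, and return along \<open>q\<close>, which carries entry \<open>j\<close>
      to the image of \<open>xj j\<close> under \<open>a j\<close>.\<close>
    have "L.acts fz (ident ?H Q) = L.acts (m @ q) (L.acts fz (ident ?H Q))"
      using L.acts_loc_eq[OF mq L.acts_in[OF fz(2) idQ(1)]] by simp
    also have "\<dots> = L.acts q (hclass A Q ?P x)" using x(2) by (simp add: L.acts_append)
    also have "\<dots> = hclass A Q Y ?y" unfolding hx by (rule acts_sum[OF q(1) S(1)]) (use xi y(1) aq in blast)+
    finally have fy: "?leq Q Y fz [Fwd Q (hclass A Q Y ?y) Y]"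
      using L.loc_eq_single[OF fz(2)] by simp
    show "\<exists>S. finite S \<and> S \<subseteq> J \<and> (\<forall>Y' \<iota>'. is_coproduct ?D S N Y' \<iota>' \<longrightarrow>
       (\<exists>g\<in>Hom ?D Q Y'. \<exists>m\<in>Hom ?D Y' Y. (\<forall>j\<in>S. cmp ?D (N j) Y' Y m (\<iota>' j) = \<iota> j) \<and> f = cmp ?D Q Y' Y m g))"
    proof (intro exI[of _ S] conjI S allI impI)
      fix Y' \<iota>' assume cop': "is_coproduct ?D S N Y' \<iota>'"
      have Y': "pdg_module A Y'" and \<iota>': "\<And>j. j \<in> S \<Longrightarrow> \<iota>' j \<in> Hom ?D (N j) Y'"
        using cop' by (auto simp: is_coproduct_def Ds homotopy_cat_simps(1))
      have "\<forall>j\<in>S. \<exists>a. \<iota>' j = ?lc (N j) Y' a \<and> ?zz (N j) a Y'" using \<iota>' by (auto simp: Ds)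
      from bchoice[OF this] obtain a' where a'_all: "\<forall>j\<in>S. \<iota>' j = ?lc (N j) Y' (a' j) \<and> ?zz (N j) (a' j) Y'" by (elim exE)
      have a': "\<And>j. j \<in> S \<Longrightarrow> \<iota>' j = ?lc (N j) Y' (a' j)" "\<And>j. j \<in> S \<Longrightarrow> ?zz (N j) (a' j) Y'"
        using a'_all by blast+
      have "\<forall>j\<in>S. \<iota> j \<in> Hom ?D (N j) Y" using \<iota> S(2) by blast
      from is_coproduct_factor[OF cop' YD this] obtain m'' where m''0: "m'' \<in> Hom ?D Y' Y" "\<forall>j\<in>S. cmp ?D (N j) Y' Y m'' (\<iota>' j) = \<iota> j" by (elim exE conjE)
      from m''0(1) obtain m' where m'1: "m'' = ?lc Y' Y m'" "?zz Y' m' Y" unfolding Ds(2) by blast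
      note m' = m'1(2) bspec[OF m''0(2)[unfolded m'1(1)]]
      have am: "?leq (N j) Y (a' j @ m') (a j)" if j: "j \<in> S" for j
      proof -
        have jJ: "j \<in> J" using j S(2) by blast
        have "?lc (N j) Y (a' j @ m') = ?lc (N j) Y (a j)"
          using m'(2)[OF j] Dc[OF a'(2)[OF j] m'(1)] a'(1)[OF j] a(1)[OF jJ] by simp
        then show ?thesis using lc_eq_iff[OF zigzag_append[OF a'(2)[OF j] m'(1)]] by blast
      qed
      have "\<forall>j\<in>S. \<exists>y. y \<in> pdg_hom Q Y' \<and> L.acts (a' j) (hclass A Q (N j) (xj j)) = hclass A Q Y' y"
        using acts_hclass[OF a'(2) xj] S(2) by blast
      from bchoice[OF this] obtain y' where y'_all: "\<forall>j\<in>S. y' j \<in> pdg_hom Q Y' \<and> L.acts (a' j) (hclass A Q (N j) (xj j)) = hclass A Q Y' (y' j)" by (elim exE)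
      have y': "\<And>j. j \<in> S \<Longrightarrow> y' j \<in> pdg_hom Q Y'"
        "\<And>j. j \<in> S \<Longrightarrow> L.acts (a' j) (hclass A Q (N j) (xj j)) = hclass A Q Y' (y' j)"
      using y'_all by blast+
      let ?y' = "\<lambda>c. \<Oplus>\<^bsub>Y'\<^esub>j\<in>S. y' j c"
      have y'm: "?y' \<in> pdg_hom Q Y'" by (rule pdg_module_pair.finsum_pdg_hom[OF pair[OF Q_module Y'] S(1)]) (rule y'(1))
      have "L.acts m' (hclass A Q Y' (y' j)) = hclass A Q Y (y j)" if j: "j \<in> S" for j
        using L.acts_loc_eq[OF am[OF j] xjH[OF j]] y(2)[OF j] y'(2)[OF j] by (simp add: L.acts_append)
      \<comment> \<open>The same sum formed in \<open>Y'\<close> is carried by \<open>m'\<close> to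
        the sum formed in \<open>Y\<close>, because \<open>a' j\<close> followed by
        \<open>m'\<close> equals \<open>a j\<close>.\<close>
      then have act': "L.acts m' (hclass A Q Y' ?y') = hclass A Q Y ?y"
        by (intro acts_sum[OF m'(1) S(1)]) (use y'(1) y(1) in blast)+
      have y'H: "hclass A Q Y' ?y' \<in> Hom ?H Q Y'" using y'm by (auto simp: homotopy_cat_simps)
      have zg: "?zz Q [Fwd Q (hclass A Q Y' ?y') Y'] Y'" using y'H Q_module Y' by (simp add: zigzag_iffs homotopy_cat_simps(1))
      have "?leq Q Y (Fwd Q (hclass A Q Y' ?y') Y' # m') [Fwd Q (hclass A Q Y ?y) Y]"
        using L.loc_eq_acts[OF m'(1) y'H] act' by simp
      then have "?leq Q Y fz ([Fwd Q (hclass A Q Y' ?y') Y'] @ m')" using le_trans[OF fy le_sym] by simp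
      then have "f = cmp ?D Q Y' Y (?lc Y' Y m') (?lc Q Y' [Fwd Q (hclass A Q Y' ?y') Y'])"
        using fz lc_eq_iff[OF fz(2)] Dc[OF zg m'(1)] by simp
      moreover have "?lc Q Y' [Fwd Q (hclass A Q Y' ?y') Y'] \<in> Hom ?D Q Y'" "?lc Y' Y m' \<in> Hom ?D Y' Y" using zg m'(1) by (auto simp: Ds(2))
      ultimately show "\<exists>g\<in>Hom ?D Q Y'. \<exists>m\<in>Hom ?D Y' Y. (\<forall>j\<in>S. cmp ?D (N j) Y' Y m (\<iota>' j) = \<iota> j) \<and> f = cmp ?D Q Y' Y m g"
        using m'(2) by blast
    qed
  qed
qed

end

section \<open>Left ideals of idempotents and the cells of a filtration\<close>

section \<open>Left ideals generated by idempotents\<close>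

text \<open>The ring as a module over itself; it is the single coordinate module for all left
  ideals.\<close>

definition regular :: "('k::field, 'r::{ring, monoid_mult}) pdg_alg \<Rightarrow> ('r, 'r) pdg_mod" where
  "regular A = \<lparr>carrier = UNIV, monoid.mult = (*), monoid.one = 1, ring.zero = 0, ring.add = (+),
     smult = (*), grade = agr A, dif = adif A\<rparr>"

lemma regular_simps [simp]:
  "carrier (regular A) = UNIV" "\<zero>\<^bsub>regular A\<^esub> = 0" "x \<oplus>\<^bsub>regular A\<^esub> y = x + y"
  "r \<odot>\<^bsub>regular A\<^esub> x = r * x" "grade (regular A) = agr A" "dif (regular A) = adif A"
  by (simp_all add: regular_def)

lemma left_ideal_simps [simp]:
  "carrier (left_ideal A e) = Elem ` range (\<lambda>r. r * e)" "\<zero>\<^bsub>left_ideal A e\<^esub> = Elem 0"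
  "x \<oplus>\<^bsub>left_ideal A e\<^esub> y = Elem (elem_of x + elem_of y)" "r \<odot>\<^bsub>left_ideal A e\<^esub> x = Elem (r * elem_of x)"
  "grade (left_ideal A e) n = Elem ` (agr A n \<inter> range (\<lambda>r. r * e))"
  "dif (left_ideal A e) x = Elem (adif A (elem_of x))"
  by (simp_all add: left_ideal_def)

text \<open>The last condition places \<open>adif A e\<close> in the left ideal of \<open>e\<close>,
  which is what makes this ideal stable under the differential. It holds for the partial sums of a
  filtration even where their differential is not zero.\<close>

definition dg_idem where
  "dg_idem A e \<longleftrightarrow> e \<in> agr A 0 \<and> e * e = e \<and> adif A e * e = adif A e"

lemma range_idem:
  fixes e :: "'r::{ring, monoid_mult}"
  assumes "e * e = e"
  shows "range (\<lambda>r. r * e) = {x. x * e = x}"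
  using assms by (auto simp: mult.assoc) (metis rangeI)

context pdg_algebra begin

lemma abelian_group_regular: "abelian_group (regular A)"
  by (rule abelian_groupI) (auto simp: add.assoc add.commute intro: exI[of _ "- _"] left_minus)

lemma finsum_regular: "finsum (regular A) f S = sum f S"
proof (induction S rule: infinite_finite_induct)
  interpret R: abelian_group "regular A" by (rule abelian_group_regular)
  case (insert x S)
  then show ?case by (simp add: R.finsum_insert)
next
  interpret R: abelian_group "regular A" by (rule abelian_group_regular)
  case empty
  show ?case by simp
next
  interpret R: abelian_group "regular A" by (rule abelian_group_regular)
  case (infinite S)
  then show ?case by (simp add: R.add.finprod_infinite[simplified])
qed

lemma pdg_module_regular: "pdg_module A (regular A)"
proof (intro pdg_module.intro pdg_module_axioms.intro abelian_group_regular)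
  interpret R: abelian_group "regular A" by (rule abelian_group_regular)
  fix n
  have ne: "agr A n \<noteq> {}" using agr_0[of n] by blast
  show "additive_subgroup (grade (regular A) n) (regular A)"
    by (rule R.add.subgroupI[THEN additive_subgroup.intro, simplified])
       (auto simp: ne agr_add intro: agr_neg simp: a_inv_def[symmetric] R.minus_equality[of "- _" _, simplified])
next
  fix x show "\<exists>!c. (\<forall>n. c n \<in> grade (regular A) n) \<and> finite {n. c n \<noteq> \<zero>\<^bsub>regular A\<^esub>} \<and>
      x = (\<Oplus>\<^bsub>regular A\<^esub>n\<in>{n. c n \<noteq> \<zero>\<^bsub>regular A\<^esub>}. c n)"
    using agr_decomp[of x] by (simp add: finsum_regular)
qed (auto simp: algebra_simps agr_mult adif_add adif_degree adif_nilpotent adif_Leibniz)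

lemma left_ideal_closed:
  assumes "dg_idem A e" "x * e = x"
  shows "adif A x * e = adif A x"
proof -
  have "adif A x = adif A x * e + x * adif A e" using adif_Leibniz[of x e] assms(2) by simp
  moreover have "adif A x * e * e + x * adif A e * e = adif A x * e + x * adif A e"
    using assms(1) by (simp add: dg_idem_def mult.assoc)
  ultimately show ?thesis by (metis distrib_right)
qed

lemma pdg_module_left_ideal:
  assumes e: "dg_idem A e"
  shows "pdg_module A (left_ideal A e)"
proof -
  have ee: "e * e = e" and eg: "e \<in> agr A 0" using e by (auto simp: dg_idem_def)
  note r = range_idem[OF ee]
  interpret R: pdg_module A "regular A" by (rule pdg_module_regular)
  \<comment> \<open>Right multiplication by \<open>e\<close> is homogeneous of degree 0, so
    components of elements of the ideal stay in the ideal.\<close>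
  have c: "cpt (regular A) n x * e = cpt (regular A) n (x * e)" for n x
    using cpt_hom[OF pdg_module_regular pdg_module_regular, of "\<lambda>x. x * e" 0 x n]
    by (simp add: gr_hom_def algebra_simps agr_mult[OF _ eg, simplified])
  interpret coord_module A "left_ideal A e" "{()}" "\<lambda>_. regular A" "\<lambda>_. elem_of" "\<lambda>_. 0"
  proof (unfold_locales; (simp only: left_ideal_simps r)?)
    show "\<exists>y\<in>Elem ` {x. x * e = x}. \<forall>j\<in>{()}. elem_of y = cpt (regular A) (n + 0) (elem_of x)"
      if "x \<in> Elem ` {x. x * e = x}" for x n
      using that c[of n "elem_of x"] by (intro bexI[of _ "Elem (cpt (regular A) n (elem_of x))"]) auto
    show "finite {n. \<exists>j\<in>{()}. cpt (regular A) (n + 0) (elem_of x) \<noteq> \<zero>\<^bsub>regular A\<^esub>}" for x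
      using R.cpt_finite[of "elem_of x"] by simp
  qed (auto simp: pdg_module_regular algebra_simps image_iff)
  show ?thesis
    by (rule pdg_moduleI_strict[OF pdg_algebra_axioms])
       (auto simp: r left_ideal_closed[OF e])
qed

end

context pdg_module begin

lemma grade_finsum: "(\<And>i. i \<in> S \<Longrightarrow> f i \<in> grade M n) \<Longrightarrow> finsum M f S \<in> grade M n"
proof (induction S rule: infinite_finite_induct)
  case (insert i S)
  then have "f \<in> S \<rightarrow> carrier M" "f i \<in> carrier M" using grade_carrier by blast+
  then show ?case using insert by (simp add: finsum_insert grade_add)
qed (simp_all add: add.finprod_infinite[simplified])

lemma dif_pow_degree: "x \<in> grade M n \<Longrightarrow> (dif M ^^ k) x \<in> grade M (n + 2 * int k)"
proof (induction k)
  case (Suc k)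
  then show ?case using dif_degree[of "(dif M ^^ k) x" "n + 2 * int k"] by (simp add: algebra_simps)
qed simp

end

text \<open>The kernel of a contractible fibration is contractible, so a cycle for \<open>\<partial>\<^sup>p\<^sup>-\<^sup>1\<close> in it is a boundary
  for \<open>\<partial>\<close>.\<close>

lemma contraction_antidif:
  assumes A: "pdg_algebra A" "pdg_module A W" "pdg_module A X" and G: "contraction A W X w G" and w: "w \<in> pdg_hom W X"
    and y: "y \<in> grade W n" "w y = \<zero>\<^bsub>X\<^esub>" "(dif W ^^ (pchar A - 1)) y = \<zero>\<^bsub>W\<^esub>"
  shows "\<exists>y'\<in>grade W (n - 2). w y' = \<zero>\<^bsub>X\<^esub> \<and> dif W y' = y"
proof -
  interpret W: pdg_module_pair A W W using A by (intro pdg_module_pair.intro)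
  interpret X: pdg_module A X by fact
  have Gd: "G \<in> gr_hom (2 - 2 * int (pchar A)) W W" using G by (simp add: contraction_def)
  have yc: "y \<in> carrier W" using y(1) W.M.grade_carrier by blast
  \<comment> \<open>Term \<open>i + 1\<close> of the null-homotopy formula with one outer
    differential taken off. The remaining term 0 is \<open>G\<close> applied to
    \<open>dif^(p - 1) y = 0\<close>.\<close>
  define z where "z i = (dif W ^^ i) (G ((dif W ^^ (pchar A - 1 - Suc i)) y))" for i
  have p: "pchar A = Suc (pchar A - 1)" using W.pchar_ge2 by simp
  have zg: "z i \<in> grade W (n - 2)" if "i < pchar A - 1" for i
  proof -
    have "G ((dif W ^^ (pchar A - 1 - Suc i)) y) \<in> grade W (n + 2 * int (pchar A - 1 - Suc i) + (2 - 2 * int (pchar A)))"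
      by (rule gr_hom_grade[OF Gd W.M.dif_pow_degree[OF y(1)]])
    from W.M.dif_pow_degree[OF this, of i] show ?thesis
      using that by (simp add: z_def of_nat_diff algebra_simps)
  qed
  have gc: "G ((dif W ^^ k) y) \<in> carrier W" for k by (rule gr_hom_closed[OF Gd]) (simp add: yc)
  have zc: "z i \<in> carrier W" for i using gc by (simp add: z_def)
  have dz: "dif W (z i) = (dif W ^^ Suc i) (G ((dif W ^^ (pchar A - 1 - Suc i)) y))" for i by (simp add: z_def)
  have "y = (dl W W ^^ (pchar A - 1)) G y" using G y(2) yc by (simp add: contraction_def)
  also have "\<dots> = (\<Oplus>\<^bsub>W\<^esub>i\<in>{..<pchar A}. (dif W ^^ i) (G ((dif W ^^ (pchar A - 1 - i)) y)))"
    by (rule W.dl_pow_pred[OF W.gr_hom_funcset[OF Gd] yc])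
  also have "{..<pchar A} = insert 0 (Suc ` {..<pchar A - 1})"
    by (subst p) (simp add: lessThan_Suc_eq_insert_0 del: One_nat_def)
  also have "(\<Oplus>\<^bsub>W\<^esub>i\<in>insert 0 (Suc ` {..<pchar A - 1}). (dif W ^^ i) (G ((dif W ^^ (pchar A - 1 - i)) y)))
      = G ((dif W ^^ (pchar A - 1)) y) \<oplus>\<^bsub>W\<^esub> (\<Oplus>\<^bsub>W\<^esub>i\<in>Suc ` {..<pchar A - 1}. (dif W ^^ i) (G ((dif W ^^ (pchar A - 1 - i)) y)))"
    using gc W.M.dif_pow_closed by (subst W.M.finsum_insert) auto
  also have "G ((dif W ^^ (pchar A - 1)) y) = \<zero>\<^bsub>W\<^esub>"
    using y(3) addmap_zero[OF W.M.abelian_group_axioms W.M.abelian_group_axioms gr_hom_addmap[OF Gd]] by simp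
  also have "(\<Oplus>\<^bsub>W\<^esub>i\<in>Suc ` {..<pchar A - 1}. (dif W ^^ i) (G ((dif W ^^ (pchar A - 1 - i)) y)))
      = (\<Oplus>\<^bsub>W\<^esub>i\<in>{..<pchar A - 1}. dif W (z i))"
    unfolding dz using gc W.M.dif_pow_closed by (subst W.M.add.finprod_reindex) auto
  also have "\<dots> = dif W (\<Oplus>\<^bsub>W\<^esub>i\<in>{..<pchar A - 1}. z i)"
    using zc by (intro addmap_finsum[OF W.M.abelian_group_axioms W.M.abelian_group_axioms W.M.addmap_dif, symmetric]) auto
  also have "\<zero>\<^bsub>W\<^esub> \<oplus>\<^bsub>W\<^esub> dif W (\<Oplus>\<^bsub>W\<^esub>i\<in>{..<pchar A - 1}. z i) = dif W (\<Oplus>\<^bsub>W\<^esub>i\<in>{..<pchar A - 1}. z i)"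
    using zc by (intro W.M.l_zero W.M.dif_closed W.M.finsum_closed) auto
  finally have "y = dif W (\<Oplus>\<^bsub>W\<^esub>i\<in>{..<pchar A - 1}. z i)" .
  moreover have "w (\<Oplus>\<^bsub>W\<^esub>i\<in>{..<pchar A - 1}. z i) = (\<Oplus>\<^bsub>X\<^esub>i\<in>{..<pchar A - 1}. w (z i))"
    using zc by (intro addmap_finsum[OF W.M.abelian_group_axioms X.abelian_group_axioms pdg_hom_addmap[OF w]]) auto
  moreover have "w (z i) = \<zero>\<^bsub>X\<^esub>" for i
  proof -
    have "w ((dif W ^^ k) x) = (dif X ^^ k) (w x)" if "x \<in> carrier W" for k x
      using that by (induction k) (simp_all add: pdg_hom_dif[OF w])
    moreover have "w (G ((dif W ^^ k) y)) = \<zero>\<^bsub>X\<^esub>" for k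
      using G yc by (simp add: contraction_def)
    ultimately show ?thesis using gc by (simp add: z_def)
  qed
  ultimately have "y = dif W (\<Oplus>\<^bsub>W\<^esub>i\<in>{..<pchar A - 1}. z i)" "w (\<Oplus>\<^bsub>W\<^esub>i\<in>{..<pchar A - 1}. z i) = \<zero>\<^bsub>X\<^esub>"
    by simp_all
  moreover have "(\<Oplus>\<^bsub>W\<^esub>i\<in>{..<pchar A - 1}. z i) \<in> grade W (n - 2)"
    by (rule W.M.grade_finsum) (simp add: zg)
  ultimately show ?thesis by metis
qed

text \<open>The equation concerns a single element, so a contraction that is linear over the ground
  field can solve it inside a module over the algebra.\<close>

lemma saf_antidif:
  fixes A :: "('k::field, 'r::{ring, monoid_mult}) pdg_alg"
  assumes A: "pdg_algebra A" "pdg_module A W" "pdg_module A X" and w: "saf A W X w"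
    and y: "y \<in> grade W n" "w y = \<zero>\<^bsub>X\<^esub>" "(dif W ^^ (pchar A - 1)) y = \<zero>\<^bsub>W\<^esub>"
  shows "\<exists>y'\<in>grade W (n - 2). w y' = \<zero>\<^bsub>X\<^esub> \<and> dif W y' = y"
proof -
  obtain G where G: "contraction (ground :: ('k, 'k) pdg_alg) (underlying A W) (underlying A X) w G"
    and w': "w \<in> pdg_hom W X" using w by (auto simp: saf_def)
  show ?thesis
    using contraction_antidif[OF pdg_algebra_ground[OF A(1)] pdg_module_underlying[OF A(1,2)] pdg_module_underlying[OF A(1,3)]
        G pdg_hom_underlying[OF w'], of y n] y by (simp add: pchar_ground[of A])
qed


text \<open>One step of the filtration: the left ideal of \<open>e'\<close> is the part below the
  cell, which adds the idempotent \<open>u * v\<close>. The condition \<open>dv\<close> says that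
  the differential of \<open>v\<close> lies in the part below; \<open>e'u\<close> and
  \<open>ve'\<close> express orthogonality.\<close>

locale cell_step = pdg_algebra A
  for A :: "('k::field, 'r::{ring, monoid_mult}) pdg_alg" +
  fixes e' u v :: 'r
  assumes e': "dg_idem A e'" and gu: "u \<in> agr A 0" and gv: "v \<in> agr A 0"
    and uvu: "u * v * u = u" and vuv: "v * u * v = v" and e'u: "e' * u = 0" and ve': "v * e' = 0"
    and vdu: "v * adif A u = 0" and dv: "adif A v * e' = adif A v"
begin

definition e where "e = e' + u * v"

lemma idem: "e' * e' = e'" "adif A e' * e' = adif A e'" "e' \<in> agr A 0" using e' by (auto simp: dg_idem_def)

lemma e_mult: "e' * e = e'" "e * e' = e'" "e * u = u" "v * e = v" "e * e = e"
proof -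
  have uvu': "u * (v * u) = u" and vuv': "v * (u * v) = v" and uvuv: "u * v * (u * v) = u * v"
    using uvu vuv by (simp_all add: mult.assoc)
  have *: "e' * (u * v) = 0" "u * v * e' = 0" using e'u ve' by (simp_all add: mult.assoc flip: mult.assoc[of e'])
  show "e' * e = e'" "e * e' = e'" "e * u = u" "v * e = v" "e * e = e"
    using idem * e'u ve' uvu' vuv' uvuv by (simp_all add: e_def distrib_left distrib_right mult.assoc)
qed

lemma dvu: "adif A v * u = 0" using dv e'u by (metis mult.assoc mult_zero_right)

lemma d_vu: "adif A (v * u) = 0" using vdu dvu by (simp add: adif_Leibniz)

lemma adif_e: "adif A e = adif A e' + (adif A u * v + u * adif A v)"
  by (simp add: e_def adif_add adif_Leibniz)

lemma e: "dg_idem A e"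
proof -
  have "adif A e' * e = adif A e'" using idem(2) e_mult(1) by (metis mult.assoc)
  moreover have "adif A u * v * e = adif A u * v" using e_mult(4) by (simp add: mult.assoc)
  moreover have "u * adif A v * e = u * adif A v" using dv e_mult(1) by (metis mult.assoc)
  ultimately have "adif A e * e = adif A e"
    by (simp add: adif_e distrib_right)
  moreover have "e \<in> agr A 0" using idem(3) agr_mult[OF gu gv] by (simp add: e_def agr_add)
  ultimately show ?thesis using e_mult(5) by (simp add: dg_idem_def)
qed

lemma e_de: "e * adif A e = 0"
  using adif_Leibniz[of e e] e by (simp add: dg_idem_def)

lemma e'du: "e' * adif A u = 0"
proof -
  have "adif A e' * u = 0" using idem(2) e'u by (metis mult.assoc mult_zero_right)
  then show ?thesis using adif_Leibniz[of e' u] e'u by simp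
qed

text \<open>Both \<open>e'\<close> and \<open>v\<close> annihilate \<open>adif A u\<close> from the
  left, hence so does \<open>e\<close>. As a result right multiplication by \<open>u\<close>
  commutes with the differential on the left ideal of \<open>e\<close>.\<close>

lemma mult_du: assumes "x * e = x" shows "x * adif A u = 0"
proof -
  have "x * adif A u = x * (e * adif A u)" using assms by (simp flip: mult.assoc)
  also have "e * adif A u = 0" using e'du vdu by (simp add: e_def distrib_right mult.assoc)
  finally show ?thesis by simp
qed

lemma dif_mult_u: "x * e = x \<Longrightarrow> adif A (x * u) = adif A x * u"
  by (simp add: adif_Leibniz mult_du)

text \<open>Right multiplication by \<open>e'\<close> projects the ideal of \<open>e\<close> to that
  of \<open>e'\<close>, but need not commute with the differential; this term is the error. It comes
  from expanding \<open>e * adif A e = 0\<close> along \<open>e = e' + u * v\<close>.\<close>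

lemma mult_de': assumes "x * e = x" shows "x * adif A e' = - (x * u * adif A v)"
proof -
  have "x * adif A e = 0" using assms e_de by (metis mult.assoc mult_zero_right)
  then have "x * adif A e' + (x * adif A u * v + x * u * adif A v) = 0"
    by (simp add: adif_e distrib_left mult.assoc)
  moreover have "x * adif A u * v = 0" using mult_du[OF assms] by simp
  ultimately show ?thesis by (simp add: eq_neg_iff_add_eq_0)
qed

lemma idem_vu: "dg_idem A (v * u)"
  using d_vu agr_mult[OF gv gu] vuv by (simp add: dg_idem_def mult.assoc[symmetric])

lemma mem_left_ideal: "dg_idem A f \<Longrightarrow> z \<in> carrier (left_ideal A f) \<longleftrightarrow> (\<exists>x. z = Elem x \<and> x * f = x)"
  using range_idem[of f] by (auto simp: dg_idem_def)

lemma Elem_mem_left_ideal: "dg_idem A f \<Longrightarrow> Elem x \<in> carrier (left_ideal A f) \<longleftrightarrow> x * f = x"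
  by (simp only: mem_left_ideal) auto

text \<open>Since \<open>x = x * e' + (x * u) * v\<close> on the ideal of \<open>e\<close>, a
  section there is determined by the given one over the ideal of \<open>e'\<close> and by a lift of
  \<open>v\<close> whose differential is prescribed by that section. The fibration lies over a
  possibly larger ideal, that of \<open>T\<close>, and so stays fixed while the section is extended
  cell by cell.\<close>

lemma lift_step:
  fixes W :: "('r, ('r, 'x) univ) pdg_mod"
  assumes W: "pdg_module A W" and T: "dg_idem A T" "e * T = e" and w: "saf A W (left_ideal A T :: ('r, ('r, 'x) univ) pdg_mod) w"
    and \<sigma>': "\<sigma>' \<in> pdg_hom (left_ideal A e' :: ('r, ('r, 'x) univ) pdg_mod) W" "\<And>x. x * e' = x \<Longrightarrow> w (\<sigma>' (Elem x)) = Elem x"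
  shows "\<exists>\<sigma>\<in>pdg_hom (left_ideal A e :: ('r, ('r, 'x) univ) pdg_mod) W. \<forall>x. x * e = x \<longrightarrow> w (\<sigma> (Elem x)) = Elem x"
proof -
  interpret W: pdg_module A W by fact
  let ?T = "left_ideal A T :: ('r, ('r, 'x) univ) pdg_mod" and ?e' = "left_ideal A e' :: ('r, ('r, 'x) univ) pdg_mod"
    and ?e = "left_ideal A e :: ('r, ('r, 'x) univ) pdg_mod"
  have MT: "pdg_module A ?T" by (rule pdg_module_left_ideal[OF T(1)])
  interpret T: pdg_module A ?T by (rule MT)
  note c = mem_left_ideal and cE = Elem_mem_left_ideal
  have g: "Elem x \<in> grade (left_ideal A f :: ('r, ('r, 'x) univ) pdg_mod) n \<longleftrightarrow> x \<in> agr A n \<and> x * f = x" if "dg_idem A f" for f n x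
    using range_idem[of f] that by (auto simp: dg_idem_def)
  obtain \<sigma>0 where \<sigma>0: "\<sigma>0 \<in> gr_hom 0 ?T W" "\<forall>x\<in>carrier ?T. w (\<sigma>0 x) = x" and wh: "w \<in> pdg_hom W ?T"
    using w by (auto simp: saf_def)
  have vT: "v * T = v" using T(2) e_mult(4) by (metis mult.assoc)
  have vc: "Elem v \<in> carrier ?T" using vT by (simp only: cE[OF T(1)])
  \<comment> \<open>A graded lift of \<open>v\<close>, taken from the splitting. Its differential
    may differ from the prescribed value \<open>\<sigma>' (Elem (adif A v))\<close>, but only by an
    element \<open>y\<close> of the kernel.\<close>
  define w0 where "w0 = \<sigma>0 (Elem v)"
  have w0: "w0 \<in> grade W 0" "w w0 = Elem v"
    using gr_hom_grade[OF \<sigma>0(1), of "Elem v" 0] g[OF T(1)] gv vT \<sigma>0(2) vc by (auto simp: w0_def)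
  have w0c: "w0 \<in> carrier W" using w0(1) W.grade_carrier by blast
  have dvc: "Elem (adif A v) \<in> carrier ?e'" using dv by (simp only: cE[OF e'])
  define y where "y = dif W w0 \<ominus>\<^bsub>W\<^esub> \<sigma>' (Elem (adif A v))"
  have sc: "\<sigma>' z \<in> carrier W" if "z \<in> carrier ?e'" for z by (rule pdg_hom_closed[OF \<sigma>'(1) that])
  have yg: "y \<in> grade W (0 + 2)" unfolding y_def
  proof (rule W.grade_sub)
    show "dif W w0 \<in> grade W (0 + 2)" using W.dif_degree[OF w0(1)] by simp
    show "\<sigma>' (Elem (adif A v)) \<in> grade W (0 + 2)"
      by (rule pdg_hom_grade[OF \<sigma>'(1)]) (simp only: g[OF e'] dv, simp add: adif_degree[OF gv, simplified])
  qed
  have ws: "w (a \<ominus>\<^bsub>W\<^esub> b) = w a \<ominus>\<^bsub>?T\<^esub> w b" if "a \<in> carrier W" "b \<in> carrier W" for a b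
    by (rule addmap_sub[OF W.abelian_group_axioms T.abelian_group_axioms pdg_hom_addmap[OF wh] that])
  have wy: "w y = \<zero>\<^bsub>?T\<^esub>"
  proof -
    have "w y = w (dif W w0) \<ominus>\<^bsub>?T\<^esub> w (\<sigma>' (Elem (adif A v)))" unfolding y_def
      using w0c sc[OF dvc] by (intro ws) (auto simp: W.dif_closed)
    also have "w (dif W w0) = Elem (adif A v)" using pdg_hom_dif[OF wh w0c] w0(2) by simp
    also have "w (\<sigma>' (Elem (adif A v))) = Elem (adif A v)" by (rule \<sigma>'(2)[OF dv])
    also have "Elem (adif A v) \<ominus>\<^bsub>?T\<^esub> Elem (adif A v) = \<zero>\<^bsub>?T\<^esub>"
      using T.dif_closed[OF vc] by (intro T.sub_self) simp
    finally show ?thesis .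
  qed
  \<comment> \<open>\<open>dif^(p - 1)\<close> turns the two parts of \<open>y\<close> into
    \<open>dif^p w0\<close> and the image of the \<open>p\<close>th differential of
    \<open>v\<close>; both vanish. This is the condition for \<open>y\<close> to be a boundary
    within the kernel.\<close>
  have dy: "(dif W ^^ (pchar A - 1)) y = \<zero>\<^bsub>W\<^esub>"
  proof -
    have p: "pchar A = Suc (pchar A - 1)" using pchar_ge2 by simp
    have "(dif W ^^ k) (\<sigma>' (Elem x)) = \<sigma>' (Elem ((adif A ^^ k) x)) \<and> (adif A ^^ k) x * e' = (adif A ^^ k) x" if "x * e' = x" for k x
    proof (induction k)
      case (Suc k)
      then have "Elem ((adif A ^^ k) x) \<in> carrier ?e'" by (simp only: cE[OF e'])
      from pdg_hom_dif[OF \<sigma>'(1) this] Suc left_ideal_closed[OF e'] show ?case by simp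
    qed (use that in simp)
    from this[OF dv, of "pchar A - 1"] have "(dif W ^^ (pchar A - 1)) (\<sigma>' (Elem (adif A v))) = \<sigma>' (Elem ((adif A ^^ pchar A) v))"
      by (subst p) (simp add: funpow_swap1 del: One_nat_def)
    also have "\<dots> = \<zero>\<^bsub>W\<^esub>"
      using addmap_zero[OF pdg_module.axioms(1)[OF pdg_module_left_ideal[OF e']] W.abelian_group_axioms pdg_hom_addmap[OF \<sigma>'(1)]]
      by (simp add: adif_nilpotent)
    finally have 1: "(dif W ^^ (pchar A - 1)) (\<sigma>' (Elem (adif A v))) = \<zero>\<^bsub>W\<^esub>" .
    have "(dif W ^^ (pchar A - 1)) (dif W w0) = (dif W ^^ pchar A) w0"
      by (subst (2) p) (simp add: funpow_swap1 del: One_nat_def)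
    then have 2: "(dif W ^^ (pchar A - 1)) (dif W w0) = \<zero>\<^bsub>W\<^esub>" using W.dif_nilpotent[OF w0c] by simp
    show ?thesis
      unfolding y_def a_minus_def
      using 1 2 w0c sc[OF dvc] by (simp add: W.dif_pow_add W.dif_pow_neg W.dif_closed)
  qed
  obtain y' where y': "y' \<in> grade W 0" "w y' = \<zero>\<^bsub>?T\<^esub>" "dif W y' = y"
    using saf_antidif[OF pdg_algebra_axioms W MT w yg wy dy] by auto
  have y'c: "y' \<in> carrier W" using y'(1) W.grade_carrier by blast
  \<comment> \<open>The corrected lift, multiplied by the closed idempotent \<open>v * u\<close>,
    which fixes \<open>v\<close> from the left.\<close>
  define w2 where "w2 = (v * u) \<odot>\<^bsub>W\<^esub> (w0 \<ominus>\<^bsub>W\<^esub> y')"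
  have w2c: "w2 \<in> carrier W" using w0c y'c by (simp add: w2_def W.smult_closed)
  have w2g: "w2 \<in> grade W 0"
    using W.grade_smult[OF agr_mult[OF gv gu] W.grade_sub[OF w0(1) y'(1)]] by (simp add: w2_def)
  have ww2: "w w2 = Elem v"
  proof -
    have "w (w0 \<ominus>\<^bsub>W\<^esub> y') = Elem v" using ws[OF w0c y'c] w0(2) y'(2) T.sub_zero[OF vc] by simp
    then show ?thesis using pdg_hom_smult[OF wh, of "w0 \<ominus>\<^bsub>W\<^esub> y'" "v * u"] w0c y'c vuv by (simp add: w2_def)
  qed
  have dw2: "dif W w2 = \<sigma>' (Elem (v * u * adif A v))"
  proof -
    have "dif W (w0 \<ominus>\<^bsub>W\<^esub> y') = \<sigma>' (Elem (adif A v))"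
      using w0c y'c sc[OF dvc] by (simp add: W.dif_sub y'(3) y_def W.sub_sub_cancel W.dif_closed)
    then show ?thesis
      using W.dif_Leibniz[of "w0 \<ominus>\<^bsub>W\<^esub> y'" "v * u"] w0c y'c d_vu pdg_hom_smult[OF \<sigma>'(1) dvc, of "v * u"] sc[OF dvc]
      by (simp add: w2_def W.smult_closed)
  qed
  \<comment> \<open>The decomposition \<open>x = x * e' + (x * u) * v\<close> with each part
    replaced by its lift.\<close>
  define \<sigma> where "\<sigma> z = \<sigma>' (Elem (elem_of z * e')) \<oplus>\<^bsub>W\<^esub> (elem_of z * u) \<odot>\<^bsub>W\<^esub> w2" for z :: "('r, 'x) univ"
  have e'c: "Elem (x * e') \<in> carrier ?e'" for x using idem(1) by (simp only: cE[OF e'] mult.assoc)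
  have s'c: "\<sigma>' (Elem (x * e')) \<in> carrier W" for x by (rule sc[OF e'c])
  have s'add: "\<sigma>' (Elem (x * e' + z * e')) = \<sigma>' (Elem (x * e')) \<oplus>\<^bsub>W\<^esub> \<sigma>' (Elem (z * e'))" for x z
    using pdg_hom_add[OF \<sigma>'(1) e'c e'c] by simp
  have "\<sigma> \<in> pdg_hom ?e W"
  proof (rule pdg_homI; (rule gr_homI)?)
    fix z assume z: "z \<in> carrier ?e"
    show "\<sigma> z \<in> carrier W" using s'c w2c by (simp add: \<sigma>_def W.smult_closed)
    show "\<sigma> (r \<odot>\<^bsub>?e\<^esub> z) = r \<odot>\<^bsub>W\<^esub> \<sigma> z" for r
      using pdg_hom_smult[OF \<sigma>'(1) e'c, of r "elem_of z"] s'c w2c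
      by (simp add: \<sigma>_def W.smult_closed W.smult_r_distr mult.assoc W.smult_assoc[OF w2c, of r "elem_of z * u"])
    show "\<sigma> (z \<oplus>\<^bsub>?e\<^esub> t) = \<sigma> z \<oplus>\<^bsub>W\<^esub> \<sigma> t" for t
      using s'c w2c by (simp add: \<sigma>_def distrib_right s'add W.smult_l_distr W.smult_closed W.a_ac)
    obtain x where x: "z = Elem x" "x * e = x" using z by (auto simp only: c[OF e])
    have ux: "Elem (x * u * adif A v) \<in> carrier ?e'" using dv by (simp only: cE[OF e'] mult.assoc)
    have "adif A (x * e') = adif A x * e' + - (x * u * adif A v)" using adif_Leibniz mult_de'[OF x(2)] by simp
    moreover have "- (x * u * adif A v) * e' = - (x * u * adif A v)" using dv by (simp add: mult.assoc)
    ultimately have "\<sigma>' (Elem (adif A (x * e'))) = \<sigma>' (Elem (adif A x * e')) \<oplus>\<^bsub>W\<^esub> \<sigma>' (Elem (- (x * u * adif A v)))"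
      using s'add[of "adif A x" "- (x * u * adif A v)"] by simp
    moreover have "\<sigma>' (Elem (- (x * u * adif A v))) = \<ominus>\<^bsub>W\<^esub> \<sigma>' (Elem (x * u * adif A v))"
      using pdg_hom_smult[OF \<sigma>'(1) ux, of "- 1"] W.neg_smult[OF sc[OF ux], of 1] W.smult_one[OF sc[OF ux]] by simp
    ultimately have 1: "dif W (\<sigma>' (Elem (x * e'))) = \<sigma>' (Elem (adif A x * e')) \<ominus>\<^bsub>W\<^esub> \<sigma>' (Elem (x * u * adif A v))"
      using pdg_hom_dif[OF \<sigma>'(1) e'c] by (simp add: a_minus_def)
    have "(x * u) \<odot>\<^bsub>W\<^esub> dif W w2 = \<sigma>' (Elem (x * u * (v * u * adif A v)))"
    proof -
      have "Elem (v * u * adif A v) \<in> carrier ?e'" using dv by (simp only: cE[OF e'] mult.assoc)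
      from pdg_hom_smult[OF \<sigma>'(1) this, of "x * u"] show ?thesis by (simp add: dw2)
    qed
    also have "x * u * (v * u * adif A v) = x * u * adif A v" using uvu by (metis mult.assoc)
    finally have 2: "dif W ((x * u) \<odot>\<^bsub>W\<^esub> w2) = (adif A x * u) \<odot>\<^bsub>W\<^esub> w2 \<oplus>\<^bsub>W\<^esub> \<sigma>' (Elem (x * u * adif A v))"
      using W.dif_Leibniz[OF w2c, of "x * u"] dif_mult_u[OF x(2)] by simp
    \<comment> \<open>The error of the projection to the ideal of \<open>e'\<close> and the
      differential of \<open>w2\<close> contribute the same element
      \<open>\<sigma>' (Elem (x * u * adif A v))\<close>, with opposite signs.\<close>
    have "dif W (\<sigma> z) = (\<sigma>' (Elem (adif A x * e')) \<ominus>\<^bsub>W\<^esub> \<sigma>' (Elem (x * u * adif A v)))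
        \<oplus>\<^bsub>W\<^esub> ((adif A x * u) \<odot>\<^bsub>W\<^esub> w2 \<oplus>\<^bsub>W\<^esub> \<sigma>' (Elem (x * u * adif A v)))"
      using s'c w2c by (simp add: \<sigma>_def x(1) W.dif_add W.smult_closed 1 2)
    also have "\<dots> = \<sigma>' (Elem (adif A x * e')) \<oplus>\<^bsub>W\<^esub> (adif A x * u) \<odot>\<^bsub>W\<^esub> w2"
      using s'c[of "adif A x"] sc[OF ux] W.smult_closed[OF w2c, of "adif A x * u"]
      by (simp add: a_minus_def W.a_ac W.r_neg)
    finally show "\<sigma> (dif ?e z) = dif W (\<sigma> z)" by (simp add: \<sigma>_def x(1))
  next
    fix n z assume "z \<in> grade ?e n"
    then obtain x where x: "z = Elem x" "x \<in> agr A n" by auto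
    have "\<sigma>' (Elem (x * e')) \<in> grade W n"
      by (rule pdg_hom_grade[OF \<sigma>'(1)]) (use g[OF e', of "x * e'" n] agr_mult[OF x(2) idem(3)] idem(1) in \<open>simp add: mult.assoc del: left_ideal_simps\<close>)
    moreover have "(x * u) \<odot>\<^bsub>W\<^esub> w2 \<in> grade W n" using W.grade_smult[OF agr_mult[OF x(2) gu] w2g] by simp
    ultimately show "\<sigma> z \<in> grade W (n + 0)" by (simp add: \<sigma>_def x(1) W.grade_add)
  qed
  moreover have "w (\<sigma> (Elem x)) = Elem x" if x: "x * e = x" for x
  proof -
    have "w (\<sigma> (Elem x)) = w (\<sigma>' (Elem (x * e'))) \<oplus>\<^bsub>?T\<^esub> w ((x * u) \<odot>\<^bsub>W\<^esub> w2)"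
      using s'c w2c unfolding \<sigma>_def by (subst pdg_hom_add[OF wh]) (auto simp: W.smult_closed)
    also have "\<dots> = Elem (x * e' + x * u * v)"
      using \<sigma>'(2)[of "x * e'"] idem(1) pdg_hom_smult[OF wh w2c, of "x * u"] ww2 by (simp add: mult.assoc)
    also have "x * e' + x * u * v = x" using x by (simp add: e_def distrib_left mult.assoc)
    finally show ?thesis .
  qed
  ultimately show ?thesis by blast
qed

end


lemma zero_lift:
  assumes "pdg_algebra A" "pdg_module A W"
  shows "(\<lambda>_. \<zero>\<^bsub>W\<^esub>) \<in> pdg_hom M W"
proof -
  interpret W: pdg_module A W by fact
  show ?thesis by (intro pdg_homI gr_homI) auto
qed

context pdg_category begin

text \<open>The ideal is cyclic with generator \<open>e\<close>, so only the splitting of acyclic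
  fibrations onto it remains to be supplied.\<close>

lemma compact_left_ideal:
  fixes e :: 'r
  assumes e: "dg_idem A e"
    and lift: "\<And>(W :: ('r, ('r, 'x) univ) pdg_mod) (w :: ('r, 'x) univ \<Rightarrow> ('r, 'x) univ). pdg_module A W \<Longrightarrow> saf A W (left_ideal A e) w \<Longrightarrow>
      \<exists>\<sigma>\<in>pdg_hom (left_ideal A e :: ('r, ('r, 'x) univ) pdg_mod) W. \<forall>x. x * e = x \<longrightarrow> w (\<sigma> (Elem x)) = Elem x"
  shows "(left_ideal A e :: ('r, ('r, 'x) univ) pdg_mod) \<in> compact_obs A"
proof -
  have ee: "e * e = e" using e by (simp add: dg_idem_def)
  have c: "z \<in> carrier (left_ideal A e :: ('r, ('r, 'x) univ) pdg_mod) \<longleftrightarrow> (\<exists>x. z = Elem x \<and> x * e = x)" for z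
    using range_idem[OF ee] by auto
  have "lifts (left_ideal A e :: ('r, ('r, 'x) univ) pdg_mod)"
    unfolding lifts_def
  proof (intro conjI allI impI)
    show "pdg_module A (left_ideal A e)" by (rule pdg_module_left_ideal[OF e])
    fix W :: "('r, ('r, 'x) univ) pdg_mod" and w :: "('r, 'x) univ \<Rightarrow> ('r, 'x) univ"
    assume "pdg_module A W" "saf A W (left_ideal A e) w"
    from lift[OF this] obtain \<sigma> where "\<sigma> \<in> pdg_hom (left_ideal A e :: ('r, ('r, 'x) univ) pdg_mod) W" "\<forall>x. x * e = x \<longrightarrow> w (\<sigma> (Elem x)) = Elem x"
      by (elim bexE)
    then show "\<exists>\<sigma>\<in>pdg_hom (left_ideal A e :: ('r, ('r, 'x) univ) pdg_mod) W. \<forall>x\<in>carrier (left_ideal A e). w (\<sigma> x) = x"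
      by (intro bexI[of _ \<sigma>]) (auto simp only: c)
  qed
  then have "is_compact TYPE(('r, 'x) univ) (derived_cat A :: (('r, ('r, 'x) univ) pdg_mod, _) cat) (left_ideal A e)"
  proof (rule compact_of_lifts)
    show "Elem e \<in> carrier (left_ideal A e :: ('r, ('r, 'x) univ) pdg_mod)" using ee by (simp only: c) auto
    fix z assume "z \<in> carrier (left_ideal A e :: ('r, ('r, 'x) univ) pdg_mod)"
    then obtain x where "z = Elem x" "x * e = x" by (auto simp only: c)
    then show "\<exists>r. z = r \<odot>\<^bsub>left_ideal A e\<^esub> Elem e" by (intro exI[of _ x]) simp
  qed
  then show ?thesis by (simp only: compact_obs_def mem_Collect_eq)
qed

end

text \<open>The list enumerates the index set in increasing order.\<close>

locale cell_chain = pdg_category A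
  for A :: "('k::field, 'r::{ring, monoid_mult}) pdg_alg" +
  fixes xs :: "'i list" and u v :: "'i \<Rightarrow> 'r"
  assumes dist: "distinct xs"
    and gr: "\<And>i. i \<in> set xs \<Longrightarrow> u i \<in> agr A 0" "\<And>i. i \<in> set xs \<Longrightarrow> v i \<in> agr A 0"
    and uvu: "\<And>i. i \<in> set xs \<Longrightarrow> u i * v i * u i = u i" and vuv: "\<And>i. i \<in> set xs \<Longrightarrow> v i * u i * v i = v i"
    and orth: "\<And>i j. i \<in> set xs \<Longrightarrow> j \<in> set xs \<Longrightarrow> i \<noteq> j \<Longrightarrow> v i * u j = 0"
    and total: "adif A (\<Sum>i\<in>set xs. u i * v i) = 0"
    and dvu: "\<And>i. i \<in> set xs \<Longrightarrow> adif A (v i * u i) = 0"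
    and ord: "sorted_wrt (\<lambda>i j. v i * adif A (u j) = 0) xs"
    and diag: "\<And>i. i \<in> set xs \<Longrightarrow> v i * adif A (u i) = 0"
begin

abbreviation "E ys \<equiv> \<Sum>i\<in>set ys. u i * v i"

text \<open>The point is the condition on the differential of \<open>v m\<close>. From
  \<open>v m * E xs = v m\<close> and the closedness of \<open>E xs\<close> follows
  \<open>adif A (v m) = adif A (v m) * E xs\<close>, and the summands from \<open>m\<close> on
  vanish because \<open>adif A (v m) * u i = - (v m * adif A (u i)) = 0\<close> there.\<close>

lemma cell_step_axioms:
  assumes xs: "xs = ys @ m # zs" and E: "dg_idem A (E ys)"
  shows "cell_step A (E ys) (u m) (v m)"
proof
  have m: "m \<in> set xs" "m \<notin> set ys" "set ys \<subseteq> set xs" using xs dist by auto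
  show "dg_idem A (E ys)" by fact
  show "u m \<in> agr A 0" "v m \<in> agr A 0" "u m * v m * u m = u m" "v m * u m * v m = v m" "v m * adif A (u m) = 0"
    using m gr uvu vuv diag by auto
  have "u i * v i * u m = 0" if "i \<in> set ys" for i using that m orth[of i m] by (metis mult.assoc mult_zero_right subsetD)
  then show "E ys * u m = 0" by (simp add: sum_distrib_right)
  have "v m * (u i * v i) = 0" if "i \<in> set ys" for i using that m orth[of m i] by (metis mult.assoc mult_zero_left subsetD)
  then show "v m * E ys = 0" by (simp add: sum_distrib_left)
  have "v m * E xs = (\<Sum>i\<in>set xs. if i = m then v m else 0)"
    unfolding sum_distrib_left using m orth[of m] vuv[of m]
    by (intro sum.cong) (auto simp flip: mult.assoc)
  then have vE: "v m * E xs = v m" using m by simp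
  have "adif A (v m) = adif A (v m) * E xs" using adif_Leibniz[of "v m" "E xs"] vE total by simp
  also have "\<dots> = (\<Sum>i\<in>set xs. adif A (v m) * u i * v i)" by (simp add: sum_distrib_left mult.assoc)
  also have "\<dots> = (\<Sum>i\<in>set ys. adif A (v m) * u i * v i)"
  proof (rule sum.mono_neutral_right)
    show "\<forall>i\<in>set xs - set ys. adif A (v m) * u i * v i = 0"
    proof
      fix i assume i: "i \<in> set xs - set ys"
      have "v m * adif A (u i) = 0"
        using i ord diag xs by (auto simp: sorted_wrt_append)
      moreover have "adif A (v m * u i) = 0" using i m orth[of m i] dvu by (cases "i = m") auto
      ultimately have "adif A (v m) * u i = 0" by (simp add: adif_Leibniz)
      then show "adif A (v m) * u i * v i = 0" by simp
    qed
  qed (use m in auto)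
  also have "\<dots> = adif A (v m) * E ys" by (simp add: sum_distrib_left mult.assoc)
  finally show "adif A (v m) * E ys = adif A (v m)" by simp
qed

lemma E_snoc: "xs = ys @ m # zs \<Longrightarrow> E (ys @ [m]) = E ys + u m * v m"
  using dist by (simp add: add.commute)

lemma idem_E: "xs = ys @ zs \<Longrightarrow> dg_idem A (E ys)"
proof (induction ys arbitrary: zs rule: rev_induct)
  case Nil
  show ?case by (simp add: dg_idem_def)
next
  case (snoc m ys)
  then have xs: "xs = ys @ m # zs" by simp
  interpret cell_step A "E ys" "u m" "v m" by (rule cell_step_axioms[OF xs snoc.IH[OF xs]])
  show ?case using e unfolding e_def E_snoc[OF xs] .
qed

text \<open>Says that the left ideals of the prefixes increase, as needed to extend a section along
  them: the larger idempotent annihilates the next \<open>u m\<close>.\<close>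

lemma E_prefix: "xs = ys @ zs @ ws \<Longrightarrow> E ys * E (ys @ zs) = E ys"
proof (induction zs arbitrary: ws rule: rev_induct)
  case Nil
  then show ?case using idem_E[of ys] by (simp add: dg_idem_def)
next
  case (snoc m zs)
  then have xs: "xs = (ys @ zs) @ m # ws" by simp
  interpret cell_step A "E (ys @ zs)" "u m" "v m" by (rule cell_step_axioms[OF xs idem_E[OF xs]])
  have "E ys * (u m * v m) = E ys * E (ys @ zs) * (u m * v m)" using snoc.IH[of "m # ws"] xs by simp
  also have "\<dots> = E ys * (E (ys @ zs) * u m) * v m" by (simp only: mult.assoc)
  also have "\<dots> = 0" unfolding e'u by simp
  finally show ?case using snoc.IH[of "m # ws"] xs E_snoc[OF xs] by (simp add: distrib_left)
qed

lemma compact_E: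
  assumes xs: "xs = ys @ zs"
  shows "(left_ideal A (E ys) :: ('r, ('r, 'x) univ) pdg_mod) \<in> compact_obs A"
proof (rule compact_left_ideal)
  show "dg_idem A (E ys)" by (rule idem_E[OF xs])
  fix W :: "('r, ('r, 'x) univ) pdg_mod" and w :: "('r, 'x) univ \<Rightarrow> ('r, 'x) univ"
  assume W: "pdg_module A W" and w: "saf A W (left_ideal A (E ys)) w"
  \<comment> \<open>The fibration over the ideal of \<open>ys\<close> is kept fixed; sections are
    built over the ideals of the prefixes of \<open>ys\<close>, beginning with the zero map over the
    zero ideal.\<close>
  have "\<exists>\<sigma>\<in>pdg_hom (left_ideal A (E as) :: ('r, ('r, 'x) univ) pdg_mod) W. \<forall>x. x * E as = x \<longrightarrow> w (\<sigma> (Elem x)) = Elem x" if "ys = as @ bs" for as bs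
    using that
  proof (induction as arbitrary: bs rule: rev_induct)
    case Nil
    interpret ww: pdg_module_pair A W "left_ideal A (E ys) :: ('r, ('r, 'x) univ) pdg_mod"
      by (rule pair[OF W pdg_module_left_ideal[OF idem_E[OF xs]]])
    have "w \<zero>\<^bsub>W\<^esub> = Elem 0"
      using w addmap_zero[OF ww.M.abelian_group_axioms ww.N.abelian_group_axioms pdg_hom_addmap[of w]] by (auto simp: saf_def)
    then show ?case by (intro bexI[OF _ zero_lift[OF pdg_algebra_axioms W]]) simp
  next
    case (snoc m as)
    have ys: "ys = as @ m # bs" and xs': "xs = as @ m # bs @ zs" using snoc.prems xs by auto
    interpret cell_step A "E as" "u m" "v m" by (rule cell_step_axioms[OF xs' idem_E[OF xs']])
    obtain \<sigma> where \<sigma>: "\<sigma> \<in> pdg_hom (left_ideal A (E as) :: ('r, ('r, 'x) univ) pdg_mod) W" "\<forall>x. x * E as = x \<longrightarrow> w (\<sigma> (Elem x)) = Elem x"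
      using snoc.IH[OF ys] by (elim bexE)
    have e: "e = E (as @ [m])" using E_snoc[OF xs'] by (simp add: e_def)
    have "e * E ys = e" unfolding e using E_prefix[of "as @ [m]" bs zs] xs' ys by simp
    from lift_step[OF W idem_E[OF xs] this w \<sigma>(1)] \<sigma>(2) show ?case unfolding e by blast
  qed
  from this[of ys "[]"]
  show "\<exists>\<sigma>\<in>pdg_hom (left_ideal A (E ys) :: ('r, ('r, 'x) univ) pdg_mod) W. \<forall>x. x * E ys = x \<longrightarrow> w (\<sigma> (Elem x)) = Elem x" by simp
qed

end

section \<open>The shift functor and distinguished triangles\<close>

section \<open>The shift functor\<close>

lemma entries_shift_map [simp]: "entries (shift_map f x) = map f (entries x)"
  by (simp add: shift_map_def)

lemma shift_map_comp: "shift_map g (shift_map f x) = shift_map (\<lambda>x. g (f x)) x"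
  by (simp add: shift_map_def)

context pdg_category begin

lemma pdg_tower_shift: "pdg_module A X \<Longrightarrow> pdg_tower A (replicate (pchar A - 1) X) (\<lambda>_ x. x)"
  by (intro pdg_tower.intro pdg_tower_axioms.intro pdg_algebra_axioms) (auto intro: pdg_hom_ident)

lemma pdg_module_shift: "pdg_module A X \<Longrightarrow> pdg_module A (shift_ob A X)"
  unfolding shift_ob_def by (intro pdg_tower.pdg_module_tower pdg_tower_shift)

end

locale shift_pair = pdg_category A
  for A :: "('k::field, 'r::{ring, monoid_mult}) pdg_alg" +
  fixes X Y :: "('r, ('a, 'x) univ) pdg_mod"
  assumes MX: "pdg_module A X" and MY: "pdg_module A Y"
begin

sublocale pdg_module_pair A X Y by (rule pair[OF MX MY])

sublocale TX: pdg_tower A "replicate (pchar A - 1) X" "\<lambda>_ x. x"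
  rewrites "tower A (replicate (pchar A - 1) X) (\<lambda>_ x. x) = shift_ob A X"
  by (rule pdg_tower_shift[OF MX]) (simp add: shift_ob_def)

sublocale TY: pdg_tower A "replicate (pchar A - 1) Y" "\<lambda>_ x. x"
  rewrites "tower A (replicate (pchar A - 1) Y) (\<lambda>_ x. x) = shift_ob A Y"
  by (rule pdg_tower_shift[OF MY]) (simp add: shift_ob_def)

abbreviation "SX \<equiv> shift_ob A X"
abbreviation "SY \<equiv> shift_ob A Y"

sublocale S: pdg_module_pair A SX SY by (rule pair[OF pdg_module_shift[OF MX] pdg_module_shift[OF MY]])

lemma SX_entries: "z \<in> carrier SX \<Longrightarrow> length (entries z) = pchar A - 1"
  "z \<in> carrier SX \<Longrightarrow> i < pchar A - 1 \<Longrightarrow> entries z ! i \<in> carrier X"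
  using TX.tower_carrierD(2)[of z] TX.tower_carrierD(3)[of z i] by simp_all

lemma SX_dif: "i < pchar A - 1 \<Longrightarrow> entries (dif SX z) ! i =
    (if i = 0 then dif X (entries z ! i) else dif X (entries z ! i) \<oplus>\<^bsub>X\<^esub> entries z ! (i - 1))"
  using TX.entries_dif_tower[of i z] by simp

lemma SY_dif: "i < pchar A - 1 \<Longrightarrow> entries (dif SY z) ! i =
    (if i = 0 then dif Y (entries z ! i) else dif Y (entries z ! i) \<oplus>\<^bsub>Y\<^esub> entries z ! (i - 1))"
  using TY.entries_dif_tower[of i z] by simp

lemma shift_map_closed: "(\<And>x. x \<in> carrier X \<Longrightarrow> f x \<in> carrier Y) \<Longrightarrow> z \<in> carrier SX \<Longrightarrow> shift_map f z \<in> carrier SY"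
  unfolding shift_map_def by (rule TY.tower_carrierI) (auto simp: SX_entries)

lemma shift_gr_hom_closed: "f \<in> gr_hom d X Y \<Longrightarrow> z \<in> carrier SX \<Longrightarrow> shift_map f z \<in> carrier SY"
  by (erule shift_map_closed[rotated]) (rule gr_hom_closed)

lemma shift_map_nth: "z \<in> carrier SX \<Longrightarrow> i < pchar A - 1 \<Longrightarrow> entries (shift_map f z) ! i = f (entries z ! i)"
  by (simp add: SX_entries)

lemma SY_eqI:
  "x \<in> carrier SY \<Longrightarrow> y \<in> carrier SY \<Longrightarrow> (\<And>i. i < pchar A - 1 \<Longrightarrow> entries x ! i = entries y ! i) \<Longrightarrow> x = y"
  using TY.tower_eqI[of x y] by simp

lemma shift_gr_hom:
  assumes f: "f \<in> gr_hom d X Y"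
  shows "shift_map f \<in> gr_hom d SX SY"
proof (rule gr_homI)
  note cl = shift_gr_hom_closed[OF f]
  fix x assume x: "x \<in> carrier SX"
  show "shift_map f x \<in> carrier SY" by (rule cl[OF x])
  show "shift_map f (x \<oplus>\<^bsub>SX\<^esub> y) = shift_map f x \<oplus>\<^bsub>SY\<^esub> shift_map f y" if y: "y \<in> carrier SX" for y
  proof (rule SY_eqI)
    fix i assume i: "i < pchar A - 1"
    then show "entries (shift_map f (x \<oplus>\<^bsub>SX\<^esub> y)) ! i = entries (shift_map f x \<oplus>\<^bsub>SY\<^esub> shift_map f y) ! i"
      using x y TX.tower.add(1)[OF x y]
      by (simp add: shift_map_nth TY.entries_add_tower TX.entries_add_tower gr_hom_add[OF f] SX_entries del: entries_shift_map)
  qed (auto intro: cl x y TX.tower.add TY.tower.add)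
  show "shift_map f (r \<odot>\<^bsub>SX\<^esub> x) = r \<odot>\<^bsub>SY\<^esub> shift_map f x" for r
  proof (rule SY_eqI)
    fix i assume i: "i < pchar A - 1"
    then show "entries (shift_map f (r \<odot>\<^bsub>SX\<^esub> x)) ! i = entries (r \<odot>\<^bsub>SY\<^esub> shift_map f x) ! i"
      using x TX.tower.smult(1)[OF x]
      by (simp add: shift_map_nth TY.entries_smult_tower TX.entries_smult_tower gr_hom_smult[OF f] SX_entries del: entries_shift_map)
  qed (auto intro: cl x TX.tower.smult TY.tower.smult)
next
  fix n x assume x: "x \<in> grade SX n"
  then have xc: "x \<in> carrier SX" and xg: "entries x ! i \<in> grade X (n + 2 * (int (pchar A) - 1 - int i))" if "i < pchar A - 1" for i
    using that by (auto simp: TX.tower.grade)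
  have xc: "x \<in> carrier SX" using x by (auto simp: TX.tower.grade)
  have "f (entries x ! i) \<in> grade Y (n + d + 2 * (int (pchar A) - 1 - int i))" if "i < pchar A - 1" for i
    using gr_hom_grade[OF f xg[OF that]] by (simp add: algebra_simps)
  then show "shift_map f x \<in> grade SY (n + d)"
    using shift_gr_hom_closed[OF f xc] shift_map_nth[OF xc] by (auto simp: TY.tower.grade simp del: entries_shift_map)
qed

text \<open>The two differentials contribute the same connecting term
  \<open>f (entries z ! (i - 1))\<close>, which cancels in the commutator. Hence homotopies can be
  shifted entry by entry.\<close>

lemma dl_shift:
  assumes f: "f \<in> gr_hom d X Y" and z: "z \<in> carrier SX"
  shows "dl SX SY (shift_map f) z = shift_map (dl X Y f) z"
proof (rule SY_eqI)
  note sf = shift_gr_hom[OF f]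
  have dz: "dif SX z \<in> carrier SX" by (rule S.M.dif_closed[OF z])
  show "dl SX SY (shift_map f) z \<in> carrier SY"
    using gr_hom_closed[OF sf] z dz by (simp add: dl_apply S.N.dif_closed)
  show "shift_map (dl X Y f) z \<in> carrier SY"
    by (rule shift_gr_hom_closed[OF dl_gr_hom[OF f] z])
  fix i assume i: "i < pchar A - 1"
  have "entries (dl SX SY (shift_map f) z) ! i =
      f (entries (dif SX z) ! i) \<ominus>\<^bsub>Y\<^esub> entries (dif SY (shift_map f z)) ! i"
    using TY.tower.\<pi>_sub[of i "shift_map f (dif SX z)" "dif SY (shift_map f z)"] i gr_hom_closed[OF sf] z dz
    by (simp add: dl_apply S.N.dif_closed shift_map_nth del: entries_shift_map)
  also have "\<dots> = dl X Y f (entries z ! i)"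
    using i SX_entries(2)[OF z i] SX_entries(2)[OF z, of "i - 1"] gr_hom_closed[OF f]
    by (simp add: SX_dif SY_dif shift_map_nth[OF z] dl_apply gr_hom_add[OF f] M.dif_closed N.dif_closed N.add_sub_add
        del: entries_shift_map)
  finally show "entries (dl SX SY (shift_map f) z) ! i = entries (shift_map (dl X Y f) z) ! i"
    using shift_map_nth[OF z i] by simp
qed

lemma dl_pow_shift:
  assumes f: "f \<in> gr_hom d X Y" and z: "z \<in> carrier SX"
  shows "(dl SX SY ^^ n) (shift_map f) z = shift_map ((dl X Y ^^ n) f) z"
  using z
proof (induction n arbitrary: z)
  case (Suc n)
  have "(dl SX SY ^^ Suc n) (shift_map f) z = (dl SX SY ^^ n) (shift_map f) (dif SX z) \<ominus>\<^bsub>SY\<^esub> dif SY ((dl SX SY ^^ n) (shift_map f) z)"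
    by (rule dl_pow_Suc)
  also have "\<dots> = dl SX SY (shift_map ((dl X Y ^^ n) f)) z"
    unfolding Suc.IH[OF Suc.prems] Suc.IH[OF S.M.dif_closed[OF Suc.prems]] dl_apply[of SX] ..
  also have "\<dots> = shift_map (dl X Y ((dl X Y ^^ n) f)) z" by (rule dl_shift[OF dl_pow_gr_hom[OF f] Suc.prems])
  finally show ?case by simp
qed simp

lemma shift_pdg_hom: assumes f: "f \<in> pdg_hom X Y" shows "shift_map f \<in> pdg_hom SX SY"
proof (rule pdg_homI)
  show sf: "shift_map f \<in> gr_hom 0 SX SY" by (rule shift_gr_hom[OF pdg_hom_gr[OF f]])
  fix z assume z: "z \<in> carrier SX"
  have dz: "dif SX z \<in> carrier SX" by (rule S.M.dif_closed[OF z])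
  show "shift_map f (dif SX z) = dif SY (shift_map f z)"
  proof (rule SY_eqI)
    fix i assume i: "i < pchar A - 1"
    then show "entries (shift_map f (dif SX z)) ! i = entries (dif SY (shift_map f z)) ! i"
      using SX_entries(2)[OF z i] SX_entries(2)[OF z, of "i - 1"]
      by (cases "i = 0") (simp_all add: SX_dif SY_dif shift_map_nth[OF z] shift_map_nth[OF dz] pdg_hom_add[OF f] pdg_hom_dif[OF f] M.dif_closed
          del: entries_shift_map)
  qed (use gr_hom_closed[OF sf] z dz S.N.dif_closed in blast)+
qed

lemma homotopic_shift:
  assumes f: "f \<in> pdg_hom X Y" "g \<in> pdg_hom X Y" and h: "homotopic A X Y f g"
  shows "homotopic A SX SY (shift_map f) (shift_map g)"
proof -
  obtain k where k: "k \<in> gr_hom (2 - 2 * int (pchar A)) X Y" "\<forall>x\<in>carrier X. f x \<ominus>\<^bsub>Y\<^esub> g x = (dl X Y ^^ (pchar A - 1)) k x"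
    using h unfolding homotopic_iff by blast
  have "shift_map f z \<ominus>\<^bsub>SY\<^esub> shift_map g z = (dl SX SY ^^ (pchar A - 1)) (shift_map k) z" if z: "z \<in> carrier SX" for z
  proof (rule SY_eqI)
    note c = pdg_hom_closed[OF shift_pdg_hom[OF f(1)] z] pdg_hom_closed[OF shift_pdg_hom[OF f(2)] z]
    show "shift_map f z \<ominus>\<^bsub>SY\<^esub> shift_map g z \<in> carrier SY" using c by simp
    show "(dl SX SY ^^ (pchar A - 1)) (shift_map k) z \<in> carrier SY"
      by (rule S.dl_pow_closed'[OF S.gr_hom_funcset[OF shift_gr_hom[OF k(1)]] z]) 
    fix i assume i: "i < pchar A - 1"
    have "entries (shift_map f z \<ominus>\<^bsub>SY\<^esub> shift_map g z) ! i = f (entries z ! i) \<ominus>\<^bsub>Y\<^esub> g (entries z ! i)"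
      using TY.tower.\<pi>_sub[of i "shift_map f z" "shift_map g z"] i c by (simp add: shift_map_nth[OF z] del: entries_shift_map)
    then show "entries (shift_map f z \<ominus>\<^bsub>SY\<^esub> shift_map g z) ! i = entries ((dl SX SY ^^ (pchar A - 1)) (shift_map k) z) ! i"
      unfolding dl_pow_shift[OF k(1) z] using k(2) SX_entries(2)[OF z i] by (simp only: shift_map_nth[OF z i])
  qed
  then show ?thesis unfolding S.homotopic_iff using shift_gr_hom[OF k(1)] by blast
qed

end

context pdg_category begin

lemma shift_pairI: "pdg_module A X \<Longrightarrow> pdg_module A Y \<Longrightarrow> shift_pair A X Y"
  by (intro shift_pair.intro shift_pair_axioms.intro pdg_category_axioms)

lemma shift_ident:
  assumes X: "pdg_module A X"
  shows "x \<in> carrier (shift_ob A X) \<Longrightarrow> shift_map (\<lambda>x. x) x = x"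
proof -
  interpret shift_pair A X X by (rule shift_pairI[OF X X])
  show "x \<in> carrier SX \<Longrightarrow> shift_map (\<lambda>x. x) x = x" using TX.tower_carrierD(1)[of x] by (simp add: shift_map_def)
qed

lemma heq_shift:
  fixes X Y :: "('r, ('a, 'x) univ) pdg_mod"
  assumes X: "pdg_module A X" and Y: "pdg_module A Y" and f: "heq A X Y f"
  shows "heq A (shift_ob A X) (shift_ob A Y) (shift_map f)"
proof -
  obtain g where fg: "f \<in> pdg_hom X Y" "g \<in> pdg_hom Y X" "homotopic A X X (\<lambda>x. g (f x)) (\<lambda>x. x)"
    "homotopic A Y Y (\<lambda>x. f (g x)) (\<lambda>x. x)" using f by (auto simp: heq_def)
  have *: "homotopic A (shift_ob A U) (shift_ob A U) (\<lambda>x. shift_map b (shift_map a x)) (\<lambda>x. x)"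
    if U: "pdg_module A U" and b: "(\<lambda>x. b (a x)) \<in> pdg_hom U U" and h: "homotopic A U U (\<lambda>x. b (a x)) (\<lambda>x. x)"
    for U :: "('r, ('a, 'x) univ) pdg_mod" and a b
  proof -
    interpret shift_pair A U U by (rule shift_pairI[OF U U])
    have "homotopic A SX SX (shift_map (\<lambda>x. b (a x))) (shift_map (\<lambda>x. x))"
      by (rule homotopic_shift[OF b pdg_hom_ident h])
    moreover have "homotopic A SX SX (shift_map (\<lambda>x. x)) (\<lambda>x. x)"
      by (rule S.homotopicI_eq[OF shift_pdg_hom[OF pdg_hom_ident] shift_ident[OF U]])
    ultimately have "homotopic A SX SX (shift_map (\<lambda>x. b (a x))) (\<lambda>x. x)"
      by (rule S.homotopic_trans[OF shift_pdg_hom[OF b] shift_pdg_hom[OF pdg_hom_ident] pdg_hom_ident])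
    then show ?thesis by (simp add: shift_map_comp)
  qed
  show ?thesis
    by (rule heqI[OF shift_pair.shift_pdg_hom[OF shift_pairI[OF X Y] fg(1)] shift_pair.shift_pdg_hom[OF shift_pairI[OF Y X] fg(2)]
      *[of X g f, OF X pdg_hom_comp[OF fg(1,2)] fg(3)] *[of Y f g, OF Y pdg_hom_comp[OF fg(2,1)] fg(4)]])
qed

end

lemma underlying_shift:
  fixes A :: "('k::field, 'r::{ring, monoid_mult}) pdg_alg"
  shows "underlying A (shift_ob A X) = shift_ob (ground :: ('k, 'k) pdg_alg) (underlying A X)"
  unfolding shift_ob_def tower_def pchar_ground[of A]
  by (auto simp: underlying_def fun_eq_iff)

context pdg_category begin

text \<open>The shift commutes with restriction to the ground field, where a quasi-isomorphism is a
  homotopy equivalence. This keeps backward steps of a zigzag legitimate after shifting.\<close>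

lemma kheq_shift:
  fixes X Y :: "('r, ('a, 'x) univ) pdg_mod"
  assumes X: "pdg_module A X" and Y: "pdg_module A Y" and f: "kheq A X Y f"
  shows "kheq A (shift_ob A X) (shift_ob A Y) (shift_map f)"
proof -
  interpret G: pdg_category "ground :: ('k, 'k) pdg_alg"
    by (intro pdg_category.intro pdg_algebra_ground[OF pdg_algebra_axioms])
  show ?thesis
    using f G.heq_shift[OF pdg_module_underlying[OF pdg_algebra_axioms X] pdg_module_underlying[OF pdg_algebra_axioms Y]]
      shift_pair.shift_pdg_hom[OF shift_pairI[OF X Y]]
    by (simp add: kheq_def underlying_shift)
qed

lemma hshift_hclass:
  fixes X Y :: "('r, ('a, 'x) univ) pdg_mod"
  assumes X: "pdg_module A X" and Y: "pdg_module A Y" and f: "f \<in> pdg_hom X Y"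
  shows "hshift A X Y (hclass A X Y f) = hclass A (shift_ob A X) (shift_ob A Y) (shift_map f)"
proof -
  interpret shift_pair A X Y by (rule shift_pairI[OF X Y])
  have "hclass A SX SY (shift_map k) = hclass A SX SY (shift_map f)" if "k \<in> hclass A X Y f" for k
  proof -
    have k: "k \<in> pdg_hom X Y" "homotopic A X Y f k" using that by (auto simp: hclass_def)
    have "hclass A SX SY (shift_map f) = hclass A SX SY (shift_map k)"
      using hclass_eq_iff[OF pdg_module_shift[OF X] pdg_module_shift[OF Y] shift_pdg_hom[OF f] shift_pdg_hom[OF k(1)]]
        homotopic_shift[OF f k] by simp
    then show ?thesis by simp
  qed
  then show ?thesis using mem_hclass[OF X Y f] unfolding hshift_def by blast
qed

lemma zigzag_shift:
  fixes X Y :: "('r, ('a, 'x) univ) pdg_mod"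
  assumes "zigzag (homotopy_cat A) (qis A) X a Y"
  shows "zigzag (homotopy_cat A) (qis A) (shift_ob A X) (map (shift_step A) a) (shift_ob A Y)"
  using assms
proof (induction rule: zigzag.induct)
  case (zz_Nil X)
  then show ?case using pdg_module_shift[of X] by (simp add: zigzag_iffs homotopy_cat_simps)
next
  case (zz_Fwd X F Y a Z)
  have M: "pdg_module A X" "pdg_module A Y" using zz_Fwd(1) zigzag_Ob[OF zz_Fwd(3)] by (auto simp: homotopy_cat_simps)
  obtain f where f: "F = hclass A X Y f" "f \<in> pdg_hom X Y" using zz_Fwd(2) by (auto simp: homotopy_cat_simps)
  show ?case
    using zz_Fwd.IH pdg_module_shift[OF M(1)] shift_pair.shift_pdg_hom[OF shift_pairI[OF M] f(2)] hshift_hclass[OF M f(2)] f(1)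
    by (simp add: zigzag_iffs homotopy_cat_simps)
next
  case (zz_Bwd X F Y a Z)
  have M: "pdg_module A X" "pdg_module A Y" using zz_Bwd(1) zigzag_Ob[OF zz_Bwd(4)] by (auto simp: homotopy_cat_simps)
  obtain f where f: "F = hclass A Y X f" "f \<in> pdg_hom Y X" using zz_Bwd(2) by (auto simp: homotopy_cat_simps)
  note sf = shift_pair.shift_pdg_hom[OF shift_pairI[OF M(2,1)] f(2)]
  have "kheq A Y X f" using zz_Bwd(3) qis_iff[OF M(2,1) f(2)] f(1) by simp
  then have "qis A (shift_ob A Y) (shift_ob A X) (hclass A (shift_ob A Y) (shift_ob A X) (shift_map f))"
    using qis_iff[OF pdg_module_shift[OF M(2)] pdg_module_shift[OF M(1)] sf] kheq_shift[OF M(2,1)] by simp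
  then show ?case
    using zz_Bwd.IH pdg_module_shift[OF M(1)] sf hshift_hclass[OF M(2,1) f(2)] f(1)
    by (simp add: zigzag_iffs homotopy_cat_simps)
qed

lemma loc_rel_shift:
  fixes X Y :: "('r, ('a, 'x) univ) pdg_mod"
  assumes "loc_rel (homotopy_cat A) l r" "zigzag (homotopy_cat A) (qis A) X l Y"
  shows "loc_rel (homotopy_cat A) (map (shift_step A) l) (map (shift_step A) r)"
  using assms(1)
proof (cases rule: loc_rel.cases)
  case (lr_comp F U V G W)
  have M: "pdg_module A U" "pdg_module A V" "pdg_module A W"
    using assms(2) lr_comp(1) by (auto simp: zigzag_iffs homotopy_cat_simps(1))
  obtain f g where fg: "F = hclass A U V f" "f \<in> pdg_hom U V" "G = hclass A V W g" "g \<in> pdg_hom V W"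
    using lr_comp(3,4) by (auto simp: homotopy_cat_simps)
  note sf = shift_pair.shift_pdg_hom[OF shift_pairI[OF M(1,2)] fg(2)] and sg = shift_pair.shift_pdg_hom[OF shift_pairI[OF M(2,3)] fg(4)]
  note SM = M[THEN pdg_module_shift]
  have "hshift A U W (cmp (homotopy_cat A) U V W G F) =
      cmp (homotopy_cat A) (shift_ob A U) (shift_ob A V) (shift_ob A W) (hshift A V W G) (hshift A U V F)"
    by (simp add: fg(1,3) cmp_hclass[OF M fg(2,4)] hshift_hclass[OF M(1,3) pdg_hom_comp[OF fg(2,4)]]
        hshift_hclass[OF M(1,2) fg(2)] hshift_hclass[OF M(2,3) fg(4)] cmp_hclass[OF SM sf sg] shift_map_comp)
  moreover have "hshift A U V F \<in> Hom (homotopy_cat A) (shift_ob A U) (shift_ob A V)"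
    "hshift A V W G \<in> Hom (homotopy_cat A) (shift_ob A V) (shift_ob A W)"
    using sf sg fg(1,3) hshift_hclass[OF M(1,2) fg(2)] hshift_hclass[OF M(2,3) fg(4)] by (auto simp: homotopy_cat_simps)
  ultimately show ?thesis using loc_rel.lr_comp unfolding lr_comp(1,2) by simp
next
  case (lr_ident U)
  have U: "pdg_module A U" using assms(2) lr_ident(1) by (auto simp: zigzag_iffs homotopy_cat_simps(1))
  interpret shift_pair A U U by (rule shift_pairI[OF U U])
  have "homotopic A SX SX (shift_map (\<lambda>x. x)) (\<lambda>x. x)"
    by (rule S.homotopicI_eq[OF shift_pdg_hom[OF pdg_hom_ident] shift_ident[OF U]])
  then have "hshift A U U (ident (homotopy_cat A) U) = ident (homotopy_cat A) SX"
    using hclass_eq_iff[OF pdg_module_shift[OF U] pdg_module_shift[OF U] shift_pdg_hom[OF pdg_hom_ident] pdg_hom_ident]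
    by (simp add: homotopy_cat_simps(3) hshift_hclass[OF U U pdg_hom_ident])
  then show ?thesis using loc_rel.lr_ident[of "homotopy_cat A" SX] unfolding lr_ident by simp
qed (auto intro: loc_rel.intros)

lemma loc_eq_shift:
  fixes X Y :: "('r, ('a, 'x) univ) pdg_mod"
  assumes "loc_eq (homotopy_cat A) (qis A) X Y a b"
  shows "loc_eq (homotopy_cat A) (qis A) (shift_ob A X) (shift_ob A Y) (map (shift_step A) a) (map (shift_step A) b)"
  using assms
proof (induction rule: loc_eq.induct)
  case (le_rel l r a b)
  from zigzag_appendD[OF le_rel(2)] obtain U where "zigzag (homotopy_cat A) (qis A) U (l @ b) Y" by (elim exE conjE)
  from zigzag_appendD[OF this] obtain V where "zigzag (homotopy_cat A) (qis A) U l V" by (elim exE conjE)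
  from loc_rel_shift[OF le_rel(1) this] show ?case
    using loc_eq.le_rel[where a = "map (shift_step A) a" and b = "map (shift_step A) b"] zigzag_shift[OF le_rel(2)] zigzag_shift[OF le_rel(3)]
    by simp
qed (blast intro: loc_eq.le_refl loc_eq.le_sym loc_eq.le_trans zigzag_shift)+

text \<open>\<open>dshift\<close> collects the shifts of all zigzags in a class, so even the case of
  an identity rests on the fact that shifting respects \<open>loc_eq\<close>.\<close>

lemma dshift_ident:
  fixes X :: "('r, ('a, 'x) univ) pdg_mod"
  assumes X: "pdg_module A X"
  shows "dshift A X X (lc (homotopy_cat A) (qis A) X X []) = lc (homotopy_cat A) (qis A) (shift_ob A X) (shift_ob A X) []"
proof -
  let ?S = "shift_ob A X"
  have z: "zigzag (homotopy_cat A) (qis A) X [] X" "zigzag (homotopy_cat A) (qis A) ?S [] ?S"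
    using X pdg_module_shift[OF X] by (simp_all add: zigzag_iffs homotopy_cat_simps)
  have "lc (homotopy_cat A) (qis A) ?S ?S (map (shift_step A) a) = lc (homotopy_cat A) (qis A) ?S ?S []"
    if "a \<in> lc (homotopy_cat A) (qis A) X X []" for a
  proof -
    have "loc_eq (homotopy_cat A) (qis A) X X [] a" using that by (simp add: lc_def)
    from loc_eq_shift[OF this] show ?thesis using lc_eq_iff[OF z(2), of "map (shift_step A) a"] by simp
  qed
  moreover have "[] \<in> lc (homotopy_cat A) (qis A) X X []" using le_refl[OF z(1)] by (simp add: lc_def)
  ultimately show ?thesis unfolding dshift_def by (auto simp: lc_def)
qed

end

section \<open>The triangle of a cell\<close>

context inclusion_cone begin

lemma cone_incl_entries:
  "length (entries (cone_incl A X y)) = Suc q"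
  "i < q \<Longrightarrow> entries (cone_incl A X y) ! i = \<zero>\<^bsub>X\<^esub>" "entries (cone_incl A X y) ! q = y"
  by (simp_all add: cone_incl_def q nth_append)

lemma zero_incl: "\<zero>\<^bsub>Y\<^esub> = \<zero>\<^bsub>X\<^esub>"
  using addmap_zero[OF M.abelian_group_axioms N.abelian_group_axioms pdg_hom_addmap[OF incl]] by simp

lemma cone_incl_closed: "y \<in> carrier Y \<Longrightarrow> cone_incl A X y \<in> carrier T"
  unfolding cone_incl_def q by (rule T.tower_carrierI) (auto simp: nth_append less_Suc_eq)

lemma cone_incl_pdg_hom: "cone_incl A X \<in> pdg_hom Y T"
proof (rule pdg_homI; (rule gr_homI)?)
  fix x assume x: "x \<in> carrier Y"
  show "cone_incl A X x \<in> carrier T" by (rule cone_incl_closed[OF x])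
  show "cone_incl A X (x \<oplus>\<^bsub>Y\<^esub> y) = cone_incl A X x \<oplus>\<^bsub>T\<^esub> cone_incl A X y" if y: "y \<in> carrier Y" for y
  proof (rule T.tower_eqI)
    fix i assume "i < length Ms"
    then show "entries (cone_incl A X (x \<oplus>\<^bsub>Y\<^esub> y)) ! i = entries (cone_incl A X x \<oplus>\<^bsub>T\<^esub> cone_incl A X y) ! i"
      by (cases "i = q") (auto simp: T.entries_add_tower cone_incl_entries nth_append)
  qed (use x y cone_incl_closed T.tower.add in auto)
  show "cone_incl A X (r \<odot>\<^bsub>Y\<^esub> x) = r \<odot>\<^bsub>T\<^esub> cone_incl A X x" for r
  proof (rule T.tower_eqI)
    fix i assume "i < length Ms"
    then show "entries (cone_incl A X (r \<odot>\<^bsub>Y\<^esub> x)) ! i = entries (r \<odot>\<^bsub>T\<^esub> cone_incl A X x) ! i"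
      by (cases "i = q") (auto simp: T.entries_smult_tower cone_incl_entries nth_append)
  qed (use x cone_incl_closed T.tower.smult N.smult_closed in auto)
  show "cone_incl A X (dif Y x) = dif T (cone_incl A X x)"
  proof (rule T.tower_eqI)
    fix i assume "i < length Ms"
    then show "entries (cone_incl A X (dif Y x)) ! i = entries (dif T (cone_incl A X x)) ! i"
      using q_pos N.r_zero[OF N.dif_closed[OF x], unfolded zero_incl]
      by (cases "i = q") (auto simp: T.entries_dif_tower cone_incl_entries nth_append)
  qed (use x cone_incl_closed T.tower_dif_closed N.dif_closed in auto)
next
  fix n x assume x: "x \<in> grade Y n"
  then show "cone_incl A X x \<in> grade T (n + 0)"
    using cone_incl_closed[of x] N.grade_carrier[OF x] q
    by (auto simp: T.tower.grade cone_incl_entries nth_append less_Suc_eq)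
qed

lemma cone_proj_closed:
  assumes z: "z \<in> carrier T" shows "cone_proj z \<in> carrier (shift_ob A X)"
proof -
  interpret SX: pdg_tower A "replicate (pchar A - 1) X" "\<lambda>_ x. x"
    by (rule pdg_category.pdg_tower_shift[OF pdg_category.intro[OF pdg_algebra_axioms] M.pdg_module_axioms])
  show ?thesis unfolding cone_proj_def shift_ob_def
    by (rule SX.tower_carrierI) (use T.tower_carrierD(2)[OF z] T_entries(1)[OF z] q in \<open>auto simp: nth_butlast\<close>)
qed

lemma cone_proj_pdg_hom: "cone_proj \<in> pdg_hom T (shift_ob A X)"
proof -
  interpret SX: pdg_tower A "replicate (pchar A - 1) X" "\<lambda>_ x. x"
    rewrites "tower A (replicate (pchar A - 1) X) (\<lambda>_ x. x) = shift_ob A X"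
    by (rule pdg_category.pdg_tower_shift[OF pdg_category.intro[OF pdg_algebra_axioms] M.pdg_module_axioms]) (simp add: shift_ob_def)
  have e: "entries (cone_proj z) ! i = entries z ! i" if "z \<in> carrier T" "i < q" for z i
    using T.tower_carrierD(2)[OF that(1)] that(2) by (simp add: cone_proj_def nth_butlast)
  note cl = cone_proj_closed
  show ?thesis
  proof (rule pdg_homI; (rule gr_homI)?)
    fix x assume x: "x \<in> carrier T"
    show "cone_proj x \<in> carrier (shift_ob A X)" by (rule cl[OF x])
    show "cone_proj (x \<oplus>\<^bsub>T\<^esub> y) = cone_proj x \<oplus>\<^bsub>shift_ob A X\<^esub> cone_proj y" if y: "y \<in> carrier T" for y
    proof (rule SX.tower_eqI)
      fix i assume "i < length (replicate (pchar A - 1) X)"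
      then show "entries (cone_proj (x \<oplus>\<^bsub>T\<^esub> y)) ! i = entries (cone_proj x \<oplus>\<^bsub>shift_ob A X\<^esub> cone_proj y) ! i"
        using x y T.tower.add(1)[OF x y] q by (simp add: e SX.entries_add_tower T.entries_add_tower nth_append)
    qed (use x y cl T.tower.add SX.tower.add in auto)
    show "cone_proj (r \<odot>\<^bsub>T\<^esub> x) = r \<odot>\<^bsub>shift_ob A X\<^esub> cone_proj x" for r
    proof (rule SX.tower_eqI)
      fix i assume "i < length (replicate (pchar A - 1) X)"
      then show "entries (cone_proj (r \<odot>\<^bsub>T\<^esub> x)) ! i = entries (r \<odot>\<^bsub>shift_ob A X\<^esub> cone_proj x) ! i"
        using x T.tower.smult(1)[OF x] q by (simp add: e SX.entries_smult_tower T.entries_smult_tower nth_append)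
    qed (use x cl T.tower.smult SX.tower.smult in auto)
    show "cone_proj (dif T x) = dif (shift_ob A X) (cone_proj x)"
    proof (rule SX.tower_eqI)
      fix i assume "i < length (replicate (pchar A - 1) X)"
      then show "entries (cone_proj (dif T x)) ! i = entries (dif (shift_ob A X) (cone_proj x)) ! i"
        using x T.tower_dif_closed[OF x] q by (simp add: e SX.entries_dif_tower T.entries_dif_tower nth_append)
    qed (use x cl T.tower_dif_closed SX.tower_dif_closed in auto)
  next
    fix n x assume x: "x \<in> grade T n"
    then have xc: "x \<in> carrier T" by (auto simp: T.tower.grade)
    have "entries x ! i \<in> grade X (n + 2 * (int (pchar A) - 1 - int i))" if "i < q" for i
      using x that by (auto simp: T.tower.grade nth_append dest!: bspec[of _ _ i])
    then show "cone_proj x \<in> grade (shift_ob A X) (n + 0)"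
      using cl[OF xc] e[OF xc] q by (auto simp: SX.tower.grade)
  qed
qed

end

locale cell_triangle = pdg_category A + cell_step A e' u v
  for A :: "('k::field, 'r::{ring, monoid_mult}) pdg_alg" and e' u v :: 'r
begin

abbreviation LX :: "('r, ('r, 'x) univ) pdg_mod" where "LX \<equiv> left_ideal A e'"
abbreviation LY :: "('r, ('r, 'x) univ) pdg_mod" where "LY \<equiv> left_ideal A e"
abbreviation LZ :: "('r, ('r, 'x) univ) pdg_mod" where "LZ \<equiv> left_ideal A (v * u)"

lemma LXE: "z \<in> carrier LX \<longleftrightarrow> (\<exists>x. z = Elem x \<and> x * e' = x)" by (rule mem_left_ideal[OF e'])
lemma LYE: "z \<in> carrier LY \<longleftrightarrow> (\<exists>x. z = Elem x \<and> x * e = x)" by (rule mem_left_ideal[OF e])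
lemma LZE: "z \<in> carrier LZ \<longleftrightarrow> (\<exists>x. z = Elem x \<and> x * (v * u) = x)" by (rule mem_left_ideal[OF idem_vu])

lemmas left_ideal_modules = pdg_module_left_ideal[OF e'] pdg_module_left_ideal[OF e] pdg_module_left_ideal[OF idem_vu]

lemma grade_left_ideal: "dg_idem A f \<Longrightarrow> z \<in> grade (left_ideal A f) n \<longleftrightarrow> (\<exists>x. z = Elem x \<and> x \<in> agr A n \<and> x * f = x)"
  using range_idem[of f] by (auto simp: dg_idem_def)

text \<open>The graded retraction is right multiplication by \<open>e'\<close>, which is linear for
  left modules and preserves degrees.\<close>

lemma inclusion_cone_cell: "pchar A = Suc q \<Longrightarrow> inclusion_cone A LX LY (\<lambda>z. Elem (elem_of z * e')) q"
proof (intro inclusion_cone.intro inclusion_cone_axioms.intro pair left_ideal_modules)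
  show "(\<lambda>x. x) \<in> pdg_hom LX LY"
  proof (rule pdg_homI; (rule gr_homI)?)
    have *: "x * e' = x \<Longrightarrow> x * e = x" for x using e_mult(1) by (metis mult.assoc)
    show "x \<in> carrier LY" if "x \<in> carrier LX" for x using that * unfolding LXE LYE by blast
    show "x \<in> grade LY (n + 0)" if "x \<in> grade LX n" for x n
      using that * unfolding grade_left_ideal[OF e'] grade_left_ideal[OF e] by auto
  qed simp_all
  show "(\<lambda>z. Elem (elem_of z * e')) \<in> gr_hom 0 LY LX"
  proof (rule gr_homI)
    show "Elem (elem_of z * e') \<in> carrier LX" for z unfolding LXE using idem(1) by (auto simp: mult.assoc)
    show "Elem (elem_of z * e') \<in> grade LX (n + 0)" if "z \<in> grade LY n" for z n
      using that agr_mult[OF _ idem(3), of _ n] idem(1)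
      unfolding grade_left_ideal[OF e'] grade_left_ideal[OF e] by (auto simp: mult.assoc)
  qed (simp_all add: distrib_right mult.assoc)
  show "Elem (elem_of x * e') = x" if "x \<in> carrier LX" for x using that unfolding LXE by auto
qed

text \<open>The connecting term of the cone lies in the ideal of \<open>e'\<close> and is killed by
  \<open>u\<close>, so multiplying the last entry by \<open>u\<close> gives a morphism. If
  \<open>y * u = 0\<close> then \<open>y = y * e = y * e'\<close>, so the kernel is the tower of
  copies of the ideal of \<open>e'\<close>, which \<open>C.G\<close> contracts.\<close>

lemma cone_quotient_saf:
  assumes q: "pchar A = Suc q"
  shows "saf A (inctower A (LX :: ('r, ('r, 'x) univ) pdg_mod) LY) (LZ :: ('r, ('r, 'x) univ) pdg_mod) (\<lambda>t. Elem (elem_of (entries t ! q) * u))"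
proof -
  let ?X = "LX :: ('r, ('r, 'x) univ) pdg_mod" and ?Y = "LY :: ('r, ('r, 'x) univ) pdg_mod" and ?Z = "LZ :: ('r, ('r, 'x) univ) pdg_mod"
  interpret C: inclusion_cone A ?X ?Y "\<lambda>z. Elem (elem_of z * e')" q by (rule inclusion_cone_cell[OF q])
  let ?w = "\<lambda>t :: ('r, 'x) univ. Elem (elem_of (entries t ! q) * u) :: ('r, 'x) univ"
  \<comment> \<open>Right multiplication by \<open>v\<close> undoes that by \<open>u\<close> and
    gives the graded section, with values in the last layer.\<close>
  let ?s = "\<lambda>z :: ('r, 'x) univ. Tuple (replicate q (Elem 0) @ [Elem (elem_of z * v)]) :: ('r, 'x) univ"
  note d = C.T.entries_add_tower[of q] C.T.entries_smult_tower[of q] C.T.entries_dif_tower[of q]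
  have w: "?w \<in> pdg_hom C.T ?Z"
  proof (rule pdg_homI; (rule gr_homI)?)
    fix t assume t: "t \<in> carrier C.T"
    obtain y where y: "entries t ! q = Elem y" "y * e = y" using C.T_entries(2)[OF t] unfolding LYE by blast
    have "q - 1 < q" using C.q_pos by simp
    then obtain x where x: "entries t ! (q - 1) = Elem x" "x * e' = x" using C.T_entries(1)[OF t, of "q - 1"] unfolding LXE by blast
    show "?w t \<in> carrier ?Z" unfolding LZE using uvu by (auto simp: mult.assoc)
    show "?w (t \<oplus>\<^bsub>C.T\<^esub> t') = ?w t \<oplus>\<^bsub>?Z\<^esub> ?w t'" if "t' \<in> carrier C.T" for t' using d by (simp add: C.nth_Ms distrib_right)
    show "?w (r \<odot>\<^bsub>C.T\<^esub> t) = r \<odot>\<^bsub>?Z\<^esub> ?w t" for r using d by (simp add: C.nth_Ms mult.assoc)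
    have "x * u = 0" using x(2) e'u by (metis mult.assoc mult_zero_right)
    then show "?w (dif C.T t) = dif ?Z (?w t)"
      using d C.q_pos x y dif_mult_u[OF y(2)] by (simp add: C.nth_Ms distrib_right)
  next
    fix n t assume t: "t \<in> grade C.T n"
    then have "entries t ! q \<in> grade ?Y n" using q by (auto simp: C.T.tower.grade C.nth_Ms simp del: left_ideal_simps dest!: bspec[of _ _ q])
    then obtain y where y: "entries t ! q = Elem y" "y \<in> agr A n" unfolding grade_left_ideal[OF e] by blast
    show "?w t \<in> grade ?Z (n + 0)"
      unfolding grade_left_ideal[OF idem_vu] using y agr_mult[OF y(2) gu] uvu by (auto simp: mult.assoc)
  qed
  have ve: "y * v * e = y * v" for y using e_mult(4) by (simp add: mult.assoc)
  have sc: "?s z \<in> carrier C.T" for z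
    by (rule C.T.tower_carrierI)
       (use ve in \<open>auto simp: nth_append less_Suc_eq LXE LYE simp del: left_ideal_simps(1)\<close>)
  have s: "?s \<in> gr_hom 0 ?Z C.T"
  proof (rule gr_homI)
    show "?s z \<in> carrier C.T" for z by (rule sc)
    show "?s (x \<oplus>\<^bsub>?Z\<^esub> y) = ?s x \<oplus>\<^bsub>C.T\<^esub> ?s y" for x y
    proof (rule C.T.tower_eqI[OF sc C.T.tower.add(1)[OF sc sc]])
      show "entries (?s (x \<oplus>\<^bsub>?Z\<^esub> y)) ! i = entries (?s x \<oplus>\<^bsub>C.T\<^esub> ?s y) ! i" if "i < length (replicate q ?X @ [?Y])" for i
        using that by (cases "i = q") (auto simp: C.T.entries_add_tower nth_append distrib_right)
    qed
    show "?s (r \<odot>\<^bsub>?Z\<^esub> x) = r \<odot>\<^bsub>C.T\<^esub> ?s x" for r x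
    proof (rule C.T.tower_eqI[OF sc C.T.tower.smult(1)[OF sc]])
      show "entries (?s (r \<odot>\<^bsub>?Z\<^esub> x)) ! i = entries (r \<odot>\<^bsub>C.T\<^esub> ?s x) ! i" if "i < length (replicate q ?X @ [?Y])" for i
        using that by (cases "i = q") (auto simp: C.T.entries_smult_tower nth_append mult.assoc)
    qed
    show "?s z \<in> grade C.T (n + 0)" if "z \<in> grade ?Z n" for z n
    proof -
      obtain y where y: "z = Elem y" "y \<in> agr A n" using \<open>z \<in> grade ?Z n\<close> unfolding grade_left_ideal[OF idem_vu] by blast
      have "Elem (y * v) \<in> grade ?Y n" unfolding grade_left_ideal[OF e] using agr_mult[OF y(2) gv] ve by auto
      moreover have "Elem 0 \<in> grade ?X m" for m unfolding grade_left_ideal[OF e'] by simp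
      ultimately show ?thesis
        using sc[of z] q by (auto simp: C.T.tower.grade nth_append less_Suc_eq y(1) simp del: left_ideal_simps)
    qed
  qed
  have ws: "?w (?s z) = z" if "z \<in> carrier ?Z" for z
    using that unfolding LZE by (auto simp: nth_append mult.assoc)
  have ct: "contraction (ground :: ('k, 'k) pdg_alg) (underlying A C.T) (underlying A ?Z) ?w C.G"
    unfolding contraction_def
  proof (intro conjI ballI impI)
    show "C.G \<in> gr_hom (2 - 2 * int (pchar (ground :: ('k, 'k) pdg_alg))) (underlying A C.T) (underlying A C.T)"
      using gr_hom_underlying[OF C.G_gr_hom] by (simp add: pchar_ground[of A])
    fix t assume "t \<in> carrier (underlying A C.T)"
    then have t: "t \<in> carrier C.T" by simp
    show "?w (C.G t) = \<zero>\<^bsub>underlying A ?Z\<^esub>" using C.entries_G[of q t] C.q_pos by simp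
    assume "?w t = \<zero>\<^bsub>underlying A ?Z\<^esub>"
    obtain y where y: "entries t ! q = Elem y" "y * e = y" using C.T_entries(2)[OF t] unfolding LYE by blast
    then have "y * u = 0" using \<open>?w t = _\<close> by simp
    then have "y * (u * v) = 0" by (simp flip: mult.assoc)
    then have "y * e' = y" using y(2) by (simp add: e_def distrib_left)
    then have "entries t ! q \<in> carrier ?X" unfolding LXE using y by blast
    then show "(dl (underlying A C.T) (underlying A C.T) ^^ (pchar (ground :: ('k, 'k) pdg_alg) - 1)) C.G t = t"
      using C.contraction[OF t] by (simp add: pchar_ground[of A] C.pred_q del: One_nat_def)
  qed
  show ?thesis unfolding saf_def by (intro conjI w bexI[OF _ s] ballI exI[of _ C.G] ct ws)
qed

text \<open>The triangle is compared with the standard one by identities on the first two objects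
  and by the formal inverse of the acyclic fibration from the cone on the third. Its second and
  third maps are defined through that fibration, so that the squares commute after cancelling
  it.\<close>

lemma distinguished_cell:
  "\<exists>f g h. distinguished A (LX :: ('r, ('r, 'x) univ) pdg_mod) LY LZ f g h"
proof -
  obtain q where q: "pchar A = Suc q" using pchar_ge2 by (cases "pchar A") auto
  let ?X = "LX :: ('r, ('r, 'x) univ) pdg_mod" and ?Y = "LY :: ('r, ('r, 'x) univ) pdg_mod" and ?Z = "LZ :: ('r, ('r, 'x) univ) pdg_mod"
  let ?H = "homotopy_cat A :: (('r, ('r, 'x) univ) pdg_mod, _) cat" and ?D = "derived_cat A :: (('r, ('r, 'x) univ) pdg_mod, _) cat"
  interpret C: inclusion_cone A ?X ?Y "\<lambda>z. Elem (elem_of z * e')" q by (rule inclusion_cone_cell[OF q])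
  interpret HC: category ?H by (rule category_homotopy_cat)
  let ?C = "inctower A ?X ?Y" and ?S = "shift_ob A ?X"
  let ?w = "\<lambda>t :: ('r, 'x) univ. Elem (elem_of (entries t ! q) * u) :: ('r, 'x) univ"
  have D: "?D = localization ?H (qis A)" by (simp add: derived_cat_def)
  note Ds = localization_simps[where C = ?H and W = "qis A", folded D]
  note Dc = cmp_lc[where C = ?H and W = "qis A", folded D]
  let ?lc = "lc ?H (qis A)" and ?zz = "zigzag ?H (qis A)"
  have M: "pdg_module A ?X" "pdg_module A ?Y" "pdg_module A ?Z" "pdg_module A ?C" "pdg_module A ?S"
    using left_ideal_modules C.pdg_module_T pdg_module_shift by blast+
  have Obs: "?X \<in> Ob ?H" "?Y \<in> Ob ?H" "?Z \<in> Ob ?H" "?C \<in> Ob ?H" "?S \<in> Ob ?H"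
    using M by (simp_all only: homotopy_cat_simps(1) mem_Collect_eq)
  have saf: "saf A ?C ?Z ?w" by (rule cone_quotient_saf[OF q])
  have wm: "?w \<in> pdg_hom ?C ?Z" using saf by (simp only: saf_def)
  let ?W = "hclass A ?C ?Z ?w" and ?F = "hclass A ?X ?Y (\<lambda>x. x)" and ?I = "hclass A ?Y ?C (cone_incl A ?X)" and ?P = "hclass A ?C ?S cone_proj"
  have homs: "?W \<in> Hom ?H ?C ?Z" "?F \<in> Hom ?H ?X ?Y" "?I \<in> Hom ?H ?Y ?C" "?P \<in> Hom ?H ?C ?S"
    unfolding homotopy_cat_simps using wm C.incl C.cone_incl_pdg_hom C.cone_proj_pdg_hom by blast+
  have qW: "qis A ?C ?Z ?W" using qis_iff[OF M(4,3) wm] saf_kheq[OF pdg_algebra_axioms M(4,3) saf] by simp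
  \<comment> \<open>The exceptional last connecting map of \<open>cone\<close> is the identity
    function like all the others.\<close>
  have cone: "cone A ?X ?Y (\<lambda>x. x) = ?C" by (simp add: cone_def inctower_def)
  have n: "?zz ?X [] ?X" "?zz ?Y [] ?Y" "?zz ?Z [] ?Z" "?zz ?C [] ?C" "?zz ?S [] ?S" using Obs by (simp_all only: zigzag_iffs simp_thms)
  let ?zf = "[Fwd ?X ?F ?Y]" and ?zi = "[Fwd ?Y ?I ?C]" and ?zp = "[Fwd ?C ?P ?S]" and ?zw = "[Fwd ?C ?W ?Z]" and ?zb = "[Bwd ?Z ?W ?C]"
  have z: "?zz ?X ?zf ?Y" "?zz ?Y ?zi ?C" "?zz ?C ?zp ?S" "?zz ?C ?zw ?Z" "?zz ?Z ?zb ?C"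
    using Obs homs qW by (simp_all only: zigzag_iffs simp_thms)
  note zg = zigzag_append[OF z(2,4)] and zh = zigzag_append[OF z(5,3)]
  have dm: "dmor A U V f = ?lc U V [Fwd U (hclass A U V f) V]" for U V f by (simp add: dmor_def lc_def)
  have "distinguished A ?X ?Y ?Z (?lc ?X ?Y ?zf) (?lc ?Y ?Z (?zi @ ?zw)) (?lc ?Z ?S (?zb @ ?zp))"
    unfolding distinguished_def Let_def
  proof (intro conjI; (rule exI[of _ ?X], rule exI[of _ ?Y], rule exI[of _ "\<lambda>x. x"], rule exI[of _ "?lc ?X ?X []"],
      rule exI[of _ "?lc ?Y ?Y []"], rule exI[of _ "?lc ?Z ?C ?zb"], intro conjI)?; (unfold cone dm)?; (rule M C.incl)?)
    show "?X \<in> Ob ?D" "?Y \<in> Ob ?D" "?Z \<in> Ob ?D" using Obs by (simp_all only: Ds(1))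
    show "?lc ?X ?Y ?zf \<in> Hom ?D ?X ?Y" unfolding Ds(2) using z(1) by blast
    show "?lc ?Y ?Z (?zi @ ?zw) \<in> Hom ?D ?Y ?Z" unfolding Ds(2) using zg by blast
    show "?lc ?Z ?S (?zb @ ?zp) \<in> Hom ?D ?Z ?S" unfolding Ds(2) using zh by blast
    show "is_iso ?D ?X ?X (?lc ?X ?X [])" unfolding D by (rule HC.is_iso_ident[OF Obs(1)])
    show "is_iso ?D ?Y ?Y (?lc ?Y ?Y [])" unfolding D by (rule HC.is_iso_ident[OF Obs(2)])
    show "is_iso ?D ?Z ?C (?lc ?Z ?C ?zb)" unfolding D by (rule HC.is_iso_Bwd[where W = "qis A", OF Obs(4,3) homs(1) qW])
    show "cmp ?D ?X ?Y ?Y (?lc ?Y ?Y []) (?lc ?X ?Y ?zf) = cmp ?D ?X ?X ?Y (?lc ?X ?Y ?zf) (?lc ?X ?X [])"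
      unfolding Dc[OF z(1) n(2)] Dc[OF n(1) z(1)] by simp
    have "loc_eq ?H (qis A) ?Y ?C ((?zi @ ?zw) @ ?zb) ?zi"
      using loc_eq_cong[OF HC.loc_eq_cancel[where W = "qis A", OF Obs(4,3) homs(1) qW] z(2) n(4)] by simp
    then show "cmp ?D ?Y ?Z ?C (?lc ?Z ?C ?zb) (?lc ?Y ?Z (?zi @ ?zw)) = cmp ?D ?Y ?Y ?C (?lc ?Y ?C ?zi) (?lc ?Y ?Y [])"
      unfolding Dc[OF zg z(5)] Dc[OF n(2) z(2)] append_Nil lc_eq_iff[OF zigzag_append[OF zg z(5)]] .
    show "cmp ?D ?Z ?S ?S (dshift A ?X ?X (?lc ?X ?X [])) (?lc ?Z ?S (?zb @ ?zp)) = cmp ?D ?Z ?C ?S (?lc ?C ?S ?zp) (?lc ?Z ?C ?zb)"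
      unfolding dshift_ident[OF M(1)] Dc[OF zh n(5)] Dc[OF z(5,3)] by simp
  qed
  then show ?thesis by blast
qed

end


section \<open>The class in the Grothendieck group and the criterion for a filtration\<close>

section \<open>Relations in the Grothendieck group\<close>

context pdg_category begin

abbreviation cobs :: "('r, ('r, 'x) univ) pdg_mod set" where "cobs \<equiv> compact_obs A"

lemma subgroup_K0_relations: "subgroup (K0_relations A) (free_Abelian_group cobs)"
  unfolding K0_relations_def
proof (rule group.generate_is_subgroup[OF group_free_Abelian_group], rule subsetI)
  fix c assume "c \<in> {frag_of Y - frag_of X - frag_of Z | X Y Z. X \<in> cobs \<and> Y \<in> cobs \<and> Z \<in> cobs \<and> (\<exists>f g h. distinguished A X Y Z f g h)}"
  then obtain X Y Z where c: "c = frag_of Y - frag_of X - frag_of Z" "X \<in> cobs" "Y \<in> cobs" "Z \<in> cobs"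
    by (elim CollectE exE conjE)
  have "Poly_Mapping.keys c \<subseteq> {Y, X, Z}"
    unfolding c(1) using keys_diff[of "frag_of Y - frag_of X" "frag_of Z"] keys_diff[of "frag_of Y" "frag_of X"]
    by (simp only: keys_frag_of) blast
  then show "c \<in> carrier (free_Abelian_group cobs)" using c by auto
qed

lemma normal_K0_relations: "K0_relations A \<lhd> free_Abelian_group cobs"
  by (rule comm_group.subgroup_imp_normal[OF abelian_free_Abelian_group subgroup_K0_relations])

lemma comm_group_K0: "comm_group (K0 A)"
  unfolding K0_def by (rule comm_group.abelian_FactGroup[OF abelian_free_Abelian_group subgroup_K0_relations])

lemma K0_class_closed: "X \<in> cobs \<Longrightarrow> K0_class A X \<in> carrier (K0 A)"
  unfolding K0_def K0_class_def FactGroup_def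
  using group.rcosetsI[OF group_free_Abelian_group subgroup.subset[OF subgroup_K0_relations], of "frag_of X"] by simp

lemma K0_class_triangle:
  assumes X: "X \<in> cobs" and Y: "Y \<in> cobs" and Z: "Z \<in> cobs" and d: "distinguished A X Y Z f g h"
  shows "K0_class A Y = K0_class A X \<otimes>\<^bsub>K0 A\<^esub> K0_class A Z"
proof -
  let ?F = "free_Abelian_group cobs :: (('r, ('r, 'x) univ) pdg_mod \<Rightarrow>\<^sub>0 int) monoid"
  have F: "frag_of X \<in> carrier ?F" "frag_of Y \<in> carrier ?F" "frag_of Z \<in> carrier ?F" using X Y Z by simp_all
  have XZ: "frag_of X + frag_of Z \<in> carrier ?F" using monoid.m_closed[OF group.is_monoid[OF group_free_Abelian_group] F(1,3)] by (simp only: mult_free_Abelian_group)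
  have "frag_of Y - frag_of X - frag_of Z \<in> K0_relations A"
    unfolding K0_relations_def by (rule generate.incl, rule CollectI, rule exI[of _ X], rule exI[of _ Y], rule exI[of _ Z], intro conjI refl X Y Z exI, rule d)
  moreover have "frag_of Y = (frag_of Y - frag_of X - frag_of Z) \<otimes>\<^bsub>?F\<^esub> (frag_of X + frag_of Z)" by simp
  ultimately have "frag_of Y \<in> K0_relations A #>\<^bsub>?F\<^esub> (frag_of X + frag_of Z)" unfolding r_coset_def by (intro UN_I) auto
  from group.repr_independence[OF group_free_Abelian_group this XZ subgroup_K0_relations]
  have "K0_class A Y = K0_relations A #>\<^bsub>?F\<^esub> (frag_of X + frag_of Z)" by (simp add: K0_class_def)
  also have "\<dots> = K0_class A X \<otimes>\<^bsub>K0 A\<^esub> K0_class A Z"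
    using normal.rcos_sum[OF normal_K0_relations F(1,3)] by (simp add: K0_class_def K0_def FactGroup_def)
  finally show ?thesis .
qed

end

context cell_chain begin

text \<open>The closed idempotent \<open>v m * u m\<close> is by itself a chain with a single cell,
  in which it plays the parts of both \<open>u\<close> and \<open>v\<close>; compactness of chains
  then applies.\<close>

lemma compact_cell:
  assumes m: "m \<in> set xs"
  shows "(left_ideal A (v m * u m) :: ('r, ('r, 'x) univ) pdg_mod) \<in> compact_obs A"
proof -
  have idm: "v m * u m * (v m * u m) = v m * u m" using vuv[OF m] by (simp flip: mult.assoc)
  interpret M: cell_chain A "[m]" "\<lambda>_. v m * u m" "\<lambda>_. v m * u m"
    by unfold_locales (use agr_mult[OF gr(2)[OF m] gr(1)[OF m]] idm dvu[OF m] in \<open>simp_all add: adif_Leibniz\<close>)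
  show ?thesis using M.compact_E[of "[m]" "[]"] idm by simp
qed

theorem K0_class_E:
  assumes "xs = ys @ zs"
  shows "K0_class A (left_ideal A (E ys) :: ('r, ('r, 'x) univ) pdg_mod) =
    finprod (K0 A) (\<lambda>i. K0_class A (left_ideal A (v i * u i))) (set ys)"
  using assms
proof (induction ys arbitrary: zs rule: rev_induct)
  let ?L = "left_ideal A :: 'r \<Rightarrow> ('r, ('r, 'x) univ) pdg_mod"
  interpret K: comm_group "K0 A :: (('r, ('r, 'x) univ) pdg_mod \<Rightarrow>\<^sub>0 int) set monoid" by (rule comm_group_K0)
  case Nil
  \<comment> \<open>A zero cell over the zero ideal gives a distinguished triangle of three zero
    modules. The class of the zero module therefore equals its own double and is trivial.\<close>
  interpret C: cell_triangle A 0 0 0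
    by unfold_locales (simp_all add: dg_idem_def)
  have c: "?L 0 \<in> compact_obs A" using compact_E[OF Nil] by simp
  obtain f g h where "distinguished A (?L 0) (?L C.e) (?L (0 * 0)) f g h" using C.distinguished_cell by blast
  then have d: "distinguished A (?L 0) (?L 0) (?L 0) f g h" by (simp add: C.e_def)
  have "K0_class A (?L 0) = K0_class A (?L 0) \<otimes>\<^bsub>K0 A\<^esub> K0_class A (?L 0)" by (rule K0_class_triangle[OF c c c d])
  then have "K0_class A (?L 0) = \<one>\<^bsub>K0 A\<^esub>" using K.r_cancel_one'[OF K0_class_closed[OF c] K0_class_closed[OF c]] by simp
  then show ?case by simp
next
  let ?L = "left_ideal A :: 'r \<Rightarrow> ('r, ('r, 'x) univ) pdg_mod"
  interpret K: comm_group "K0 A :: (('r, ('r, 'x) univ) pdg_mod \<Rightarrow>\<^sub>0 int) set monoid" by (rule comm_group_K0)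
  case (snoc m ys)
  then have xs: "xs = ys @ m # zs" by simp
  interpret S: cell_step A "E ys" "u m" "v m" by (rule cell_step_axioms[OF xs idem_E[OF xs]])
  interpret C: cell_triangle A "E ys" "u m" "v m" by unfold_locales
  have e: "S.e = E (ys @ [m])" unfolding S.e_def E_snoc[OF xs] ..
  have m: "m \<in> set xs" "m \<notin> set ys" "set ys \<subseteq> set xs" using xs dist by auto
  obtain f g h where d: "distinguished A (?L (E ys)) (?L (E (ys @ [m]))) (?L (v m * u m)) f g h"
    using C.distinguished_cell unfolding e by blast
  have "K0_class A (?L (E (ys @ [m]))) = K0_class A (?L (E ys)) \<otimes>\<^bsub>K0 A\<^esub> K0_class A (?L (v m * u m))"
    by (rule K0_class_triangle[OF compact_E[OF xs] compact_E[OF snoc.prems] compact_cell[OF m(1)] d])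
  also have "\<dots> = K0_class A (?L (v m * u m)) \<otimes>\<^bsub>K0 A\<^esub> finprod (K0 A) (\<lambda>i. K0_class A (?L (v i * u i))) (set ys)"
    unfolding snoc.IH[OF xs]
    using m K0_class_closed[OF compact_cell] by (intro K.m_comm K.finprod_closed) auto
  also have "\<dots> = finprod (K0 A) (\<lambda>i. K0_class A (?L (v i * u i))) (insert m (set ys))"
    using m K0_class_closed[OF compact_cell] by (intro K.finprod_insert[symmetric]) auto
  finally show ?case by simp
qed

end

section \<open>Fantastic filtrations\<close>

lemma linear_order_list:
  assumes "finite S" "S \<subseteq> I" "linear_order_on I ord"
  shows "\<exists>xs. set xs = S \<and> distinct xs \<and> sorted_wrt (\<lambda>i j. (i, j) \<in> ord) xs"
  using assms(1,2)
proof (induction S rule: finite_induct)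
  case (insert x S)
  have tr: "\<And>a b c. (a, b) \<in> ord \<Longrightarrow> (b, c) \<in> ord \<Longrightarrow> (a, c) \<in> ord" and tot: "\<And>a b. a \<in> I \<Longrightarrow> b \<in> I \<Longrightarrow> a \<noteq> b \<Longrightarrow> (a, b) \<in> ord \<or> (b, a) \<in> ord"
    using assms(3) unfolding linear_order_on_def partial_order_on_def preorder_on_def trans_def total_on_def by blast+
  obtain xs where xs: "set xs = S" "distinct xs" "sorted_wrt (\<lambda>i j. (i, j) \<in> ord) xs" using insert by auto
  let ?ys = "filter (\<lambda>i. (i, x) \<in> ord) xs @ x # filter (\<lambda>i. (i, x) \<notin> ord) xs"
  have gt: "(x, i) \<in> ord" if "i \<in> S" "(i, x) \<notin> ord" for i using tot[of i x] that insert by auto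
  have "sorted_wrt (\<lambda>i j. (i, j) \<in> ord) ?ys"
    using xs gt tr by (auto simp: sorted_wrt_append intro: sorted_wrt_filter)
  moreover have "set ?ys = insert x S" "distinct ?ys" using xs insert.hyps by auto
  ultimately show ?case by blast
qed simp

text \<open>The equivalence holds for each order separately. By the Leibniz rule
  \<open>adif A (v i) * u j = - (v i * adif A (u j))\<close>. If \<open>u i * adif A (v i)\<close>
  lies in the part below \<open>i\<close>, it is annihilated by \<open>u j\<close> for
  \<open>j\<close> at or above \<open>i\<close>. Conversely the differential of \<open>v i\<close>
  is unchanged by right multiplication with the total idempotent, whose summands at or above
  \<open>i\<close> contribute zero.\<close>

lemma fantastic_filtration_iff:
  fixes A :: "('k::field, 'r::{ring, monoid_mult}) pdg_alg" and u v :: "'i \<Rightarrow> 'r"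
  assumes A: "pdg_algebra A" and fin: "finite I"
    and uvu: "\<forall>i\<in>I. u i * v i * u i = u i" and vuv: "\<forall>i\<in>I. v i * u i * v i = v i"
    and orth: "\<forall>i\<in>I. \<forall>j\<in>I. i \<noteq> j \<longrightarrow> v i * u j = 0"
    and d\<epsilon>: "adif A (\<Sum>i\<in>I. u i * v i) = 0" and dvu: "\<forall>i\<in>I. adif A (v i * u i) = 0"
  shows "fantastic_filtration A I u v ord \<longleftrightarrow>
    linear_order_on I ord \<and> (\<forall>i\<in>I. \<forall>j\<in>I. (i, j) \<in> ord \<longrightarrow> v i * adif A (u j) = 0)"
proof -
  interpret pdg_algebra A by fact
  let ?lt = "\<lambda>i. {k. k \<in> I \<and> (k, i) \<in> ord \<and> k \<noteq> i}"
  have dv: "adif A (v i) * u j = - (v i * adif A (u j))" if "i \<in> I" "j \<in> I" for i j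
  proof -
    have "adif A (v i * u j) = 0" using that orth dvu by (cases "i = j") auto
    then show ?thesis by (simp add: adif_Leibniz eq_neg_iff_add_eq_0)
  qed
  have "v i * adif A (u j) = 0"
    if lin: "linear_order_on I ord" and F: "\<forall>i\<in>I. v i * adif A (u i) = 0" "\<forall>i\<in>I. u i * adif A (v i) \<in> filt_lt I u v ord i"
      and ij: "i \<in> I" "j \<in> I" "(i, j) \<in> ord" for i j
  proof (cases "i = j")
    case False
    \<comment> \<open>Antisymmetry ensures that no index strictly below \<open>i\<close> equals
      \<open>j\<close>, so that \<open>v k * u j = 0\<close> for all of them.\<close>
    have asym: "(j, i) \<notin> ord"
      using lin ij(3) False unfolding linear_order_on_def partial_order_on_def antisym_def by blast
    obtain a where a: "u i * adif A (v i) = (\<Sum>k\<in>?lt i. a k * (u k * v k))" using F(2) ij(1) by (auto simp: filt_lt_def)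
    have "a k * (u k * v k) * u j = 0" if "k \<in> ?lt i" for k
    proof -
      have "v k * u j = 0" using that asym orth ij by auto
      then show ?thesis by (simp add: mult.assoc)
    qed
    then have "u i * adif A (v i) * u j = 0" unfolding a by (simp add: sum_distrib_right)
    \<comment> \<open>The factor \<open>u i\<close> is removed by multiplying with
      \<open>v i\<close> on the left, since \<open>v i * u i * v i = v i\<close>.\<close>
    then have "v i * u i * (adif A (v i) * u j) = 0" by (metis mult.assoc mult_zero_right)
    then have "v i * u i * v i * adif A (u j) = 0" using dv[OF ij(1,2)] by (simp add: mult.assoc)
    then show ?thesis using vuv ij(1) by simp
  qed (use F ij in auto)
  moreover have "u i * adif A (v i) \<in> filt_lt I u v ord i"
    if lin: "linear_order_on I ord" and *: "\<forall>i\<in>I. \<forall>j\<in>I. (i, j) \<in> ord \<longrightarrow> v i * adif A (u j) = 0" and i: "i \<in> I" for i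
  proof -
    have "v i * (\<Sum>k\<in>I. u k * v k) = (\<Sum>k\<in>I. if k = i then v i else 0)"
      unfolding sum_distrib_left using i orth vuv by (intro sum.cong) (auto simp flip: mult.assoc)
    then have "v i * (\<Sum>k\<in>I. u k * v k) = v i" using i fin by simp
    then have "adif A (v i) = adif A (v i) * (\<Sum>k\<in>I. u k * v k)" using adif_Leibniz[of "v i" "\<Sum>k\<in>I. u k * v k"] d\<epsilon> by simp
    then have "u i * adif A (v i) = u i * adif A (v i) * (\<Sum>k\<in>I. u k * v k)" by (metis mult.assoc)
    also have "\<dots> = (\<Sum>k\<in>I. u i * adif A (v i) * (u k * v k))" by (simp add: sum_distrib_left)
    also have "\<dots> = (\<Sum>k\<in>?lt i. u i * adif A (v i) * (u k * v k))"
    proof (rule sum.mono_neutral_right[OF fin])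
      show "\<forall>k\<in>I - ?lt i. u i * adif A (v i) * (u k * v k) = 0"
      proof
        fix k assume k: "k \<in> I - ?lt i"
        have "(i, k) \<in> ord"
          using lin k i unfolding linear_order_on_def partial_order_on_def preorder_on_def refl_on_def total_on_def
          by (cases "k = i") auto
        then have "adif A (v i) * u k = 0" using dv[of i k] * k i by simp
        then have "u i * (adif A (v i) * u k) * v k = 0" by simp
        then show "u i * adif A (v i) * (u k * v k) = 0" by (simp add: mult.assoc)
      qed
    qed auto
    finally have eq: "u i * adif A (v i) = (\<Sum>k\<in>?lt i. u i * adif A (v i) * (u k * v k))" .
    show ?thesis unfolding filt_lt_def by (rule CollectI, rule exI[of _ "\<lambda>_. u i * adif A (v i)"], rule conjI[OF eq TrueI])
  qed
  moreover have "v i * adif A (u i) = 0" if "linear_order_on I ord" "\<forall>i\<in>I. \<forall>j\<in>I. (i, j) \<in> ord \<longrightarrow> v i * adif A (u j) = 0" "i \<in> I" for i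
    using that unfolding linear_order_on_def partial_order_on_def preorder_on_def refl_on_def by blast
  ultimately show ?thesis unfolding fantastic_filtration_def using d\<epsilon> dvu by blast
qed

text \<open>In the second half, degree 0 of \<open>u i\<close> and \<open>v i\<close> makes
  \<open>\<epsilon>\<close> and the \<open>v i * u i\<close> homogeneous, so that their left ideals
  are graded modules and right multiplication by \<open>u i\<close> and \<open>v i\<close> preserves
  degrees.\<close>

theorem corollary5p8:
  fixes A :: "('k::field, 'r::{ring, monoid_mult}) pdg_alg"
    and I :: "'i set" and u v :: "'i \<Rightarrow> 'r" and \<epsilon> :: 'r
  assumes "pdg_algebra A"
    and "finite I"
    and "\<forall>i\<in>I. u i * v i * u i = u i"
    and "\<forall>i\<in>I. v i * u i * v i = v i"
    and "\<forall>i\<in>I. \<forall>j\<in>I. i \<noteq> j \<longrightarrow> v i * u j = 0"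
    and "\<epsilon> = (\<Sum>i\<in>I. u i * v i)"
    and "adif A \<epsilon> = 0"
    and "\<forall>i\<in>I. adif A (v i * u i) = 0"
  shows "((\<exists>ord. fantastic_filtration A I u v ord) \<longleftrightarrow>
           (\<exists>ord. linear_order_on I ord \<and>
              (\<forall>i\<in>I. \<forall>j\<in>I. (i, j) \<in> ord \<longrightarrow> v i * adif A (u j) = 0)))
       \<and> ((\<exists>ord. fantastic_filtration A I u v ord) \<and> (\<forall>i\<in>I. u i \<in> agr A 0 \<and> v i \<in> agr A 0) \<longrightarrow>
           (left_ideal A \<epsilon> :: ('r, ('r, 'x) univ) pdg_mod) \<in> compact_obs A
         \<and> (\<forall>i\<in>I. (left_ideal A (v i * u i) :: ('r, ('r, 'x) univ) pdg_mod) \<in> compact_obs A)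
         \<and> K0_class A (left_ideal A \<epsilon> :: ('r, ('r, 'x) univ) pdg_mod)
             = finprod (K0 A) (\<lambda>i. K0_class A (left_ideal A (v i * u i))) I)"
proof (intro conjI impI)
  note iff = fantastic_filtration_iff[OF assms(1-5) assms(7)[unfolded assms(6)] assms(8)]
  show "(\<exists>ord. fantastic_filtration A I u v ord) \<longleftrightarrow>
    (\<exists>ord. linear_order_on I ord \<and> (\<forall>i\<in>I. \<forall>j\<in>I. (i, j) \<in> ord \<longrightarrow> v i * adif A (u j) = 0))"
    unfolding iff ..
  assume *: "(\<exists>ord. fantastic_filtration A I u v ord) \<and> (\<forall>i\<in>I. u i \<in> agr A 0 \<and> v i \<in> agr A 0)"
  then obtain ord where ord: "linear_order_on I ord" "\<forall>i\<in>I. \<forall>j\<in>I. (i, j) \<in> ord \<longrightarrow> v i * adif A (u j) = 0"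
    unfolding iff by blast
  obtain xs where xs: "set xs = I" "distinct xs" "sorted_wrt (\<lambda>i j. (i, j) \<in> ord) xs"
    using linear_order_list[OF assms(2) subset_refl ord(1)] by blast
  interpret pdg_category A by (rule pdg_category.intro[OF assms(1)])
  have diag: "v i * adif A (u i) = 0" if "i \<in> I" for i
    using ord that unfolding linear_order_on_def partial_order_on_def preorder_on_def refl_on_def by blast
  interpret cell_chain A xs u v
  proof
    show "sorted_wrt (\<lambda>i j. v i * adif A (u j) = 0) xs"
      by (rule sorted_wrt_mono_rel[OF _ xs(3)]) (use ord(2) xs(1) in blast)
  qed (use xs(1,2) assms * diag in auto)
  have E: "E xs = \<epsilon>" using xs(1) assms(6) by simp
  show "(left_ideal A \<epsilon> :: ('r, ('r, 'x) univ) pdg_mod) \<in> compact_obs A"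
    using compact_E[of xs "[]"] unfolding E by simp
  show "\<forall>i\<in>I. (left_ideal A (v i * u i) :: ('r, ('r, 'x) univ) pdg_mod) \<in> compact_obs A"
    using compact_cell xs(1) by blast
  show "K0_class A (left_ideal A \<epsilon> :: ('r, ('r, 'x) univ) pdg_mod) = finprod (K0 A) (\<lambda>i. K0_class A (left_ideal A (v i * u i))) I"
    using K0_class_E[of xs "[]"] unfolding E by (simp add: xs(1))
qed

end
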